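(* Let $f$ be a non-degenerate, centered, normalized, continuous, stationary Gaussian field on $\mathbb{R}^2$ with covariance function $\kappa$. Assume that: (a) $\kappa$ takes only non-negative values, and $f$ is invariant (in law) by $\frac{\pi}{2}$-rotation and by reflection through the horizontal axis; (b) $\kappa$ is $C^8$ and for each $\beta\in\mathbb{N}^2$ with $\beta_1+\beta_2\leq 2$, $\partial^\beta\kappa(x)\to 0$ as $|x|\to+\infty$; (c) there exist $\alpha>4$ and $C'<+\infty$ such that $|\kappa(x)|\leq C'|x|^{-\alpha}$ for each $x\in\mathbb{R}^2$. Assume also that there exist $\delta>0$ and $C<+\infty$ such that for every $\varepsilon>0$ sufficiently small $K^\varepsilon$ admits a symmetric square root $\sqrt{K^\varepsilon}$ with $$\|\sqrt{K^\varepsilon}\|_{\infty,op}\leq C\,\frac{1}{\varepsilon^{2-\delta}}\,.$$ Then the critical threshold for the continuous percolation model induced by $f$ is $0$. More precisely, the probability that $\mathcal{D}_p$ has an unbounded connected component is $1$ if $p>0$, and $0$ if $p\leq 0$. Moreover, in the case where $p>0$, the component is a.s. unique.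
   Context: Field: non-degenerate means that for any pairwise distinct $x_1,\dots,x_k\in\mathbb{R}^2$ the covariance matrix of $(f(x_1),\dots,f(x_k))$ is invertible; normalized means $\mathrm{Var}(f(x))=1$ for every $x$. By stationarity, $\mathbb{E}[f(x)f(y)]=\kappa(x-y)$ for a function $\kappa:\mathbb{R}^2\to[-1,1]$ with $\kappa(0)=1$. $\mathcal{D}_p=f^{-1}([-p,+\infty[)$. $\mathcal{V}^\varepsilon=\varepsilon\big(\mathbb{Z}^2\cup(\mathbb{Z}^2+(\frac12,\frac12))\big)$ is the vertex set of the face-centered square lattice scaled by $\varepsilon$. $K^\varepsilon$ is the infinite matrix $(\kappa(x-y))_{x,y\in\mathcal{V}^\varepsilon}$. Products of infinite matrices are defined when all the sums involved are absolutely convergent; a square root of $K^\varepsilon$ is an infinite matrix $\sqrt{K^\varepsilon}$ indexed by $\mathcal{V}^\varepsilon\times\mathcal{V}^\varepsilon$ such that $(\sqrt{K^\varepsilon})^2=K^\varepsilon$ in this sense. For an infinite matrix $M$, $\|M\|_{\infty,op}=\sup_i\sum_j|M(i,j)|\in[0,+\infty]$. *)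

theory Defs
  imports "HOL-Probability.Probability" "Jordan_Normal_Form.Matrix"
begin

no_notation vec_index (infixl \<open>$\<close> 100)

type_synonym plane = "real ^ 2"

text \<open>
  A random field on the plane is a map \<open>f\<close> with \<open>f x \<omega>\<close> the value at the point \<open>x\<close> for the
  outcome \<open>\<omega>\<close>.
\<close>

section \<open>Gaussian fields\<close>

text \<open>Constant random variables count as (degenerate) Gaussian variables.\<close>

definition gaussian_rv :: "'w measure \<Rightarrow> ('w \<Rightarrow> real) \<Rightarrow> bool" where
  "gaussian_rv M X \<longleftrightarrow> X \<in> borel_measurable M \<and>
     ((\<exists>\<mu>. AE \<omega> in M. X \<omega> = \<mu>) \<or>
      (\<exists>\<mu> \<sigma>. \<sigma> > 0 \<and> distributed M lborel X (normal_density \<mu> \<sigma>)))"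

definition gaussian_field :: "'w measure \<Rightarrow> (plane \<Rightarrow> 'w \<Rightarrow> real) \<Rightarrow> bool" where
  "gaussian_field M f \<longleftrightarrow> (\<forall>x. f x \<in> borel_measurable M) \<and>
     (\<forall>S a. finite S \<longrightarrow> gaussian_rv M (\<lambda>\<omega>. \<Sum>x\<in>S. a x * f x \<omega>))"

definition covariance :: "'w measure \<Rightarrow> ('w \<Rightarrow> real) \<Rightarrow> ('w \<Rightarrow> real) \<Rightarrow> real" where
  "covariance M X Y =
     (LINT \<omega>|M. (X \<omega> - (LINT \<omega>'|M. X \<omega>')) * (Y \<omega> - (LINT \<omega>'|M. Y \<omega>')))"

definition centered :: "'w measure \<Rightarrow> (plane \<Rightarrow> 'w \<Rightarrow> real) \<Rightarrow> bool" where
  "centered M f \<longleftrightarrow> (\<forall>x. prob_space.expectation M (f x) = 0)"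

definition normalized :: "'w measure \<Rightarrow> (plane \<Rightarrow> 'w \<Rightarrow> real) \<Rightarrow> bool" where
  "normalized M f \<longleftrightarrow> (\<forall>x. prob_space.variance M (f x) = 1)"

definition covariance_matrix :: "'w measure \<Rightarrow> (plane \<Rightarrow> 'w \<Rightarrow> real) \<Rightarrow> plane list \<Rightarrow> real mat" where
  "covariance_matrix M f xs =
     Matrix.mat (length xs) (length xs) (\<lambda>(i, j). covariance M (f (xs ! i)) (f (xs ! j)))"

definition nondegenerate :: "'w measure \<Rightarrow> (plane \<Rightarrow> 'w \<Rightarrow> real) \<Rightarrow> bool" where
  "nondegenerate M f \<longleftrightarrow> (\<forall>xs. distinct xs \<longrightarrow> invertible_mat (covariance_matrix M f xs))"

text \<open>Continuity of the sample paths is only required almost surely.\<close>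

definition continuous_field :: "'w measure \<Rightarrow> (plane \<Rightarrow> 'w \<Rightarrow> real) \<Rightarrow> bool" where
  "continuous_field M f \<longleftrightarrow> (AE \<omega> in M. continuous_on UNIV (\<lambda>x. f x \<omega>))"

text \<open>The law on the space of all functions on the plane, with the product sigma-algebra.\<close>

definition field_law :: "'w measure \<Rightarrow> (plane \<Rightarrow> 'w \<Rightarrow> real) \<Rightarrow> (plane \<Rightarrow> real) measure" where
  "field_law M f = distr M (Pi\<^sub>M UNIV (\<lambda>_. borel)) (\<lambda>\<omega> x. f x \<omega>)"

definition law_invariant :: "'w measure \<Rightarrow> (plane \<Rightarrow> 'w \<Rightarrow> real) \<Rightarrow> (plane \<Rightarrow> plane) \<Rightarrow> bool" where
  "law_invariant M f T \<longleftrightarrow> field_law M (\<lambda>x. f (T x)) = field_law M f"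

definition stationary :: "'w measure \<Rightarrow> (plane \<Rightarrow> 'w \<Rightarrow> real) \<Rightarrow> bool" where
  "stationary M f \<longleftrightarrow> (\<forall>v. law_invariant M f (\<lambda>x. x + v))"

definition quarter_turn :: "plane \<Rightarrow> plane" where
  "quarter_turn x = vector [- (x $ 2), x $ 1]"

definition horizontal_reflection :: "plane \<Rightarrow> plane" where
  "horizontal_reflection x = vector [x $ 1, - (x $ 2)]"

section \<open>Regularity\<close>

definition partial :: "2 \<Rightarrow> (plane \<Rightarrow> real) \<Rightarrow> plane \<Rightarrow> real" where
  "partial i g = (\<lambda>x. frechet_derivative g (at x) (axis i 1))"

fun C_class :: "nat \<Rightarrow> (plane \<Rightarrow> real) \<Rightarrow> bool" where
  "C_class 0 g \<longleftrightarrow> continuous_on UNIV g"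
| "C_class (Suc n) g \<longleftrightarrow> (\<forall>x. g differentiable (at x)) \<and> (\<forall>i. C_class n (partial i g))"

section \<open>Infinite matrices indexed by the lattice\<close>

definition Z2 :: "plane set" where
  "Z2 = {v. \<forall>i. v $ i \<in> \<int>}"

definition face_centered_lattice :: "real \<Rightarrow> plane set" where
  "face_centered_lattice \<epsilon> = (\<lambda>v. \<epsilon> *\<^sub>R v) ` (Z2 \<union> (\<lambda>v. v + vector [1/2, 1/2]) ` Z2)"

text \<open>
  An infinite matrix with index set \<open>I\<close> is a function of two arguments; only its values on \<open>I\<close>
  matter.
\<close>

definition is_matrix_sqrt :: "'i set \<Rightarrow> ('i \<Rightarrow> 'i \<Rightarrow> real) \<Rightarrow> ('i \<Rightarrow> 'i \<Rightarrow> real) \<Rightarrow> bool" where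
  "is_matrix_sqrt I R K \<longleftrightarrow> (\<forall>i\<in>I. \<forall>j\<in>I.
     (\<lambda>k. \<bar>R i k * R k j\<bar>) summable_on I \<and> (\<Sum>\<^sub>\<infinity>k\<in>I. R i k * R k j) = K i j)"

definition symmetric_matrix :: "'i set \<Rightarrow> ('i \<Rightarrow> 'i \<Rightarrow> real) \<Rightarrow> bool" where
  "symmetric_matrix I R \<longleftrightarrow> (\<forall>i\<in>I. \<forall>j\<in>I. R i j = R j i)"

definition inf_op_norm :: "'i set \<Rightarrow> ('i \<Rightarrow> 'i \<Rightarrow> real) \<Rightarrow> ennreal" where
  "inf_op_norm I R = (SUP i\<in>I. \<Sum>\<^sub>\<infinity>j\<in>I. ennreal \<bar>R i j\<bar>)"

section \<open>Percolation\<close>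

definition excursion :: "(plane \<Rightarrow> 'w \<Rightarrow> real) \<Rightarrow> real \<Rightarrow> 'w \<Rightarrow> plane set" where
  "excursion f p \<omega> = {x. f x \<omega> \<ge> - p}"

definition unbounded_components :: "plane set \<Rightarrow> plane set set" where
  "unbounded_components D = {C \<in> components D. \<not> bounded C}"

text \<open>
  The infimum of the levels at which percolation has positive probability. Positive probability is
  expressed as failure of almost sure non-percolation, so that no measurability with respect to
  the possibly incomplete \<open>M\<close> is presupposed.
\<close>

definition critical_threshold :: "'w measure \<Rightarrow> (plane \<Rightarrow> 'w \<Rightarrow> real) \<Rightarrow> ereal" where
  "critical_threshold M f =
     Inf {ereal p | p. \<not> (AE \<omega> in M. unbounded_components (excursion f p \<omega>) = {})}"

end

theory Submission
 imports Defs "HOL-Real_Asymp.Real_Asymp"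
begin

text \<open>At level \<open>0\<close> the field and its negative have the same law, so by planar duality squares are crossed
 with probability \<open>1 / 2\<close>; positive association (Pitt) and Tassion's gluing argument produce rings at
 arbitrarily large scales, and decorrelation of distant rings excludes unbounded components for \<open>p \<le> 0\<close>.
 For \<open>p > 0\<close> the crossing level of a rectangle, the largest level at which it is crossed, is a limit of
 max-min functionals of finitely many values of the field. Such a functional selects one coordinate,
 and Gaussian interpolation writes its variance through the covariance of the selected sites of two
 correlated copies. Rings make every given cell unlikely to be selected, so hypercontractivity makes
 the clipped variance small (superconcentration), while a noncrossing probability bounded away from
 \<open>0\<close> would keep it bounded from below. Hence rectangles are crossed with probability close to \<open>1\<close> at level \<open>p\<close>,
 and a renormalisation gives the unbounded component; rings at level \<open>p\<close> give its uniqueness.\<close>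

text \<open>Functionals that select one coordinate are the right class because their gradient has l1
  norm at most one: decoupling two regions then costs the largest kernel value between them,
  whatever the number of sites. The price is that indicators become ramps, so every decoupling
  shifts the level and divides by the product of the ramp widths. An anti-concentration bound for
  crossing levels (for the rings) or a summable sequence of shifts (for the renormalisation) pays
  for this.

  Tassion's argument yields long crossings only along an unbounded sequence of scales. This
  suffices: a fixed lower bound on failing scales gives rings, and one large good scale starts a
  renormalisation that reaches all scales \<open>3^k * L\<close>.

  Decay of order 4 enters twice: the weights \<open>(1 + a)^-2 (1 + b)^-2\<close> are summable over
  the unit cells of the plane, and \<open>s^-4\<close> beats the factor \<open>s^2\<close> of the
  anti-concentration bound in a box of size \<open>s\<close>.

  Laws are compared through characteristic functions of finite linear combinations only.\<close>

abbreviation vecs :: "'i set \<Rightarrow> ('i \<Rightarrow> real) measure" where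
 "vecs S \<equiv> PiM S (\<lambda>_. borel)"

abbreviation pc :: "'a::topological_space set \<Rightarrow> 'a \<Rightarrow> 'a \<Rightarrow> bool" where
 "pc \<equiv> path_component"

abbreviation bm :: "'a measure \<Rightarrow> ('a \<Rightarrow> 'b::topological_space) set" where
 "bm M \<equiv> borel_measurable M"

section \<open>Laws determined by characteristic functions\<close>

lemma (in prob_space) integrable_unit:
 fixes u :: "'a => real"
 assumes "u : bm M" "!!x. \<bar>u x\<bar> <= c"
 shows "integrable M u"
 by (rule integrable_const_bound[of _ c]) (use assms in auto)

text \<open>Normalising the weight \<open>u\<close> turns weighted integrals of functions of
  \<open>Y\<close> into integrals against a law on the line, to which Levy's theorems apply. Weights
  are what allows several coordinates to be treated one at a time.\<close>

lemma tilted_distribution: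
 fixes u Y :: "'w => real"
 assumes M: "prob_space M" and [measurable]: "u : bm M" "Y : bm M"
  and u: "!!x. 0 <= u x" "!!x. u x <= 1" and c: "c = (LINT x|M. u x)" "c > 0"
 shows "EX m. real_distribution m &
  (ALL t. char m t = Complex ((LINT x|M. u x * cos (t * Y x)) / c) ((LINT x|M. u x * sin (t * Y x)) / c)) &
  (ALL g::real => real. g : bm borel --> (\<integral>y. g y \<partial>m) = (LINT x|M. u x * g (Y x)) / c)"
proof -
 interpret prob_space M by fact
 define D where "D = density M (%x. ennreal (u x / c))"
 define m where "m = distr D borel Y"
 have iu: "integrable M u" by (rule integrable_unit[of _ 1]) (use u in auto)
 have [measurable]: "Y : bm D" by (simp add: D_def)
 have "emeasure D (space D) = (\<integral>\<^sup>+x. ennreal (u x / c) \<partial>M)"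
  by (simp add: D_def emeasure_density cong: nn_integral_cong)
 also have "... = ennreal (LINT x|M. u x / c)"
  using u c iu by (intro nn_integral_eq_integral) auto
 also have "... = 1" using c by simp
 finally have D: "prob_space D" by (rule prob_spaceI)
 have m: "real_distribution m" unfolding m_def by (rule prob_space.real_distribution_distr[OF D]) simp
 have I: "(\<integral>y. g y \<partial>m) = (LINT x|M. u x * g (Y x)) / c"
  if [measurable]: "g : bm borel" for g :: "real => real"
 proof -
  have "(\<integral>y. g y \<partial>m) = (LINT x|D. g (Y x))" unfolding m_def by (rule integral_distr) auto
  also have "... = (LINT x|M. (u x / c) *\<^sub>R g (Y x))"
   unfolding D_def by (rule integral_density) (use u c in auto)
  also have "... = (LINT x|M. (u x * g (Y x)) / c)" by (simp add: field_simps)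
  also have "... = (LINT x|M. u x * g (Y x)) / c" by simp
  finally show ?thesis .
 qed
 have "char m t = Complex ((LINT x|M. u x * cos (t * Y x)) / c) ((LINT x|M. u x * sin (t * Y x)) / c)" for t
 proof -
  interpret m: real_distribution m by fact
  have i: "integrable m (%x. iexp (t * x))" by (intro m.integrable_iexp) auto
  have "Re (char m t) = (\<integral>x. cos (t * x) \<partial>m)" unfolding char_def
   using i by (subst integral_Re[symmetric]) (auto simp: Re_exp Im_exp)
  moreover have "Im (char m t) = (\<integral>x. sin (t * x) \<partial>m)" unfolding char_def
   using i by (subst integral_Im[symmetric]) (auto simp: Re_exp Im_exp)
  ultimately show ?thesis by (simp add: complex_eq_iff I)
 qed
 with m I show ?thesis by blast
qed

text \<open>The two tilted laws have the same characteristic function and hence agree. If the mass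
  \<open>c\<close> vanishes there is nothing to normalise, and both sides are squeezed between 0 and
  \<open>c\<close>.\<close>

lemma weighted_law_unique:
 fixes u Y :: "'w => real" and v Z :: "'v => real"
 assumes M: "prob_space M" and m: "u : bm M" "Y : bm M"
  and N: "prob_space N" and n: "v : bm N" "Z : bm N"
  and u: "!!x. 0 <= u x" "!!x. u x <= 1" and v: "!!x. 0 <= v x" "!!x. v x <= 1"
  and cos: "!!t. (LINT x|M. u x * cos (t * Y x)) = (LINT x|N. v x * cos (t * Z x))"
  and sin: "!!t. (LINT x|M. u x * sin (t * Y x)) = (LINT x|N. v x * sin (t * Z x))"
  and B: "B : sets borel"
 shows "(LINT x|M. u x * indicator B (Y x)) = (LINT x|N. v x * indicator B (Z x))"
proof -
 note [measurable] = m n B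
 interpret M: prob_space M by fact
 interpret N: prob_space N by fact
 define c where "c = (LINT x|M. u x)"
 have c': "c = (LINT x|N. v x)" using cos[of 0] by (simp add: c_def)
 have "c >= 0" unfolding c_def using u by (intro integral_nonneg_AE) auto
 have iu: "integrable M u" "integrable N v" using u v by (auto intro!: M.integrable_unit[of _ 1] N.integrable_unit[of _ 1])
 show ?thesis
 proof (cases "c = 0")
  case True
  have "(LINT x|M. u x * indicator B (Y x)) <= c" unfolding c_def
   using u iu by (intro integral_mono M.integrable_unit[of _ 1]) (auto simp: indicator_def split: if_splits)
  moreover have "(LINT x|N. v x * indicator B (Z x)) <= c" unfolding c'
   using v iu by (intro integral_mono N.integrable_unit[of _ 1]) (auto simp: indicator_def split: if_splits)
  moreover have "(LINT x|M. u x * indicator B (Y x)) >= 0" "(LINT x|N. v x * indicator B (Z x)) >= 0"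
   using u v by (auto intro!: integral_nonneg_AE)
  ultimately show ?thesis using True by simp
 next
  case False
  with `c >= 0` have "c > 0" by simp
  obtain a where a: "real_distribution a"
   "!!t. char a t = Complex ((LINT x|M. u x * cos (t * Y x)) / c) ((LINT x|M. u x * sin (t * Y x)) / c)"
   "!!g::real => real. g : bm borel ==> (\<integral>y. g y \<partial>a) = (LINT x|M. u x * g (Y x)) / c"
   using tilted_distribution[OF M m u c_def `c > 0`] by blast
  obtain \<nu> where \<nu>: "real_distribution \<nu>"
   "!!t. char \<nu> t = Complex ((LINT x|N. v x * cos (t * Z x)) / c) ((LINT x|N. v x * sin (t * Z x)) / c)"
   "!!g::real => real. g : bm borel ==> (\<integral>y. g y \<partial>\<nu>) = (LINT x|N. v x * g (Z x)) / c"
   using tilted_distribution[OF N n v c' `c > 0`] by blast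
  have "a = \<nu>" by (rule Levy_uniqueness[OF a(1) \<nu>(1)]) (simp add: fun_eq_iff a(2) \<nu>(2) cos sin)
  hence "(LINT x|M. u x * indicator B (Y x)) / c = (LINT x|N. v x * indicator B (Z x)) / c"
   using a(3)[of "indicator B"] \<nu>(3)[of "indicator B"] by simp
  thus ?thesis using `c > 0` by simp
 qed
qed

text \<open>The analogue of \<open>weighted_law_unique\<close> for limits, by Levy's continuity
  theorem. The masses converge and are eventually positive unless the limit mass is 0; in that case
  the bound \<open>B * c k\<close> sends both sides to 0.\<close>

lemma weighted_weak_limit:
 fixes u :: "nat => 'w => real" and Y :: "nat => 'w => real" and v Z :: "'v => real" and g :: "real => real"
 assumes M: "!!k. prob_space (M k)" and m: "!!k. u k : bm (M k)" "!!k. Y k : bm (M k)"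
  and N: "prob_space N" and n: "v : bm N" "Z : bm N"
  and u: "!!k x. 0 <= u k x" "!!k x. u k x <= 1" and v: "!!x. 0 <= v x" "!!x. v x <= 1"
  and cos: "!!t. (%k. \<integral>x. u k x * cos (t * Y k x) \<partial>M k) \<longlonglongrightarrow> (LINT x|N. v x * cos (t * Z x))"
  and sin: "!!t. (%k. \<integral>x. u k x * sin (t * Y k x) \<partial>M k) \<longlonglongrightarrow> (LINT x|N. v x * sin (t * Z x))"
  and g: "!!x. isCont g x" "!!x. \<bar>g x\<bar> <= B"
 shows "(%k. \<integral>x. u k x * g (Y k x) \<partial>M k) \<longlonglongrightarrow> (LINT x|N. v x * g (Z x))"
proof -
 note [measurable] = m n
 have [measurable]: "g : bm borel"
  using g by (intro borel_measurable_continuous_onI continuous_at_imp_continuous_on) auto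
 interpret N: prob_space N by fact
 have B: "B >= 0" using g(2)[of 0] by simp
 define c where "c k = (LINT x|M k. u k x)" for k
 define d where "d = (LINT x|N. v x)"
 have cd: "c \<longlonglongrightarrow> d" using cos[of 0] by (simp add: c_def[abs_def] d_def)
 have "d >= 0" unfolding d_def using v by (intro integral_nonneg_AE) auto
 have bnd: "\<bar>\<integral>x. w x * g (W x) \<partial>K\<bar> <= B * (LINT x|K. w x)"
  if K: "prob_space K" and [measurable]: "w : bm K" "W : bm K"
   and w: "!!x. 0 <= w x" "!!x. w x <= 1" for K :: "'z measure" and w W
 proof -
  interpret K: prob_space K by fact
  have b: "\<bar>w x * g (W x)\<bar> <= B * w x" for x
   using mult_left_mono[OF g(2)[of "W x"] w(1)[of x]] w(1)[of x] by (simp add: abs_mult mult.commute)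
  have b1: "B * w x <= B" for x using mult_left_mono[OF w(2)[of x] B] by simp
  have "\<bar>\<integral>x. w x * g (W x) \<partial>K\<bar> <= (LINT x|K. \<bar>w x * g (W x)\<bar>)" by (rule integral_abs_bound)
  also have "... <= (LINT x|K. B * w x)"
  proof (rule integral_mono)
   show "integrable K (%x. \<bar>w x * g (W x)\<bar>)" by (rule K.integrable_unit[of _ B]) (use order_trans[OF b b1] in auto)
   show "integrable K (%x. B * w x)" by (rule K.integrable_unit[of _ B]) (use b1 w(1) B in auto)
  qed (rule b)
  finally show ?thesis by simp
 qed
 show ?thesis
 proof (cases "d = 0")
  case True
  have "(%k. B * c k) \<longlonglongrightarrow> B * d" by (intro tendsto_intros cd)
  hence "(%k. B * c k) \<longlonglongrightarrow> 0" using True by simp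
  hence "(%k. \<integral>x. u k x * g (Y k x) \<partial>M k) \<longlonglongrightarrow> 0"
   by (rule Lim_null_comparison[rotated]) (auto simp: c_def intro!: always_eventually bnd M u)
  moreover have "(LINT x|N. v x * g (Z x)) = 0" using bnd[OF N n v] True by (simp add: d_def)
  ultimately show ?thesis by simp
 next
  case False
  with `d >= 0` have d: "d > 0" by simp
  hence "eventually (%k. c k > 0) sequentially" by (rule order_tendstoD(1)[OF cd])
  then obtain K where K: "!!k. k >= K ==> c k > 0" by (auto simp: eventually_sequentially)
  have "EX a. real_distribution a &
   (ALL t. char a t = Complex ((LINT x|M (k + K). u (k + K) x * cos (t * Y (k + K) x)) / c (k + K))
     ((LINT x|M (k + K). u (k + K) x * sin (t * Y (k + K) x)) / c (k + K))) &
   (\<integral>y. g y \<partial>a) = (LINT x|M (k + K). u (k + K) x * g (Y (k + K) x)) / c (k + K)" for k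
   using tilted_distribution[OF M[of "k + K"] m(1)[of "k + K"] m(2)[of "k + K"] u(1)[of "k + K"] u(2)[of "k + K"] c_def K[of "k + K"]]
   by auto
  hence "EX a. ALL k. real_distribution (a k) &
   (ALL t. char (a k) t = Complex ((LINT x|M (k + K). u (k + K) x * cos (t * Y (k + K) x)) / c (k + K))
     ((LINT x|M (k + K). u (k + K) x * sin (t * Y (k + K) x)) / c (k + K))) &
   (\<integral>y. g y \<partial>a k) = (LINT x|M (k + K). u (k + K) x * g (Y (k + K) x)) / c (k + K)"
   by (intro choice) simp
  then obtain a where a: "!!k. real_distribution (a k)"
   "!!k t. char (a k) t = Complex ((LINT x|M (k + K). u (k + K) x * cos (t * Y (k + K) x)) / c (k + K))
     ((LINT x|M (k + K). u (k + K) x * sin (t * Y (k + K) x)) / c (k + K))"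
   "!!k. (\<integral>y. g y \<partial>a k) = (LINT x|M (k + K). u (k + K) x * g (Y (k + K) x)) / c (k + K)" by blast
  obtain \<nu> where \<nu>: "real_distribution \<nu>"
   "!!t. char \<nu> t = Complex ((LINT x|N. v x * cos (t * Z x)) / d) ((LINT x|N. v x * sin (t * Z x)) / d)"
   "!!g::real => real. g : bm borel ==> (\<integral>y. g y \<partial>\<nu>) = (LINT x|N. v x * g (Z x)) / d"
   using tilted_distribution[OF N n v d_def d] by blast
  have cd': "(%k. c (k + K)) \<longlonglongrightarrow> d" using cd by (rule LIMSEQ_ignore_initial_segment)
  have "(%k. char (a k) t) \<longlonglongrightarrow> char \<nu> t" for t
   unfolding a(2) \<nu>(2) using d
   by (intro tendsto_intros LIMSEQ_ignore_initial_segment[OF cos] LIMSEQ_ignore_initial_segment[OF sin] cd') auto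
  hence "weak_conv_m a \<nu>" by (rule levy_continuity[OF a(1) \<nu>(1)])
  from weak_conv_imp_integral_bdd_continuous_conv[OF a(1) \<nu>(1) this g(1), of B]
  have "(%k. integral\<^sup>L (a k) g) \<longlonglongrightarrow> integral\<^sup>L \<nu> g" using g(2) by simp
  from tendsto_mult[OF this cd']
  have "(%k. (\<integral>y. g y \<partial>a k) * c (k + K)) \<longlonglongrightarrow> (LINT x|N. v x * g (Z x))"
   using d by (simp add: \<nu>(3))
  moreover have "(\<integral>y. g y \<partial>a k) * c (k + K) = (LINT x|M (k + K). u (k + K) x * g (Y (k + K) x))" for k
   using K[of "k + K"] by (simp add: a(3))
  ultimately have "(%k. \<integral>x. u (k + K) x * g (Y (k + K) x) \<partial>M (k + K)) \<longlonglongrightarrow> (LINT x|N. v x * g (Z x))" by simp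
  thus ?thesis by (rule LIMSEQ_offset)
 qed
qed

text \<open>Uniqueness in several dimensions from the one-dimensional theorem, by induction on the
  coordinates. The indicator of coordinate \<open>r\<close> is absorbed into the weight. The
  induction hypothesis then asks for trigonometric integrals of the remaining coordinates under the
  new weight; these come from the one-dimensional theorem in coordinate \<open>r\<close>, with the
  trigonometric function moved into the weight.\<close>

lemma weighted_joint_law_unique:
 fixes u :: "'w => real" and v :: "'v => real" and X :: "'i => 'w => real" and Y :: "'i => 'v => real"
 assumes "finite S" and M: "prob_space M" and N: "prob_space N"
  and X: "!!s. s : S ==> X s : bm M" and Y: "!!s. s : S ==> Y s : bm N"
  and m: "u : bm M" "v : bm N"
  and u: "!!x. 0 <= u x" "!!x. u x <= 1" and v: "!!x. 0 <= v x" "!!x. v x <= 1"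
  and cos: "!!a. (LINT x|M. u x * cos (\<Sum>s\<in>S. a s * X s x)) = (LINT x|N. v x * cos (\<Sum>s\<in>S. a s * Y s x))"
  and sin: "!!a. (LINT x|M. u x * sin (\<Sum>s\<in>S. a s * X s x)) = (LINT x|N. v x * sin (\<Sum>s\<in>S. a s * Y s x))"
  and B: "!!s. s : S ==> B s : sets borel"
 shows "(LINT x|M. u x * (\<Prod>s\<in>S. indicator (B s) (X s x))) = (LINT x|N. v x * (\<Prod>s\<in>S. indicator (B s) (Y s x)))"
 using assms(1) X Y m u v cos sin B
proof (induction S arbitrary: u v rule: finite_induct)
 case empty
 from empty.prems(9)[of undefined] empty.prems(7) show ?case by simp
next
 case (insert r S)
 note [measurable] = insert.prems(1)[of r, simplified] insert.prems(2)[of r, simplified] insert.prems(3,4) insert.prems(11)[of r, simplified]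
 have [measurable]: "!!s. s : S ==> X s : bm M" "!!s. s : S ==> Y s : bm N"
  using insert.prems(1,2) by auto
 interpret M: prob_space M by fact
 interpret N: prob_space N by fact
 have aC: "(LINT x|M. u x * cos (p * (\<Sum>s\<in>S. a s * X s x) + t * X r x))
   = (LINT x|N. v x * cos (p * (\<Sum>s\<in>S. a s * Y s x) + t * Y r x))"
  and aS: "(LINT x|M. u x * sin (p * (\<Sum>s\<in>S. a s * X s x) + t * X r x))
   = (LINT x|N. v x * sin (p * (\<Sum>s\<in>S. a s * Y s x) + t * Y r x))" for a p t
 proof -
  have *: "(\<Sum>s\<in>insert r S. (if s = r then t else p * a s) * W s) = p * (\<Sum>s\<in>S. a s * W s) + t * W r" for W :: "'i => real"
   using insert.hyps by (simp add: sum_distrib_left mult.assoc) (intro sum.cong, auto)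
  show "(LINT x|M. u x * cos (p * (\<Sum>s\<in>S. a s * X s x) + t * X r x))
   = (LINT x|N. v x * cos (p * (\<Sum>s\<in>S. a s * Y s x) + t * Y r x))"
   using insert.prems(9)[of "%s. if s = r then t else p * a s"] by (simp only: *)
  show "(LINT x|M. u x * sin (p * (\<Sum>s\<in>S. a s * X s x) + t * X r x))
   = (LINT x|N. v x * sin (p * (\<Sum>s\<in>S. a s * Y s x) + t * Y r x))"
   using insert.prems(10)[of "%s. if s = r then t else p * a s"] by (simp only: *)
 qed
 define u' where "u' x = u x * indicator (B r) (X r x)" for x
 define v' where "v' x = v x * indicator (B r) (Y r x)" for x
 \<comment> \<open>A trigonometric function changes sign and is not an admissible weight;
   \<open>(1 + trig) / 2\<close> stays between 0 and 1. Product-to-sum formulas reduce its Fourier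
   coefficients in coordinate \<open>r\<close> to the joint ones in \<open>aC\<close> and
   \<open>aS\<close>.\<close>
 have tilt: "(LINT x|M. u' x * ((1 + trig (\<Sum>s\<in>S. a s * X s x)) / 2)) = (LINT x|N. v' x * ((1 + trig (\<Sum>s\<in>S. a s * Y s x)) / 2))"
  if trig: "trig = sin | trig = cos" for a and trig :: "real => real"
 proof -
  \<comment> \<open>Sine as a shifted cosine lets one expansion serve both cases.\<close>
  obtain e where trig': "!!w. trig w = cos (w - e)"
  proof (cases "trig = sin")
   case True
   thus thesis by (intro that[of "pi / 2"]) (simp add: cos_diff)
  next
   case False
   with trig show thesis by (intro that[of 0]) simp
  qed
  have tm[measurable]: "trig : bm borel" using trig by auto
  have tb: "-1 <= trig w" "trig w <= 1" for w by (auto simp: trig')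
  have eq: "u x * ((1 + trig A) / 2) * cos (t * b) =
    u x * cos (0 * A + t * b) / 2 + cos e / 4 * (u x * cos (1 * A + t * b)) + sin e / 4 * (u x * sin (1 * A + t * b))
    + cos e / 4 * (u x * cos ((-1) * A + t * b)) - sin e / 4 * (u x * sin ((-1) * A + t * b))"
   for u :: "'z => real" and x A t b by (simp add: trig' cos_diff cos_add sin_add algebra_simps sin_diff)
  have eq2: "u x * ((1 + trig A) / 2) * sin (t * b) =
    u x * sin (0 * A + t * b) / 2 + cos e / 4 * (u x * sin (1 * A + t * b)) - sin e / 4 * (u x * cos (1 * A + t * b))
    + cos e / 4 * (u x * sin ((-1) * A + t * b)) + sin e / 4 * (u x * cos ((-1) * A + t * b))"
   for u :: "'z => real" and x A t b by (simp add: trig' cos_diff cos_add sin_add algebra_simps sin_diff)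
  have iM: "integrable M (%x. u x * cos (p * (\<Sum>s\<in>S. a s * X s x) + t * X r x))"
       "integrable M (%x. u x * sin (p * (\<Sum>s\<in>S. a s * X s x) + t * X r x))" for p t
   using insert.prems(5,6) by (auto intro!: M.integrable_unit[of _ 1] simp: abs_mult intro!: mult_le_one)
  have iN: "integrable N (%x. v x * cos (p * (\<Sum>s\<in>S. a s * Y s x) + t * Y r x))"
       "integrable N (%x. v x * sin (p * (\<Sum>s\<in>S. a s * Y s x) + t * Y r x))" for p t
   using insert.prems(7,8) by (auto intro!: N.integrable_unit[of _ 1] simp: abs_mult intro!: mult_le_one)
  have "(LINT x|M. (u x * ((1 + trig (\<Sum>s\<in>S. a s * X s x)) / 2)) * indicator (B r) (X r x)) =
    (LINT x|N. (v x * ((1 + trig (\<Sum>s\<in>S. a s * Y s x)) / 2)) * indicator (B r) (Y r x))"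
  proof (rule weighted_law_unique[OF M _ _ N])
   show "(LINT x|M. u x * ((1 + trig (\<Sum>s\<in>S. a s * X s x)) / 2) * cos (t * X r x))
    = (LINT x|N. v x * ((1 + trig (\<Sum>s\<in>S. a s * Y s x)) / 2) * cos (t * Y r x))" for t
    unfolding eq by (simp only: Bochner_Integration.integral_add Bochner_Integration.integral_diff
     integral_mult_right_zero integral_divide_zero iM iN aC aS
     Bochner_Integration.integrable_add Bochner_Integration.integrable_diff integrable_mult_right integrable_divide)
   show "(LINT x|M. u x * ((1 + trig (\<Sum>s\<in>S. a s * X s x)) / 2) * sin (t * X r x))
    = (LINT x|N. v x * ((1 + trig (\<Sum>s\<in>S. a s * Y s x)) / 2) * sin (t * Y r x))" for t
    unfolding eq2 by (simp only: Bochner_Integration.integral_add Bochner_Integration.integral_diff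
     integral_mult_right_zero integral_divide_zero iM iN aC aS
     Bochner_Integration.integrable_add Bochner_Integration.integrable_diff integrable_mult_right integrable_divide)
   have half: "0 <= w * ((1 + trig A) / 2)" "w * ((1 + trig A) / 2) <= 1" if "0 <= w" "w <= 1" for w A
    using that tb[of A] mult_le_one[of w "(1 + trig A) / 2"] by auto
   show "0 <= u x * ((1 + trig (\<Sum>s\<in>S. a s * X s x)) / 2)" "u x * ((1 + trig (\<Sum>s\<in>S. a s * X s x)) / 2) <= 1" for x
    by (intro half insert.prems)+
   show "0 <= v x * ((1 + trig (\<Sum>s\<in>S. a s * Y s x)) / 2)" "v x * ((1 + trig (\<Sum>s\<in>S. a s * Y s x)) / 2) <= 1" for x
    by (intro half insert.prems)+
  qed measurable
  thus ?thesis by (simp add: u'_def v'_def mult_ac)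
 qed
 have m': "u' : bm M" "v' : bm N" unfolding u'_def v'_def by measurable
 note [measurable] = m'
 have b': "0 <= u' x" "u' x <= 1" "0 <= v' y" "v' y <= 1" for x y
  using insert.prems(5-8) by (auto simp: u'_def v'_def indicator_def)
 have i': "integrable M u'" "integrable N v'" using b' by (auto intro!: M.integrable_unit[of _ 1] N.integrable_unit[of _ 1])
 have "(LINT x|M. u' x * trig (\<Sum>s\<in>S. a s * X s x)) = (LINT x|N. v' x * trig (\<Sum>s\<in>S. a s * Y s x))"
  if trig: "trig = sin | trig = cos" for a and trig :: "real => real"
 proof -
  have tm[measurable]: "trig : bm borel" using trig by auto
  have tb: "\<bar>trig w\<bar> <= 1" for w using trig by auto
  have mass: "(LINT x|M. u' x) = (LINT x|N. v' x)" using tilt[of cos "%_. 0"] by simp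
  have i: "integrable M (%x. u' x * trig (\<Sum>s\<in>S. a s * X s x))" "integrable N (%x. v' x * trig (\<Sum>s\<in>S. a s * Y s x))"
   using b' tb by (auto intro!: M.integrable_unit[of _ 1] N.integrable_unit[of _ 1] simp: abs_mult intro!: mult_le_one)
  have r: "w * ((1 + trig A) / 2) = w / 2 + w * trig A / 2" for w A by (simp add: field_simps)
  show ?thesis using tilt[OF trig, of a] unfolding r using i i' mass by simp
 qed
 hence "(LINT x|M. u' x * (\<Prod>s\<in>S. indicator (B s) (X s x))) = (LINT x|N. v' x * (\<Prod>s\<in>S. indicator (B s) (Y s x)))"
  using insert.prems b' m' by (intro insert.IH) auto
 thus ?case using insert.hyps by (simp add: u'_def v'_def mult.assoc)
qed

text \<open>Constant weights in \<open>weighted_joint_law_unique\<close> give equality on boxes,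
  which are stable under intersection and generate the product sigma-algebra.\<close>

lemma joint_law_unique:
 fixes X :: "'i => 'w => real" and Y :: "'i => 'v => real"
 assumes S: "finite S" and M: "prob_space M" and N: "prob_space N"
  and X: "!!s. s : S ==> X s : bm M" and Y: "!!s. s : S ==> Y s : bm N"
  and cos: "!!a. (LINT x|M. cos (\<Sum>s\<in>S. a s * X s x)) = (LINT x|N. cos (\<Sum>s\<in>S. a s * Y s x))"
  and sin: "!!a. (LINT x|M. sin (\<Sum>s\<in>S. a s * X s x)) = (LINT x|N. sin (\<Sum>s\<in>S. a s * Y s x))"
 shows "distr M (vecs S) (%x. \<lambda>s\<in>S. X s x) = distr N (vecs S) (%x. \<lambda>s\<in>S. Y s x)"
proof -
 interpret M: prob_space M by fact
 interpret N: prob_space N by fact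
 note [measurable] = X Y


 have E: "emeasure (distr K (vecs S) (%x. \<lambda>s\<in>S. Z s x)) (Pi\<^sub>E S A)
   = ennreal (LINT x|K. 1 * (\<Prod>s\<in>S. indicator (A s) (Z s x)))"
  if K: "prob_space K" and Z[measurable]: "!!s. s : S ==> Z s : bm K"
   and A: "!!s. s : S ==> A s : sets borel" for K :: "'z measure" and Z :: "'i => 'z => real" and A
 proof -
  interpret K: prob_space K by fact
  have [measurable]: "Pi\<^sub>E S A : sets (vecs S)" using A S by auto
  have V: "(%x. \<lambda>s\<in>S. Z s x) -` (Pi\<^sub>E S A) Int space K : sets K"
   by (rule measurable_sets[where A="vecs S"]) measurable
  have "emeasure (distr K (vecs S) (%x. \<lambda>s\<in>S. Z s x)) (Pi\<^sub>E S A)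
   = emeasure K ((%x. \<lambda>s\<in>S. Z s x) -` (Pi\<^sub>E S A) Int space K)" by (subst emeasure_distr) auto
  also have "... = ennreal (LINT x|K. indicator ((%x. \<lambda>s\<in>S. Z s x) -` (Pi\<^sub>E S A) Int space K) x)"
   using V by (simp add: K.emeasure_eq_measure)
  also have "(LINT x|K. indicator ((%x. \<lambda>s\<in>S. Z s x) -` (Pi\<^sub>E S A) Int space K) x) = (LINT x|K. 1 * (\<Prod>s\<in>S. indicator (A s) (Z s x) :: real))"
  proof (rule Bochner_Integration.integral_cong[OF refl])
   fix x assume "x : space K"
   thus "indicator ((%x. \<lambda>s\<in>S. Z s x) -` (Pi\<^sub>E S A) Int space K) x = 1 * (\<Prod>s\<in>S. indicator (A s) (Z s x) :: real)"
    using S by (cases "ALL s:S. Z s x : A s") (auto simp: PiE_iff prod_zero_iff indicator_def)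
  qed
  finally show ?thesis .
 qed
 have main: "emeasure (distr M (vecs S) (%x. \<lambda>s\<in>S. X s x)) (Pi\<^sub>E S A) =
  emeasure (distr N (vecs S) (%x. \<lambda>s\<in>S. Y s x)) (Pi\<^sub>E S A)"
  if A: "!!i. i : S ==> A i : sets borel" for A
 proof -
  have "(LINT x|M. 1 * (\<Prod>s\<in>S. indicator (A s) (X s x) :: real)) = (LINT x|N. 1 * (\<Prod>s\<in>S. indicator (A s) (Y s x)))"
   by (rule weighted_joint_law_unique[OF S M N X Y]) (simp_all add: cos sin A)
  thus ?thesis using E[of M X A] E[of N Y A] M N X Y A by simp
 qed
 interpret DM: prob_space "distr M (vecs S) (%x. \<lambda>s\<in>S. X s x)" by (rule M.prob_space_distr) measurable
 have "space (vecs S) : prod_algebra S (%_. borel)" by (auto simp: space_PiM intro!: prod_algebraI_finite[OF S])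
 thus ?thesis by (intro measure_eqI_PiM_finite[OF S, where M = "%_. borel" and A = "%_. space (vecs S)"])
   (auto simp: main DM.emeasure_finite)
qed

section \<open>Gaussian processes and independent copies\<close>

lemma pair_expectation_mult:
 fixes f :: "'a => real" and g :: "'b => real"
 assumes P: "prob_space P" and Q: "prob_space Q"
  and f: "integrable P f" and g: "integrable Q g"
 shows "integrable (P \<Otimes>\<^sub>M Q) (%w. f (fst w) * g (snd w))"
  and "(LINT w|(P \<Otimes>\<^sub>M Q). f (fst w) * g (snd w)) = (LINT x|P. f x) * (LINT y|Q. g y)"
proof -
 interpret P: prob_space P by fact
 interpret Q: prob_space Q by fact
 interpret pair_sigma_finite P Q by unfold_locales
 have [measurable]: "f : bm P" "g : bm Q" using f g by auto
 have i: "integrable (P \<Otimes>\<^sub>M Q) (%(x, y). f x * g y)"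
 proof (rule Fubini_integrable)
  show "integrable P (%x. \<integral>y. norm (case (x, y) of (x, y) => f x * g y) \<partial>Q)"
   using f by (simp add: abs_mult)
  show "AE x in P. integrable Q (%y. case (x, y) of (x, y) => f x * g y)"
   using g by simp
 qed simp
 thus "integrable (P \<Otimes>\<^sub>M Q) (%w. f (fst w) * g (snd w))" by (simp only: case_prod_beta')
 show "(LINT w|(P \<Otimes>\<^sub>M Q). f (fst w) * g (snd w)) = (LINT x|P. f x) * (LINT y|Q. g y)"
  using integral_fst'[OF i] by (simp add: case_prod_beta')
qed

lemma pair_char_add:
 fixes U :: "'a => real" and W :: "'b => real"
 assumes P: "prob_space P" and Q: "prob_space Q"
  and [measurable]: "U : bm P" "W : bm Q"
  and s: "(LINT x|P. sin (U x)) = 0" "(LINT x|Q. sin (W x)) = 0"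
 shows "(LINT w|(P \<Otimes>\<^sub>M Q). cos (U (fst w) + W (snd w))) = (LINT x|P. cos (U x)) * (LINT x|Q. cos (W x))"
  and "(LINT w|(P \<Otimes>\<^sub>M Q). sin (U (fst w) + W (snd w))) = 0"
proof -
 interpret P: prob_space P by fact
 interpret Q: prob_space Q by fact
 have i: "integrable P (%x. cos (U x))" "integrable P (%x. sin (U x))" "integrable Q (%x. cos (W x))" "integrable Q (%x. sin (W x))"
  by (auto intro!: P.integrable_unit[of _ 1] Q.integrable_unit[of _ 1])
 note p = pair_expectation_mult[OF P Q]
 show "(LINT w|(P \<Otimes>\<^sub>M Q). cos (U (fst w) + W (snd w))) = (LINT x|P. cos (U x)) * (LINT x|Q. cos (W x))"
  unfolding cos_add
  by (simp add: Bochner_Integration.integral_diff[OF p(1)[OF i(1) i(3)] p(1)[OF i(2) i(4)]] p(2)[OF i(1) i(3)] p(2)[OF i(2) i(4)] s)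
 show "(LINT w|(P \<Otimes>\<^sub>M Q). sin (U (fst w) + W (snd w))) = 0"
  unfolding sin_add
  by (simp add: Bochner_Integration.integral_add[OF p(1)[OF i(2) i(3)] p(1)[OF i(1) i(4)]] p(2)[OF i(2) i(3)] p(2)[OF i(1) i(4)] s)
qed

text \<open>A pair of vectors is one vector indexed by \<open>S\<close> times the two truth values,
  so \<open>joint_law_unique\<close> covers functions of both.\<close>

lemma pair_law_unique:
 fixes A B :: "'i => 'w => real" and C D :: "'i => 'v => real"
  and H :: "('i => real) => ('i => real) => real"
 assumes S: "finite S" and P: "prob_space P" and Q: "prob_space Q"
  and A: "!!s. s : S ==> A s : bm P" "!!s. s : S ==> B s : bm P"
  and C: "!!s. s : S ==> C s : bm Q" "!!s. s : S ==> D s : bm Q"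
  and cos: "!!a b. (LINT x|P. cos ((\<Sum>s\<in>S. a s * A s x) + (\<Sum>s\<in>S. b s * B s x)))
    = (LINT x|Q. cos ((\<Sum>s\<in>S. a s * C s x) + (\<Sum>s\<in>S. b s * D s x)))"
  and sin: "!!a b. (LINT x|P. sin ((\<Sum>s\<in>S. a s * A s x) + (\<Sum>s\<in>S. b s * B s x)))
    = (LINT x|Q. sin ((\<Sum>s\<in>S. a s * C s x) + (\<Sum>s\<in>S. b s * D s x)))"
  and H: "(%(x, y). H x y) : bm (vecs S \<Otimes>\<^sub>M vecs S)"
 shows "(LINT x|P. H (\<lambda>s\<in>S. A s x) (\<lambda>s\<in>S. B s x)) = (LINT x|Q. H (\<lambda>s\<in>S. C s x) (\<lambda>s\<in>S. D s x))"
  and "integrable P (%x. H (\<lambda>s\<in>S. A s x) (\<lambda>s\<in>S. B s x)) = integrable Q (%x. H (\<lambda>s\<in>S. C s x) (\<lambda>s\<in>S. D s x))"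
proof -
 let ?S = "S \<times> (UNIV :: bool set)"
 let ?X = "%A B (s, b). if b then B s else A s"
 let ?P = "vecs ?S"
 let ?T = "%w. (\<lambda>s\<in>S. w (s, False), \<lambda>s\<in>S. w (s, True))"
 note [measurable] = A C H
 have sum: "(\<Sum>s\<in>?S. a s * ?X A B s x) = (\<Sum>s\<in>S. a (s, False) * A s x) + (\<Sum>s\<in>S. a (s, True) * B s x)"
  for a x and A B :: "'i => 'z => real"
 proof -
  have "(\<Sum>w\<in>?S. h w) = (\<Sum>s\<in>S. \<Sum>b\<in>UNIV. h (s, b))" for h :: "'i \<times> bool => real"
   by (simp add: sum.cartesian_product)
  thus ?thesis by (simp add: UNIV_bool sum.distrib)
 qed
 have mX: "!!s. s : ?S ==> ?X A B s : bm P" "!!s. s : ?S ==> ?X C D s : bm Q"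
  using A C by auto
 have E: "distr P ?P (%x. \<lambda>s\<in>?S. ?X A B s x) = distr Q ?P (%x. \<lambda>s\<in>?S. ?X C D s x)"
 proof (rule joint_law_unique[OF _ P Q])
  show "(LINT x|P. cos (\<Sum>s\<in>?S. a s * ?X A B s x)) = (LINT x|Q. cos (\<Sum>s\<in>?S. a s * ?X C D s x))" for a
   unfolding sum by (rule cos)
  show "(LINT x|P. sin (\<Sum>s\<in>?S. a s * ?X A B s x)) = (LINT x|Q. sin (\<Sum>s\<in>?S. a s * ?X C D s x))" for a
   unfolding sum by (rule sin)
 qed (use S mX in auto)
 have T[measurable]: "?T : ?P \<rightarrow>\<^sub>M vecs S \<Otimes>\<^sub>M vecs S"
  by (intro measurable_Pair measurable_restrict measurable_component_singleton) auto
 have HT[measurable]: "(%w. case ?T w of (x, y) => H x y) : bm ?P" by (rule measurable_compose[OF T H])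
 have mP: "(%x. \<lambda>s\<in>?S. ?X A B s x) : P \<rightarrow>\<^sub>M ?P" by (intro measurable_restrict mX)
 have mQ: "(%x. \<lambda>s\<in>?S. ?X C D s x) : Q \<rightarrow>\<^sub>M ?P" by (intro measurable_restrict mX)
 have TP: "?T (\<lambda>s\<in>?S. ?X A B s x) = (\<lambda>s\<in>S. A s x, \<lambda>s\<in>S. B s x)" for x and A B :: "'i => 'z => real"
  by (auto simp: fun_eq_iff)
 have "(LINT w|distr P ?P (%x. \<lambda>s\<in>?S. ?X A B s x). (case ?T w of (x, y) => H x y)) = (LINT x|P. H (\<lambda>s\<in>S. A s x) (\<lambda>s\<in>S. B s x))"
  by (subst integral_distr[OF mP HT]) (simp only: TP case_prod_conv)
 moreover have "(LINT w|distr Q ?P (%x. \<lambda>s\<in>?S. ?X C D s x). (case ?T w of (x, y) => H x y)) = (LINT x|Q. H (\<lambda>s\<in>S. C s x) (\<lambda>s\<in>S. D s x))"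
  by (subst integral_distr[OF mQ HT]) (simp only: TP case_prod_conv)
 ultimately show "(LINT x|P. H (\<lambda>s\<in>S. A s x) (\<lambda>s\<in>S. B s x)) = (LINT x|Q. H (\<lambda>s\<in>S. C s x) (\<lambda>s\<in>S. D s x))"
  using E by simp
 have "integrable (distr P ?P (%x. \<lambda>s\<in>?S. ?X A B s x)) (%w. case ?T w of (x, y) => H x y) = integrable P (%x. H (\<lambda>s\<in>S. A s x) (\<lambda>s\<in>S. B s x))"
  by (subst integrable_distr_eq[OF mP HT]) (simp only: TP case_prod_conv)
 moreover have "integrable (distr Q ?P (%x. \<lambda>s\<in>?S. ?X C D s x)) (%w. case ?T w of (x, y) => H x y) = integrable Q (%x. H (\<lambda>s\<in>S. C s x) (\<lambda>s\<in>S. D s x))"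
  by (subst integrable_distr_eq[OF mQ HT]) (simp only: TP case_prod_conv)
 ultimately show "integrable P (%x. H (\<lambda>s\<in>S. A s x) (\<lambda>s\<in>S. B s x)) = integrable Q (%x. H (\<lambda>s\<in>S. C s x) (\<lambda>s\<in>S. D s x))"
  using E by simp
qed

definition qform :: "'i set => ('i => 'i => real) => ('i => real) => ('i => real) => real" where
 "qform S K a b = (\<Sum>s\<in>S. \<Sum>t\<in>S. a s * b t * K s t)"

lemma qform_lin:
 "qform S K (%s. p * a s + q * b s) (%s. p * a s + q * b s)
  = p^2 * qform S K a a + p * q * (qform S K a b + qform S K b a) + q^2 * qform S K b b"
proof -
 have e: "(p * a s + q * b s) * (p * a t + q * b t) * K s t
   = p^2 * (a s * a t * K s t) + p * q * (a s * b t * K s t + b s * a t * K s t) + q^2 * (b s * b t * K s t)" for s t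
  by (simp add: power2_eq_square algebra_simps)
 show ?thesis unfolding qform_def e by (simp add: sum.distrib sum_distrib_left distrib_left)
qed

text \<open>The Gaussian law is encoded by its characteristic function, split into real and
  imaginary part. Degenerate covariances fit without a separate case, and laws can be compared
  without densities.\<close>

locale gaussian_process = prob_space M for M :: "'w measure" +
 fixes X :: "'i => 'w => real" and K :: "'i => 'i => real"
 assumes rv[measurable]: "X s : bm M"
  and exp_cos: "finite S ==> (LINT w|M. cos (\<Sum>s\<in>S. a s * X s w)) = exp (- qform S K a a / 2)"
  and exp_sin: "finite S ==> (LINT w|M. sin (\<Sum>s\<in>S. a s * X s w)) = 0"
  and square_integrable: "integrable M (%w. (X s w)^2)"
  and exp_zero: "(LINT w|M. X s w) = 0"
  and exp_mult: "(LINT w|M. X s w * X t w) = K s t"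
begin

abbreviation M2 :: "('w \<times> 'w) measure" where "M2 \<equiv> M \<Otimes>\<^sub>M M"

lemma prob_space_pair: "prob_space M2"
proof -
 interpret pair_prob_space M M by unfold_locales
 show ?thesis by unfold_locales
qed

lemma pair_char:
 assumes S: "finite S"
 shows "(LINT w|M2. cos ((\<Sum>s\<in>S. a s * (\<alpha> * X s (fst w) + \<beta> * X s (snd w))) + (\<Sum>s\<in>S. b s * (\<gamma> * X s (fst w) + \<delta> * X s (snd w)))))
   = exp (- ((\<alpha>^2 + \<beta>^2) * qform S K a a + (\<alpha> * \<gamma> + \<beta> * \<delta>) * (qform S K a b + qform S K b a) + (\<gamma>^2 + \<delta>^2) * qform S K b b) / 2)"
  and "(LINT w|M2. sin ((\<Sum>s\<in>S. a s * (\<alpha> * X s (fst w) + \<beta> * X s (snd w))) + (\<Sum>s\<in>S. b s * (\<gamma> * X s (fst w) + \<delta> * X s (snd w))))) = 0"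
proof -
 have r: "(\<Sum>s\<in>S. a s * (\<alpha> * X s (fst w) + \<beta> * X s (snd w))) + (\<Sum>s\<in>S. b s * (\<gamma> * X s (fst w) + \<delta> * X s (snd w)))
  = (\<Sum>s\<in>S. (\<alpha> * a s + \<gamma> * b s) * X s (fst w)) + (\<Sum>s\<in>S. (\<beta> * a s + \<delta> * b s) * X s (snd w))" for w
  unfolding sum.distrib[symmetric] by (rule sum.cong) (auto simp: algebra_simps)
 have m: "(%w. \<Sum>s\<in>S. c s * X s w) : bm M" for c by measurable
 note c = pair_char_add[OF prob_space_axioms prob_space_axioms m m exp_sin[OF S] exp_sin[OF S]]
 show "(LINT w|M2. cos ((\<Sum>s\<in>S. a s * (\<alpha> * X s (fst w) + \<beta> * X s (snd w))) + (\<Sum>s\<in>S. b s * (\<gamma> * X s (fst w) + \<delta> * X s (snd w)))))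
   = exp (- ((\<alpha>^2 + \<beta>^2) * qform S K a a + (\<alpha> * \<gamma> + \<beta> * \<delta>) * (qform S K a b + qform S K b a) + (\<gamma>^2 + \<delta>^2) * qform S K b b) / 2)"
  unfolding r c(1) exp_cos[OF S] qform_lin exp_add[symmetric] by (rule arg_cong[where f = exp]) (simp add: field_simps)
 show "(LINT w|M2. sin ((\<Sum>s\<in>S. a s * (\<alpha> * X s (fst w) + \<beta> * X s (snd w))) + (\<Sum>s\<in>S. b s * (\<gamma> * X s (fst w) + \<delta> * X s (snd w))))) = 0"
  unfolding r by (rule c(2))
qed

text \<open>The law of a pair of linear combinations of two independent copies only depends on the
 Gram matrix of the coefficient vectors.\<close>

lemma pair_law:
 fixes H :: "('i => real) => ('i => real) => real"
 assumes S: "finite S" and N: "gaussian_process N Y K"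
  and g: "\<alpha>^2 + \<beta>^2 = \<alpha>'^2 + \<beta>'^2" "\<alpha> * \<gamma> + \<beta> * \<delta> = \<alpha>' * \<gamma>' + \<beta>' * \<delta>'" "\<gamma>^2 + \<delta>^2 = \<gamma>'^2 + \<delta>'^2"
  and H: "(%(x, y). H x y) : bm (vecs S \<Otimes>\<^sub>M vecs S)"
 shows "(LINT w|M2. H (\<lambda>s\<in>S. \<alpha> * X s (fst w) + \<beta> * X s (snd w)) (\<lambda>s\<in>S. \<gamma> * X s (fst w) + \<delta> * X s (snd w)))
   = (LINT w|(N \<Otimes>\<^sub>M N). H (\<lambda>s\<in>S. \<alpha>' * Y s (fst w) + \<beta>' * Y s (snd w)) (\<lambda>s\<in>S. \<gamma>' * Y s (fst w) + \<delta>' * Y s (snd w)))"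
  and "integrable M2 (%w. H (\<lambda>s\<in>S. \<alpha> * X s (fst w) + \<beta> * X s (snd w)) (\<lambda>s\<in>S. \<gamma> * X s (fst w) + \<delta> * X s (snd w)))
   = integrable (N \<Otimes>\<^sub>M N) (%w. H (\<lambda>s\<in>S. \<alpha>' * Y s (fst w) + \<beta>' * Y s (snd w)) (\<lambda>s\<in>S. \<gamma>' * Y s (fst w) + \<delta>' * Y s (snd w)))"
proof -
 interpret N: gaussian_process N Y K by fact
 note u = pair_law_unique[OF S prob_space_pair N.prob_space_pair,
   of "%s w. \<alpha> * X s (fst w) + \<beta> * X s (snd w)" "%s w. \<gamma> * X s (fst w) + \<delta> * X s (snd w)"
     "%s w. \<alpha>' * Y s (fst w) + \<beta>' * Y s (snd w)" "%s w. \<gamma>' * Y s (fst w) + \<delta>' * Y s (snd w)",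
   OF _ _ _ _ _ _ H]
 show "(LINT w|M2. H (\<lambda>s\<in>S. \<alpha> * X s (fst w) + \<beta> * X s (snd w)) (\<lambda>s\<in>S. \<gamma> * X s (fst w) + \<delta> * X s (snd w)))
   = (LINT w|(N \<Otimes>\<^sub>M N). H (\<lambda>s\<in>S. \<alpha>' * Y s (fst w) + \<beta>' * Y s (snd w)) (\<lambda>s\<in>S. \<gamma>' * Y s (fst w) + \<delta>' * Y s (snd w)))"
  by (rule u(1)) (auto simp only: pair_char[OF S] N.pair_char[OF S] g intro!: borel_measurable_add borel_measurable_times borel_measurable_const measurable_compose[OF measurable_fst] measurable_compose[OF measurable_snd] rv N.rv)
 show "integrable M2 (%w. H (\<lambda>s\<in>S. \<alpha> * X s (fst w) + \<beta> * X s (snd w)) (\<lambda>s\<in>S. \<gamma> * X s (fst w) + \<delta> * X s (snd w)))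
   = integrable (N \<Otimes>\<^sub>M N) (%w. H (\<lambda>s\<in>S. \<alpha>' * Y s (fst w) + \<beta>' * Y s (snd w)) (\<lambda>s\<in>S. \<gamma>' * Y s (fst w) + \<delta>' * Y s (snd w)))"
  by (rule u(2)) (auto simp only: pair_char[OF S] N.pair_char[OF S] g intro!: borel_measurable_add borel_measurable_times borel_measurable_const measurable_compose[OF measurable_fst] measurable_compose[OF measurable_snd] rv N.rv)
qed

text \<open>Two copies with correlation \<open>p^2\<close> can be realised as two noisy versions of
  one common sample, each with correlation \<open>p\<close> to it and conditionally independent
  given it. This gives the semigroup property behind \<open>noise_square\<close>.\<close>

lemma triple_law:
 fixes H :: "('i => real) => ('i => real) => real"
 assumes S: "finite S" and g: "p^2 + q^2 = 1" "r^2 + t^2 = 1" "r = p^2"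
  and H: "(%(x, y). H x y) : bm (vecs S \<Otimes>\<^sub>M vecs S)"
 shows "(LINT w|M2. H (\<lambda>s\<in>S. X s (fst w)) (\<lambda>s\<in>S. r * X s (fst w) + t * X s (snd w)))
  = (LINT w|(M \<Otimes>\<^sub>M M2). H (\<lambda>s\<in>S. p * X s (fst w) + q * X s (fst (snd w))) (\<lambda>s\<in>S. p * X s (fst w) + q * X s (snd (snd w))))"
proof (rule pair_law_unique(1)[OF S prob_space_pair _ _ _ _ _ _ _ H])
 interpret P2: pair_prob_space M "M \<Otimes>\<^sub>M M"
  using prob_space_pair prob_space_axioms by (simp add: pair_prob_space_def pair_sigma_finite_def prob_space_imp_sigma_finite)
 show "prob_space (M \<Otimes>\<^sub>M M2)" by unfold_locales
 fix a b :: "'i => real"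
 have l: "(\<Sum>s\<in>S. a s * (p * X s (fst w) + q * X s (fst (snd w)))) + (\<Sum>s\<in>S. b s * (p * X s (fst w) + q * X s (snd (snd w))))
  = (\<Sum>s\<in>S. (p * a s + p * b s) * X s (fst w)) + (%w. (\<Sum>s\<in>S. a s * (q * X s (fst w) + 0 * X s (snd w))) + (\<Sum>s\<in>S. b s * (0 * X s (fst w) + q * X s (snd w)))) (snd w)" for w :: "'w \<times> 'w \<times> 'w"
  unfolding sum.distrib[symmetric] by (rule sum.cong) (auto simp: algebra_simps)
 have m: "(%w. \<Sum>s\<in>S. c s * X s w) : bm M" for c by measurable
 have m2: "(%w. (\<Sum>s\<in>S. a s * (q * X s (fst w) + 0 * X s (snd w))) + (\<Sum>s\<in>S. b s * (0 * X s (fst w) + q * X s (snd w)))) : bm M2"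
  by measurable
 note c = pair_char_add[OF prob_space_axioms prob_space_pair m m2 exp_sin[OF S] pair_char(2)[OF S]]
 note L = pair_char[OF S, where \<alpha> = 1 and \<beta> = 0 and \<gamma> = r and \<delta> = t and a = a and b = b, simplified]
 have e: "- (qform S K a a + r * (qform S K a b + qform S K b a) + (r^2 + t^2) * qform S K b b) / 2 =
  - (p^2 * qform S K a a + p * p * (qform S K a b + qform S K b a) + p^2 * qform S K b b) / 2 + - (q^2 * qform S K a a + q^2 * qform S K b b) / 2"
 proof -
  have "p * p = r" using g(3) by (simp add: power2_eq_square)
  moreover have "q^2 = 1 - r" using g by simp
  ultimately show ?thesis unfolding g(2) g(3)[symmetric] by (simp only:) (simp add: field_simps)
 qed
 show "(LINT w|M2. cos ((\<Sum>s\<in>S. a s * X s (fst w)) + (\<Sum>s\<in>S. b s * (r * X s (fst w) + t * X s (snd w)))))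
  = (LINT w|(M \<Otimes>\<^sub>M M2). cos ((\<Sum>s\<in>S. a s * (p * X s (fst w) + q * X s (fst (snd w)))) + (\<Sum>s\<in>S. b s * (p * X s (fst w) + q * X s (snd (snd w))))))"
  unfolding l c(1) L(1) exp_cos[OF S] pair_char(1)[OF S] qform_lin exp_add[symmetric]
  by (rule arg_cong[where f = exp]) (use e in simp)
 show "(LINT w|M2. sin ((\<Sum>s\<in>S. a s * X s (fst w)) + (\<Sum>s\<in>S. b s * (r * X s (fst w) + t * X s (snd w)))))
  = (LINT w|(M \<Otimes>\<^sub>M M2). sin ((\<Sum>s\<in>S. a s * (p * X s (fst w) + q * X s (fst (snd w)))) + (\<Sum>s\<in>S. b s * (p * X s (fst w) + q * X s (snd (snd w))))))"
  unfolding l L(2) by (rule c(2)[symmetric])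
qed measurable

end

section \<open>Gaussian integration by parts\<close>

text \<open>Exact local affinity in place of differentiability: a selector coincides near a generic
  point with a single coordinate, so no smoothing is necessary.\<close>

definition affine_at :: "'i set => (('i => real) => real) => (('i => real) => 'i => real) => ('i => real) => bool" where
 "affine_at S F DF x \<longleftrightarrow> (EX r>0. ALL y. (ALL s:S. \<bar>y s - x s\<bar> < r) --> F y = F x + (\<Sum>s\<in>S. DF x s * (y s - x s)))"

lemma affine_at_quotient_limit:
 fixes z :: "nat => 'i => real"
 assumes S: "finite S" and F: "affine_at S F DF x"
  and h: "!!n. h n ~= 0" "h \<longlonglongrightarrow> 0" and z: "!!s. s : S ==> (%n. (z n s - x s) / h n) \<longlonglongrightarrow> v s"
 shows "(%n. (F (z n) - F x) / h n) \<longlonglongrightarrow> (\<Sum>s\<in>S. DF x s * v s)"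
proof -
 obtain r where r: "r > 0" "!!y. (ALL s:S. \<bar>y s - x s\<bar> < r) ==> F y = F x + (\<Sum>s\<in>S. DF x s * (y s - x s))"
  using F by (auto simp: affine_at_def)
 have "(%n. z n s - x s) \<longlonglongrightarrow> 0" if "s : S" for s
  using tendsto_mult[OF z[OF that] h(2)] h(1) by simp
 hence "\<forall>\<^sub>F n in sequentially. \<bar>z n s - x s\<bar> < r" if "s : S" for s
  using that r(1) by (auto simp: tendsto_iff dist_real_def)
 hence "\<forall>\<^sub>F n in sequentially. ALL s:S. \<bar>z n s - x s\<bar> < r"
  using S by (simp add: eventually_ball_finite_distrib)
 hence "\<forall>\<^sub>F n in sequentially. (\<Sum>s\<in>S. DF x s * ((z n s - x s) / h n)) = (F (z n) - F x) / h n"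
  by eventually_elim (simp add: r(2) sum_divide_distrib)
 moreover have "(%n. \<Sum>s\<in>S. DF x s * ((z n s - x s) / h n)) \<longlonglongrightarrow> (\<Sum>s\<in>S. DF x s * v s)"
  by (intro tendsto_intros z)
 ultimately show ?thesis by (rule Lim_transform_eventually[rotated])
qed

lemma integrable_bounded_mult:
 fixes f g :: "'a => real"
 assumes g: "integrable P g" and [measurable]: "f : bm P" and f: "!!x. \<bar>f x\<bar> <= B"
 shows "integrable P (%x. f x * g x)"
proof (rule Bochner_Integration.integrable_bound)
 have [measurable]: "g : bm P" using g by auto
 show "integrable P (%x. B * \<bar>g x\<bar>)" using g by simp
 have "B >= 0" using f[of undefined] by linarith
 thus "AE x in P. norm (f x * g x) <= norm (B * \<bar>g x\<bar>)" by (auto simp: abs_mult intro!: mult_right_mono f)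
 show "(%x. f x * g x) : bm P" by measurable
qed

context gaussian_process
begin

definition comb :: "'i set => real => real => 'w \<times> 'w => 'i => real" where
 "comb S a b w = (\<lambda>s\<in>S. a * X s (fst w) + b * X s (snd w))"

lemma comb_measurable[measurable]: "comb S \<alpha> \<beta> : M2 \<rightarrow>\<^sub>M vecs S"
 unfolding comb_def[abs_def] by measurable

lemma comb_apply: "s : S ==> comb S a b w s = a * X s (fst w) + b * X s (snd w)"
 by (simp add: comb_def)

lemma restr_measurable[measurable]: "(%w. \<lambda>s\<in>S. X s w) : M \<rightarrow>\<^sub>M vecs S"
 by measurable

lemma comb_law:
 fixes H :: "('i => real) => ('i => real) => real"
 assumes "finite S" "a^2 + b^2 = a'^2 + b'^2" "a * g + b * d = a' * g' + b' * d'" "g^2 + d^2 = g'^2 + d'^2"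
  and "(%(x, y). H x y) : bm (vecs S \<Otimes>\<^sub>M vecs S)"
 shows "(LINT w|M2. H (comb S a b w) (comb S g d w)) = (LINT w|M2. H (comb S a' b' w) (comb S g' d' w))"
 unfolding comb_def by (rule pair_law(1)[OF assms(1) gaussian_process_axioms assms(2-5)])

lemma expectation_fst:
 fixes f :: "'w => real"
 assumes "integrable M f"
 shows "integrable M2 (%w. f (fst w))" "(LINT w|M2. f (fst w)) = (LINT x|M. f x)"
 using pair_expectation_mult[OF prob_space_axioms prob_space_axioms assms, of "%_. 1"] by (auto simp: prob_space)

lemma expectation_snd:
 fixes f :: "'w => real"
 assumes "integrable M f"
 shows "integrable M2 (%w. f (snd w))" "(LINT w|M2. f (snd w)) = (LINT x|M. f x)"
 using pair_expectation_mult[OF prob_space_axioms prob_space_axioms _ assms, of "%_. 1"] by (auto simp: prob_space)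

lemma comb_single_law:
 fixes H :: "('i => real) => real"
 assumes S: "finite S" and g: "a^2 + d^2 = 1" and [measurable]: "H : bm (vecs S)"
  and b: "!!x. \<bar>H x\<bar> <= c"
 shows "(LINT w|M2. H (comb S a d w)) = (LINT w|M. H (\<lambda>s\<in>S. X s w))"
proof -
 have "(LINT w|M2. H (comb S a d w)) = (LINT w|M2. H (comb S 1 0 w))"
  using comb_law[OF S, of a d 1 0 0 0 0 0 "%x y. H x"] g by simp
 also have "... = (LINT w|M2. (%w. H (\<lambda>s\<in>S. X s w)) (fst w))" by (simp add: comb_def)
 also have "... = (LINT w|M. H (\<lambda>s\<in>S. X s w))"
  by (rule expectation_fst(2)) (auto intro!: integrable_unit[of _ c] b)
 finally show ?thesis .
qed

lemma integrable_X: "integrable M (X s)"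
 using square_integrable_imp_integrable[OF rv square_integrable] .

lemma integrable_mult_X: "integrable M (%w. \<bar>X s w\<bar> * \<bar>X t w\<bar>)"
proof (rule Bochner_Integration.integrable_bound)
 show "integrable M (%w. (X s w)^2 + (X t w)^2)" using square_integrable by simp
 show "AE w in M. norm (\<bar>X s w\<bar> * \<bar>X t w\<bar>) <= norm ((X s w)^2 + (X t w)^2)"
 proof (rule AE_I2)
  fix w
  have "2 * (\<bar>X s w\<bar> * \<bar>X t w\<bar>) <= (X s w)^2 + (X t w)^2"
   using sum_squares_bound[of "\<bar>X s w\<bar>" "\<bar>X t w\<bar>"] by simp
  moreover have "0 <= \<bar>X s w\<bar> * \<bar>X t w\<bar>" by simp
  ultimately have "\<bar>X s w\<bar> * \<bar>X t w\<bar> <= (X s w)^2 + (X t w)^2" by linarith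
  thus "norm (\<bar>X s w\<bar> * \<bar>X t w\<bar>) <= norm ((X s w)^2 + (X t w)^2)" by (simp add: abs_mult)
 qed
qed measurable

lemma integrable_pair_dominant:
 assumes "finite S"
 shows "integrable M2 (%w. (\<Sum>s\<in>S. \<bar>X s (fst w)\<bar> + \<bar>X s (snd w)\<bar>) * \<bar>X t (snd w)\<bar>)"
  and "integrable M2 (%w. (\<Sum>s\<in>S. \<bar>X s (fst w)\<bar> + \<bar>X s (snd w)\<bar>))"
proof -
 have a: "integrable M (%w. \<bar>X s w\<bar>)" for s using integrable_X by simp
 show "integrable M2 (%w. (\<Sum>s\<in>S. \<bar>X s (fst w)\<bar> + \<bar>X s (snd w)\<bar>) * \<bar>X t (snd w)\<bar>)"
  unfolding sum_distrib_right distrib_right by (intro Bochner_Integration.integrable_sum Bochner_Integration.integrable_add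
    pair_expectation_mult(1)[OF prob_space_axioms prob_space_axioms a a] expectation_snd(1)[OF integrable_mult_X])
 show "integrable M2 (%w. (\<Sum>s\<in>S. \<bar>X s (fst w)\<bar> + \<bar>X s (snd w)\<bar>))"
  by (intro Bochner_Integration.integrable_sum Bochner_Integration.integrable_add expectation_snd(1)[OF a] expectation_fst(1)[OF a])
qed

text \<open>A Lipschitz function of the process, tested along the rotation
 \<open>cos h X + sin h X'\<close> of two independent copies.\<close>

lemma rotation_quotient:
 fixes F :: "('i => real) => real" and Z :: "'w \<times> 'w => real"
 assumes S: "finite S" and [measurable]: "F : bm (vecs S)" "Z : bm M2"
  and lip: "!!x y. \<bar>F x - F y\<bar> <= (\<Sum>s\<in>S. \<bar>x s - y s\<bar>)"
  and ae: "AE w in M. affine_at S F DF (\<lambda>s\<in>S. X s w)"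
  and dm: "!!s. s : S ==> (%x. DF x s) : bm (vecs S)"
  and h: "!!n. h n ~= 0" "h \<longlonglongrightarrow> 0"
  and i: "integrable M2 (%w. (\<Sum>s\<in>S. \<bar>X s (fst w)\<bar> + \<bar>X s (snd w)\<bar>) * \<bar>Z w\<bar>)"
 shows "(%n. \<integral>w. (F (comb S (cos (h n)) (sin (h n)) w) - F (comb S 1 0 w)) / h n * Z w \<partial>M2)
   \<longlonglongrightarrow> (LINT w|M2. (\<Sum>s\<in>S. DF (comb S 1 0 w) s * X s (snd w)) * Z w)"
proof (rule integral_dominated_convergence[OF _ _ i])
 note [measurable] = dm
 have [measurable]: "!!s. s : S ==> (%w. DF (comb S 1 0 w) s) : bm M2" by (rule measurable_compose[OF comb_measurable dm])
 show "(%w. (\<Sum>s\<in>S. DF (comb S 1 0 w) s * X s (snd w)) * Z w) : bm M2" by measurable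
 show "(%w. (F (comb S (cos (h n)) (sin (h n)) w) - F (comb S 1 0 w)) / h n * Z w) : bm M2" for n
  by measurable
 have q: "(%n. sin (h n) / h n) \<longlonglongrightarrow> 1" "(%n. (cos (h n) - 1) / h n) \<longlonglongrightarrow> 0"
 proof -
  have at: "filterlim h (at 0) sequentially" using h by (simp add: filterlim_at)
  have "((%x::real. sin x / x) \<longlongrightarrow> 1) (at 0)"
   using DERIV_sin[of "0::real"] by (simp add: DERIV_def)
  from filterlim_compose[OF this at] show "(%n. sin (h n) / h n) \<longlonglongrightarrow> 1" .
  have "((%x::real. (cos x - 1) / x) \<longlongrightarrow> 0) (at 0)"
   using DERIV_cos[of "0::real"] by (simp add: DERIV_def)
  from filterlim_compose[OF this at] show "(%n. (cos (h n) - 1) / h n) \<longlonglongrightarrow> 0" .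
 qed
 have "AE w in M \<Otimes>\<^sub>M M. affine_at S F DF (\<lambda>s\<in>S. X s (fst w))"
  by (rule AE_distrD[OF measurable_fst[of M M]]) (simp only: distr_pair_fst ae)
 thus "AE w in M \<Otimes>\<^sub>M M. (%n. (F (comb S (cos (h n)) (sin (h n)) w) - F (comb S 1 0 w)) / h n * Z w)
   \<longlonglongrightarrow> (\<Sum>s\<in>S. DF (comb S 1 0 w) s * X s (snd w)) * Z w"
 proof eventually_elim
  case (elim w)
  hence "affine_at S F DF (comb S 1 0 w)" by (simp add: comb_def)
  thus ?case
  proof (intro tendsto_mult tendsto_const affine_at_quotient_limit[OF S _ h])
   fix s assume s: "s : S"
   have "(%n. (cos (h n) - 1) / h n * X s (fst w) + sin (h n) / h n * X s (snd w)) \<longlonglongrightarrow> 0 * X s (fst w) + 1 * X s (snd w)"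
    by (intro tendsto_intros q)
   thus "(%n. (comb S (cos (h n)) (sin (h n)) w s - comb S 1 0 w s) / h n) \<longlonglongrightarrow> X s (snd w)"
    using s by (simp add: comb_def field_simps diff_divide_distrib add_divide_distrib)
  qed
 qed
 show "AE w in M \<Otimes>\<^sub>M M. norm ((F (comb S (cos (h n)) (sin (h n)) w) - F (comb S 1 0 w)) / h n * Z w)
   <= (\<Sum>s\<in>S. \<bar>X s (fst w)\<bar> + \<bar>X s (snd w)\<bar>) * \<bar>Z w\<bar>" for n
 proof (rule AE_I2)
  fix w
  \<comment> \<open>First-order bounds for both coefficients dominate the difference quotient by the
    absolute values of the coordinates of the two copies, uniformly in \<open>n\<close>.\<close>
  have c: "\<bar>cos (h n) - 1\<bar> <= \<bar>h n\<bar>" "\<bar>sin (h n)\<bar> <= \<bar>h n\<bar>"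
  proof -
   have "\<bar>sin (h n / 2)\<bar> <= \<bar>h n / 2\<bar>" by (rule abs_sin_x_le_abs_x)
   moreover have "1 - cos (h n) = 2 * \<bar>sin (h n / 2)\<bar> * \<bar>sin (h n / 2)\<bar>"
    using cos_double_sin[of "h n / 2"] by (simp add: power2_eq_square abs_mult[symmetric])
   moreover have "2 * \<bar>sin (h n / 2)\<bar> * \<bar>sin (h n / 2)\<bar> <= 2 * \<bar>h n / 2\<bar> * 1"
    using calculation(1) by (intro mult_mono) auto
   ultimately show "\<bar>cos (h n) - 1\<bar> <= \<bar>h n\<bar>" by simp
   show "\<bar>sin (h n)\<bar> <= \<bar>h n\<bar>" by (rule abs_sin_x_le_abs_x)
  qed
  have "\<bar>F (comb S (cos (h n)) (sin (h n)) w) - F (comb S 1 0 w)\<bar> <= (\<Sum>s\<in>S. \<bar>comb S (cos (h n)) (sin (h n)) w s - comb S 1 0 w s\<bar>)"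
   by (rule lip)
  also have "... <= (\<Sum>s\<in>S. \<bar>h n\<bar> * (\<bar>X s (fst w)\<bar> + \<bar>X s (snd w)\<bar>))"
  proof (rule sum_mono)
   fix s assume "s : S"
   hence "\<bar>comb S (cos (h n)) (sin (h n)) w s - comb S 1 0 w s\<bar> = \<bar>(cos (h n) - 1) * X s (fst w) + sin (h n) * X s (snd w)\<bar>"
    by (simp add: comb_def algebra_simps)
   also have "... <= \<bar>cos (h n) - 1\<bar> * \<bar>X s (fst w)\<bar> + \<bar>sin (h n)\<bar> * \<bar>X s (snd w)\<bar>"
    by (metis abs_mult abs_triangle_ineq)
   also have "... <= \<bar>h n\<bar> * \<bar>X s (fst w)\<bar> + \<bar>h n\<bar> * \<bar>X s (snd w)\<bar>"
    using c by (intro add_mono mult_right_mono) auto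
   finally show "\<bar>comb S (cos (h n)) (sin (h n)) w s - comb S 1 0 w s\<bar> <= \<bar>h n\<bar> * (\<bar>X s (fst w)\<bar> + \<bar>X s (snd w)\<bar>)"
    by (simp add: distrib_left)
  qed
  finally have "\<bar>F (comb S (cos (h n)) (sin (h n)) w) - F (comb S 1 0 w)\<bar> <= \<bar>h n\<bar> * (\<Sum>s\<in>S. \<bar>X s (fst w)\<bar> + \<bar>X s (snd w)\<bar>)"
   by (simp add: sum_distrib_left)
  hence "\<bar>(F (comb S (cos (h n)) (sin (h n)) w) - F (comb S 1 0 w)) / h n\<bar> <= (\<Sum>s\<in>S. \<bar>X s (fst w)\<bar> + \<bar>X s (snd w)\<bar>)"
   using h(1)[of n] by (simp add: abs_divide pos_divide_le_eq mult.commute)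
  thus "norm ((F (comb S (cos (h n)) (sin (h n)) w) - F (comb S 1 0 w)) / h n * Z w)
   <= (\<Sum>s\<in>S. \<bar>X s (fst w)\<bar> + \<bar>X s (snd w)\<bar>) * \<bar>Z w\<bar>"
   unfolding real_norm_def abs_mult by (rule mult_right_mono) simp
 qed
qed

text \<open>Rotation proof of Gaussian integration by parts. The derivative of \<open>F\<close>
  along the rotation, tested against the second copy at \<open>t\<close>, is computed in two ways:
  directly it gives the sum over \<open>s\<close> with the factor \<open>K s t\<close>; by the
  orthogonality \<open>rot\<close> it is the limit of \<open>tan h / h\<close> times the expectation
  of \<open>F\<close> against the first copy at \<open>t\<close>.\<close>

lemma integration_by_parts:
 fixes F :: "('i => real) => real"
 assumes S: "finite S" and t: "t : S" and F[measurable]: "F : bm (vecs S)"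
  and B: "!!x. \<bar>F x\<bar> <= B"
  and lip: "!!x y. \<bar>F x - F y\<bar> <= (\<Sum>s\<in>S. \<bar>x s - y s\<bar>)"
  and ae: "AE v in M. affine_at S F DF (\<lambda>s\<in>S. X s v)"
  and dm: "!!s. s : S ==> (%x. DF x s) : bm (vecs S)"
  and db: "!!x s. \<bar>DF x s\<bar> <= 1"
 shows "(LINT v|M. F (\<lambda>s\<in>S. X s v) * X t v) = (\<Sum>s\<in>S. K s t * (LINT v|M. DF (\<lambda>s\<in>S. X s v) s))"
proof -
 define h where "h n = 1 / real (Suc n)" for n
 have h: "h n > 0" "h n <= 1" "h \<longlonglongrightarrow> 0" for n
  unfolding h_def[abs_def] using LIMSEQ_inverse_real_of_nat by (auto simp: inverse_eq_divide)
 have Bi: "integrable M2 (%v. F (comb S a b v) * X t (fst v))" "integrable M2 (%v. F (comb S a b v) * X t (snd v))" for a b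
  by (rule integrable_bounded_mult[of _ _ _ B]; auto intro!: B expectation_fst(1)[OF integrable_X] expectation_snd(1)[OF integrable_X])+
 let ?Xt = "%v::'w \<times> 'w. X t (snd v)"
 have z: "(LINT v|M2. F (comb S 1 0 v) * X t (snd v)) = 0"
 proof -
  have "integrable M (%v. F (\<lambda>s\<in>S. X s v))" by (rule integrable_unit[of _ B]) (auto simp: B)
  thus ?thesis
   using pair_expectation_mult(2)[OF prob_space_axioms prob_space_axioms _ integrable_X, of "%v. F (\<lambda>s\<in>S. X s v)" t]
   by (simp add: comb_def exp_zero)
 qed
 \<comment> \<open>The combination \<open>- sin h X + cos h X'\<close> is independent of
   \<open>cos h X + sin h X'\<close>, so its product with \<open>F\<close> has mean 0; this trades
   the second copy for \<open>tan h\<close> times the first.\<close>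
 have rot: "cos (h n) * (LINT v|M2. F (comb S (cos (h n)) (sin (h n)) v) * X t (snd v))
   = sin (h n) * (LINT v|M2. F (comb S (cos (h n)) (sin (h n)) v) * X t (fst v))" for n
 proof -
  have "(LINT v|M2. F (comb S (cos (h n)) (sin (h n)) v) * comb S (- sin (h n)) (cos (h n)) v t)
    = (LINT v|M2. F (comb S 1 0 v) * comb S 0 1 v t)"
   by (rule comb_law[OF S]) (use t in \<open>auto simp: power2_eq_square[symmetric] split_beta'\<close>)
  also have "... = 0" using z t by (simp add: comb_def)
  finally have "(LINT v|M2. cos (h n) * (F (comb S (cos (h n)) (sin (h n)) v) * X t (snd v)) - sin (h n) * (F (comb S (cos (h n)) (sin (h n)) v) * X t (fst v))) = 0"
   using t by (simp add: comb_apply algebra_simps)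
  thus ?thesis using Bi by simp
 qed
 have "(%n. \<integral>v. (F (comb S (cos (h n)) (sin (h n)) v) - F (comb S 1 0 v)) / h n * ?Xt v \<partial>M2)
   \<longlonglongrightarrow> (LINT v|M2. (\<Sum>s\<in>S. DF (comb S 1 0 v) s * X s (snd v)) * ?Xt v)"
  using h by (intro rotation_quotient[OF S F _ lip ae dm] integrable_pair_dominant S) (auto simp: less_imp_neq[symmetric] abs_of_pos)
 moreover have "(LINT v|M2. (F (comb S (cos (h n)) (sin (h n)) v) - F (comb S 1 0 v)) / h n * ?Xt v)
   = sin (h n) / h n / cos (h n) * (LINT v|M2. F (comb S (cos (h n)) (sin (h n)) v) * X t (fst v))" for n
 proof -
  have "h n < pi / 2" using h(2)[of n] pi_gt3 by linarith
  hence c: "cos (h n) > 0" using h(1)[of n] by (intro cos_gt_zero) auto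
  have "(LINT v|M2. (F (comb S (cos (h n)) (sin (h n)) v) - F (comb S 1 0 v)) / h n * ?Xt v)
   = (LINT v|M2. (F (comb S (cos (h n)) (sin (h n)) v) * ?Xt v - F (comb S 1 0 v) * ?Xt v) / h n)"
   by (simp add: field_simps)
  also have "... = (LINT v|M2. F (comb S (cos (h n)) (sin (h n)) v) * ?Xt v) / h n"
   using Bi z by simp
  finally have *: "(LINT v|M2. (F (comb S (cos (h n)) (sin (h n)) v) - F (comb S 1 0 v)) / h n * ?Xt v)
   = (LINT v|M2. F (comb S (cos (h n)) (sin (h n)) v) * ?Xt v) / h n" .
  have "(LINT v|M2. F (comb S (cos (h n)) (sin (h n)) v) * ?Xt v)
   = sin (h n) / cos (h n) * (LINT v|M2. F (comb S (cos (h n)) (sin (h n)) v) * X t (fst v))"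
   using rot[of n] c by (simp add: nonzero_eq_divide_eq mult.commute)
  thus ?thesis unfolding * by simp
 qed
 ultimately have 1: "(%n. sin (h n) / h n / cos (h n) * (LINT v|M2. F (comb S (cos (h n)) (sin (h n)) v) * X t (fst v)))
   \<longlonglongrightarrow> (LINT v|M2. (\<Sum>s\<in>S. DF (comb S 1 0 v) s * X s (snd v)) * ?Xt v)" by simp
 have 2: "(%n. \<integral>v. F (comb S (cos (h n)) (sin (h n)) v) * X t (fst v) \<partial>M2) \<longlonglongrightarrow> (LINT v|M2. F (comb S 1 0 v) * X t (fst v))"
 proof (rule integral_dominated_convergence[where w = "%v. B * \<bar>X t (fst v)\<bar>"])
  show "integrable M2 (%v. B * \<bar>X t (fst v)\<bar>)" using expectation_fst(1)[OF integrable_X] by auto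
  show "AE v in M \<Otimes>\<^sub>M M. (%n. F (comb S (cos (h n)) (sin (h n)) v) * X t (fst v)) \<longlonglongrightarrow> F (comb S 1 0 v) * X t (fst v)"
  proof (intro AE_I2 tendsto_mult tendsto_const)
   fix v
   have "(%n. comb S (cos (h n)) (sin (h n)) v s) \<longlonglongrightarrow> comb S 1 0 v s" if "s : S" for s
   proof -
    have "(%n. cos (h n) * X s (fst v) + sin (h n) * X s (snd v)) \<longlonglongrightarrow> cos 0 * X s (fst v) + sin 0 * X s (snd v)"
     by (intro tendsto_intros h)
    thus ?thesis using that by (simp add: comb_def)
   qed
   hence "(%n. \<Sum>s\<in>S. \<bar>comb S (cos (h n)) (sin (h n)) v s - comb S 1 0 v s\<bar>) \<longlonglongrightarrow> (\<Sum>s\<in>S. \<bar>comb S 1 0 v s - comb S 1 0 v s\<bar>)"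
    by (intro tendsto_intros)
   hence "(%n. \<Sum>s\<in>S. \<bar>comb S (cos (h n)) (sin (h n)) v s - comb S 1 0 v s\<bar>) \<longlonglongrightarrow> 0" by simp
   hence "(%n. F (comb S (cos (h n)) (sin (h n)) v) - F (comb S 1 0 v)) \<longlonglongrightarrow> 0"
    by (rule Lim_null_comparison[rotated]) (auto intro!: always_eventually lip)
   thus "(%n. F (comb S (cos (h n)) (sin (h n)) v)) \<longlonglongrightarrow> F (comb S 1 0 v)" by (simp add: LIM_zero_iff)
  qed
 qed (auto simp: abs_mult intro!: mult_right_mono B)
 have 3: "(%n. sin (h n) / h n / cos (h n)) \<longlonglongrightarrow> 1"
 proof -
  have at: "filterlim h (at 0) sequentially" using h by (simp add: filterlim_at less_imp_neq[symmetric])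
  have "((%x::real. sin x / x) \<longlongrightarrow> 1) (at 0)" using DERIV_sin[of "0::real"] by (simp add: DERIV_def)
  from filterlim_compose[OF this at] have "(%n. sin (h n) / h n / cos (h n)) \<longlonglongrightarrow> 1 / cos 0" by (intro tendsto_intros h) auto
  thus ?thesis by simp
 qed
 have "(LINT v|M2. (\<Sum>s\<in>S. DF (comb S 1 0 v) s * X s (snd v)) * ?Xt v) = (LINT v|M2. F (comb S 1 0 v) * X t (fst v))"
  using LIMSEQ_unique[OF 1 tendsto_mult[OF 3 2]] by simp
 moreover have "(LINT v|M2. F (comb S 1 0 v) * X t (fst v)) = (LINT v|M. F (\<lambda>s\<in>S. X s v) * X t v)"
 proof -
  have "integrable M (%v. F (\<lambda>s\<in>S. X s v) * X t v)"
   by (rule integrable_bounded_mult[of _ _ _ B]) (auto intro!: B integrable_X)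
  from expectation_fst(2)[OF this] show ?thesis by (simp add: comb_def)
 qed
 moreover have "(LINT v|M2. (\<Sum>s\<in>S. DF (comb S 1 0 v) s * X s (snd v)) * ?Xt v) = (\<Sum>s\<in>S. K s t * (LINT v|M. DF (\<lambda>s\<in>S. X s v) s))"
 proof -
  have ii: "integrable M (%v. X s v * X t v)" for s
   using integrable_mult_X[of s t] by (subst integrable_abs_iff[symmetric]) (auto simp: abs_mult)
  have id: "integrable M (%v. DF (\<lambda>s\<in>S. X s v) s)" if "s : S" for s
   using measurable_compose[OF restr_measurable dm[OF that]] db by (intro integrable_unit[of _ 1]) auto
  have "(LINT v|M2. (\<Sum>s\<in>S. DF (comb S 1 0 v) s * X s (snd v)) * ?Xt v)
   = (LINT v|M2. (\<Sum>s\<in>S. DF (\<lambda>s\<in>S. X s (fst v)) s * (X s (snd v) * X t (snd v))))"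
   by (simp add: sum_distrib_right comb_def mult.assoc)
  also have "... = (\<Sum>s\<in>S. (LINT v|M2. DF (\<lambda>s\<in>S. X s (fst v)) s * (X s (snd v) * X t (snd v))))"
   by (intro Bochner_Integration.integral_sum pair_expectation_mult(1)[OF prob_space_axioms prob_space_axioms id ii])
  also have "... = (\<Sum>s\<in>S. K s t * (LINT v|M. DF (\<lambda>s\<in>S. X s v) s))"
   by (intro sum.cong refl) (simp add: pair_expectation_mult(2)[OF prob_space_axioms prob_space_axioms id ii] exp_mult)
  finally show ?thesis .
 qed
 ultimately show ?thesis by simp
qed

end

section \<open>Covariances of functions of a Gaussian process\<close>

text \<open>\<open>DF\<close> is the gradient away from an exceptional set: vectors with two equal
  entries or with an entry in \<open>E\<close>. A nondegenerate process avoids this set almost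
  surely; for clipped selectors \<open>E\<close> consists of the two clipping levels.\<close>

definition diffble :: "'i set => real set => (('i => real) => real) => (('i => real) => 'i => real) => real => bool" where
 "diffble S E F DF B \<longleftrightarrow> finite S & finite E & F : bm (vecs S) &
   (ALL s:S. (%x. DF x s) : bm (vecs S)) &
   (ALL x. \<bar>F x\<bar> <= B) & (ALL x s. \<bar>DF x s\<bar> <= 1) & (ALL x y. \<bar>F x - F y\<bar> <= (\<Sum>s\<in>S. \<bar>x s - y s\<bar>)) &
   (ALL x. inj_on x S & (ALL s:S. x s ~: E) --> affine_at S F DF x)"

lemma affine_at_compose_line:
 assumes F: "affine_at S F DF (\<lambda>s\<in>S. c s - p * x s)"
  and lip: "!!x y. \<bar>F x - F y\<bar> <= (\<Sum>s\<in>S. \<bar>x s - y s\<bar>)"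
 shows "affine_at S (%y. F (\<lambda>s\<in>S. c s - p * y s)) (%y s. - p * DF (\<lambda>s\<in>S. c s - p * y s) s) x"
proof -
 obtain r where r: "r > 0" "!!y. (ALL s:S. \<bar>y s - (c s - p * x s)\<bar> < r) ==>
   F y = F (\<lambda>s\<in>S. c s - p * x s) + (\<Sum>s\<in>S. DF (\<lambda>s\<in>S. c s - p * x s) s * (y s - (c s - p * x s)))"
  using F by (auto simp: affine_at_def)
 have "F (\<lambda>s\<in>S. c s - p * y s) = F (\<lambda>s\<in>S. c s - p * x s) + (\<Sum>s\<in>S. - p * DF (\<lambda>s\<in>S. c s - p * x s) s * (y s - x s))"
  if y: "ALL s:S. \<bar>y s - x s\<bar> < r / (\<bar>p\<bar> + 1)" for y
 proof -
  have "\<bar>(\<lambda>s\<in>S. c s - p * y s) s - (c s - p * x s)\<bar> < r" if s: "s : S" for s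
  proof -
   have "\<bar>(\<lambda>s\<in>S. c s - p * y s) s - (c s - p * x s)\<bar> = \<bar>p\<bar> * \<bar>y s - x s\<bar>"
    using s by (simp add: abs_mult[symmetric] algebra_simps abs_minus_commute)
   also have "... <= (\<bar>p\<bar> + 1) * \<bar>y s - x s\<bar>" by (intro mult_right_mono) auto
   also have "... < r" using y s by (simp add: pos_less_divide_eq mult.commute)
   finally show ?thesis .
  qed
  hence "F (\<lambda>s\<in>S. c s - p * y s) = F (\<lambda>s\<in>S. c s - p * x s)
    + (\<Sum>s\<in>S. DF (\<lambda>s\<in>S. c s - p * x s) s * ((\<lambda>s\<in>S. c s - p * y s) s - (c s - p * x s)))"
   by (intro r(2)) auto
  also have "(\<Sum>s\<in>S. DF (\<lambda>s\<in>S. c s - p * x s) s * ((\<lambda>s\<in>S. c s - p * y s) s - (c s - p * x s)))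
   = (\<Sum>s\<in>S. - p * DF (\<lambda>s\<in>S. c s - p * x s) s * (y s - x s))"
   by (rule sum.cong) (auto simp: algebra_simps)
  finally show ?thesis .
 qed
 moreover have "r / (\<bar>p\<bar> + 1) > 0" using r(1) by (intro divide_pos_pos) auto
 ultimately show ?thesis unfolding affine_at_def by blast
qed

locale nondegenerate_gaussian_process = gaussian_process M X K
 for M :: "'w measure" and X :: "'i => 'w => real" and K +
 assumes AE_distinct: "s ~= t ==> AE w in M. X s w ~= X t w"
  and AE_no_atom: "AE w in M. X s w ~= e"
begin

text \<open>The locale assumptions give the statement for one copy, and \<open>comb S a b\<close>
  has the same law. Failure is written as a measurable indicator \<open>H\<close>, so that equality
  of expectations transfers it.\<close>

lemma AE_comb_generic:
 assumes S: "finite S" and E: "finite E" and g: "a^2 + b^2 = 1"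
 shows "AE w in M \<Otimes>\<^sub>M M. inj_on (comb S a b w) S & (ALL s:S. comb S a b w s ~: E)"
proof -
 interpret MM: prob_space "M \<Otimes>\<^sub>M M" by (rule prob_space_pair)
 let ?P = "%x. (ALL s:S. ALL t:S. s = t | x s ~= x t) & (ALL s:S. ALL e:E. x s ~= e)"
 define H where "H x = (if ?P x then 0 else 1 :: real)" for x
 have c: "(%x. x s) : bm (vecs S)" if "s : S" for s
  using that by (rule measurable_component_singleton)
 have "Measurable.pred (vecs S) (%x. s = t | x s ~= x t)" if "s : S" "t : S" for s t
  using c[OF that(1)] c[OF that(2)] by (cases "s = t") (auto simp: pred_def intro!: borel_measurable_neq)
 moreover have "Measurable.pred (vecs S) (%x. x s ~= e)" if "s : S" for s e
  using c[OF that(1)] by (auto simp: pred_def intro!: borel_measurable_neq)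
 ultimately have [measurable]: "Measurable.pred (vecs S) ?P"
  using S E by (intro pred_intros_logic(3) pred_intros_finite)
 have Hm[measurable]: "H : bm (vecs S)" unfolding H_def by measurable
 have "AE w in M. ?P (\<lambda>s\<in>S. X s w)"
 proof -
  have "AE w in M. s = t | X s w ~= X t w" for s t using AE_distinct[of s t] by (cases "s = t") auto
  hence "AE w in M. (ALL s:S. ALL t:S. s = t | X s w ~= X t w) & (ALL s:S. ALL e:E. X s w ~= e)"
   using S E AE_no_atom by (auto simp: AE_finite_all AE_conj_iff)
  thus ?thesis by eventually_elim auto
 qed
 hence "AE w in M. H (\<lambda>s\<in>S. X s w) = 0" by eventually_elim (simp add: H_def)
 hence "(LINT w|M. H (\<lambda>s\<in>S. X s w)) = 0" by (subst integral_cong_AE[where g = "%_. 0"]) auto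
 hence "(LINT w|M2. H (comb S a b w)) = 0"
  using comb_single_law[OF S g Hm, of 1] by (simp add: H_def)
 moreover have "integrable M2 (%w. H (comb S a b w))" by (rule MM.integrable_unit[of _ 1]) (auto simp: H_def)
 ultimately have "AE w in M \<Otimes>\<^sub>M M. H (comb S a b w) = 0"
  by (subst integral_nonneg_eq_0_iff_AE[symmetric]) (auto simp: H_def)
 thus ?thesis by eventually_elim (auto simp: H_def inj_on_def split: if_splits)
qed

lemma AE_diffble:
 assumes F: "diffble S E F DF B"
 shows "AE w in M. affine_at S F DF (\<lambda>s\<in>S. X s w)"
proof -
 have fin: "finite S" "finite E" using F by (auto simp: diffble_def)
 have "AE w in M. s = t | X s w ~= X t w" for s t using AE_distinct[of s t] by (cases "s = t") auto
 hence "AE w in M. (ALL s:S. ALL t:S. s = t | X s w ~= X t w) & (ALL s:S. ALL e:E. X s w ~= e)"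
  using fin AE_no_atom by (auto simp: AE_finite_all AE_conj_iff)
 thus ?thesis
 proof eventually_elim
  case (elim w)
  hence "inj_on (\<lambda>s\<in>S. X s w) S" "ALL s:S. (\<lambda>s\<in>S. X s w) s ~: E" by (auto simp: inj_on_def)
  thus ?case using F by (simp only: diffble_def)
 qed
qed

text \<open>The interpolation path: at angle 0 both functions see the same copy, at
  \<open>pi / 2\<close> they see independent ones. Its total increment is minus the covariance of
  \<open>F\<close> and \<open>G\<close>.\<close>

definition rotated_covariance :: "'i set => (('i => real) => real) => (('i => real) => real) => real => real" where
 "rotated_covariance S F G h = (LINT w|M2. F (comb S 1 0 w) * G (comb S (cos h) (sin h) w))"

end

context nondegenerate_gaussian_process
begin

text \<open>After a rotation by the angle \<open>d\<close>, the increment sits in \<open>G\<close>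
  alone, so the rotation quotient yields the derivative as a mean of \<open>DG\<close> times the
  second copy times \<open>F\<close>. Integration by parts in the second copy then moves a
  derivative onto \<open>F\<close> and produces the kernel and the factor
  \<open>- sin d\<close>.\<close>

lemma DERIV_rotated_covariance:
 fixes F G :: "('i => real) => real"
 assumes dF: "diffble S E F DF B" and dG: "diffble S E' G DG B'"
 shows "(rotated_covariance S F G has_real_derivative
   - sin d * (LINT w|M2. (\<Sum>s\<in>S. \<Sum>t\<in>S. K s t * (DF (comb S (cos d) (- sin d) w) s * DG (comb S 1 0 w) t)))) (at d)"
proof -
 interpret MM: pair_prob_space M M by unfold_locales
 have S: "finite S" "finite E" and F[measurable]: "F : bm (vecs S)"
  and DF: "!!s. s : S ==> (%x. DF x s) : bm (vecs S)"
  and B: "!!x. \<bar>F x\<bar> <= B" and DB: "!!x s. \<bar>DF x s\<bar> <= 1"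
  and lip: "!!x y. \<bar>F x - F y\<bar> <= (\<Sum>s\<in>S. \<bar>x s - y s\<bar>)"
  and aff: "!!x. inj_on x S ==> (ALL s:S. x s ~: E) ==> affine_at S F DF x"
  using dF unfolding diffble_def by auto
 have G[measurable]: "G : bm (vecs S)"
  and DG: "!!s. s : S ==> (%x. DG x s) : bm (vecs S)"
  and B': "!!x. \<bar>G x\<bar> <= B'" and DB': "!!x s. \<bar>DG x s\<bar> <= 1"
  and lip': "!!x y. \<bar>G x - G y\<bar> <= (\<Sum>s\<in>S. \<bar>x s - y s\<bar>)"
  using dG unfolding diffble_def by auto
 define c where "c = cos d"
 define p where "p = sin d"
 have cp: "c^2 + p^2 = 1" "\<bar>p\<bar> <= 1" by (auto simp: c_def p_def)
 let ?Z = "%w. F (comb S c (- p) w)"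
 let ?f = "%w. (\<Sum>s\<in>S. \<bar>X s (fst w)\<bar> + \<bar>X s (snd w)\<bar>)"
 have bF: "\<bar>f w * ?Z w\<bar> <= b * B" if "\<bar>f w\<bar> <= b" for f :: "'w \<times> 'w => real" and b w
  using mult_mono'[OF that B[of "comb S c (- p) w"]] by (simp add: abs_mult)
 have GF: "integrable M2 (%w. G (comb S a e w) * ?Z w)" for a e
  by (rule MM.P.integrable_unit[of _ "B' * B"]) (auto intro: bF B')
 \<comment> \<open>The Gram matrix of the coefficients depends only on the difference of the angles;
   rotating back by \<open>d\<close> leaves \<open>F\<close> fixed while \<open>h\<close>
   varies.\<close>
 have shift: "rotated_covariance S F G (d + h) = (LINT w|M2. G (comb S (cos h) (sin h) w) * ?Z w)" for h
 proof -
  have "rotated_covariance S F G (d + h) = (LINT w|M2. F (comb S c (- p) w) * G (comb S (cos h) (sin h) w))"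
   unfolding rotated_covariance_def by (rule comb_law[OF S(1)]) (simp_all add: cp, simp_all add: c_def p_def cos_add)
  thus ?thesis by (simp add: mult.commute)
 qed
 have iZ: "integrable M2 (%w. ?f w * \<bar>?Z w\<bar>)"
  using integrable_bounded_mult[OF integrable_pair_dominant(2)[OF S(1)], of "%w. \<bar>?Z w\<bar>" B] B by (simp add: mult.commute)
 let ?L = "\<integral>w. (\<Sum>t\<in>S. DG (comb S 1 0 w) t * X t (snd w)) * ?Z w \<partial>M2"
 have "((%h. (rotated_covariance S F G (d + h) - rotated_covariance S F G d) / h) \<longlongrightarrow> ?L) (at 0)"
  unfolding tendsto_at_iff_sequentially
 proof (intro allI impI)
  fix h :: "nat => real" assume h: "ALL i. h i : UNIV - {0}" "h \<longlonglongrightarrow> 0"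
  have "(rotated_covariance S F G (d + h n) - rotated_covariance S F G d) / h n
   = (LINT w|M2. (G (comb S (cos (h n)) (sin (h n)) w) - G (comb S 1 0 w)) / h n * ?Z w)" for n
  proof -
   have "(LINT w|M2. (G (comb S (cos (h n)) (sin (h n)) w) - G (comb S 1 0 w)) / h n * ?Z w)
    = (LINT w|M2. (G (comb S (cos (h n)) (sin (h n)) w) * ?Z w - G (comb S 1 0 w) * ?Z w) / h n)"
    by (simp add: left_diff_distrib)
   also have "... = (rotated_covariance S F G (d + h n) - rotated_covariance S F G (d + 0)) / h n"
    unfolding shift using GF[of "cos (h n)" "sin (h n)"] GF[of 1 0] by simp
   finally show ?thesis by (simp only: add_0_right)
  qed
  thus "((%h. (rotated_covariance S F G (d + h) - rotated_covariance S F G d) / h) \<circ> h) \<longlonglongrightarrow> ?L"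
   using rotation_quotient[OF S(1) G _ lip' AE_diffble[OF dG] DG _ h(2) iZ] h(1) by (simp add: comp_def)
 qed
 moreover have "?L = - sin d * (LINT w|M2. (\<Sum>s\<in>S. \<Sum>t\<in>S. K s t * (DF (comb S (cos d) (- sin d) w) s * DG (comb S 1 0 w) t)))"
 proof -
  have mD[measurable]: "(%w. DF (comb S a e w) s) : bm M2"
    "(%w. DG (comb S a e w) s) : bm M2" if "s : S" for s a e
   by (rule measurable_compose[OF comb_measurable DF[OF that]], rule measurable_compose[OF comb_measurable DG[OF that]])
  have iD: "integrable M2 (%w. DF (comb S c (- p) w) s * DG (comb S 1 0 w) t)" if "s : S" "t : S" for s t
   using that DB DB' by (intro MM.P.integrable_unit[of _ 1]) (auto simp: abs_mult intro!: mult_le_one)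
  have gen: "AE x in M. AE y in M. affine_at S F DF (comb S c (- p) (x, y))"
  proof -
   have "AE w in M \<Otimes>\<^sub>M M. affine_at S F DF (comb S c (- p) w)"
    using AE_comb_generic[OF S, of c "- p"] cp(1) by (auto intro: aff)
   thus ?thesis by (rule MM.AE_pair)
  qed
  have it: "integrable M2 (%w. DG (comb S 1 0 w) t * X t (snd w) * ?Z w)" if t: "t : S" for t
  proof -
   have "integrable M2 (%w. (DG (comb S 1 0 w) t * ?Z w) * X t (snd w))"
    using t by (intro integrable_bounded_mult[of _ _ _ "1 * B"] expectation_snd(1)[OF integrable_X] bF DB') measurable
   thus ?thesis by (simp add: mult_ac)
  qed
  have t: "(LINT w|M2. DG (comb S 1 0 w) t * X t (snd w) * ?Z w)
    = - p * (\<Sum>s\<in>S. K s t * (LINT w|M2. DF (comb S c (- p) w) s * DG (comb S 1 0 w) t))"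
   if t: "t : S" for t
  proof -
   have iDs: "integrable M2 (%w. - p * K s t * (DF (comb S c (- p) w) s * DG (comb S 1 0 w) t))" if "s : S" for s
    by (rule integrable_mult_right[OF iD[OF that t]])
   have inner: "(LINT y|M. DG (comb S 1 0 (x, y)) t * X t y * ?Z (x, y))
     = (\<Sum>s\<in>S. (LINT y|M. - p * K s t * (DF (comb S c (- p) (x, y)) s * DG (comb S 1 0 (x, y)) t)))"
    if elim: "AE y in M. affine_at S F DF (comb S c (- p) (x, y))" for x
   proof -
    let ?c = "%s. c * X s x"
    let ?F = "%y. F (\<lambda>s\<in>S. ?c s - p * y s)"
    let ?DF = "%y s. - p * DF (\<lambda>s\<in>S. ?c s - p * y s) s"
    have cy: "comb S c (- p) (x, y) = (\<lambda>s\<in>S. ?c s - p * (\<lambda>s\<in>S. X s y) s)" for y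
     by (auto simp: comb_def)
    have line[measurable]: "(%y. \<lambda>s\<in>S. ?c s - p * y s) : vecs S \<rightarrow>\<^sub>M vecs S"
     by measurable
    have "(LINT y|M. ?F (\<lambda>s\<in>S. X s y) * X t y) = (\<Sum>s\<in>S. K s t * (LINT y|M. ?DF (\<lambda>s\<in>S. X s y) s))"
    proof (rule integration_by_parts[OF S(1) t])
     show "?F : bm (vecs S)" by (rule measurable_compose[OF line F])
     show "\<bar>?F y\<bar> <= B" for y by (rule B)
     show "\<bar>?F y - ?F z\<bar> <= (\<Sum>s\<in>S. \<bar>y s - z s\<bar>)" for y z
     proof -
      have "\<bar>?F y - ?F z\<bar> <= (\<Sum>s\<in>S. \<bar>(\<lambda>s\<in>S. ?c s - p * y s) s - (\<lambda>s\<in>S. ?c s - p * z s) s\<bar>)" by (rule lip)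
      also have "... <= (\<Sum>s\<in>S. \<bar>y s - z s\<bar>)"
      proof (rule sum_mono)
       fix s assume "s : S"
       hence "(\<lambda>s\<in>S. ?c s - p * y s) s - (\<lambda>s\<in>S. ?c s - p * z s) s = p * (z s - y s)"
        by (simp add: right_diff_distrib)
       hence "\<bar>(\<lambda>s\<in>S. ?c s - p * y s) s - (\<lambda>s\<in>S. ?c s - p * z s) s\<bar> = \<bar>p\<bar> * \<bar>y s - z s\<bar>"
        by (simp only: abs_mult abs_minus_commute)
       thus "\<bar>(\<lambda>s\<in>S. ?c s - p * y s) s - (\<lambda>s\<in>S. ?c s - p * z s) s\<bar> <= \<bar>y s - z s\<bar>"
        using cp(2) by (simp only: mult_left_le_one_le abs_ge_zero)
      qed
      finally show ?thesis .
     qed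
     show "AE y in M. affine_at S ?F ?DF (\<lambda>s\<in>S. X s y)"
      using elim
     proof eventually_elim
      case (elim y)
      thus ?case unfolding cy by (rule affine_at_compose_line[OF _ lip])
     qed
     show "(%y. ?DF y s) : bm (vecs S)" if "s : S" for s
      by (intro borel_measurable_times borel_measurable_const measurable_compose[OF line DF[OF that]])
     show "\<bar>?DF y s\<bar> <= 1" for y s using cp(2) DB by (auto simp: abs_mult intro!: mult_le_one)
    qed
    hence *: "(LINT y|M. ?Z (x, y) * X t y) = (\<Sum>s\<in>S. K s t * (LINT y|M. - p * DF (comb S c (- p) (x, y)) s))"
     by (simp only: cy)
    have one: "comb S 1 0 (x, y) = (\<lambda>s\<in>S. X s x)" for y by (auto simp: comb_def)
    have "(LINT y|M. DG (comb S 1 0 (x, y)) t * X t y * ?Z (x, y)) = (LINT y|M. DG (\<lambda>s\<in>S. X s x) t * (?Z (x, y) * X t y))"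
     by (simp only: one mult_ac)
    also have "... = DG (\<lambda>s\<in>S. X s x) t * (LINT y|M. ?Z (x, y) * X t y)" by simp
    also have "... = (\<Sum>s\<in>S. DG (\<lambda>s\<in>S. X s x) t * (K s t * (LINT y|M. - p * DF (comb S c (- p) (x, y)) s)))"
     unfolding * sum_distrib_left ..
    also have "... = (\<Sum>s\<in>S. (LINT y|M. - p * K s t * (DF (comb S c (- p) (x, y)) s * DG (comb S 1 0 (x, y)) t)))"
     unfolding one by (intro sum.cong) (auto simp: mult_ac)
    finally show ?thesis .
   qed
   have "(LINT w|M2. DG (comb S 1 0 w) t * X t (snd w) * ?Z w)
    = (LINT x|M. (LINT y|M. DG (comb S 1 0 (x, y)) t * X t y * ?Z (x, y)))"
    using MM.integral_fst'[OF it[OF t]] by simp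
   also have "... = (LINT x|M. (\<Sum>s\<in>S. (LINT y|M. - p * K s t * (DF (comb S c (- p) (x, y)) s * DG (comb S 1 0 (x, y)) t))))"
   proof (rule integral_cong_AE)
    show "(%x. \<integral>y. DG (comb S 1 0 (x, y)) t * X t y * ?Z (x, y) \<partial>M) : bm M"
     using MM.integrable_fst'[OF it[OF t]] by simp
    show "(%x. \<Sum>s\<in>S. (LINT y|M. - p * K s t * (DF (comb S c (- p) (x, y)) s * DG (comb S 1 0 (x, y)) t))) : bm M"
     by (rule borel_measurable_sum) (rule borel_measurable_integrable, rule MM.integrable_fst'[OF iDs])
    show "AE x in M. (LINT y|M. DG (comb S 1 0 (x, y)) t * X t y * ?Z (x, y))
     = (\<Sum>s\<in>S. (LINT y|M. - p * K s t * (DF (comb S c (- p) (x, y)) s * DG (comb S 1 0 (x, y)) t)))"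
     using gen by (rule eventually_mono) (rule inner)
   qed
   also have "... = (\<Sum>s\<in>S. (LINT x|M. (LINT y|M. - p * K s t * (DF (comb S c (- p) (x, y)) s * DG (comb S 1 0 (x, y)) t))))"
    by (rule Bochner_Integration.integral_sum) (rule MM.integrable_fst'[OF iDs])
   also have "... = (\<Sum>s\<in>S. (LINT w|M2. - p * K s t * (DF (comb S c (- p) w) s * DG (comb S 1 0 w) t)))"
    by (rule sum.cong[OF refl]) (rule MM.integral_fst'[OF iDs])
   also have "... = - p * (\<Sum>s\<in>S. K s t * (LINT w|M2. DF (comb S c (- p) w) s * DG (comb S 1 0 w) t))"
    unfolding sum_distrib_left by (rule sum.cong[OF refl]) simp
   finally show ?thesis .
  qed
  have "?L = (LINT w|M2. (\<Sum>t\<in>S. DG (comb S 1 0 w) t * X t (snd w) * ?Z w))" by (simp only: sum_distrib_right)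
  also have "... = (\<Sum>t\<in>S. \<integral>w. DG (comb S 1 0 w) t * X t (snd w) * ?Z w \<partial>M2)"
   by (rule Bochner_Integration.integral_sum) (rule it)
  also have "... = (\<Sum>t\<in>S. - p * (\<Sum>s\<in>S. K s t * (LINT w|M2. DF (comb S c (- p) w) s * DG (comb S 1 0 w) t)))"
   by (rule sum.cong[OF refl]) (rule t)
  also have "... = - p * (\<Sum>s\<in>S. \<Sum>t\<in>S. K s t * (LINT w|M2. DF (comb S c (- p) w) s * DG (comb S 1 0 w) t))"
   by (subst sum.swap) (simp only: sum_distrib_left)
  also have "(\<Sum>s\<in>S. \<Sum>t\<in>S. K s t * (LINT w|M2. DF (comb S c (- p) w) s * DG (comb S 1 0 w) t))
   = (\<Sum>s\<in>S. (LINT w|M2. (\<Sum>t\<in>S. K s t * (DF (comb S c (- p) w) s * DG (comb S 1 0 w) t))))"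
   using iD by (intro sum.cong refl) (subst Bochner_Integration.integral_sum, auto)
  also have "... = (LINT w|M2. (\<Sum>s\<in>S. \<Sum>t\<in>S. K s t * (DF (comb S c (- p) w) s * DG (comb S 1 0 w) t)))"
   by (rule Bochner_Integration.integral_sum[symmetric]) (intro Bochner_Integration.integrable_sum integrable_mult_right iD)
  finally show ?thesis by (simp only: c_def p_def)
 qed
 ultimately show ?thesis unfolding DERIV_def by simp
qed

end

section \<open>Selectors\<close>

text \<open>Threshold functionals such as \<open>max min\<close> over paths pick one of the coordinates.\<close>

definition selector :: "'i set => (('i => real) => real) => bool" where
 "selector S L \<longleftrightarrow> finite S & L : bm (vecs S) & (ALL x. EX s:S. L x = x s) &
   (ALL x y e. (ALL s:S. \<bar>x s - y s\<bar> <= e) --> \<bar>L x - L y\<bar> <= e)"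

definition clip :: "real => real => (('i => real) => real) => ('i => real) => real" where
 "clip a b L x = max a (min b (L x))"

text \<open>The gradient of \<open>clip\<close> at generic points: the unit vector of the selected
  coordinate while the value lies strictly between the clipping levels, and 0 otherwise.\<close>

definition clipD :: "'i set => real => real => (('i => real) => real) => ('i => real) => 'i => real" where
 "clipD S a b L x s = of_bool (s : S & a < L x & L x < b & x s = L x)"

lemma selector_cong: "selector S L ==> (!!s. s : S ==> x s = y s) ==> L x = L y"
 unfolding selector_def by (metis abs_le_zero_iff diff_self eq_iff_diff_eq_0 abs_zero order_refl)

lemma selector_select: "selector S L ==> EX s:S. L x = x s"
 by (simp add: selector_def)

lemma selector_lipschitz: "selector S L ==> (!!s. s : S ==> \<bar>x s - y s\<bar> <= e) ==> \<bar>L x - L y\<bar> <= e"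
 by (simp add: selector_def)

lemma selector_measurable:
 assumes L: "selector S1 L" and S: "S1 <= S"
 shows "L : bm (vecs S)"
proof -
 have "(%x. L (restrict x S1)) : bm (vecs S)"
  using L S by (intro measurable_compose[OF measurable_restrict_subset]) (auto simp: selector_def)
 moreover have "L (restrict x S1) = L x" for x by (rule selector_cong[OF L]) simp
 ultimately show ?thesis by simp
qed

lemma diffble_clip:
 assumes L: "selector S1 L" and S: "S1 <= S" "finite S" and ab: "a < b"
 shows "diffble S {a, b} (clip a b L) (clipD S1 a b L) (max \<bar>a\<bar> \<bar>b\<bar>)"
 unfolding diffble_def
proof (intro conjI ballI allI impI S)
 note mL[measurable] = selector_measurable[OF L S(1)]
 show "clip a b L : bm (vecs S)" unfolding clip_def[abs_def] by measurable
 show "(%x. clipD S1 a b L x s) : bm (vecs S)" if s: "s : S" for s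
 proof -
  have d: "(%x. x s - L x) : bm (vecs S)"
   using s by (intro borel_measurable_diff mL measurable_component_singleton)
  have "(%x. of_bool (s : S1) * indicator {a<..<b} (L x) * indicator {0} (x s - L x) :: real) : bm (vecs S)"
   by (intro borel_measurable_times borel_measurable_const measurable_compose[OF mL] measurable_compose[OF d]) simp_all
  moreover have "clipD S1 a b L x s = of_bool (s : S1) * indicator {a<..<b} (L x) * indicator {0} (x s - L x)" for x
   by (auto simp: clipD_def indicator_def)
  ultimately show ?thesis by (simp only:)
 qed
 show "\<bar>clip a b L x\<bar> <= max \<bar>a\<bar> \<bar>b\<bar>" for x using ab by (auto simp: clip_def)
 show "\<bar>clipD S1 a b L x s\<bar> <= 1" for x s by (simp add: clipD_def)
 show "\<bar>clip a b L x - clip a b L y\<bar> <= (\<Sum>s\<in>S. \<bar>x s - y s\<bar>)" for x y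
 proof -
  have "\<bar>clip a b L x - clip a b L y\<bar> <= \<bar>L x - L y\<bar>" by (auto simp: clip_def)
  also have "... <= (\<Sum>s\<in>S. \<bar>x s - y s\<bar>)"
   using S by (intro selector_lipschitz[OF L] member_le_sum) auto
  finally show ?thesis .
 qed
 fix x :: "'a => real" assume x: "inj_on x S & (ALL s:S. x s ~: {a, b})"
 obtain s0 where s0: "s0 : S1" "L x = x s0" using selector_select[OF L] by blast
 hence s0S: "s0 : S" using S by auto
 \<comment> \<open>\<open>d\<close> separates the selected value from all other values and from
   \<open>a\<close> and \<open>b\<close>. A perturbation below \<open>d / 2\<close> moves the
   selector by at most \<open>d / 2\<close>, hence cannot change the selected index or the clipping
   regime.\<close>
 obtain d where d: "d > 0" "ALL v:x ` S Un {a, b}. v ~= x s0 --> d <= dist (x s0) v"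
  using finite_set_avoid[of "x ` S Un {a, b}" "x s0"] S by auto
 have D: "clipD S1 a b L x s = (if s = s0 then of_bool (a < x s0 & x s0 < b) else 0)" if "s : S" for s
  using that x s0 s0S by (auto simp: clipD_def inj_on_def)
 show "affine_at S (clip a b L) (clipD S1 a b L) x"
  unfolding affine_at_def
 proof (intro exI[of _ "d / 2"] conjI allI impI)
  fix y assume y: "ALL s:S. \<bar>y s - x s\<bar> < d / 2"
  obtain s1 where s1: "s1 : S1" "L y = y s1" using selector_select[OF L] by blast
  hence s1S: "s1 : S" using S by auto
  have "\<bar>L y - L x\<bar> <= d / 2" using y S by (intro selector_lipschitz[OF L]) (auto intro: less_imp_le)
  moreover have "\<bar>y s1 - x s1\<bar> < d / 2" using y s1S by auto
  ultimately have "\<bar>x s1 - x s0\<bar> < d" using s1 s0 by (auto simp: abs_if split: if_splits)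
  hence "x s1 = x s0" using d(2) s1S by (force simp: dist_real_def)
  hence "s1 = s0" using x s1S s0S by (auto simp: inj_on_def)
  hence Ly: "L y = y s0" using s1 by simp
  have y0: "\<bar>y s0 - x s0\<bar> < d / 2" using y s0S by auto
  have da: "\<bar>x s0 - a\<bar> >= d" "\<bar>x s0 - b\<bar> >= d" using d(2) x s0S by (auto simp: dist_real_def)
  have "(\<Sum>s\<in>S. clipD S1 a b L x s * (y s - x s)) = (\<Sum>s\<in>S. if s = s0 then of_bool (a < x s0 & x s0 < b) * (y s0 - x s0) else 0)"
   by (intro sum.cong) (auto simp: D)
  also have "... = of_bool (a < x s0 & x s0 < b) * (y s0 - x s0)" using S s0S by simp
  finally show "clip a b L y = clip a b L x + (\<Sum>s\<in>S. clipD S1 a b L x s * (y s - x s))"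
   using Ly s0(2) y0 da d(1) ab by (auto simp: clip_def of_bool_def abs_if split: if_splits)
 qed (use d in auto)
qed simp

text \<open>Distinct entries leave at most one selected coordinate. This l1 bound on the gradient is
  what makes covariance estimates independent of the number of sites.\<close>

lemma clipD_sum_le:
 assumes "inj_on x S" "finite S" "S1 <= S"
 shows "(\<Sum>s\<in>S. clipD S1 a b L x s) <= 1"
proof (cases "EX s:S. clipD S1 a b L x s ~= 0")
 case True
 then obtain s0 where s0: "s0 : S" "clipD S1 a b L x s0 ~= 0" by auto
 have "(\<Sum>s\<in>S. clipD S1 a b L x s) <= (\<Sum>s\<in>S. if s = s0 then 1 else 0)"
  using s0 assms by (intro sum_mono) (auto simp: clipD_def inj_on_def split: if_splits)
 also have "... <= 1" using assms(2) s0 by simp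
 finally show ?thesis .
next
 case False hence "(\<Sum>s\<in>S. clipD S1 a b L x s) = 0" by (intro sum.neutral) auto
 thus ?thesis by simp
qed

section \<open>Association, decoupling and anti-concentration for clipped selectors\<close>

context nondegenerate_gaussian_process
begin

lemma rotated_covariance_ends:
 assumes S: "finite S" and [measurable]: "F : bm (vecs S)" "G : bm (vecs S)"
  and B: "!!x. \<bar>F x\<bar> <= B" "!!x. \<bar>G x\<bar> <= B'"
 shows "rotated_covariance S F G 0 = (LINT w|M. F (\<lambda>s\<in>S. X s w) * G (\<lambda>s\<in>S. X s w))"
  and "rotated_covariance S F G (pi / 2) = (LINT w|M. F (\<lambda>s\<in>S. X s w)) * (LINT w|M. G (\<lambda>s\<in>S. X s w))"
proof -
 have i: "integrable M (%w. F (\<lambda>s\<in>S. X s w))" "integrable M (%w. G (\<lambda>s\<in>S. X s w))"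
  by (rule integrable_unit[of _ B], simp, rule B) (rule integrable_unit[of _ B'], simp, rule B)
 have "integrable M (%w. F (\<lambda>s\<in>S. X s w) * G (\<lambda>s\<in>S. X s w))"
  by (rule integrable_bounded_mult[OF i(2), of _ B]) (auto intro: B)
 from expectation_fst(2)[OF this]
 show "rotated_covariance S F G 0 = (LINT w|M. F (\<lambda>s\<in>S. X s w) * G (\<lambda>s\<in>S. X s w))"
  by (simp add: rotated_covariance_def comb_def)
 show "rotated_covariance S F G (pi / 2) = (LINT w|M. F (\<lambda>s\<in>S. X s w)) * (LINT w|M. G (\<lambda>s\<in>S. X s w))"
  using pair_expectation_mult(2)[OF prob_space_axioms prob_space_axioms i] by (simp add: rotated_covariance_def comb_def)
qed

text \<open>Mean value theorem for \<open>rotated_covariance\<close> on \<open>[0, pi / 2]\<close>.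
  The intermediate angle is unknown, which is harmless where the integrand has a sign or a uniform
  bound; \<open>clip_variance\<close> needs a case distinction on it. Both functionals are placed on
  the common index set \<open>S1 Un S2\<close>.\<close>

lemma clip_covariance:
 assumes L: "selector S1 L" "a < b" and L': "selector S2 L'" "a' < b'"
 shows "EX h. 0 < h & h < pi / 2 &
   (LINT w|M. clip a b L (%s. X s w) * clip a' b' L' (%s. X s w))
   - (LINT w|M. clip a b L (%s. X s w)) * (LINT w|M. clip a' b' L' (%s. X s w))
   = pi / 2 * (sin h * (LINT w|M2. (\<Sum>s\<in>S1 Un S2. \<Sum>t\<in>S1 Un S2. K s t * (clipD S1 a b L (comb (S1 Un S2) (cos h) (- sin h) w) s * clipD S2 a' b' L' (comb (S1 Un S2) 1 0 w) t))))"
proof -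
 let ?S = "S1 Un S2"
 have S: "finite ?S" "S1 <= ?S" "S2 <= ?S" using L L' by (auto simp: selector_def)
 note d1 = diffble_clip[OF L(1) S(2,1) L(2)] and d2 = diffble_clip[OF L'(1) S(3,1) L'(2)]
 note D = DERIV_rotated_covariance[OF d1 d2]
 let ?\<phi> = "rotated_covariance ?S (clip a b L) (clip a' b' L')"
 have "EX h>0. h < pi / 2 & ?\<phi> (pi / 2) - ?\<phi> 0 = (pi / 2 - 0) *
   (- sin h * (LINT w|M2. (\<Sum>s\<in>S1 Un S2. \<Sum>t\<in>S1 Un S2. K s t * (clipD S1 a b L (comb (S1 Un S2) (cos h) (- sin h) w) s * clipD S2 a' b' L' (comb (S1 Un S2) 1 0 w) t))))"
  by (rule MVT2) (use D in auto)
 moreover have "?\<phi> 0 = (LINT w|M. clip a b L (\<lambda>s\<in>?S. X s w) * clip a' b' L' (\<lambda>s\<in>?S. X s w))"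
  "?\<phi> (pi / 2) = (LINT w|M. clip a b L (\<lambda>s\<in>?S. X s w)) * (LINT w|M. clip a' b' L' (\<lambda>s\<in>?S. X s w))"
  by (rule rotated_covariance_ends[OF S(1)]; use d1 d2 in \<open>auto simp: diffble_def\<close>)+
 moreover have "clip a b L (\<lambda>s\<in>?S. X s w) = clip a b L (%s. X s w)" "clip a' b' L' (\<lambda>s\<in>?S. X s w) = clip a' b' L' (%s. X s w)" for w
  unfolding clip_def using selector_cong[OF L(1), of "\<lambda>s\<in>?S. X s w" "%s. X s w"] selector_cong[OF L'(1), of "\<lambda>s\<in>?S. X s w" "%s. X s w"] by auto
 ultimately show ?thesis by (auto simp: algebra_simps)
qed

lemma clipD_product_integrable:
 assumes L: "selector S1 L" "a < b" and L': "selector S2 L'" "a' < b'" and st: "s : S1 Un S2" "t : S1 Un S2"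
 shows "integrable M2 (%w. clipD S1 a b L (comb (S1 Un S2) c d w) s * clipD S2 a' b' L' (comb (S1 Un S2) g e w) t)"
proof -
 interpret MM: prob_space "M \<Otimes>\<^sub>M M" by (rule prob_space_pair)
 let ?S = "S1 Un S2"
 have S: "finite ?S" "S1 <= ?S" "S2 <= ?S" using L L' by (auto simp: selector_def)
 have m: "(%x. clipD S1 a b L x s) : bm (vecs ?S)" "(%x. clipD S2 a' b' L' x t) : bm (vecs ?S)"
  using diffble_clip[OF L(1) S(2,1) L(2)] diffble_clip[OF L'(1) S(3,1) L'(2)] st by (auto simp: diffble_def)
 have [measurable]: "(%w. clipD S1 a b L (comb ?S c d w) s) : bm M2"
  "(%w. clipD S2 a' b' L' (comb ?S g e w) t) : bm M2"
  by (rule measurable_compose[OF comb_measurable m(1)], rule measurable_compose[OF comb_measurable m(2)])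
 show ?thesis
 proof (rule MM.integrable_unit[of _ 1])
  show "\<bar>clipD S1 a b L (comb ?S c d w) s * clipD S2 a' b' L' (comb ?S g e w) t\<bar> <= 1" for w
   by (simp add: clipD_def)
 qed measurable
qed

text \<open>Pitt's inequality for clipped selectors.\<close>

lemma clip_positive_association:
 assumes L: "selector S1 L" "a < b" and L': "selector S2 L'" "a' < b'"
  and K: "!!s t. s : S1 ==> t : S2 ==> K s t >= 0"
 shows "(LINT w|M. clip a b L (%s. X s w)) * (LINT w|M. clip a' b' L' (%s. X s w))
  <= (LINT w|M. clip a b L (%s. X s w) * clip a' b' L' (%s. X s w))"
proof -
 obtain h where h: "0 < h" "h < pi / 2" and e: "(LINT w|M. clip a b L (%s. X s w) * clip a' b' L' (%s. X s w))
   - (LINT w|M. clip a b L (%s. X s w)) * (LINT w|M. clip a' b' L' (%s. X s w))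
   = pi / 2 * (sin h * (LINT w|M2. (\<Sum>s\<in>S1 Un S2. \<Sum>t\<in>S1 Un S2. K s t * (clipD S1 a b L (comb (S1 Un S2) (cos h) (- sin h) w) s * clipD S2 a' b' L' (comb (S1 Un S2) 1 0 w) t))))"
  using clip_covariance[OF L L'] by blast
 have "0 <= K s t * (clipD S1 a b L x s * clipD S2 a' b' L' y t)" for s t x y
  using K[of s t] by (auto simp: clipD_def)
 hence "0 <= (LINT w|M2. (\<Sum>s\<in>S1 Un S2. \<Sum>t\<in>S1 Un S2. K s t * (clipD S1 a b L (comb (S1 Un S2) (cos h) (- sin h) w) s * clipD S2 a' b' L' (comb (S1 Un S2) 1 0 w) t)))"
  by (intro integral_nonneg_AE AE_I2 sum_nonneg)
 moreover have "sin h >= 0" using h by (intro sin_ge_zero) auto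
 ultimately have "0 <= pi / 2 * (sin h * (LINT w|M2. (\<Sum>s\<in>S1 Un S2. \<Sum>t\<in>S1 Un S2. K s t * (clipD S1 a b L (comb (S1 Un S2) (cos h) (- sin h) w) s * clipD S2 a' b' L' (comb (S1 Un S2) 1 0 w) t))))"
  by (intro mult_nonneg_nonneg) auto
 thus ?thesis using e by linarith
qed

text \<open>Each gradient has l1 norm at most one, so the integrand of
  \<open>clip_covariance\<close> is at most \<open>k\<close>; the factor 2 bounds
  \<open>pi / 2\<close>.\<close>

lemma clip_decoupling:
 assumes L: "selector S1 L" "a < b" and L': "selector S2 L'" "a' < b'"
  and K: "!!s t. s : S1 ==> t : S2 ==> K s t <= k" and k: "k >= 0"
 shows "(LINT w|M. clip a b L (%s. X s w) * clip a' b' L' (%s. X s w))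
  <= (LINT w|M. clip a b L (%s. X s w)) * (LINT w|M. clip a' b' L' (%s. X s w)) + 2 * k"
proof -
 let ?S = "S1 Un S2"
 interpret MM: prob_space "M \<Otimes>\<^sub>M M" by (rule prob_space_pair)
 have S: "finite ?S" "S1 <= ?S" "S2 <= ?S" using L L' by (auto simp: selector_def)
 obtain h where h: "0 < h" "h < pi / 2" and e: "(LINT w|M. clip a b L (%s. X s w) * clip a' b' L' (%s. X s w))
   - (LINT w|M. clip a b L (%s. X s w)) * (LINT w|M. clip a' b' L' (%s. X s w))
   = pi / 2 * (sin h * (LINT w|M2. (\<Sum>s\<in>?S. \<Sum>t\<in>?S. K s t * (clipD S1 a b L (comb ?S (cos h) (- sin h) w) s * clipD S2 a' b' L' (comb ?S 1 0 w) t))))"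
  using clip_covariance[OF L L'] by blast
 let ?I = "\<integral>w. (\<Sum>s\<in>?S. \<Sum>t\<in>?S. K s t * (clipD S1 a b L (comb ?S (cos h) (- sin h) w) s * clipD S2 a' b' L' (comb ?S 1 0 w) t)) \<partial>M2"
 have "?I <= (LINT w|M2. k)"
 proof (rule integral_mono_AE)
  show "integrable M2 (%w. \<Sum>s\<in>?S. \<Sum>t\<in>?S. K s t * (clipD S1 a b L (comb ?S (cos h) (- sin h) w) s * clipD S2 a' b' L' (comb ?S 1 0 w) t))"
   by (intro Bochner_Integration.integrable_sum integrable_mult_right clipD_product_integrable L L')
  show "AE w in M \<Otimes>\<^sub>M M. (\<Sum>s\<in>?S. \<Sum>t\<in>?S. K s t * (clipD S1 a b L (comb ?S (cos h) (- sin h) w) s * clipD S2 a' b' L' (comb ?S 1 0 w) t)) <= k"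
   using AE_comb_generic[OF S(1) finite.emptyI, of "cos h" "- sin h", simplified] AE_comb_generic[OF S(1) finite.emptyI, of 1 0, simplified]
  proof eventually_elim
   case (elim w)
   let ?D = "clipD S1 a b L (comb ?S (cos h) (- sin h) w)" and ?D' = "clipD S2 a' b' L' (comb ?S 1 0 w)"
   have "(\<Sum>s\<in>?S. \<Sum>t\<in>?S. K s t * (?D s * ?D' t)) <= (\<Sum>s\<in>?S. \<Sum>t\<in>?S. k * (?D s * ?D' t))"
    using K by (intro sum_mono) (auto simp: clipD_def)
   also have "... = k * ((\<Sum>s\<in>?S. ?D s) * (\<Sum>t\<in>?S. ?D' t))"
    by (simp only: sum_product) (simp only: sum_distrib_left)
   also have "... <= k * (1 * 1)"
    using k clipD_sum_le[OF elim(1) S(1,2)] clipD_sum_le[OF elim(2) S(1,3)]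
    by (intro mult_left_mono mult_mono) (auto intro!: sum_nonneg simp: clipD_def)
   finally show ?case by simp
  qed
 qed auto
 hence I: "?I <= k" by (simp add: MM.prob_space)
 have "pi / 2 * (sin h * ?I) <= 2 * k"
 proof -
  have sn: "0 <= sin h" using h by (intro sin_ge_zero) auto
  have "sin h * ?I <= sin h * k" using I sn by (rule mult_left_mono)
  also have "... <= 1 * k" using k by (intro mult_right_mono) auto
  finally have "pi / 2 * (sin h * ?I) <= pi / 2 * k" by (intro mult_left_mono) auto
  also have "... <= 2 * k" using k pi_less_4 by (intro mult_right_mono) auto
  finally show ?thesis .
 qed
 thus ?thesis using e by linarith
qed

text \<open>Integration by parts against \<open>Y\<close>, the sum of the process over the auxiliary
  set \<open>T\<close>. Each possible selected site has total covariance at least \<open>m\<close>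
  with \<open>Y\<close>, so the probability of the window times \<open>m\<close> is at most the mean
  of the clipped selector times \<open>Y\<close>; this mean is at most the window width times the
  standard deviation of \<open>Y\<close>.\<close>

lemma clip_density:
 assumes L: "selector S1 L" "a < b" and T: "finite T"
  and m: "!!s. s : S1 ==> m <= (\<Sum>t\<in>T. K s t)"
 shows "m * prob {w\<in>space M. a < L (%s. X s w) & L (%s. X s w) < b} <= (b - a) * sqrt (\<Sum>s\<in>T. \<Sum>t\<in>T. K s t)"
proof -
 let ?S = "S1 Un T"
 let ?F = "clip a b L" and ?D = "clipD S1 a b L"
 have S: "finite ?S" "S1 <= ?S" using L T by (auto simp: selector_def)
 note d = diffble_clip[OF L(1) S(2,1) L(2)]
 have d': "finite ?S" "?F : bm (vecs ?S)" "!!s. s : ?S ==> (%x. ?D x s) : bm (vecs ?S)"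
   "!!x. \<bar>?F x\<bar> <= max \<bar>a\<bar> \<bar>b\<bar>" "!!x s. \<bar>?D x s\<bar> <= 1" "!!x y. \<bar>?F x - ?F y\<bar> <= (\<Sum>s\<in>?S. \<bar>x s - y s\<bar>)"
  using d unfolding diffble_def by blast+
 note [measurable] = d'(2)
 let ?x = "%w. \<lambda>s\<in>?S. X s w"
 have mD[measurable]: "(%w. ?D (?x w) s) : bm M" if "s : ?S" for s
  by (rule measurable_compose[OF restr_measurable d'(3)[OF that]])
 have iD: "integrable M (%w. ?D (?x w) s)" if "s : ?S" for s
  using that d'(5) by (intro integrable_unit[of _ 1]) auto
 have iF: "integrable M (%w. ?F (?x w) * X t w)" for t
  by (rule integrable_bounded_mult[OF integrable_X, of _ "max \<bar>a\<bar> \<bar>b\<bar>"]) (auto intro: d'(4))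
 have ibp: "(LINT w|M. ?F (?x w) * X t w) = (\<Sum>s\<in>?S. K s t * (LINT w|M. ?D (?x w) s))" if "t : T" for t
  using that by (intro integration_by_parts[OF S(1) _ d'(2,4,6) AE_diffble[OF d] d'(3,5)]) auto
 define Y where "Y w = (\<Sum>t\<in>T. X t w)" for w
 have Y[measurable]: "Y : bm M" unfolding Y_def by measurable
 have iY: "integrable M Y" unfolding Y_def[abs_def] by (intro Bochner_Integration.integrable_sum integrable_X)
 have xx: "integrable M (%w. X s w * X t w)" for s t
  using integrable_mult_X[of s t] by (subst integrable_abs_iff[symmetric]) (auto simp: abs_mult)
 have Y2: "integrable M (%w. (Y w)^2)" "(LINT w|M. (Y w)^2) = (\<Sum>s\<in>T. \<Sum>t\<in>T. K s t)"
  unfolding Y_def power2_eq_square sum_product using xx by (auto simp: exp_mult)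
 have EY: "(LINT w|M. \<bar>Y w\<bar>) <= sqrt (\<Sum>s\<in>T. \<Sum>t\<in>T. K s t)"
 proof -
  have "(LINT w|M. \<bar>Y w\<bar>)^2 <= (LINT w|M. \<bar>Y w\<bar>^2)"
  proof -
   let ?m = "\<integral>w. \<bar>Y w\<bar> \<partial>M"
   have "0 <= (LINT w|M. (\<bar>Y w\<bar> - ?m)^2)" by (intro integral_nonneg_AE) auto
   also have "... = (LINT w|M. \<bar>Y w\<bar>^2 - 2 * ?m * \<bar>Y w\<bar> + ?m^2)" by (simp add: power2_diff algebra_simps)
   also have "... = (LINT w|M. \<bar>Y w\<bar>^2) - ?m^2"
    using Y2(1) iY by (simp add: prob_space power2_eq_square)
   finally show ?thesis by simp
  qed
  thus ?thesis using Y2(2) by (intro real_le_rsqrt) simp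
 qed
 have YF: "(\<Sum>s\<in>?S. (LINT w|M. ?D (?x w) s) * (\<Sum>t\<in>T. K s t)) = (LINT w|M. ?F (?x w) * Y w)"
 proof -
  have "(LINT w|M. ?F (?x w) * Y w) = (\<Sum>t\<in>T. \<integral>w. ?F (?x w) * X t w \<partial>M)"
   unfolding Y_def sum_distrib_left by (rule Bochner_Integration.integral_sum) (rule iF)
  also have "... = (\<Sum>t\<in>T. \<Sum>s\<in>?S. K s t * (LINT w|M. ?D (?x w) s))" by (rule sum.cong[OF refl]) (rule ibp)
  also have "... = (\<Sum>s\<in>?S. (LINT w|M. ?D (?x w) s) * (\<Sum>t\<in>T. K s t))"
   by (subst sum.swap) (simp add: sum_distrib_left sum_distrib_right mult.commute)
  finally show ?thesis by simp
 qed
 \<comment> \<open>\<open>Y\<close> is centred, so the clipped value may be shifted to lie between 0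
   and \<open>b - a\<close>.\<close>
 have "(LINT w|M. ?F (?x w) * Y w) = (LINT w|M. (?F (?x w) - a) * Y w)"
 proof -
  have "(LINT w|M. Y w) = 0" unfolding Y_def using integrable_X by (simp add: exp_zero)
  moreover have "integrable M (%w. ?F (?x w) * Y w)"
   by (rule integrable_bounded_mult[OF iY, of _ "max \<bar>a\<bar> \<bar>b\<bar>"]) (auto intro: d'(4))
  ultimately show ?thesis using iY by (simp add: left_diff_distrib)
 qed
 also have "... <= (LINT w|M. (b - a) * \<bar>Y w\<bar>)"
 proof (rule integral_mono)
  show "integrable M (%w. (?F (?x w) - a) * Y w)"
  proof (rule integrable_bounded_mult[OF iY, of _ "b - a"])
   show "\<bar>?F (?x w) - a\<bar> <= b - a" for w using L(2) by (auto simp: clip_def)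
  qed measurable
  show "integrable M (%w. (b - a) * \<bar>Y w\<bar>)" using iY by simp
  fix w
  have "(?F (?x w) - a) * Y w <= (?F (?x w) - a) * \<bar>Y w\<bar>" by (intro mult_left_mono) (auto simp: clip_def)
  also have "... <= (b - a) * \<bar>Y w\<bar>" using L(2) by (intro mult_right_mono) (auto simp: clip_def)
  finally show "(?F (?x w) - a) * Y w <= (b - a) * \<bar>Y w\<bar>" .
 qed
 also have "... <= (b - a) * sqrt (\<Sum>s\<in>T. \<Sum>t\<in>T. K s t)" using EY L(2) by simp
 finally have up: "(LINT w|M. ?F (?x w) * Y w) <= (b - a) * sqrt (\<Sum>s\<in>T. \<Sum>t\<in>T. K s t)" .
 have Lx: "L (?x w) = L (%s. X s w)" for w by (rule selector_cong[OF L(1)]) simp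
 have mL[measurable]: "(%w. L (%s. X s w)) : bm M"
  using measurable_compose[OF restr_measurable selector_measurable[OF L(1) S(2)]] by (simp add: Lx)
 have "prob {w\<in>space M. a < L (%s. X s w) & L (%s. X s w) < b} = (LINT w|M. (\<Sum>s\<in>?S. ?D (?x w) s))"
 proof -
  have "(LINT w|M. (\<Sum>s\<in>?S. ?D (?x w) s)) = (LINT w|M. indicator {w\<in>space M. a < L (%s. X s w) & L (%s. X s w) < b} w)"
  proof (rule integral_cong_AE)
   have "AE w in M. s = t | X s w ~= X t w" for s t using AE_distinct[of s t] by (cases "s = t") auto
   hence "AE w in M. ALL s:?S. ALL t:?S. s = t | X s w ~= X t w"
    using S by (auto simp: AE_finite_all)
   thus "AE w in M. (\<Sum>s\<in>?S. ?D (?x w) s) = indicator {w\<in>space M. a < L (%s. X s w) & L (%s. X s w) < b} w"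
    using AE_space
   proof eventually_elim
    case (elim w)
    obtain s0 where s0: "s0 : S1" "L (?x w) = ?x w s0" using selector_select[OF L(1)] by blast
    have "?D (?x w) s = (if s = s0 then of_bool (a < L (?x w) & L (?x w) < b) else 0)" if "s : ?S" for s
     using that s0 elim by (auto simp: clipD_def)
    hence "(\<Sum>s\<in>?S. ?D (?x w) s) = (\<Sum>s\<in>?S. if s = s0 then of_bool (a < L (?x w) & L (?x w) < b) else 0)"
     by (intro sum.cong) auto
    also have "... = of_bool (a < L (?x w) & L (?x w) < b)" using S s0 by simp
    finally show ?case using elim(2) by (simp add: Lx indicator_def)
   qed
   show "(%w. \<Sum>s\<in>?S. ?D (?x w) s) : bm M" by (intro borel_measurable_sum mD)
  qed simp
  thus ?thesis by simp
 qed
 also have "... = (\<Sum>s\<in>?S. \<integral>w. ?D (?x w) s \<partial>M)"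
  by (rule Bochner_Integration.integral_sum) (rule iD)
 finally have "m * prob {w\<in>space M. a < L (%s. X s w) & L (%s. X s w) < b} = (\<Sum>s\<in>?S. (LINT w|M. ?D (?x w) s) * m)"
  by (simp add: sum_distrib_left mult.commute)
 also have "... <= (\<Sum>s\<in>?S. (LINT w|M. ?D (?x w) s) * (\<Sum>t\<in>T. K s t))"
 proof (rule sum_mono)
  fix s assume s: "s : ?S"
  have n: "0 <= (LINT w|M. ?D (?x w) s)" by (intro integral_nonneg_AE) (auto simp: clipD_def)
  show "(LINT w|M. ?D (?x w) s) * m <= (LINT w|M. ?D (?x w) s) * (\<Sum>t\<in>T. K s t)"
  proof (cases "s : S1")
   case True thus ?thesis using m n by (intro mult_left_mono) auto
  next
   case False thus ?thesis by (simp add: clipD_def)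
  qed
 qed
 also have "... <= (b - a) * sqrt (\<Sum>s\<in>T. \<Sum>t\<in>T. K s t)" using YF up by simp
 finally show ?thesis .
qed

end

section \<open>Hypercontractivity\<close>

text \<open>The pair \<open>(X, Y)\<close> of random elements satisfies the \<open>L^{4/3}\<close>-\<open>L^2\<close> inequality.\<close>

definition hyper :: "'w measure => 'e measure => ('w => 'e) => ('w => 'e) => bool" where
 "hyper P E X Y \<longleftrightarrow> X : P \<rightarrow>\<^sub>M E & Y : P \<rightarrow>\<^sub>M E &
   (\<forall>(f :: 'e => real) (g :: 'e => real). f : bm E --> g : bm E --> (ALL x. 0 <= f x & f x <= 1) --> (ALL x. 0 <= g x & g x <= 1) -->
    (LINT w|P. f (X w) * g (Y w)) <= (LINT w|P. f (X w) powr (4/3)) powr (3/4) * (LINT w|P. g (Y w) powr 2) powr (1/2))"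

lemma hyperD:
 fixes f g :: "'e => real"
 assumes "hyper P E X Y" "f : bm E" "g : bm E" "!!x. 0 <= f x" "!!x. f x <= 1" "!!x. 0 <= g x" "!!x. g x <= 1"
 shows "(LINT w|P. f (X w) * g (Y w)) <= (LINT w|P. f (X w) powr (4/3)) powr (3/4) * (LINT w|P. g (Y w) powr 2) powr (1/2)"
 using assms unfolding hyper_def by blast

lemma powr_le_one: "0 <= x ==> x <= 1 ==> 0 <= r ==> x powr r <= (1 :: real)"
 using powr_mono2[of r x 1] by simp

text \<open>Tensorisation. With the first samples frozen, the second factor bounds the inner
  integral by \<open>a (X x) powr (3/4) * b (Y x) powr (1/2)\<close>; the first factor is then
  applied to these two functions, where the exponents cancel exactly.\<close>

lemma hyper_pair:
 assumes P: "prob_space P" and Q: "prob_space Q"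
  and h: "hyper P E X Y" and h': "hyper Q E' X' Y'"
 shows "hyper (P \<Otimes>\<^sub>M Q) (E \<Otimes>\<^sub>M E') (%w. (X (fst w), X' (snd w))) (%w. (Y (fst w), Y' (snd w)))"
 unfolding hyper_def
proof (intro conjI allI impI)
 interpret P: prob_space P by fact
 interpret Q: prob_space Q by fact
 interpret PQ: pair_prob_space P Q by unfold_locales
 have m[measurable]: "X : P \<rightarrow>\<^sub>M E" "Y : P \<rightarrow>\<^sub>M E" "X' : Q \<rightarrow>\<^sub>M E'" "Y' : Q \<rightarrow>\<^sub>M E'"
  using h h' by (auto simp: hyper_def)
 show "(%w. (X (fst w), X' (snd w))) : P \<Otimes>\<^sub>M Q \<rightarrow>\<^sub>M E \<Otimes>\<^sub>M E'" by measurable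
 show "(%w. (Y (fst w), Y' (snd w))) : P \<Otimes>\<^sub>M Q \<rightarrow>\<^sub>M E \<Otimes>\<^sub>M E'" by measurable
 fix f g :: "'c \<times> 'd => real"
 assume [measurable]: "f : bm (E \<Otimes>\<^sub>M E')" "g : bm (E \<Otimes>\<^sub>M E')"
  and fg: "ALL x. 0 <= f x & f x <= 1" "ALL x. 0 <= g x & g x <= 1"
 have pf: "0 <= f x powr r" "f x powr r <= 1" "0 <= g x powr r" "g x powr r <= 1" if "r >= 0" for x r
  using fg(1)[rule_format, of x] fg(2)[rule_format, of x] that by (simp_all add: powr_le_one)
 define a where "a x = (LINT y|Q. f (x, X' y) powr (4/3))" for x
 define b where "b x = (LINT y|Q. g (x, Y' y) powr 2)" for x
 have ab: "0 <= a x" "a x <= 1" "0 <= b x" "b x <= 1" for x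
 proof -
  have "a x <= (LINT y|Q. 1)" "b x <= (LINT y|Q. 1)" unfolding a_def b_def using pf by (rule_tac integral_mono'; auto)+
  thus "a x <= 1" "b x <= 1" by (auto simp: Q.prob_space)
  show "0 <= a x" "0 <= b x" unfolding a_def b_def using pf by (auto intro!: integral_nonneg_AE)
 qed
 have [measurable]: "a : bm E" "b : bm E"
  unfolding a_def b_def by measurable
 have fi: "integrable (P \<Otimes>\<^sub>M Q) (%w. f (X (fst w), X' (snd w)) * g (Y (fst w), Y' (snd w)))"
  using fg by (intro PQ.P.integrable_unit[of _ 1]) (auto simp: abs_mult intro!: mult_le_one)
 have "(LINT w|(P \<Otimes>\<^sub>M Q). f (X (fst w), X' (snd w)) * g (Y (fst w), Y' (snd w)))
  = (LINT x|P. (LINT y|Q. f (X x, X' y) * g (Y x, Y' y)))"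
  using PQ.integral_fst'[OF fi] by simp
 also have "... <= (LINT x|P. a (X x) powr (3/4) * b (Y x) powr (1/2))"
 proof (rule integral_mono)
  show "integrable P (%x. (LINT y|Q. f (X x, X' y) * g (Y x, Y' y)))"
   using PQ.integrable_fst'[OF fi] by simp
  show "integrable P (%x. a (X x) powr (3/4) * b (Y x) powr (1/2))"
   using ab by (intro P.integrable_unit[of _ 1]) (auto simp: abs_mult intro!: mult_le_one powr_le_one)
  fix x
  assume "x : space P"
  hence [measurable]: "X x : space E" "Y x : space E" using measurable_space[OF m(1)] measurable_space[OF m(2)] by auto
  show "(LINT y|Q. f (X x, X' y) * g (Y x, Y' y)) <= a (X x) powr (3/4) * b (Y x) powr (1/2)"
   unfolding a_def b_def using fg by (intro hyperD[OF h', of "%z. f (X x, z)" "%z. g (Y x, z)"]) auto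
 qed
 also have "... <= (LINT x|P. (a (X x) powr (3/4)) powr (4/3)) powr (3/4) * (LINT x|P. (b (Y x) powr (1/2)) powr 2) powr (1/2)"
  using ab by (intro hyperD[OF h, of "%z. a z powr (3/4)" "%z. b z powr (1/2)"]) (auto intro: powr_le_one)
 also have "(LINT x|P. (a (X x) powr (3/4)) powr (4/3)) = (LINT x|P. a (X x))"
  using ab by (simp add: powr_powr powr_one)
 also have "(LINT x|P. (b (Y x) powr (1/2)) powr 2) = (LINT x|P. b (Y x))"
  using ab by (simp add: powr_powr powr_one)
 also have "(LINT x|P. a (X x)) = (LINT w|(P \<Otimes>\<^sub>M Q). f (X (fst w), X' (snd w)) powr (4/3))"
 proof -
  have "integrable (P \<Otimes>\<^sub>M Q) (%w. f (X (fst w), X' (snd w)) powr (4/3))"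
   using pf by (intro PQ.P.integrable_unit[of _ 1]) auto
  from PQ.integral_fst'[OF this] show ?thesis by (simp add: a_def)
 qed
 also have "(LINT x|P. b (Y x)) = (LINT w|(P \<Otimes>\<^sub>M Q). g (Y (fst w), Y' (snd w)) powr 2)"
 proof -
  have "integrable (P \<Otimes>\<^sub>M Q) (%w. g (Y (fst w), Y' (snd w)) powr 2)"
   using pf by (intro PQ.P.integrable_unit[of _ 1]) auto
  from PQ.integral_fst'[OF this] show ?thesis by (simp add: b_def)
 qed
 finally show "(LINT w|(P \<Otimes>\<^sub>M Q). f (X (fst w), X' (snd w)) * g (Y (fst w), Y' (snd w)))
   <= (LINT w|(P \<Otimes>\<^sub>M Q). f (X (fst w), X' (snd w)) powr (4/3)) powr (3/4)
   * (LINT w|(P \<Otimes>\<^sub>M Q). g (Y (fst w), Y' (snd w)) powr 2) powr (1/2)" .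
qed

lemma hyper_image:
 assumes "hyper P E X Y" and T: "T : E \<rightarrow>\<^sub>M E'"
 shows "hyper P E' (%w. T (X w)) (%w. T (Y w))"
 unfolding hyper_def
proof (intro conjI allI impI)
 show "(%w. T (X w)) : P \<rightarrow>\<^sub>M E'" "(%w. T (Y w)) : P \<rightarrow>\<^sub>M E'"
  using assms by (auto simp: hyper_def intro: measurable_compose)
 fix f g :: "'c => real"
 assume "f : bm E'" "g : bm E'" "ALL x. 0 <= f x & f x <= 1" "ALL x. 0 <= g x & g x <= 1"
 thus "(LINT w|P. f (T (X w)) * g (T (Y w))) <= (LINT w|P. f (T (X w)) powr (4/3)) powr (3/4) * (LINT w|P. g (T (Y w)) powr 2) powr (1/2)"
  by (intro hyperD[OF assms(1), of "%x. f (T x)" "%x. g (T x)"]) (auto intro: measurable_compose[OF T])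
qed

text \<open>The two-point inequality behind everything, for a random sign \<open>\<epsilon>\<close>, is
 \<open>E (u + r v \<epsilon>)^4 <= (u\<^sup>2 + v\<^sup>2)\<^sup>2\<close> for \<open>3 r\<^sup>2 <= 1\<close>.\<close>

lemma two_point_l4:
 fixes c d r :: real
 assumes r: "3 * r^2 <= 1" and c: "c >= 0" and d: "d >= 0"
 shows "(((1 + r) / 2 * c + (1 - r) / 2 * d) ^ 4 + ((1 - r) / 2 * c + (1 + r) / 2 * d) ^ 4) / 2 <= ((c^2 + d^2) / 2)^2"
proof -
 define u v where "u = (c + d) / 2" and "v = (c - d) / 2"
 have e: "(1 + r) / 2 * c + (1 - r) / 2 * d = u + r * v" "(1 - r) / 2 * c + (1 + r) / 2 * d = u - r * v"
  "(c^2 + d^2) / 2 = u^2 + v^2" by (simp_all add: u_def v_def field_simps power2_eq_square)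
 have "((u + r * v) ^ 4 + (u - r * v) ^ 4) / 2 = (u^2)^2 + 6 * r^2 * (u^2 * v^2) + (r^2)^2 * (v^2)^2"
  by (simp add: power4_eq_xxxx power2_eq_square algebra_simps)
 also have "... <= (u^2)^2 + 2 * (u^2 * v^2) + 1 * (v^2)^2"
 proof (intro add_mono mult_right_mono)
  have "(r^2)^2 <= 1^2" using r by (intro power_mono) auto
  thus "(r^2)^2 <= 1" by simp
 qed (use r in auto)
 also have "... = (u^2 + v^2)^2" by (simp add: power2_eq_square algebra_simps)
 finally show ?thesis unfolding e .
qed

lemma holder_two_point:
 fixes a b p q :: real
 assumes n: "0 <= a" "0 <= b" "0 <= p" "0 <= q"
 shows "(a * p + b * q) / 2 <= ((a powr (4/3) + b powr (4/3)) / 2) powr (3/4) * ((p ^ 4 + q ^ 4) / 2) powr (1/4)"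
proof -
 define A where "A = (a powr (4/3) + b powr (4/3)) / 2"
 define B where "B = (p ^ 4 + q ^ 4) / 2"
 show ?thesis
 proof (cases "A = 0 | B = 0")
  case True
  have "A >= 0" "B >= 0" "a powr (4/3) >= 0" "b powr (4/3) >= 0" "p ^ 4 >= 0" "q ^ 4 >= 0" using n by (auto simp: A_def B_def)
  with True have "(a powr (4/3) = 0 & b powr (4/3) = 0) | (p ^ 4 = 0 & q ^ 4 = 0)"
   unfolding A_def B_def by (auto simp: add_nonneg_eq_0_iff)
  thus ?thesis by auto
 next
  case False
  hence AB: "A > 0" "B > 0" using n by (auto simp: A_def B_def less_le)
  let ?s = "A powr (3/4)" and ?t = "B powr (1/4)"
  have young: "x * y <= 3/4 * x powr (4/3) + 1/4 * y ^ 4" if "x >= 0" "y >= 0" for x y :: real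
  proof (cases "x = 0 | y = 0")
   case False
   hence xy: "x > 0" "y > 0" using that by auto
   have "(x powr (4/3)) powr (3/4) * (y ^ 4) powr (1/4) <= 3/4 * x powr (4/3) + 1/4 * y ^ 4"
   proof -
    have cv: "exp ((1 - 1/4) *\<^sub>R ln (x powr (4/3)) + (1/4) *\<^sub>R ln (y ^ 4)) <= (1 - 1/4) * exp (ln (x powr (4/3))) + 1/4 * exp (ln (y ^ 4))"
     by (rule convex_onD[OF exp_convex]) auto
    have e1: "exp ((1 - 1/4) *\<^sub>R ln (x powr (4/3)) + (1/4) *\<^sub>R ln (y ^ 4)) = (x powr (4/3)) powr (3/4) * (y ^ 4) powr (1/4)"
     using xy by (simp add: powr_def exp_add)
    have e2: "exp (ln (x powr (4/3))) = x powr (4/3)" "exp (ln (y ^ 4)) = y ^ 4" by (rule exp_ln, use xy in simp)+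
    show ?thesis using cv unfolding e1 e2 by simp
   qed
   moreover have "(x powr (4/3)) powr (3/4) = x" using xy by (simp add: powr_powr)
   moreover have "(y ^ 4) powr (1/4) = y"
   proof -
    have "(y ^ 4) powr (1/4) = (y powr 4) powr (1/4)" using xy by (subst powr_numeral) auto
    also have "... = y" using xy by (simp only: powr_powr) simp
    finally show ?thesis .
   qed
   ultimately show ?thesis by simp
  qed (use that in auto)
  have st: "?s > 0" "?t > 0" using AB by auto
  have s43: "(x / ?s) powr (4/3) = x powr (4/3) / A" if "x >= 0" for x
   using that AB by (simp add: powr_divide powr_powr)
  have t4: "(x / ?t) ^ 4 = x ^ 4 / B" for x
  proof -
   have "?t ^ 4 = B" using AB by (simp add: powr_powr flip: powr_realpow)
   thus ?thesis by (simp add: power_divide)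
  qed
  have "(a / ?s) * (p / ?t) + (b / ?s) * (q / ?t) <=
    (3/4 * (a / ?s) powr (4/3) + 1/4 * (p / ?t) ^ 4) + (3/4 * (b / ?s) powr (4/3) + 1/4 * (q / ?t) ^ 4)"
   using n st by (intro add_mono young) auto
  also have "... = 3/4 * ((a powr (4/3) + b powr (4/3)) / A) + 1/4 * ((p ^ 4 + q ^ 4) / B)"
   using n by (simp add: s43 t4 add_divide_distrib)
  also have "... = 2"
  proof -
   have "a powr (4/3) + b powr (4/3) = 2 * A" "p ^ 4 + q ^ 4 = 2 * B" by (simp_all add: A_def B_def)
   thus ?thesis using AB by (simp only:) simp
  qed
  finally have "(a * p + b * q) / (?s * ?t) <= 2" by (simp add: add_divide_distrib)
  hence "(a * p + b * q) / 2 <= ?s * ?t" using st by (simp add: pos_divide_le_eq)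
  thus ?thesis by (simp add: A_def B_def)
 qed
qed

text \<open>The left side is the mean of one function times the noise operator applied to the other,
  whose values are \<open>?p\<close> and \<open>?q\<close>. Hoelder with exponents 4/3 and 4 leaves
  the contraction from L2 to L4 of \<open>two_point_l4\<close>.\<close>

lemma two_point_hyper:
 fixes a b c d r :: real
 assumes r: "0 <= r" "3 * r^2 <= 1" and n: "0 <= a" "0 <= b" "0 <= c" "0 <= d"
 shows "(1 + r) / 4 * (a * c + b * d) + (1 - r) / 4 * (a * d + b * c)
  <= ((a powr (4/3) + b powr (4/3)) / 2) powr (3/4) * ((c powr 2 + d powr 2) / 2) powr (1/2)"
proof -
 have r1: "r <= 1"
 proof (rule ccontr)
  assume "\<not> r <= 1"
  hence "1 < r^2" by (simp add: one_less_power)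
  thus False using r by simp
 qed
 let ?p = "(1 + r) / 2 * c + (1 - r) / 2 * d" and ?q = "(1 - r) / 2 * c + (1 + r) / 2 * d"
 have pq: "0 <= ?p" "0 <= ?q" using r r1 n by auto
 have "(1 + r) / 4 * (a * c + b * d) + (1 - r) / 4 * (a * d + b * c) = (a * ?p + b * ?q) / 2" by (simp add: field_simps)
 also have "... <= ((a powr (4/3) + b powr (4/3)) / 2) powr (3/4) * ((?p ^ 4 + ?q ^ 4) / 2) powr (1/4)"
  by (rule holder_two_point) (use n pq in auto)
 also have "... <= ((a powr (4/3) + b powr (4/3)) / 2) powr (3/4) * (((c^2 + d^2) / 2)^2) powr (1/4)"
  using two_point_l4[OF r(2) n(3,4)] by (intro mult_left_mono powr_mono2) auto
 also have "(((c^2 + d^2) / 2)^2) powr (1/4) = ((c powr 2 + d powr 2) / 2) powr (1/2)"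
 proof (cases "c = 0 & d = 0")
  case False
  hence "(c^2 + d^2) / 2 > 0" by (simp add: sum_power2_gt_zero_iff)
  hence "(((c^2 + d^2) / 2)^2) powr (1/4) = ((c^2 + d^2) / 2) powr (2 * (1/4))" by (simp add: powr_powr flip: powr_numeral)
  also have "2 * (1 / 4) = (1 / 2 :: real)" by simp
  finally show ?thesis using n by (simp add: powr_numeral)
 qed simp
 finally show ?thesis .
qed

subsection \<open>The central limit theorem transfers the inequality to Gaussian pairs\<close>

lemma hyper_distr:
 assumes "hyper P E (%w. X (T w)) (%w. Y (T w))" and T: "T : P \<rightarrow>\<^sub>M N" and X: "X : N \<rightarrow>\<^sub>M E" and Y: "Y : N \<rightarrow>\<^sub>M E"
 shows "hyper (distr P N T) E X Y"
 unfolding hyper_def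
proof (intro conjI allI impI)
 show "X : distr P N T \<rightarrow>\<^sub>M E" "Y : distr P N T \<rightarrow>\<^sub>M E" using X Y by auto
 fix f g :: "'b => real"
 assume f[measurable]: "f : bm E" and g[measurable]: "g : bm E"
  and b: "ALL x. 0 <= f x & f x <= 1" "ALL x. 0 <= g x & g x <= 1"
 note [measurable] = X Y T
 have "(LINT w|distr P N T. f (X w) * g (Y w)) = (LINT w|P. f (X (T w)) * g (Y (T w)))" by (rule integral_distr) measurable
 also have "... <= (LINT w|P. f (X (T w)) powr (4/3)) powr (3/4) * (LINT w|P. g (Y (T w)) powr 2) powr (1/2)"
  using b by (intro hyperD[OF assms(1) f g]) auto
 also have "(LINT w|P. f (X (T w)) powr (4/3)) = (LINT w|distr P N T. f (X w) powr (4/3))"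
  by (rule integral_distr[symmetric]) measurable
 also have "(LINT w|P. g (Y (T w)) powr 2) = (LINT w|distr P N T. g (Y w) powr 2)"
  by (rule integral_distr[symmetric]) measurable
 finally show "(LINT w|distr P N T. f (X w) * g (Y w))
   <= (LINT w|distr P N T. f (X w) powr (4/3)) powr (3/4) * (LINT w|distr P N T. g (Y w) powr 2) powr (1/2)" .
qed

definition sg :: "bool => real" where "sg b = (if b then 1 else - 1)"

text \<open>Two uniform signs with correlation \<open>r\<close>: the second repeats the first with
  probability \<open>(1 + r) / 2\<close>.\<close>

definition two_point :: "real => (real \<times> real) measure" where
 "two_point r = distr (measure_pmf (pair_pmf (bernoulli_pmf (1/2)) (bernoulli_pmf ((1 + r) / 2)))) (borel \<Otimes>\<^sub>M borel)
   (%(a, b). (sg a, if b then sg a else - sg a))"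

lemma sets_two_point [simp, measurable_cong]: "sets (two_point r) = sets (borel \<Otimes>\<^sub>M borel)"
 and space_two_point [simp]: "space (two_point r) = UNIV"
 by (simp_all add: two_point_def space_pair_measure)

lemma prob_space_two_point: "prob_space (two_point r)"
 unfolding two_point_def by (rule measure_pmf.prob_space_distr) (simp add: space_pair_measure)

lemma integral_two_point:
 fixes h :: "real \<times> real => real"
 assumes r: "0 <= r" "r <= 1" and [measurable]: "h : bm (borel \<Otimes>\<^sub>M borel)"
 shows "(LINT z|two_point r. h z) = (1 + r) / 4 * (h (1, 1) + h (- 1, - 1)) + (1 - r) / 4 * (h (1, - 1) + h (- 1, 1))"
proof -
 let ?p = "pair_pmf (bernoulli_pmf (1/2)) (bernoulli_pmf ((1 + r) / 2))"
 have "(LINT z|two_point r. h z) = (LINT w|measure_pmf ?p. h (case w of (a, b) => (sg a, if b then sg a else - sg a)))"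
  unfolding two_point_def by (rule integral_distr) (simp_all add: space_pair_measure)
 also have "... = (\<Sum>w\<in>UNIV. h (case w of (a, b) => (sg a, if b then sg a else - sg a)) * pmf ?p w)"
  by (rule integral_measure_pmf_real) auto
 also have "... = (\<Sum>a\<in>UNIV. \<Sum>b\<in>UNIV. h (sg a, if b then sg a else - sg a) * pmf ?p (a, b))"
  by (simp add: sum.cartesian_product split_beta)
 also have "... = (1 + r) / 4 * (h (1, 1) + h (- 1, - 1)) + (1 - r) / 4 * (h (1, - 1) + h (- 1, 1))"
  using r by (simp add: UNIV_bool pmf_pair sg_def field_simps)
 finally show ?thesis .
qed

lemma le_one_if_hyper: "0 <= r ==> 3 * r^2 <= 1 ==> r <= (1 :: real)"
proof (rule ccontr)
 assume "0 <= r" "3 * r^2 <= 1" "\<not> r <= 1"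
 hence "1 < r^2" by (simp add: one_less_power)
 thus False using `3 * r^2 <= 1` by simp
qed

lemma hyper_two_point:
 assumes r: "0 <= r" "3 * r^2 <= 1"
 shows "hyper (two_point r) borel fst snd"
 unfolding hyper_def
proof (intro conjI allI impI)
 fix f g :: "real => real"
 assume [measurable]: "f : bm borel" "g : bm borel"
  and b: "ALL x. 0 <= f x & f x <= 1" "ALL x. 0 <= g x & g x <= 1"
 note I = integral_two_point[OF r(1) le_one_if_hyper[OF r]]
 have 1: "(LINT w|two_point r. f (fst w) * g (snd w))
   = (1 + r) / 4 * (f 1 * g 1 + f (- 1) * g (- 1)) + (1 - r) / 4 * (f 1 * g (- 1) + f (- 1) * g 1)"
  by (subst I) (simp_all)
 have 2: "(LINT w|two_point r. f (fst w) powr (4/3)) = (f 1 powr (4/3) + f (- 1) powr (4/3)) / 2"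
  by (subst I) (simp_all add: field_simps)
 have 3: "(LINT w|two_point r. g (snd w) powr 2) = (g 1 powr 2 + g (- 1) powr 2) / 2"
  by (subst I) (simp_all add: field_simps)
 show "(LINT w|two_point r. f (fst w) * g (snd w))
   <= (LINT w|two_point r. f (fst w) powr (4/3)) powr (3/4) * (LINT w|two_point r. g (snd w) powr 2) powr (1/2)"
  unfolding 1 2 3 by (rule two_point_hyper[OF r]) (use b in auto)
qed simp_all

lemma char_two_point:
 assumes r: "0 <= r" "r <= 1"
 shows "(LINT z|two_point r. cos (u * fst z + v * snd z)) = (1 + r) / 2 * cos (u + v) + (1 - r) / 2 * cos (u - v)"
  and "(LINT z|two_point r. sin (u * fst z + v * snd z)) = 0"
proof -
 have "cos (- u - v) = cos (u + v)" "cos (v - u) = cos (u - v)" "sin (- u - v) = - sin (u + v)" "sin (v - u) = - sin (u - v)"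
  using cos_minus[of "u + v"] cos_minus[of "u - v"] sin_minus[of "u + v"] sin_minus[of "u - v"] by simp_all
 thus "(LINT z|two_point r. cos (u * fst z + v * snd z)) = (1 + r) / 2 * cos (u + v) + (1 - r) / 2 * cos (u - v)"
  "(LINT z|two_point r. sin (u * fst z + v * snd z)) = 0"
  by ((subst integral_two_point[OF r]); simp add: algebra_simps add_divide_distrib diff_divide_distrib)+
qed

fun walk :: "real => nat => (real \<times> real) measure" where
 "walk r 0 = return (borel \<Otimes>\<^sub>M borel) (0, 0)"
| "walk r (Suc m) = distr (walk r m \<Otimes>\<^sub>M two_point r) (borel \<Otimes>\<^sub>M borel) (%w. (fst (fst w) + fst (snd w), snd (fst w) + snd (snd w)))"

lemma sets_walk [simp, measurable_cong]: "sets (walk r m) = sets (borel \<Otimes>\<^sub>M borel)"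
 by (cases m) simp_all

lemma prob_space_walk: "prob_space (walk r m)"
proof (induction m)
 case 0 show ?case by (simp add: prob_space_return space_pair_measure)
next
 case (Suc m)
 interpret A: prob_space "walk r m" by fact
 interpret B: prob_space "two_point r" by (rule prob_space_two_point)
 interpret pair_prob_space "walk r m" "two_point r" by unfold_locales
 show ?case by (simp, rule P.prob_space_distr) measurable
qed

text \<open>The inequality tensorises and survives any measurable map applied to both members of the
  pair, here addition of the steps.\<close>

lemma hyper_walk:
 assumes r: "0 <= r" "3 * r^2 <= 1"
 shows "hyper (walk r m) borel fst snd"
proof (induction m)
 case 0
 have "(x powr (4/3)) powr (3/4) = x" "(x powr 2) powr (1/2) = x" if "0 <= x" for x :: real
  using that by (simp_all add: powr_powr del: powr_numeral)
 thus ?case unfolding hyper_def by (auto simp: integral_return space_pair_measure simp del: powr_numeral)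
next
 case (Suc m)
 have "hyper (walk r m \<Otimes>\<^sub>M two_point r) borel (%w. (%z. fst z + snd z) (fst (fst w), fst (snd w))) (%w. (%z. fst z + snd z) (snd (fst w), snd (snd w)))"
  by (rule hyper_image[OF hyper_pair[OF prob_space_walk prob_space_two_point Suc hyper_two_point[OF r]]]) measurable
 thus ?case unfolding walk.simps by (intro hyper_distr) simp_all
qed

lemma char_add_distr:
 fixes P Q :: "(real \<times> real) measure"
 assumes P: "prob_space P" "sets P = sets (borel \<Otimes>\<^sub>M borel)" and Q: "prob_space Q" "sets Q = sets (borel \<Otimes>\<^sub>M borel)"
  and s: "(LINT z|P. sin (u * fst z + v * snd z)) = 0" "(LINT z|Q. sin (u * fst z + v * snd z)) = 0"
 shows "(LINT z|(distr (P \<Otimes>\<^sub>M Q) (borel \<Otimes>\<^sub>M borel) (%w. (fst (fst w) + fst (snd w), snd (fst w) + snd (snd w)))). cos (u * fst z + v * snd z))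
   = (LINT z|P. cos (u * fst z + v * snd z)) * (LINT z|Q. cos (u * fst z + v * snd z))"
  and "(LINT z|(distr (P \<Otimes>\<^sub>M Q) (borel \<Otimes>\<^sub>M borel) (%w. (fst (fst w) + fst (snd w), snd (fst w) + snd (snd w)))). sin (u * fst z + v * snd z)) = 0"
proof -
 note [measurable_cong] = P(2) Q(2)
 have m: "(%z. u * fst z + v * snd z) : bm P" "(%z. u * fst z + v * snd z) : bm Q" by measurable
 have T: "(%w. (fst (fst w) + fst (snd w), snd (fst w) + snd (snd w))) : P \<Otimes>\<^sub>M Q \<rightarrow>\<^sub>M borel \<Otimes>\<^sub>M (borel :: real measure)" by measurable
 have e: "u * fst (fst (fst w) + fst (snd w), snd (fst w) + snd (snd w)) + v * snd (fst (fst w) + fst (snd w), snd (fst w) + snd (snd w)) = (u * fst (fst w) + v * snd (fst w)) + (u * fst (snd w) + v * snd (snd w))"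
  for w :: "(real \<times> real) \<times> (real \<times> real)" by (simp add: algebra_simps)
 note c = pair_char_add[OF P(1) Q(1) m s]
 show "(LINT z|(distr (P \<Otimes>\<^sub>M Q) (borel \<Otimes>\<^sub>M borel) (%w. (fst (fst w) + fst (snd w), snd (fst w) + snd (snd w)))). cos (u * fst z + v * snd z))
   = (LINT z|P. cos (u * fst z + v * snd z)) * (LINT z|Q. cos (u * fst z + v * snd z))"
  by (subst integral_distr[OF T]) (simp_all only: e c(1), measurable)
 show "(LINT z|(distr (P \<Otimes>\<^sub>M Q) (borel \<Otimes>\<^sub>M borel) (%w. (fst (fst w) + fst (snd w), snd (fst w) + snd (snd w)))). sin (u * fst z + v * snd z)) = 0"
  by (subst integral_distr[OF T]) (simp_all only: e c(2), measurable)
qed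

lemma char_walk:
 assumes r: "0 <= r" "r <= 1"
 shows "(LINT z|walk r m. cos (u * fst z + v * snd z)) = ((1 + r) / 2 * cos (u + v) + (1 - r) / 2 * cos (u - v)) ^ m &
  (LINT z|walk r m. sin (u * fst z + v * snd z)) = 0"
proof (induction m)
 case 0
 show ?case by (subst (1 2) walk.simps, subst (1 2) integral_return) (simp_all add: space_pair_measure)
next
 case (Suc m)
 note c = char_add_distr[OF prob_space_walk sets_walk prob_space_two_point sets_two_point conjunct2[OF Suc] char_two_point(2)[OF r]]
 show ?case using Suc unfolding walk.simps c by (simp add: char_two_point(1)[OF r])
qed

lemma cos_scaling_limit:
 fixes s :: real
 shows "(%m. real m * (cos (s / sqrt (real m)) - 1)) \<longlonglongrightarrow> - (s^2) / 2"
proof -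
 have *: "(%m. real m * (cos (s / sqrt (real m)) - 1)) \<longlonglongrightarrow> - (s * s / 2)" if "s > 0" for s :: real
  using that by real_asymp
 consider "s = 0" | "s > 0" | "- s > 0" by linarith
 thus ?thesis using *[of s] *[of "- s"] by cases (simp_all add: power2_eq_square)
qed

lemma clt_limit:
 fixes r s t :: real
 assumes r: "0 <= r" "r <= 1"
 shows "(%m. ((1 + r) / 2 * cos (s / sqrt (real m)) + (1 - r) / 2 * cos (t / sqrt (real m))) ^ m)
   \<longlonglongrightarrow> exp (- ((1 + r) / 2 * s^2 + (1 - r) / 2 * t^2) / 2)"
proof -
 define L where "L = - ((1 + r) / 2 * s^2 + (1 - r) / 2 * t^2) / 2"
 define a where "a m = (1 + r) / 2 * cos (s / sqrt (real m)) + (1 - r) / 2 * cos (t / sqrt (real m))" for m :: nat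
 \<comment> \<open>An \<open>m\<close>-th root of the limit, so that
   \<open>\<bar>a^m - b^m\<bar> <= m * \<bar>a - b\<bar>\<close> reduces the claim to first-order
   expansions of \<open>a\<close> and \<open>b\<close>.\<close>
 define b where "b m = exp (L / real m)" for m :: nat
 have "0 <= (1 + r) / 2 * s^2 + (1 - r) / 2 * t^2" using r by (intro add_nonneg_nonneg) simp_all
 hence L: "L <= 0" unfolding L_def by (simp only: divide_le_0_iff neg_le_0_iff_le) simp
 have a1: "norm (a m) <= 1" for m
 proof -
  have "\<bar>a m\<bar> <= \<bar>(1 + r) / 2 * cos (s / sqrt (real m))\<bar> + \<bar>(1 - r) / 2 * cos (t / sqrt (real m))\<bar>"
   unfolding a_def by (rule abs_triangle_ineq)
  also have "... <= (1 + r) / 2 * 1 + (1 - r) / 2 * 1"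
   using r unfolding abs_mult by (intro add_mono mult_mono) auto
  finally show ?thesis by (simp add: field_simps)
 qed
 have b1: "norm (b m) <= 1" for m using L by (simp add: b_def divide_nonpos_nonneg)
 have ma: "(%m. real m * (a m - 1)) \<longlonglongrightarrow> L"
 proof -
  have "(%m. (1 + r) / 2 * (real m * (cos (s / sqrt (real m)) - 1)) + (1 - r) / 2 * (real m * (cos (t / sqrt (real m)) - 1)))
    \<longlonglongrightarrow> (1 + r) / 2 * (- (s^2) / 2) + (1 - r) / 2 * (- (t^2) / 2)"
   by (intro tendsto_intros cos_scaling_limit)
  moreover have "(1 + r) / 2 * (real m * (cos (s / sqrt (real m)) - 1)) + (1 - r) / 2 * (real m * (cos (t / sqrt (real m)) - 1)) = real m * (a m - 1)" for m
   by (simp add: a_def algebra_simps add_divide_distrib diff_divide_distrib)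
  moreover have "(1 + r) / 2 * (- (s^2) / 2) + (1 - r) / 2 * (- (t^2) / 2) = L" by (simp add: L_def field_simps)
  ultimately show ?thesis by simp
 qed
 have mb: "(%m. real m * (b m - 1)) \<longlonglongrightarrow> L"
 proof (cases "L = 0")
  case False
  with L have "L < 0" by simp
  thus ?thesis unfolding b_def by real_asymp
 qed (simp add: b_def)
 have "(%m. real m * norm (a m - b m)) \<longlonglongrightarrow> 0"
 proof -
  have "(%m. \<bar>real m * (a m - 1) - real m * (b m - 1)\<bar>) \<longlonglongrightarrow> \<bar>L - L\<bar>"
   by (intro tendsto_intros ma mb)
  moreover have "\<bar>real m * (a m - 1) - real m * (b m - 1)\<bar> = real m * norm (a m - b m)" for m
  proof -
   have "real m * (a m - 1) - real m * (b m - 1) = real m * (a m - b m)" by (simp add: right_diff_distrib)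
   thus ?thesis by (simp add: abs_mult)
  qed
  ultimately show ?thesis by simp
 qed
 hence "(%m. a m ^ m - b m ^ m) \<longlonglongrightarrow> 0"
  by (rule Lim_null_comparison[rotated]) (rule always_eventually, rule allI, rule norm_power_diff[OF a1 b1])
 moreover have "\<forall>\<^sub>F m in sequentially. b m ^ m = exp L"
  using eventually_gt_at_top[of 0] by eventually_elim (simp add: b_def flip: exp_of_nat_mult)
 hence "(%m. b m ^ m) \<longlonglongrightarrow> exp L" by (rule tendsto_eventually)
 ultimately have "(%m. (a m ^ m - b m ^ m) + b m ^ m) \<longlonglongrightarrow> 0 + exp L" by (rule tendsto_add)
 thus ?thesis by (simp add: a_def L_def)
qed

subsection \<open>Gaussian pairs\<close>

abbreviation "stdG \<equiv> std_normal_distribution"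

lemma prob_space_stdG: "prob_space stdG"
 using real_dist_normal_dist by (rule real_distribution.axioms(1))

lemma stdG_char: "(LINT x|stdG. cos (t * x)) = exp (- (t^2) / 2)" "(LINT x|stdG. sin (t * x)) = 0"
proof -
 interpret prob_space stdG by (rule prob_space_stdG)
 have i: "integrable stdG (%x. iexp (t * x))" by (intro integrable_iexp) auto
 have c: "(CLINT x|stdG. iexp (t * x)) = complex_of_real (exp (- (t^2) / 2))"
  using fun_cong[OF char_std_normal_distribution, of t] by (simp add: char_def)
 have "Re (CLINT x|stdG. iexp (t * x)) = (LINT x|stdG. cos (t * x))"
  using i by (subst integral_Re[symmetric]) (auto simp: Re_exp)
 thus "(LINT x|stdG. cos (t * x)) = exp (- (t^2) / 2)" unfolding c by simp
 have "Im (CLINT x|stdG. iexp (t * x)) = (LINT x|stdG. sin (t * x))"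
  using i by (subst integral_Im[symmetric]) (auto simp: Im_exp)
 thus "(LINT x|stdG. sin (t * x)) = 0" unfolding c by simp
qed

lemma stdG_pair_char:
 assumes r: "r^2 + t^2 = 1"
 shows "(LINT w|(stdG \<Otimes>\<^sub>M stdG). cos (u * fst w + v * (r * fst w + t * snd w))) = exp (- (u^2 + 2 * r * u * v + v^2) / 2)"
  and "(LINT w|(stdG \<Otimes>\<^sub>M stdG). sin (u * fst w + v * (r * fst w + t * snd w))) = 0"
proof -
 have e: "u * fst w + v * (r * fst w + t * snd w) = (u + v * r) * fst w + (v * t) * snd w" for w :: "real \<times> real"
  by (simp add: algebra_simps)
 note c = pair_char_add[OF prob_space_stdG prob_space_stdG, of "%x. (u + v * r) * x" "%x. (v * t) * x", OF _ _ stdG_char(2) stdG_char(2)]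
 have q: "(u + v * r)^2 + (v * t)^2 = u^2 + 2 * r * u * v + v^2"
 proof -
  have "(u + v * r)^2 + (v * t)^2 = u^2 + 2 * r * u * v + v^2 * (r^2 + t^2)" by (simp add: power2_eq_square algebra_simps)
  thus ?thesis using r by simp
 qed
 show "(LINT w|(stdG \<Otimes>\<^sub>M stdG). cos (u * fst w + v * (r * fst w + t * snd w))) = exp (- (u^2 + 2 * r * u * v + v^2) / 2)"
  unfolding e q[symmetric] by (subst c(1)) (simp_all add: stdG_char(1) add_divide_distrib exp_add[symmetric])
 show "(LINT w|(stdG \<Otimes>\<^sub>M stdG). sin (u * fst w + v * (r * fst w + t * snd w))) = 0"
  unfolding e by (rule c(2)) simp_all
qed


text \<open>Passes \<open>hyper_walk\<close> to the limit along walks divided by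
  \<open>sqrt m\<close>. Joint convergence is obtained from the one-dimensional
  \<open>weighted_weak_limit\<close> in stages: products of trigonometric functions
  (\<open>split\<close>), a continuous function of the first coordinate times a trigonometric one of
  the second (\<open>step\<close>), and finally two continuous functions
  (\<open>lim\<close>).\<close>

lemma hyper_stdG_continuous:
 fixes f g :: "real => real"
 assumes r: "0 <= r" "3 * r^2 <= 1" "r^2 + t^2 = 1"
  and f: "!!x. isCont f x" "!!x. 0 <= f x" "!!x. f x <= 1" and g: "!!x. isCont g x" "!!x. 0 <= g x" "!!x. g x <= 1"
 shows "(LINT d|(stdG \<Otimes>\<^sub>M stdG). f (fst d) * g (r * fst d + t * snd d))
  <= (LINT d|(stdG \<Otimes>\<^sub>M stdG). f (fst d) powr (4/3)) powr (3/4)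
   * (LINT d|(stdG \<Otimes>\<^sub>M stdG). g (r * fst d + t * snd d) powr 2) powr (1/2)"
proof -
 have r1: "r <= 1" by (rule le_one_if_hyper[OF r(1,2)])
 interpret G: prob_space stdG by (rule prob_space_stdG)
 interpret GG: pair_prob_space stdG stdG by unfold_locales
 let ?N = "stdG \<Otimes>\<^sub>M stdG"
 have N: "prob_space ?N" by unfold_locales
 let ?Z = "%d::real \<times> real. r * fst d + t * snd d"
 define Y where "Y m z = fst z / sqrt (real m)" for m :: nat and z :: "real \<times> real"
 define Y' where "Y' m z = snd z / sqrt (real m)" for m :: nat and z :: "real \<times> real"
 have Ym[measurable]: "Y m : bm (walk r m)" "Y' m : bm (walk r m)" for m
  unfolding Y_def[abs_def] Y'_def[abs_def] by measurable
 have fm[measurable]: "f : bm borel" "g : bm borel"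
  using f(1) g(1) by (auto intro!: borel_measurable_continuous_onI continuous_at_imp_continuous_on)
 have joint: "(%m. \<integral>z. cos (u * Y m z + v * Y' m z) \<partial>walk r m) \<longlonglongrightarrow> (LINT d|?N. cos (u * fst d + v * ?Z d))"
  "(%m. \<integral>z. sin (u * Y m z + v * Y' m z) \<partial>walk r m) \<longlonglongrightarrow> (LINT d|?N. sin (u * fst d + v * ?Z d))" for u v
 proof -
  have e: "u * Y m z + v * Y' m z = (u / sqrt (real m)) * fst z + (v / sqrt (real m)) * snd z" for m z
   by (simp add: Y_def Y'_def)
  have c: "(LINT z|walk r m. cos (u * Y m z + v * Y' m z)) = ((1 + r) / 2 * cos ((u + v) / sqrt (real m)) + (1 - r) / 2 * cos ((u - v) / sqrt (real m))) ^ m" for m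
   unfolding e using char_walk[OF r(1) r1, where u = "u / sqrt (real m)" and v = "v / sqrt (real m)" and m = m] by (simp add: add_divide_distrib diff_divide_distrib)
  have s: "(LINT z|walk r m. sin (u * Y m z + v * Y' m z)) = 0" for m
   unfolding e using char_walk[OF r(1) r1, where u = "u / sqrt (real m)" and v = "v / sqrt (real m)" and m = m] by simp
  have q: "- ((1 + r) / 2 * (u + v)^2 + (1 - r) / 2 * (u - v)^2) / 2 = - (u^2 + 2 * r * u * v + v^2) / 2"
   by (simp add: power2_eq_square field_simps)
  show "(%m. \<integral>z. cos (u * Y m z + v * Y' m z) \<partial>walk r m) \<longlonglongrightarrow> (LINT d|?N. cos (u * fst d + v * ?Z d))"
   unfolding c stdG_pair_char(1)[OF r(3)] q[symmetric] by (rule clt_limit[OF r(1) r1])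
  show "(%m. \<integral>z. sin (u * Y m z + v * Y' m z) \<partial>walk r m) \<longlonglongrightarrow> (LINT d|?N. sin (u * fst d + v * ?Z d))"
   unfolding s stdG_pair_char(2)[OF r(3)] by simp
 qed
 have i: "integrable (walk r m) (%z. a (Y m z) * b (Y' m z))" if "a : bm borel" "b : bm borel" "!!x. \<bar>a x\<bar> <= 1" "!!x. \<bar>b x\<bar> <= 1"
  for m and a b :: "real => real"
  using that by (intro prob_space.integrable_unit[OF prob_space_walk, of _ _ _ 1]) (auto simp: abs_mult intro!: mult_le_one)
 have iN: "integrable ?N (%d. a (fst d) * b (?Z d))" if "a : bm borel" "b : bm borel" "!!x. \<bar>a x\<bar> <= 1" "!!x. \<bar>b x\<bar> <= 1"
  for a b :: "real => real"
  using that by (intro prob_space.integrable_unit[OF N, of _ 1]) (auto simp: abs_mult intro!: mult_le_one)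
 have split: "(%m. \<integral>z. a (Y m z) * b (Y' m z) \<partial>walk r m) \<longlonglongrightarrow> (LINT d|?N. a (fst d) * b (?Z d))"
  if ab: "a = (%x. cos (u * x)) | a = (%x. sin (u * x))" "b = (%x. cos (v * x)) | b = (%x. sin (v * x))" for u v and a b :: "real => real"
 proof -
  obtain p where p: "!!x. a x = cos (u * x - p)"
   using ab(1) by (elim disjE) (auto intro: that[of 0] that[of "pi / 2"] simp: cos_diff)
  obtain q where q: "!!x. b x = cos (v * x - q)"
   using ab(2) by (elim disjE) (auto intro: that[of 0] that[of "pi / 2"] simp: cos_diff)
  have e: "a x * b y = cos (p + q) / 2 * cos (u * x + v * y) + sin (p + q) / 2 * sin (u * x + v * y)
    + cos (p - q) / 2 * cos (u * x + (- v) * y) + sin (p - q) / 2 * sin (u * x + (- v) * y)" for x y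
  proof -
   have prod: "cos A * cos B = cos (A + B) / 2 + cos (A - B) / 2" for A B :: real by (simp add: cos_add cos_diff add_divide_distrib diff_divide_distrib)
   have "(u * x - p) + (v * y - q) = (u * x + v * y) - (p + q)" "(u * x - p) - (v * y - q) = (u * x + (- v) * y) - (p - q)"
    by simp_all
   thus ?thesis unfolding p q prod
    by (simp only: cos_diff[of "u * x + v * y" "p + q"] cos_diff[of "u * x + (- v) * y" "p - q"] add_divide_distrib) (simp only: mult.commute times_divide_eq_left times_divide_eq_right add.assoc)
  qed
  have ic: "integrable (walk r m) (%z. cos (u * Y m z + w * Y' m z))" "integrable (walk r m) (%z. sin (u * Y m z + w * Y' m z))" for m w
   by (rule prob_space.integrable_unit[OF prob_space_walk, of _ _ _ 1]; simp)+
  have icN: "integrable ?N (%d. cos (u * fst d + w * ?Z d))" "integrable ?N (%d. sin (u * fst d + w * ?Z d))" for w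
   by (rule prob_space.integrable_unit[OF N, of _ 1]; simp)+
  have 1: "(LINT z|walk r m. a (Y m z) * b (Y' m z)) = cos (p + q) / 2 * (LINT z|walk r m. cos (u * Y m z + v * Y' m z)) + sin (p + q) / 2 * (LINT z|walk r m. sin (u * Y m z + v * Y' m z))
    + cos (p - q) / 2 * (LINT z|walk r m. cos (u * Y m z + (- v) * Y' m z)) + sin (p - q) / 2 * (LINT z|walk r m. sin (u * Y m z + (- v) * Y' m z))" for m
   unfolding e using ic by (simp only: Bochner_Integration.integral_add integral_mult_right_zero Bochner_Integration.integrable_add integrable_mult_right)
  have 2: "(LINT d|?N. a (fst d) * b (?Z d)) = cos (p + q) / 2 * (LINT d|?N. cos (u * fst d + v * ?Z d)) + sin (p + q) / 2 * (LINT d|?N. sin (u * fst d + v * ?Z d))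
    + cos (p - q) / 2 * (LINT d|?N. cos (u * fst d + (- v) * ?Z d)) + sin (p - q) / 2 * (LINT d|?N. sin (u * fst d + (- v) * ?Z d))"
   unfolding e using icN by (simp only: Bochner_Integration.integral_add integral_mult_right_zero Bochner_Integration.integrable_add integrable_mult_right)
  show ?thesis unfolding 1 2 by (intro tendsto_intros joint)
 qed
 have step: "(%m. \<integral>z. h (Y m z) * b (Y' m z) \<partial>walk r m) \<longlonglongrightarrow> (LINT d|?N. h (fst d) * b (?Z d))"
  if h: "!!x. isCont h x" "!!x. 0 <= h x" "!!x. h x <= 1" and b: "b = (%x. cos (v * x)) | b = (%x. sin (v * x))" for v and h b :: "real => real"
 proof -
  have hb[measurable]: "h : bm borel" "b : bm borel"
   using h(1) b by (auto intro!: borel_measurable_continuous_onI continuous_at_imp_continuous_on)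
  have b1: "\<bar>b x\<bar> <= 1" "-1 <= b x" "b x <= 1" for x using b by auto
  have h1: "\<bar>h x\<bar> <= 1" for x using h(2,3)[of x] by simp
  \<comment> \<open>As in the uniqueness theorem, the trigonometric factor enters the weight through
    \<open>(1 + c) / 2\<close>, which lies between 0 and 1.\<close>
  have tilt: "(%m. \<integral>z. (1 + c (Y' m z)) / 2 * h (Y m z) \<partial>walk r m) \<longlonglongrightarrow> (LINT d|?N. (1 + c (?Z d)) / 2 * h (fst d))"
   if c: "c = (%x. cos (v * x)) | c = (%x. sin (v * x))" for c :: "real => real" and v
  proof (rule weighted_weak_limit[where u = "%m z. (1 + c (Y' m z)) / 2" and Y = Y and v = "%d. (1 + c (?Z d)) / 2" and Z = fst, OF prob_space_walk _ _ N, where B = 1])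
   have [measurable]: "c : bm borel" using c by (auto intro!: borel_measurable_continuous_onI continuous_intros)
   have c1: "\<bar>c x\<bar> <= 1" for x using c by auto
   show "(%z. (1 + c (Y' m z)) / 2) : bm (walk r m)" for m by measurable
   show "(%d. (1 + c (?Z d)) / 2) : bm ?N" by measurable
   show "0 <= (1 + c (Y' m x)) / 2" "(1 + c (Y' m x)) / 2 <= 1" for m x using c1[of "Y' m x"] by auto
   show "0 <= (1 + c (?Z x)) / 2" "(1 + c (?Z x)) / 2 <= 1" for x using c1[of "?Z x"] by auto
   have gen: "(%m. \<integral>z. (1 + c (Y' m z)) / 2 * a (Y m z) \<partial>walk r m) \<longlonglongrightarrow> (LINT d|?N. (1 + c (?Z d)) / 2 * a (fst d))"
    if a: "a = (%x. cos (u * x)) | a = (%x. sin (u * x))" for a :: "real => real" and u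
   proof -
    have am: "a : bm borel" "!!x. \<bar>a x\<bar> <= 1" using a by (auto intro!: borel_measurable_continuous_onI continuous_intros)
    have e: "(1 + c y) / 2 * a x = a x * cos (0 * y) / 2 + a x * c y / 2" for x y by (simp add: field_simps)
    have i1: "integrable (walk r m) (%z. a (Y m z) * cos (0 * Y' m z))" "integrable (walk r m) (%z. a (Y m z) * c (Y' m z))" for m
     by (rule i[of a "%y. cos (0 * y)"]; use am in simp) (rule i[OF am(1) _ am(2) c1]; simp)
    have i2: "integrable ?N (%d. a (fst d) * cos (0 * ?Z d))" "integrable ?N (%d. a (fst d) * c (?Z d))"
     by (rule iN[of a "%y. cos (0 * y)"]; use am in simp) (rule iN[OF am(1) _ am(2) c1]; simp)
    have 1: "(LINT z|walk r m. (1 + c (Y' m z)) / 2 * a (Y m z)) = (LINT z|walk r m. a (Y m z) * cos (0 * Y' m z)) / 2 + (LINT z|walk r m. a (Y m z) * c (Y' m z)) / 2" for m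
     unfolding e using i1[of m] by (subst Bochner_Integration.integral_add) (auto intro: integrable_divide)
    have 2: "(LINT d|?N. (1 + c (?Z d)) / 2 * a (fst d)) = (LINT d|?N. a (fst d) * cos (0 * ?Z d)) / 2 + (LINT d|?N. a (fst d) * c (?Z d)) / 2"
     unfolding e using i2 by (subst Bochner_Integration.integral_add) (auto intro: integrable_divide)
    show ?thesis unfolding 1 2
     by (intro tendsto_add tendsto_divide tendsto_const split[OF a c] split[OF a disjI1[OF refl[of "%x::real. cos (0 * x)"]]]) simp_all
   qed
   show "(%m. \<integral>x. (1 + c (Y' m x)) / 2 * cos (u * Y m x) \<partial>walk r m) \<longlonglongrightarrow> (LINT x|?N. (1 + c (?Z x)) / 2 * cos (u * fst x))" for u
    by (rule gen[of "%x. cos (u * x)" u]) simp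
   show "(%m. \<integral>x. (1 + c (Y' m x)) / 2 * sin (u * Y m x) \<partial>walk r m) \<longlonglongrightarrow> (LINT x|?N. (1 + c (?Z x)) / 2 * sin (u * fst x))" for u
    by (rule gen[of "%x. sin (u * x)" u]) simp
  qed (use h h1 in auto)
  \<comment> \<open>\<open>cos (0 * y)\<close> is the constant 1 written as a trigonometric
    function, so that \<open>tilt\<close> also provides the term to be subtracted.\<close>
  have e: "h x * b y = 2 * ((1 + b y) / 2 * h x) - (1 + cos (0 * y)) / 2 * h x" for x y by (simp add: field_simps)
  have i1: "integrable (walk r m) (%z. (1 + c (Y' m z)) / 2 * h (Y m z))"
   if "c : bm borel" "!!x. \<bar>c x\<bar> <= 1" for m and c :: "real => real"
  proof -
   have "\<bar>(1 + c y) / 2\<bar> <= 1" for y using that(2)[of y] by (auto simp: abs_le_iff)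
   hence "integrable (walk r m) (%z. h (Y m z) * ((1 + c (Y' m z)) / 2))"
    by (intro i[of h "%y. (1 + c y) / 2"]) (use that h1 in auto)
   thus ?thesis by (simp add: mult.commute)
  qed
  have i2: "integrable ?N (%d. (1 + c (?Z d)) / 2 * h (fst d))"
   if "c : bm borel" "!!x. \<bar>c x\<bar> <= 1" for c :: "real => real"
  proof -
   have "\<bar>(1 + c y) / 2\<bar> <= 1" for y using that(2)[of y] by (auto simp: abs_le_iff)
   hence "integrable ?N (%d. h (fst d) * ((1 + c (?Z d)) / 2))" by (intro iN[of h "%y. (1 + c y) / 2"]) (use that h1 in auto)
   thus ?thesis by (simp add: mult.commute)
  qed
  have j0: "(%y::real. cos (0 * y)) : bm borel" "\<bar>cos (0 * y)\<bar> <= 1" for y :: real by auto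
  have 1: "(LINT z|walk r m. h (Y m z) * b (Y' m z)) = 2 * (LINT z|walk r m. (1 + b (Y' m z)) / 2 * h (Y m z)) - (LINT z|walk r m. (1 + cos (0 * Y' m z)) / 2 * h (Y m z))" for m
   unfolding e Bochner_Integration.integral_diff[OF integrable_mult_right[OF i1[OF hb(2) b1(1)]] i1[OF j0]] integral_mult_right_zero ..
  have 2: "(LINT d|?N. h (fst d) * b (?Z d)) = 2 * (LINT d|?N. (1 + b (?Z d)) / 2 * h (fst d)) - (LINT d|?N. (1 + cos (0 * ?Z d)) / 2 * h (fst d))"
   unfolding e Bochner_Integration.integral_diff[OF integrable_mult_right[OF i2[OF hb(2) b1(1)]] i2[OF j0]] integral_mult_right_zero ..
  show ?thesis unfolding 1 2
   by (intro tendsto_diff tendsto_mult tendsto_const tilt[OF b] tilt[OF disjI1[OF refl[of "%x::real. cos (0 * x)"]]])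
 qed
 have stepc: "(%m. \<integral>z. h (Y m z) * cos (w * Y' m z) \<partial>walk r m) \<longlonglongrightarrow> (LINT d|?N. h (fst d) * cos (w * ?Z d))"
  and steps: "(%m. \<integral>z. h (Y m z) * sin (w * Y' m z) \<partial>walk r m) \<longlonglongrightarrow> (LINT d|?N. h (fst d) * sin (w * ?Z d))"
  if "!!x. isCont h x" "!!x. 0 <= h x" "!!x. h x <= 1" for h :: "real => real" and w
  using step[OF that disjI1[OF refl[of "%x. cos (w * x)"]]] step[OF that disjI2[OF refl[of "%x. sin (w * x)"]]] by blast+
 have lim: "(%m. \<integral>z. f (Y m z) * g (Y' m z) \<partial>walk r m) \<longlonglongrightarrow> (LINT d|?N. f (fst d) * g (?Z d))"
  by (rule weighted_weak_limit[where u = "%m z. f (Y m z)" and Y = Y' and v = "%d. f (fst d)" and Z = ?Z, OF prob_space_walk _ _ N, where B = 1])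
   (use f g in \<open>auto intro: stepc steps\<close>)
 have cpow: "isCont (%x. h x powr p) x" if "!!x. isCont h x" "p > 0" "!!x. 0 <= h x" for h :: "real => real" and p x
  using that by (intro continuous_intros) auto
 have lf: "(%m. \<integral>z. f (Y m z) powr (4/3) \<partial>walk r m) \<longlonglongrightarrow> (LINT d|?N. f (fst d) powr (4/3))"
  using stepc[of "%x. f x powr (4/3)" 0] cpow[OF f(1), of "4/3"] f by (auto simp: powr_le_one)
 have lg: "(%m. \<integral>z. g (Y' m z) powr 2 \<partial>walk r m) \<longlonglongrightarrow> (LINT d|?N. g (?Z d) powr 2)"
 proof -
  have "(%m. \<integral>z. 1 * (%x. g x powr 2) (Y' m z) \<partial>walk r m) \<longlonglongrightarrow> (LINT d|?N. 1 * (%x. g x powr 2) (?Z d))"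
   by (rule weighted_weak_limit[where u = "%m z. 1" and Y = Y' and v = "%d. 1" and Z = ?Z, OF prob_space_walk _ _ N, where B = 1])
    (use stepc[of "%_. 1"] steps[of "%_. 1"] cpow[OF g(1), of 2] g in \<open>auto simp: powr_le_one simp del: powr_numeral\<close>)
  thus ?thesis by (simp only: mult_1)
 qed
 have "(%m. (LINT z|walk r m. f (Y m z) powr (4/3)) powr (3/4) * (LINT z|walk r m. g (Y' m z) powr 2) powr (1/2))
   \<longlonglongrightarrow> (LINT d|?N. f (fst d) powr (4/3)) powr (3/4) * (LINT d|?N. g (?Z d) powr 2) powr (1/2)"
  by (intro tendsto_mult tendsto_powr' lf lg tendsto_const) (auto intro!: always_eventually integral_nonneg_AE)
 with lim show ?thesis
 proof (rule LIMSEQ_le, intro exI[of _ 0] allI impI)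
  fix m :: nat
  show "(LINT z|walk r m. f (Y m z) * g (Y' m z)) <= (LINT z|walk r m. f (Y m z) powr (4/3)) powr (3/4) * (LINT z|walk r m. g (Y' m z) powr 2) powr (1/2)"
   unfolding Y_def Y'_def using f g
   by (intro hyperD[OF hyper_walk[OF r(1,2), of m], of "%x. f (x / sqrt (real m))" "%x. g (x / sqrt (real m))"]) auto
 qed
qed

text \<open>A Lebesgue measurable function is almost everywhere a limit of continuous ones; clamping
  keeps them between 0 and 1, and Lebesgue null sets are null for the Gaussian density.\<close>

lemma stdG_continuous_approx:
 fixes f :: "real => real"
 assumes f: "f : bm borel" "!!x. 0 <= f x" "!!x. f x <= 1"
 shows "EX h. (ALL n x. isCont (h n) x) & (ALL n x. 0 <= h n x & h n x <= 1) & (AE x in stdG. (%n::nat. h n x) \<longlonglongrightarrow> f x)"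
proof -
 have "f : bm lebesgue" using f(1) by (simp add: measurable_completion)
 hence "f measurable_on UNIV" by (intro lebesgue_measurable_imp_measurable_on) auto
 then obtain N g where N: "negligible N" and g: "!!n::nat. continuous_on UNIV (g n)" "!!x. x ~: N ==> (%n. g n x) \<longlonglongrightarrow> f x"
  by (auto simp: measurable_on_def)
 define h where "h n x = max 0 (min 1 (g n x))" for n x
 have "AE x in lebesgue. x ~: N" using N by (intro AE_not_in) (simp add: negligible_iff_null_sets)
 hence "AE x in lborel. x ~: N" by (simp add: AE_completion_iff)
 hence "AE x in stdG. x ~: N" by (subst AE_density) auto
 hence "AE x in stdG. (%n. h n x) \<longlonglongrightarrow> f x"
 proof eventually_elim
  case (elim x)
  hence "(%n. max 0 (min 1 (g n x))) \<longlonglongrightarrow> max 0 (min 1 (f x))" by (intro tendsto_intros g)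
  moreover have "max 0 (min 1 (f x)) = f x" using f(2,3)[of x] by simp
  ultimately show ?case by (simp add: h_def)
 qed
 moreover have "isCont (h n) x" for n x
  unfolding h_def using g(1)[of n] by (intro continuous_intros) (auto simp: continuous_on_eq_continuous_at)
 moreover have "0 <= h n x & h n x <= 1" for n x by (simp add: h_def)
 ultimately show ?thesis by blast
qed

text \<open>The combination is again standard normal, so null sets pull back to null sets. This
  makes almost everywhere approximation usable for both members of the correlated pair.\<close>

lemma AE_stdG_rotated:
 assumes r: "r^2 + t^2 = 1" and P: "AE x in stdG. P x"
 shows "AE w in stdG \<Otimes>\<^sub>M stdG. P (r * fst w + t * snd w)"
proof -
 interpret G: prob_space stdG by (rule prob_space_stdG)
 interpret GG: pair_prob_space stdG stdG by unfold_locales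
 obtain N where N: "N : null_sets stdG" "{x\<in>space stdG. \<not> P x} <= N"
  using P by (auto simp: eventually_ae_filter)
 have NB[measurable]: "N : sets borel" using N(1) by (auto simp: null_sets_def)
 have "(LINT w|(stdG \<Otimes>\<^sub>M stdG). 1 * indicator N (r * fst w + t * snd w)) = (\<integral>x. 1 * indicator N x \<partial>stdG :: real)"
 proof (rule weighted_law_unique[where u = "%_. 1" and v = "%_. 1" and Z = "%x. x"])
  show "(LINT w|(stdG \<Otimes>\<^sub>M stdG). 1 * cos (u * (r * fst w + t * snd w))) = (LINT x|stdG. 1 * cos (u * x))" for u
   using stdG_pair_char(1)[OF r, of 0 u] by (simp add: stdG_char)
  show "(LINT w|(stdG \<Otimes>\<^sub>M stdG). 1 * sin (u * (r * fst w + t * snd w))) = (LINT x|stdG. 1 * sin (u * x))" for u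
   using stdG_pair_char(2)[OF r, of 0 u] by (simp add: stdG_char)
 qed (auto intro: GG.prob_space_axioms G.prob_space_axioms)
 also have "... = 0" using N(1) by (simp add: measure_eq_0_null_sets)
 finally have "AE w in stdG \<Otimes>\<^sub>M stdG. (indicator N (r * fst w + t * snd w) :: real) = 0"
  by (subst integral_nonneg_eq_0_iff_AE[symmetric]) (auto intro!: GG.P.integrable_unit[of _ 1])
 thus ?thesis by (rule eventually_mono) (use N(2) in \<open>auto simp: indicator_def split: if_splits\<close>)
qed

lemma hyper_stdG:
 assumes r: "0 <= r" "3 * r^2 <= 1" "r^2 + t^2 = 1"
 shows "hyper (stdG \<Otimes>\<^sub>M stdG) borel fst (%v. r * fst v + t * snd v)"
 unfolding hyper_def
proof (intro conjI allI impI)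
 interpret G: prob_space stdG by (rule prob_space_stdG)
 interpret GG: pair_prob_space stdG stdG by unfold_locales
 let ?N = "stdG \<Otimes>\<^sub>M stdG" and ?Z = "%v::real \<times> real. r * fst v + t * snd v"
 show "fst : ?N \<rightarrow>\<^sub>M borel" by measurable
 show "?Z : ?N \<rightarrow>\<^sub>M borel" by measurable
 fix f g :: "real => real"
 assume fm[measurable]: "f : bm borel" "g : bm borel"
  and b: "ALL x. 0 <= f x & f x <= 1" "ALL x. 0 <= g x & g x <= 1"
 obtain F where F: "!!n x. isCont (F n) x" "!!n x. 0 <= F n x" "!!n x. F n x <= 1" "AE x in stdG. (%n::nat. F n x) \<longlonglongrightarrow> f x"
  using stdG_continuous_approx[OF fm(1)] b by blast
 obtain H where H: "!!n x. isCont (H n) x" "!!n x. 0 <= H n x" "!!n x. H n x <= 1" "AE x in stdG. (%n::nat. H n x) \<longlonglongrightarrow> g x"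
  using stdG_continuous_approx[OF fm(2)] b by blast
 have [measurable]: "F n : bm borel" "H n : bm borel" for n
  using F(1) H(1) by (auto intro!: borel_measurable_continuous_onI continuous_at_imp_continuous_on)
 have aF: "AE v in ?N. (%n. F n (fst v)) \<longlonglongrightarrow> f (fst v)"
  using AE_stdG_rotated[of 1 0, OF _ F(4)] by simp
 have aH: "AE v in ?N. (%n. H n (?Z v)) \<longlonglongrightarrow> g (?Z v)" by (rule AE_stdG_rotated[OF r(3) H(4)])
 have p: "0 <= x powr q" "x powr q <= 1" if "0 <= x" "x <= 1" "0 <= q" for x q :: real
  using that by (auto intro: powr_le_one)
 have 1: "(%n. \<integral>v. F n (fst v) * H n (?Z v) \<partial>?N) \<longlonglongrightarrow> (LINT v|?N. f (fst v) * g (?Z v))"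
 proof (rule integral_dominated_convergence[where w = "%_. 1"])
  show "AE v in ?N. (%n. F n (fst v) * H n (?Z v)) \<longlonglongrightarrow> f (fst v) * g (?Z v)"
   using aF aH by eventually_elim (rule tendsto_mult)
  show "AE v in ?N. norm (F n (fst v) * H n (?Z v)) <= 1" for n
   using F(2,3) H(2,3) by (auto simp: abs_mult intro!: mult_le_one)
 qed (auto intro!: GG.P.integrable_unit[of _ 1])
 have 2: "(%n. \<integral>v. F n (fst v) powr (4/3) \<partial>?N) \<longlonglongrightarrow> (LINT v|?N. f (fst v) powr (4/3))"
 proof (rule integral_dominated_convergence[where w = "%_. 1"])
  show "AE v in ?N. (%n. F n (fst v) powr (4/3)) \<longlonglongrightarrow> f (fst v) powr (4/3)"
   using aF by eventually_elim (intro tendsto_powr' tendsto_const, auto simp: F)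
  show "AE v in ?N. norm (F n (fst v) powr (4/3)) <= 1" for n
   using F(2,3) p by auto
 qed (auto intro!: GG.P.integrable_unit[of _ 1])
 have 3: "(%n. \<integral>v. H n (?Z v) powr 2 \<partial>?N) \<longlonglongrightarrow> (LINT v|?N. g (?Z v) powr 2)"
 proof (rule integral_dominated_convergence[where w = "%_. 1"])
  show "AE v in ?N. (%n. H n (?Z v) powr 2) \<longlonglongrightarrow> g (?Z v) powr 2"
   using aH by eventually_elim (intro tendsto_powr' tendsto_const, auto simp: H)
  show "AE v in ?N. norm (H n (?Z v) powr 2) <= 1" for n
   using H(2,3) p[of _ 2] by (auto simp del: powr_numeral)
 qed (auto intro!: GG.P.integrable_unit[of _ 1] simp del: powr_numeral)
 have "(%n. (LINT v|?N. F n (fst v) powr (4/3)) powr (3/4) * (LINT v|?N. H n (?Z v) powr 2) powr (1/2))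
   \<longlonglongrightarrow> (LINT v|?N. f (fst v) powr (4/3)) powr (3/4) * (LINT v|?N. g (?Z v) powr 2) powr (1/2)"
  by (intro tendsto_mult tendsto_powr' 2 3 tendsto_const) (auto intro!: always_eventually integral_nonneg_AE)
 with 1 show "(LINT v|?N. f (fst v) * g (?Z v)) <= (LINT v|?N. f (fst v) powr (4/3)) powr (3/4) * (LINT v|?N. g (?Z v) powr 2) powr (1/2)"
  by (rule LIMSEQ_le) (intro exI[of _ 0] allI impI hyper_stdG_continuous[OF r F(1-3) H(1-3)])
qed

subsection \<open>Gaussian vectors\<close>

text \<open>Gaussian vectors built from one independent correlated standard pair per entry
  \<open>b\<close> of the list: each vector has covariance the sum of the matrices
  \<open>b s * b t\<close>, and the cross covariance is \<open>r\<close> times that sum.\<close>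

fun vec_pair :: "'i set => real => real => ('i => real) list => (('i => real) \<times> ('i => real)) measure" where
 "vec_pair S r t [] = return (vecs S \<Otimes>\<^sub>M vecs S) (\<lambda>s\<in>S. 0, \<lambda>s\<in>S. 0)"
| "vec_pair S r t (b # bs) = distr (vec_pair S r t bs \<Otimes>\<^sub>M (stdG \<Otimes>\<^sub>M stdG)) (vecs S \<Otimes>\<^sub>M vecs S)
   (%w. (\<lambda>s\<in>S. fst (fst w) s + b s * fst (snd w), \<lambda>s\<in>S. snd (fst w) s + b s * (r * fst (snd w) + t * snd (snd w))))"

lemma sets_vec_pair [simp, measurable_cong]: "sets (vec_pair S r t bs) = sets (vecs S \<Otimes>\<^sub>M vecs S)"
 by (cases bs) simp_all

lemma zero_in_space_vec: "(\<lambda>s\<in>S. 0, \<lambda>s\<in>S. 0) : space (vecs S \<Otimes>\<^sub>M vecs S)"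
 by (auto simp: space_pair_measure space_PiM)

lemma vec_step_measurable:
 "(%w. (\<lambda>s\<in>S. fst (fst w) s + b s * fst (snd w), \<lambda>s\<in>S. snd (fst w) s + b s * (r * fst (snd w) + t * snd (snd w))))
  : vec_pair S r t bs \<Otimes>\<^sub>M (stdG \<Otimes>\<^sub>M stdG) \<rightarrow>\<^sub>M vecs S \<Otimes>\<^sub>M vecs S"
proof -
 have [measurable]: "(%w. fst (fst w) s) : bm (vec_pair S r t bs \<Otimes>\<^sub>M (stdG \<Otimes>\<^sub>M stdG))"
  "(%w. snd (fst w) s) : bm (vec_pair S r t bs \<Otimes>\<^sub>M (stdG \<Otimes>\<^sub>M stdG))" if "s : S" for s
  using that by measurable
 show ?thesis by (intro measurable_Pair measurable_restrict) measurable
qed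

lemma prob_space_vec_pair: "prob_space (vec_pair S r t bs)"
proof (induction bs)
 case Nil show ?case unfolding vec_pair.simps by (rule prob_space_return[OF zero_in_space_vec])
next
 case (Cons b bs)
 interpret A: prob_space "vec_pair S r t bs" by fact
 interpret G: prob_space stdG by (rule prob_space_stdG)
 interpret GG: pair_prob_space stdG stdG by unfold_locales
 interpret pair_prob_space "vec_pair S r t bs" "stdG \<Otimes>\<^sub>M stdG" by unfold_locales
 show ?case unfolding vec_pair.simps by (rule P.prob_space_distr[OF vec_step_measurable])
qed

lemma hyper_vec_pair:
 assumes r: "0 <= r" "3 * r^2 <= 1" "r^2 + t^2 = 1"
 shows "hyper (vec_pair S r t bs) (vecs S) fst snd"
proof (induction bs)
 case Nil
 have "(x powr (4/3)) powr (3/4) = x" "(x powr 2) powr (1/2) = x" if "0 <= x" for x :: real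
  using that by (simp_all add: powr_powr del: powr_numeral)
 thus ?case unfolding hyper_def using zero_in_space_vec[of S] by (auto simp: integral_return simp del: powr_numeral)
next
 case (Cons b bs)
 have G2: "prob_space (stdG \<Otimes>\<^sub>M stdG)"
 proof -
  interpret G: prob_space stdG by (rule prob_space_stdG)
  interpret GG: pair_prob_space stdG stdG by unfold_locales
  show ?thesis by unfold_locales
 qed
 let ?T = "%z. \<lambda>s\<in>S. fst z s + b s * snd z"
 have T: "?T : vecs S \<Otimes>\<^sub>M borel \<rightarrow>\<^sub>M vecs S" by measurable
 from hyper_image[OF hyper_pair[OF prob_space_vec_pair G2 Cons hyper_stdG[OF r]] T]
 show ?case unfolding vec_pair.simps by (intro hyper_distr vec_step_measurable) (simp_all del: restrict_apply)
qed

lemma char_vec_pair: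
 assumes S: "finite S" and r: "r^2 + t^2 = 1"
 shows "(LINT w|vec_pair S r t bs. cos ((\<Sum>s\<in>S. a s * fst w s) + (\<Sum>s\<in>S. c s * snd w s)))
   = exp (- (\<Sum>b\<leftarrow>bs. (\<Sum>s\<in>S. a s * b s)^2 + 2 * r * (\<Sum>s\<in>S. a s * b s) * (\<Sum>s\<in>S. c s * b s) + (\<Sum>s\<in>S. c s * b s)^2) / 2)
  & (LINT w|vec_pair S r t bs. sin ((\<Sum>s\<in>S. a s * fst w s) + (\<Sum>s\<in>S. c s * snd w s))) = 0"
proof (induction bs)
 case Nil
 have "(\<Sum>s\<in>S. a s * (\<lambda>s\<in>S. 0) s) = (0::real)" for a by (intro sum.neutral) auto
 thus ?case using zero_in_space_vec[of S] by (subst (1 2) vec_pair.simps, subst (1 2) integral_return) simp_all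
next
 case (Cons b bs)
 let ?W = "vec_pair S r t bs" and ?G = "stdG \<Otimes>\<^sub>M stdG"
 let ?u = "\<Sum>s\<in>S. a s * b s" and ?v = "\<Sum>s\<in>S. c s * b s"
 let ?f = "%w. (\<Sum>s\<in>S. a s * fst w s) + (\<Sum>s\<in>S. c s * snd w s)"
 let ?g = "%z. ?u * fst z + ?v * (r * fst z + t * snd z)"
 have G2: "prob_space ?G"
 proof -
  interpret G: prob_space stdG by (rule prob_space_stdG)
  interpret GG: pair_prob_space stdG stdG by unfold_locales
  show ?thesis by unfold_locales
 qed
 have m: "?f : bm ?W" "?g : bm ?G" by measurable
 have m': "?f : bm (vecs S \<Otimes>\<^sub>M vecs S)" by measurable
 have e: "?f (\<lambda>s\<in>S. fst (fst y) s + b s * fst (snd y), \<lambda>s\<in>S. snd (fst y) s + b s * (r * fst (snd y) + t * snd (snd y)))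
   = ?f (fst y) + ?g (snd y)" for y :: "(('a => real) \<times> ('a => real)) \<times> real \<times> real"
 proof -
  have "?f (\<lambda>s\<in>S. fst (fst y) s + b s * fst (snd y), \<lambda>s\<in>S. snd (fst y) s + b s * (r * fst (snd y) + t * snd (snd y)))
    = (\<Sum>s\<in>S. a s * fst (fst y) s + a s * b s * fst (snd y)) + (\<Sum>s\<in>S. c s * snd (fst y) s + c s * b s * (r * fst (snd y) + t * snd (snd y)))"
   by (simp add: distrib_left mult.assoc)
  thus ?thesis by (simp add: sum.distrib sum_distrib_right)
 qed
 note ch = pair_char_add[OF prob_space_vec_pair G2 m conjunct2[OF Cons] stdG_pair_char(2)[OF r]]
 have 1: "(LINT w|vec_pair S r t (b # bs). cos (?f w)) = (LINT w|?W. cos (?f w)) * (LINT z|?G. cos (?g z))"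
  unfolding vec_pair.simps by (subst integral_distr[OF vec_step_measurable]) (use m' in measurable, simp only: e ch(1))
 have 2: "(LINT w|vec_pair S r t (b # bs). sin (?f w)) = 0"
  unfolding vec_pair.simps by (subst integral_distr[OF vec_step_measurable]) (use m' in measurable, simp only: e ch(2))
 show ?case unfolding 1 2 conjunct1[OF Cons] stdG_pair_char(1)[OF r] exp_add[symmetric]
  by (simp add: add_divide_distrib[symmetric])
qed

text \<open>Cholesky elimination of the index \<open>x\<close>: subtracting the rank one matrix of
  \<open>b0\<close> clears its row and column. The rest, a Schur complement, is again positive
  semidefinite, as the value of the form minimised over the coefficient at \<open>x\<close>.\<close>

lemma psd_decomposition:
 fixes K :: "'i => 'i => real"
 assumes "finite S" "!!s t. s : S ==> t : S ==> K s t = K t s" "!!a. qform S K a a >= 0"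
 shows "EX bs. ALL s:S. ALL t:S. K s t = (\<Sum>b\<leftarrow>bs. b s * b t)"
 using assms
proof (induction S arbitrary: K rule: finite_induct)
 case empty thus ?case by simp
next
 case (insert x S)
 have sym: "K s t = K t s" if "s : insert x S" "t : insert x S" for s t using insert.prems that by blast
 define l where "l c = (\<Sum>s\<in>S. c s * K s x)" for c
 have q: "qform (insert x S) K c c = (c x)^2 * K x x + 2 * c x * l c + qform S K c c" for c
 proof -
  have "(\<Sum>t\<in>S. c x * c t * K x t) = c x * l c"
   using sym by (auto simp: l_def sum_distrib_left mult_ac intro!: sum.cong)
  moreover have "(\<Sum>s\<in>S. c s * c x * K s x) = c x * l c"
   by (auto simp: l_def sum_distrib_left mult_ac intro!: sum.cong)
  ultimately show ?thesis
   using insert.hyps by (simp add: qform_def sum.distrib power2_eq_square)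
 qed
 define m where "m = K x x"
 have m: "m >= 0"
 proof -
  have "qform (insert x S) K (%s. if s = x then 1 else 0) (%s. if s = x then 1 else 0) = m"
  proof -
   have "l (%s. if s = x then 1 else 0) = 0" unfolding l_def using insert.hyps by (intro sum.neutral) auto
   moreover have "qform S K (%s. if s = x then 1 else 0) (%s. if s = x then 1 else 0) = 0"
    unfolding qform_def using insert.hyps by (intro sum.neutral ballI) auto
   ultimately show ?thesis unfolding q by (simp add: m_def)
  qed
  thus ?thesis using insert.prems(2)[of "%s. if s = x then 1 else 0"] by simp
 qed
 have tot: "v^2 * m + 2 * v * l c + qform S K c c >= 0" for v c
 proof -
  let ?c = "c(x := v)"
  have "l ?c = l c" unfolding l_def using insert.hyps by (intro sum.cong) auto
  moreover have "qform S K ?c ?c = qform S K c c" unfolding qform_def using insert.hyps by (intro sum.cong) auto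
  ultimately show ?thesis using insert.prems(2)[of ?c] unfolding q by (simp add: m_def)
 qed
 \<comment> \<open>If the pivot \<open>m\<close> is 0, the whole column vanishes by positivity and
   nothing has to be subtracted.\<close>
 define b0 where "b0 s = (if m = 0 then 0 else K s x / sqrt m)" for s
 define K' where "K' s t = K s t - b0 s * b0 t" for s t
 have "EX bs. ALL s:S. ALL t:S. K' s t = (\<Sum>b\<leftarrow>bs. b s * b t)"
 proof (rule insert.IH)
  show "K' s t = K' t s" if "s : S" "t : S" for s t using sym that by (simp add: K'_def mult.commute)
  show "0 <= qform S K' a a" for a
  proof -
   have "qform S K' a a = qform S K a a - (\<Sum>s\<in>S. a s * b0 s)^2"
    unfolding qform_def K'_def power2_eq_square sum_product sum_subtractf[symmetric]
    by (intro sum.cong refl) (simp add: algebra_simps)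
   moreover have "(\<Sum>s\<in>S. a s * b0 s)^2 <= qform S K a a"
   proof (cases "m = 0")
    case True thus ?thesis using tot[of 0 a] by (simp add: b0_def)
   next
    case False
    hence mp: "m > 0" using m by simp
    have "(\<Sum>s\<in>S. a s * b0 s) = l a / sqrt m" using False by (simp add: b0_def l_def sum_divide_distrib)
    hence "(\<Sum>s\<in>S. a s * b0 s)^2 = (l a)^2 / m" using mp by (simp add: power_divide)
    moreover have "(- l a / m)^2 * m + 2 * (- l a / m) * l a + qform S K a a >= 0" by (rule tot)
    moreover have "(- l a / m)^2 * m + 2 * (- l a / m) * l a = - ((l a)^2 / m)"
     using mp by (simp add: power2_eq_square field_simps)
    ultimately show ?thesis by simp
   qed
   ultimately show ?thesis by simp
  qed
 qed
 then obtain bs where bs: "!!s t. s : S ==> t : S ==> K' s t = (\<Sum>b\<leftarrow>bs. b s * b t)" by blast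
 define bs' where "bs' = map (%b. b(x := 0)) bs"
 have bs': "(\<Sum>b\<leftarrow>bs'. b s * b t) = (if s = x | t = x then 0 else (\<Sum>b\<leftarrow>bs. b s * b t))" for s t
  unfolding bs'_def by (induction bs) auto
 have Kx: "K s x = b0 s * b0 x" if s: "s : insert x S" for s
 proof (cases "m = 0")
  case True
  have "K s x = 0" if "s : S"
  proof (rule ccontr)
   assume n: "K s x ~= 0"
   let ?c = "%u. if u = s then 1 else 0 :: real"
   have "l ?c = K s x" unfolding l_def using insert.hyps that by (simp add: if_distrib[of "%z. z * _"] cong: if_cong)
   moreover define Q where "Q = qform S K ?c ?c"
   \<comment> \<open>With \<open>m = 0\<close> the form is affine in the coefficient at
     \<open>x\<close>; for a nonzero slope this choice gives it the value -1.\<close>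
   ultimately have "2 * (- (Q + 1) / (2 * K s x)) * K s x + Q >= 0" using tot[of "- (Q + 1) / (2 * K s x)" ?c] True by simp
   thus False using n by (simp add: field_simps)
  qed
  thus ?thesis using s True by (auto simp: b0_def m_def)
 next
  case False
  thus ?thesis using m by (simp add: b0_def flip: m_def)
 qed
 have "K s t = (\<Sum>b\<leftarrow>b0 # bs'. b s * b t)" if "s : insert x S" "t : insert x S" for s t
 proof -
  consider "t = x" | "s = x" | "s : S" "t : S" "s ~= x" "t ~= x" using `s : insert x S` `t : insert x S` by blast
  thus ?thesis
  proof cases
   case 1 thus ?thesis using Kx[OF that(1)] bs' by simp
  next
   case 2 thus ?thesis using Kx[OF that(2)] sym[OF that] bs' by (simp add: mult.commute)
  next
   case 3 thus ?thesis using bs[of s t] bs' by (simp add: K'_def)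
  qed
 qed
 thus ?case by blast
qed

section \<open>Noise stability of unlikely events\<close>

context gaussian_process
begin

lemma qform_nonneg:
 assumes "finite S" shows "qform S K a a >= 0"
proof -
 have xx: "integrable M (%w. X s w * X t w)" for s t
  using integrable_mult_X[of s t] by (subst integrable_abs_iff[symmetric]) (auto simp: abs_mult)
 have "0 <= (LINT w|M. (\<Sum>s\<in>S. a s * X s w)^2)" by (intro integral_nonneg_AE) auto
 also have "(%w. (\<Sum>s\<in>S. a s * X s w)^2) = (%w. \<Sum>s\<in>S. \<Sum>t\<in>S. a s * a t * (X s w * X t w))"
  by (simp add: fun_eq_iff power2_eq_square sum_product mult_ac)
 also have "(LINT w|M. (\<Sum>s\<in>S. \<Sum>t\<in>S. a s * a t * (X s w * X t w))) = qform S K a a"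
  unfolding qform_def using xx by (simp add: exp_mult)
 finally show ?thesis .
qed

lemma K_commute: "K s t = K t s"
 using exp_mult[of s t] exp_mult[of t s] by (simp add: mult.commute)

text \<open>Noise stability: the process lies in \<open>A\<close> while a copy with correlation
  \<open>r\<close> to it lies in \<open>B\<close>.\<close>

definition noise :: "'i set => ('i => real) set => ('i => real) set => real => real" where
 "noise S A B r = (LINT w|M2. indicator A (comb S 1 0 w) * indicator B (comb S r (sqrt (1 - r^2)) w))"

text \<open>On finitely many sites the pair has the law of \<open>vec_pair\<close> for a
  decomposition of the kernel, so hypercontractivity applies to the indicator of \<open>A\<close>.
  The exponent is 3/4 + 1/2.\<close>

lemma noise_small:
 assumes S: "finite S" and A[measurable]: "A : sets (vecs S)" and r: "0 <= r" "3 * r^2 <= 1"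
 shows "noise S A A r <= (LINT v|M. indicat_real A (\<lambda>s\<in>S. X s v)) powr (5/4)"
proof -
 define t where "t = sqrt (1 - r^2)"
 have rt: "r^2 + t^2 = 1" using r by (simp add: t_def)
 obtain bs where bs: "!!s t. s : S ==> t : S ==> K s t = (\<Sum>b\<leftarrow>bs. b s * b t)"
  using psd_decomposition[OF S K_commute qform_nonneg[OF S]] by blast
 have Q: "qform S K a c = (\<Sum>b\<leftarrow>bs. (\<Sum>s\<in>S. a s * b s) * (\<Sum>s\<in>S. c s * b s))" for a c
 proof -
  have "qform S K a c = (\<Sum>s\<in>S. \<Sum>t\<in>S. \<Sum>b\<leftarrow>bs. (a s * b s) * (c t * b t))"
   unfolding qform_def by (intro sum.cong refl) (simp add: bs sum_list_const_mult[symmetric] mult_ac)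
  also have "... = (\<Sum>b\<leftarrow>bs. \<Sum>s\<in>S. \<Sum>t\<in>S. (a s * b s) * (c t * b t))"
   by (induction bs) (simp_all add: sum.distrib)
  finally show ?thesis by (simp add: sum_product)
 qed
 let ?V = "vec_pair S r t bs"
 have law: "(LINT v|M2. H (\<lambda>s\<in>S. X s (fst v)) (\<lambda>s\<in>S. r * X s (fst v) + t * X s (snd v))) = (LINT w|?V. H (\<lambda>s\<in>S. fst w s) (\<lambda>s\<in>S. snd w s))"
  if H: "(%(x, y). H x y) : bm (vecs S \<Otimes>\<^sub>M vecs S)" for H :: "_ => _ => real"
 proof (rule pair_law_unique(1)[OF S prob_space_pair prob_space_vec_pair _ _ _ _ _ _ H])
  fix a c :: "'i => real"
  note pc = pair_char[OF S, where \<alpha> = 1 and \<beta> = 0 and \<gamma> = r and \<delta> = t and a = a and b = c, simplified]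
  note vc = char_vec_pair[OF S rt, where a = a and c = c and bs = bs]
  have e: "qform S K a a + r * (qform S K a c + qform S K c a) + (r^2 + t^2) * qform S K c c
   = (\<Sum>b\<leftarrow>bs. (\<Sum>s\<in>S. a s * b s)^2 + 2 * r * (\<Sum>s\<in>S. a s * b s) * (\<Sum>s\<in>S. c s * b s) + (\<Sum>s\<in>S. c s * b s)^2)"
   unfolding Q rt by (induction bs) (simp_all add: power2_eq_square algebra_simps)
  have "(LINT v|M2. cos ((\<Sum>s\<in>S. a s * X s (fst v)) + (\<Sum>s\<in>S. c s * (r * X s (fst v) + t * X s (snd v)))))
    = exp (- (qform S K a a + r * (qform S K a c + qform S K c a) + (r^2 + t^2) * qform S K c c) / 2)"
   using pc(1) by (simp add: algebra_simps)
  thus "(LINT v|M2. cos ((\<Sum>s\<in>S. a s * X s (fst v)) + (\<Sum>s\<in>S. c s * (r * X s (fst v) + t * X s (snd v)))))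
    = (LINT w|?V. cos ((\<Sum>s\<in>S. a s * fst w s) + (\<Sum>s\<in>S. c s * snd w s)))"
   unfolding e using vc by simp
  show "(LINT v|M2. sin ((\<Sum>s\<in>S. a s * X s (fst v)) + (\<Sum>s\<in>S. c s * (r * X s (fst v) + t * X s (snd v)))))
    = (LINT w|?V. sin ((\<Sum>s\<in>S. a s * fst w s) + (\<Sum>s\<in>S. c s * snd w s)))"
   using pc(2) vc by simp
 qed measurable
 have rs: "(\<lambda>s\<in>S. fst w s) = fst w" "(\<lambda>s\<in>S. snd w s) = snd w" if "w : space ?V" for w
  using that sets_eq_imp_space_eq[OF sets_vec_pair[of S r t bs]]
  by (auto simp: space_pair_measure space_PiM PiE_def extensional_restrict)
 have mI: "(%(x, y). indicator A x * indicator A y :: real) : bm (vecs S \<Otimes>\<^sub>M vecs S)"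
  "(%(x, y). indicator A x :: real) : bm (vecs S \<Otimes>\<^sub>M vecs S)"
  "(%(x, y). indicator A y :: real) : bm (vecs S \<Otimes>\<^sub>M vecs S)" by measurable
 have "noise S A A r = (LINT w|?V. indicat_real A (fst w) * indicat_real A (snd w))"
  unfolding noise_def comb_def t_def[symmetric] using law[OF mI(1)] by (simp add: rs cong: Bochner_Integration.integral_cong)
 also have "... <= (LINT w|?V. indicat_real A (fst w) powr (4/3)) powr (3/4) * (LINT w|?V. indicat_real A (snd w) powr 2) powr (1/2)"
  by (intro hyperD[OF hyper_vec_pair[OF r rt]]) auto
 also have "(LINT w|?V. indicat_real A (fst w) powr (4/3)) = (LINT v|M. indicat_real A (\<lambda>s\<in>S. X s v))"
 proof -
  have "(LINT w|?V. indicat_real A (fst w) powr (4/3)) = (LINT w|?V. indicat_real A (\<lambda>s\<in>S. fst w s))"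
   by (rule Bochner_Integration.integral_cong) (auto simp: rs indicator_def)
  also have "... = (LINT v|M2. indicat_real A (\<lambda>s\<in>S. X s (fst v)))" using law[OF mI(2)] by simp
  also have "... = (LINT v|M. indicat_real A (\<lambda>s\<in>S. X s v))"
   by (rule expectation_fst(2)) (auto intro!: integrable_unit[of _ 1])
  finally show ?thesis .
 qed
 also have "(LINT w|?V. indicat_real A (snd w) powr 2) = (LINT v|M. indicat_real A (\<lambda>s\<in>S. X s v))"
 proof -
  have "(LINT w|?V. indicat_real A (snd w) powr 2) = (LINT w|?V. indicat_real A (\<lambda>s\<in>S. snd w s))"
   by (rule Bochner_Integration.integral_cong) (auto simp: rs indicator_def)
  also have "... = (LINT v|M2. indicat_real A (comb S r t v))" using law[OF mI(3)] by (simp add: comb_def)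
  also have "... = (LINT v|M. indicat_real A (\<lambda>s\<in>S. X s v))" by (rule comb_single_law[OF S rt _, of _ 1]) auto
  finally show ?thesis .
 qed
 also have "(LINT v|M. indicat_real A (\<lambda>s\<in>S. X s v)) powr (3/4) * (LINT v|M. indicat_real A (\<lambda>s\<in>S. X s v)) powr (1/2)
   = (LINT v|M. indicat_real A (\<lambda>s\<in>S. X s v)) powr (5/4)" by (simp add: powr_add[symmetric])
 finally show ?thesis .
qed

end

section \<open>Crossings of rectangles\<close>

definition rect :: "real => real => real => real => plane set" where
 "rect a b c d = {z. a <= z $ 1 & z $ 1 <= b & c <= z $ 2 & z $ 2 <= d}"

lemma rect_cbox: "rect a b c d = cbox (vector [a, c]) (vector [b, d])"
 by (auto simp: rect_def mem_box_cart forall_2)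

lemma compact_rect [simp]: "compact (rect a b c d)"
 and convex_rect [simp]: "convex (rect a b c d)"
 by (simp_all add: rect_cbox)

lemma plane_eqI: "x $ 1 = y $ 1 ==> x $ 2 = y $ 2 ==> x = (y :: plane)"
 by (simp add: Finite_Cartesian_Product.vec_eq_iff forall_2)

lemma continuous_on_plane_vector:
 assumes "continuous_on S f" "continuous_on S g"
 shows "continuous_on S (%x. vector [f x, g x] :: plane)"
proof -
 have "(vector [f x, g x] :: plane) = (\<chi> i. if i = 1 then f x else g x)" for x by (rule plane_eqI) simp_all
 moreover have "continuous_on S (%x. \<chi> i. if i = (1 :: 2) then f x else g x)"
  using assms by (intro continuous_on_vec_lambda) (rename_tac i, case_tac "i = 1", simp_all)
 ultimately show ?thesis by simp
qed

lemma continuous_on_coord [continuous_intros]: "continuous_on S (%z::plane. z $ i)"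
 by (intro continuous_intros)

lemma path_component_image:
 assumes "path g" "path_image g <= S" "z : path_image g"
 shows "pc S (pathstart g) z" "pc S z (pathfinish g)"
proof -
 have "pc (path_image g) x y" if "x : path_image g" "y : path_image g" for x y
  using path_connected_path_image[OF assms(1)] that by (simp add: path_connected_component)
 thus "pc S (pathstart g) z" "pc S z (pathfinish g)"
  using assms by (auto intro!: path_component_of_subset[OF assms(2)])
qed

definition joined :: "plane set => plane set => plane set => plane set => bool" where
 "joined Q A B U \<longleftrightarrow> (EX x:A. EX y:B. pc (Q Int U) x y)"

definition lr :: "real => real => real => real => plane set => bool" where
 "lr a b c d U \<longleftrightarrow> (EX x y. pc (rect a b c d Int U) x y & x $ 1 = a & y $ 1 = b)"

definition tb :: "real => real => real => real => plane set => bool" where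
 "tb a b c d U \<longleftrightarrow> (EX x y. pc (rect a b c d Int U) x y & x $ 2 = c & y $ 2 = d)"

lemma path_component_rect:
 assumes "pc (rect a b c d Int U) x y"
 shows "x : rect a b c d" "y : rect a b c d" "x : U" "y : U"
 using path_component_mem[OF assms] by auto

lemma lr_joined: "lr a b c d U \<longleftrightarrow> joined (rect a b c d) (rect a a c d) (rect b b c d) U"
proof -
 have "(x : rect a a c d \<longleftrightarrow> x $ 1 = a) & (y : rect b b c d \<longleftrightarrow> y $ 1 = b)"
  if "pc (rect a b c d Int U) x y" for x y
  using path_component_rect(1,2)[OF that] by (auto simp: rect_def)
 thus ?thesis unfolding lr_def joined_def by blast
qed

lemma tb_joined: "tb a b c d U \<longleftrightarrow> joined (rect a b c d) (rect a b c c) (rect a b d d) U"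
proof -
 have "(x : rect a b c c \<longleftrightarrow> x $ 2 = c) & (y : rect a b d d \<longleftrightarrow> y $ 2 = d)"
  if "pc (rect a b c d Int U) x y" for x y
  using path_component_rect(1,2)[OF that] by (auto simp: rect_def)
 thus ?thesis unfolding tb_def joined_def by blast
qed

lemma joined_mono: "joined Q A B U ==> Q Int U <= Q' Int U' ==> A <= A' ==> B <= B' ==> joined Q' A' B' U'"
 unfolding joined_def by (meson path_component_of_subset subsetD)

text \<open>The meeting theorem for a horizontal and a vertical path. The two sets may differ: equal
  sets serve gluing, disjoint ones yield contradictions.\<close>

lemma cross_meet:
 assumes f: "pc (rect a b c d Int U) x y" "x $ 1 = a" "y $ 1 = b"
  and g: "pc (rect a b c d Int W) u v" "u $ 2 = c" "v $ 2 = d"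
 shows "EX z. pc (rect a b c d Int U) x z & pc (rect a b c d Int W) u z"
proof -
 obtain f where F: "path f" "path_image f <= rect a b c d Int U" "pathstart f = x" "pathfinish f = y"
  using f(1) by (auto simp: path_component_def)
 obtain g where G: "path g" "path_image g <= rect a b c d Int W" "pathstart g = u" "pathfinish g = v"
  using g(1) by (auto simp: path_component_def)
 obtain z where "z : path_image f" "z : path_image g"
  by (rule fashoda[OF F(1) G(1), of "vector [a, c]" "vector [b, d]"]) (use F G f g in \<open>auto simp: rect_cbox\<close>)
 thus ?thesis using path_component_image(1)[OF F(1,2)] path_component_image(1)[OF G(1,2)] F G by auto
qed

text \<open>\<open>t\<close> is the first time at level \<open>b\<close> and \<open>r\<close> the
  last time at level \<open>a\<close> before \<open>t\<close>; between them the values stay in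
  \<open>[a, b]\<close> by the intermediate value theorem.\<close>

lemma crop_real:
 fixes f :: "real => real"
 assumes f: "continuous_on {0..1} f" and ab: "a <= b" "f 0 <= a" "b <= f 1"
 obtains r t where "0 <= r" "r <= t" "t <= 1" "f r = a" "f t = b" "!!u. r <= u ==> u <= t ==> a <= f u & f u <= b"
proof -
 define T where "T = {u\<in>{0..1}. f u = b}"
 have T: "compact T" "T ~= {}"
 proof -
  have "closed T" unfolding T_def by (intro continuous_closed_preimage_constant f) auto
  hence "compact ({0..1} Int T)" by (intro compact_Int_closed) auto
  moreover have "{0..1} Int T = T" by (auto simp: T_def)
  ultimately show "compact T" by simp
  have "EX v>=0. v <= 1 & f v = b" using ab by (intro IVT' f) auto
  thus "T ~= {}" by (auto simp: T_def)
 qed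
 obtain t where t: "t : T" "!!u. u : T ==> t <= u" using compact_attains_inf[OF T] by blast
 hence t01: "0 <= t" "t <= 1" "f t = b" by (auto simp: T_def)
 have below: "f u <= b" if "0 <= u" "u <= t" for u
 proof (rule ccontr)
  assume "\<not> f u <= b"
  hence "EX v>=0. v <= u & f v = b" using ab that t01 by (intro IVT' continuous_on_subset[OF f]) auto
  then obtain v where v: "0 <= v" "v <= u" "f v = b" by auto
  hence "t <= v" using that t01 by (intro t(2)) (auto simp: T_def)
  hence "v = u" using v that by simp
  thus False using v `\<not> f u <= b` by simp
 qed
 define R where "R = {u\<in>{0..t}. f u = a}"
 have f': "continuous_on {0..t} f" using t01 by (intro continuous_on_subset[OF f]) auto
 have R: "compact R" "R ~= {}"
 proof -
  have "closed R" unfolding R_def by (intro continuous_closed_preimage_constant f') auto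
  hence "compact ({0..t} Int R)" by (intro compact_Int_closed) auto
  moreover have "{0..t} Int R = R" by (auto simp: R_def)
  ultimately show "compact R" by simp
  have "EX v>=0. v <= t & f v = a" using ab t01 by (intro IVT' f') auto
  thus "R ~= {}" by (auto simp: R_def)
 qed
 obtain r where r: "r : R" "!!u. u : R ==> u <= r" using compact_attains_sup[OF R] by blast
 hence r': "0 <= r" "r <= t" "f r = a" by (auto simp: R_def)
 have above: "a <= f u" if "r <= u" "u <= t" for u
 proof (rule ccontr)
  assume "\<not> a <= f u"
  hence "EX v>=u. v <= t & f v = a" using ab that t01 r' by (intro IVT' continuous_on_subset[OF f']) auto
  then obtain v where v: "u <= v" "v <= t" "f v = a" by auto
  hence "v <= r" using that r' by (intro r(2)) (auto simp: R_def)
  hence "v = u" using v that by simp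
  thus False using v `\<not> a <= f u` by simp
 qed
 show thesis using r' t01 below above by (intro that[of r t]) auto
qed

lemma crop:
 fixes u :: "plane => real"
 assumes p: "pc U x y" and u: "continuous_on UNIV u" and ab: "a <= b" "u x <= a" "b <= u y"
 shows "EX x' y'. pc (U Int {z. a <= u z & u z <= b}) x' y' & u x' = a & u y' = b & pc U x x'"
proof -
 obtain g where g: "path g" "path_image g <= U" "pathstart g = x" "pathfinish g = y"
  using p by (auto simp: path_component_def)
 have "continuous_on {0..1} (%t. u (g t))"
  using g(1) by (intro continuous_on_compose2[OF u]) (auto simp: path_def)
 then obtain r t where rt: "0 <= r" "r <= t" "t <= 1" "u (g r) = a" "u (g t) = b"
   "!!v. r <= v ==> v <= t ==> a <= u (g v) & u (g v) <= b"
  by (rule crop_real[of "%t. u (g t)" a b]) (use g ab in \<open>auto simp: pathstart_def pathfinish_def\<close>)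
 let ?h = "subpath r t g"
 have "path ?h" using g(1) rt by (intro path_subpath) auto
 moreover have "path_image ?h <= U Int {z. a <= u z & u z <= b}"
 proof -
  have "path_image ?h = g ` {r..t}" using rt by (simp add: path_image_subpath)
  moreover have "g ` {r..t} <= path_image g" using rt by (auto simp: path_image_def)
  ultimately show ?thesis using rt(6) g(2) by auto
 qed
 ultimately have "pc (U Int {z. a <= u z & u z <= b}) (g r) (g t)"
  unfolding path_component_def by (intro exI[of _ ?h]) (auto simp: pathstart_def pathfinish_def subpath_def)
 moreover have "pc U x (g r)"
  using path_component_image(1)[OF g(1,2), of "g r"] rt g(3) by (auto simp: path_image_def)
 ultimately show ?thesis using rt by blast
qed

lemma lr_crop:
 assumes "pc U x y" "x $ 1 <= a" "b <= y $ 1" "a <= b" "!!z. z : U ==> c <= z $ 2 & z $ 2 <= d"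
 shows "EX x' y'. pc (rect a b c d Int U) x' y' & x' $ 1 = a & y' $ 1 = b & pc U x x'"
proof -
 have "U Int {z. a <= z $ 1 & z $ 1 <= b} = rect a b c d Int U" using assms(5) by (auto simp: rect_def)
 thus ?thesis using crop[OF assms(1), of "%z. z $ 1" a b] assms(2-4) by (simp add: continuous_on_coord)
qed

lemma tb_crop:
 assumes "pc U x y" "x $ 2 <= c" "d <= y $ 2" "c <= d" "!!z. z : U ==> a <= z $ 1 & z $ 1 <= b"
 shows "EX x' y'. pc (rect a b c d Int U) x' y' & x' $ 2 = c & y' $ 2 = d & pc U x x'"
proof -
 have "U Int {z. c <= z $ 2 & z $ 2 <= d} = rect a b c d Int U" using assms(5) by (auto simp: rect_def)
 thus ?thesis using crop[OF assms(1), of "%z. z $ 2" c d] assms(2-4) by (simp add: continuous_on_coord)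
qed

subsection \<open>Duality\<close>

text \<open>The sign may jump only where \<open>g\<close> is not positive, and there the product
  vanishes continuously.\<close>

lemma continuous_on_signed:
 fixes g s :: "plane => real"
 assumes g: "continuous_on R g" and s: "!!x. \<bar>s x\<bar> <= 1"
  and const: "!!x. x : R ==> g x > 0 ==> \<forall>\<^sub>F z in at x within R. s z = s x"
 shows "continuous_on R (%x. max (g x) 0 * s x)"
 unfolding continuous_on_def
proof
 fix x assume x: "x : R"
 have gx: "((%z. max (g z) 0) \<longlongrightarrow> max (g x) 0) (at x within R)"
  using g x by (auto simp: continuous_on_def intro!: tendsto_intros)
 show "((%x. max (g x) 0 * s x) \<longlongrightarrow> max (g x) 0 * s x) (at x within R)"
 proof (cases "g x > 0")
  case True
  have "\<forall>\<^sub>F z in at x within R. max (g z) 0 * s x = max (g z) 0 * s z"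
   using const[OF x True] by eventually_elim simp
  thus ?thesis by (rule Lim_transform_eventually[rotated]) (intro tendsto_intros gx)
 next
  case False
  hence "((%z. max (g z) 0) \<longlongrightarrow> 0) (at x within R)" using gx by (simp add: max_def)
  hence "((%x. max (g x) 0 * s x) \<longlongrightarrow> 0) (at x within R)" by (rule Lim_null_comparison[rotated])
    (auto intro!: always_eventually mult_left_le s simp: abs_mult)
  thus ?thesis using False by (simp add: max_def)
 qed
qed

text \<open>If there were no crossing of either kind, then every point could be pushed horizontally
 away from the left side component of \<open>{h > p}\<close> or vertically away from the bottom side
 component of \<open>{h < q}\<close>, contradicting Brouwer's theorem.\<close>

lemma crossing_duality:
 fixes h :: "plane => real"
 assumes h: "continuous_on UNIV h" and ab: "a <= b" "c <= d" and pq: "p < q"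
 shows "lr a b c d {x. h x > p} | tb a b c d {x. h x < q}"
proof (rule ccontr)
 assume no: "\<not> ?thesis"
 define R where "R = rect a b c d"
 define s1 where "s1 x = (if EX y. pc (R Int {x. h x > p}) y x & y $ 1 = a then 1 else - 1 :: real)" for x
 define s2 where "s2 x = (if EX y. pc (R Int {x. h x < q}) y x & y $ 2 = c then 1 else - 1 :: real)" for x
 have locconst: "\<forall>\<^sub>F z in at x within R. ALL y. pc (R Int U) y z = pc (R Int U) y x"
  if x: "x : R" "x : U" and U: "open U" for x U
 proof -
  obtain e where e: "e > 0" "ball x e <= U" using U x by (meson open_contains_ball)
  have "pc (R Int U) y z = pc (R Int U) y x" if "z : R" "z : ball x e" for y z
  proof -
   have "convex (R Int ball x e)" by (auto simp: R_def intro!: convex_Int)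
   hence "path_connected (R Int ball x e)" by (rule convex_imp_path_connected)
   hence "pc (R Int ball x e) z x"
    using that x e by (simp add: path_connected_component)
   hence "pc (R Int U) z x" by (rule path_component_of_subset[rotated]) (use e in auto)
   thus ?thesis using path_component_sym[of "R Int U"] path_component_trans[of "R Int U"] by blast
  qed
  thus ?thesis using e(1) by (auto simp: eventually_at dist_commute intro!: exI[of _ e])
 qed
 have o: "open {x. h x > p}" "open {x. h x < q}"
  using h by (auto intro!: open_Collect_less continuous_intros)
 define v1 where "v1 x = max (h x - p) 0 * s1 x" for x
 define v2 where "v2 x = max (q - h x) 0 * s2 x" for x
 have hR: "continuous_on R h" using h by (rule continuous_on_subset) simp
 have v1: "continuous_on R v1" unfolding v1_def[abs_def]
 proof (rule continuous_on_signed)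
  show "\<forall>\<^sub>F z in at x within R. s1 z = s1 x" if "x : R" "h x - p > 0" for x
  proof -
   have "\<forall>\<^sub>F z in at x within R. ALL y. pc (R Int {x. h x > p}) y z = pc (R Int {x. h x > p}) y x"
    using that by (intro locconst o) auto
   thus ?thesis by (rule eventually_mono) (simp add: s1_def)
  qed
 qed (auto simp: s1_def intro!: continuous_intros hR)
 have v2: "continuous_on R v2" unfolding v2_def[abs_def]
 proof (rule continuous_on_signed)
  show "\<forall>\<^sub>F z in at x within R. s2 z = s2 x" if "x : R" "q - h x > 0" for x
  proof -
   have "\<forall>\<^sub>F z in at x within R. ALL y. pc (R Int {x. h x < q}) y z = pc (R Int {x. h x < q}) y x"
    using that by (intro locconst o) auto
   thus ?thesis by (rule eventually_mono) (simp add: s2_def)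
  qed
 qed (auto simp: s2_def intro!: continuous_intros hR)
 \<comment> \<open>At a fixed point a nonzero displacement must be absorbed by the clamping, on the
   side towards which it points. The signs \<open>s1\<close> and \<open>s2\<close> point inwards on
   the sides where the component starts and, in the absence of crossings, on the opposite sides too.
   So both displacements vanish, impossible because \<open>p < q\<close>.\<close>
 define \<Phi> :: "plane => plane" where "\<Phi> x = vector [max a (min b (x $ 1 + v1 x)), max c (min d (x $ 2 + v2 x))]" for x
 have "continuous_on R \<Phi>" unfolding \<Phi>_def[abs_def] by (intro continuous_on_plane_vector continuous_intros v1 v2)
 moreover have "\<Phi> : R \<rightarrow> R" using ab by (auto simp: \<Phi>_def R_def rect_def)
 moreover have "compact R" "convex R" by (simp_all add: R_def)
 moreover have "vector [a, c] : R" using ab by (simp add: R_def rect_def)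
 ultimately obtain x where x: "x : R" "\<Phi> x = x" using brouwer[of R \<Phi>] by blast
 have "\<Phi> x $ 1 = max a (min b (x $ 1 + v1 x))" "\<Phi> x $ 2 = max c (min d (x $ 2 + v2 x))" by (simp_all add: \<Phi>_def)
 hence x1: "x $ 1 = max a (min b (x $ 1 + v1 x))" and x2: "x $ 2 = max c (min d (x $ 2 + v2 x))"
  by (simp_all only: x(2))
 have xR: "a <= x $ 1" "x $ 1 <= b" "c <= x $ 2" "x $ 2 <= d" using x(1) by (auto simp: R_def rect_def)
 have "h x <= p"
 proof (rule ccontr)
  assume hx: "\<not> h x <= p"
  hence refl: "pc (R Int {x. h x > p}) x x" using x(1) by (auto intro: path_component_refl)
  have l: "x $ 1 = a ==> v1 x > 0" using hx refl by (auto simp: v1_def s1_def)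
  have r: "x $ 1 = b ==> v1 x < 0" using hx no by (auto simp: v1_def s1_def lr_def R_def mult_less_0_iff)
  show False
  proof (cases "x $ 1 = b")
   case True thus False using x1 r xR l by (cases "a = b") auto
  next
   case False
   moreover have "v1 x ~= 0" using hx by (auto simp: v1_def s1_def)
   ultimately show False using x1 l xR by (cases "x $ 1 = a") (auto simp: max_def min_def split: if_splits)
  qed
 qed
 moreover have "h x >= q"
 proof (rule ccontr)
  assume hx: "\<not> h x >= q"
  hence refl: "pc (R Int {x. h x < q}) x x" using x(1) by (auto intro: path_component_refl)
  have l: "x $ 2 = c ==> v2 x > 0" using hx refl by (auto simp: v2_def s2_def)
  have r: "x $ 2 = d ==> v2 x < 0" using hx no by (auto simp: v2_def s2_def tb_def R_def mult_less_0_iff)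
  show False
  proof (cases "x $ 2 = d")
   case True thus False using x2 r xR l by (cases "c = d") auto
  next
   case False
   moreover have "v2 x ~= 0" using hx by (auto simp: v2_def s2_def)
   ultimately show False using x2 l xR by (cases "x $ 2 = c") (auto simp: max_def min_def split: if_splits)
  qed
 qed
 ultimately show False using pq by simp
qed

subsection \<open>Meeting lemmas\<close>

text \<open>The second path begins and ends on the right side, below and above the end of the first.
  In a rectangle widened by a strip of width 1, the first path is prolonged horizontally to the new
  right side, the second down to the bottom and up to the top. The prolongations meet by
  \<open>fashoda\<close>; the order of the heights keeps the added segments from meeting each other,
  so the original paths meet. Coinciding endpoints are settled directly.\<close>

lemma hook_meet:
 assumes f: "pc (rect a b c d Int U) x y" "x $ 1 = a" "y $ 1 = b"
  and g: "pc (rect a b c d Int W) u v" "u $ 1 = b" "v $ 1 = b" and o: "u $ 2 <= y $ 2" "y $ 2 <= v $ 2"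
 shows "EX z. pc (rect a b c d Int U) x z & pc (rect a b c d Int W) u z"
proof -
 let ?R = "rect a b c d"
 consider "u = y" | "v = y" | "u $ 2 < y $ 2" "y $ 2 < v $ 2"
  using o f g plane_eqI[of u y] plane_eqI[of v y] by force
 thus ?thesis
 proof cases
  case 1 thus ?thesis using f g by (metis path_component_mem(1) path_component_refl)
 next
  case 2 thus ?thesis using f g by metis
 next
  case 3
  obtain f where F: "path f" "path_image f <= ?R Int U" "pathstart f = x" "pathfinish f = y"
   using f(1) by (auto simp: path_component_def)
  obtain g where G: "path g" "path_image g <= ?R Int W" "pathstart g = u" "pathfinish g = v"
   using g(1) by (auto simp: path_component_def)
  define y' :: plane where "y' = vector [b + 1, y $ 2]"
  define u' :: plane where "u' = vector [b + 1 / 2, c]"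
  define v' :: plane where "v' = vector [b + 1 / 2, d]"
  have mem: "x : ?R" "y : ?R" "u : ?R" "v : ?R" using f(1) g(1) path_component_mem by blast+
  hence m: "a <= b" "c <= u $ 2" "v $ 2 <= d" "c <= y $ 2" "y $ 2 <= d" "c <= v $ 2" "u $ 2 <= d" using f g by (auto simp: rect_def)
  have seg: "z $ 2 = y $ 2 & b <= z $ 1 & (z $ 1 = b --> z = y) & z $ 1 <= b + 1" if z: "z : closed_segment y y'" for z
  proof -
   obtain t where t: "0 <= t" "t <= 1" "z = (1 - t) *\<^sub>R y + t *\<^sub>R y'" using z by (auto simp: closed_segment_def)
   have z1: "z $ 1 = b + t" unfolding t(3) by (simp add: f(3) y'_def algebra_simps)
   have z2: "z $ 2 = y $ 2" unfolding t(3) by (simp add: y'_def algebra_simps)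
   have "z = y" if "z $ 1 = b"
    using that z1 t by simp
   thus ?thesis using z1 z2 t by auto
  qed
  have segu: "z $ 2 <= u $ 2 & c <= z $ 2 & b <= z $ 1 & (z $ 1 = b --> z = u) & z $ 1 <= b + 1" if z: "z : closed_segment u' u" for z
  proof -
   obtain t where t: "0 <= t" "t <= 1" "z = (1 - t) *\<^sub>R u' + t *\<^sub>R u" using z by (auto simp: closed_segment_def)
   have z1: "z $ 1 = b + (1 - t) / 2" unfolding t(3) by (simp add: g u'_def field_simps)
   have z2: "z $ 2 = c + t * (u $ 2 - c)" unfolding t(3) by (simp add: u'_def algebra_simps)
   have "t * (u $ 2 - c) <= 1 * (u $ 2 - c)" using t m by (intro mult_right_mono) auto
   moreover have "0 <= t * (u $ 2 - c)" using t m by simp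
   moreover have "z = u" if "z $ 1 = b"
    using that z1 t by simp
   ultimately show ?thesis using z1 z2 t by auto
  qed
  have segv: "v $ 2 <= z $ 2 & z $ 2 <= d & b <= z $ 1 & (z $ 1 = b --> z = v) & z $ 1 <= b + 1" if z: "z : closed_segment v v'" for z
  proof -
   obtain t where t: "0 <= t" "t <= 1" "z = (1 - t) *\<^sub>R v + t *\<^sub>R v'" using z by (auto simp: closed_segment_def)
   have z1: "z $ 1 = b + t / 2" unfolding t(3) by (simp add: g v'_def field_simps)
   have z2: "z $ 2 = v $ 2 + t * (d - v $ 2)" unfolding t(3) by (simp add: v'_def algebra_simps)
   have "t * (d - v $ 2) <= 1 * (d - v $ 2)" using t m by (intro mult_right_mono) auto
   moreover have "0 <= t * (d - v $ 2)" using t m by simp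
   moreover have "z = v" if "z $ 1 = b"
    using that z1 t by simp
   ultimately show ?thesis using z1 z2 t by auto
  qed
  let ?f = "f +++ linepath y y'" and ?g = "linepath u' u +++ (g +++ linepath v v')"
  have imf: "path_image ?f = path_image f Un closed_segment y y'"
   using F by (simp add: path_image_join)
  have img: "path_image ?g = closed_segment u' u Un (path_image g Un closed_segment v v')"
   using G by (simp add: path_image_join)
  have inR: "z : cbox (vector [a, c]) (vector [b + 1, d])" if "z : ?R" for z
   using that by (auto simp: rect_cbox[symmetric] rect_def)
  have big: "z : cbox (vector [a, c]) (vector [b + 1, d])" if "b <= z $ 1" "z $ 1 <= b + 1" "c <= z $ 2" "z $ 2 <= d" for z :: plane
   using that m by (auto simp: rect_cbox[symmetric] rect_def)
  have pf: "path ?f" by (rule path_join_imp[OF F(1) path_linepath]) (simp only: F(4) pathstart_linepath)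
  have pg: "path ?g" by (rule path_join_imp[OF path_linepath path_join_imp[OF G(1) path_linepath]])
    (simp_all only: G(3,4) pathstart_join pathfinish_linepath pathstart_linepath)
  have "closed_segment y y' <= cbox (vector [a, c]) (vector [b + 1, d])"
  proof (rule subsetI, rule big)
   fix z assume "z : closed_segment y y'"
   from seg[OF this] m show "b <= z $ 1" "z $ 1 <= b + 1" "c <= z $ 2" "z $ 2 <= d" by linarith+
  qed
  hence bf: "path_image ?f <= cbox (vector [a, c]) (vector [b + 1, d])"
   unfolding imf using F(2) inR by blast
  have "closed_segment u' u <= cbox (vector [a, c]) (vector [b + 1, d])"
  proof (rule subsetI, rule big)
   fix z assume "z : closed_segment u' u"
   from segu[OF this] m show "b <= z $ 1" "z $ 1 <= b + 1" "c <= z $ 2" "z $ 2 <= d" by linarith+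
  qed
  moreover have "closed_segment v v' <= cbox (vector [a, c]) (vector [b + 1, d])"
  proof (rule subsetI, rule big)
   fix z assume "z : closed_segment v v'"
   from segv[OF this] m show "b <= z $ 1" "z $ 1 <= b + 1" "c <= z $ 2" "z $ 2 <= d" by linarith+
  qed
  ultimately have bg: "path_image ?g <= cbox (vector [a, c]) (vector [b + 1, d])"
   unfolding img using G(2) inR by blast
  have ends: "pathstart ?f $ 1 = (vector [a, c] :: plane) $ 1" "pathfinish ?f $ 1 = (vector [b + 1, d] :: plane) $ 1"
   "pathstart ?g $ 2 = (vector [a, c] :: plane) $ 2" "pathfinish ?g $ 2 = (vector [b + 1, d] :: plane) $ 2"
   by (simp_all add: F(3) f(2) y'_def u'_def v'_def)
  obtain z where z: "z : path_image ?f" "z : path_image ?g" by (rule fashoda[OF pf pg bf bg ends])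
  have fb: "w $ 1 <= b" if "w : path_image f Un path_image g" for w using that F(2) G(2) by (auto simp: rect_def)
  have "EX z. z : path_image f & z : path_image g"
  proof -
   have uv: "u : path_image g" "v : path_image g" "y : path_image f"
    using G F pathstart_in_path_image pathfinish_in_path_image by metis+
   have fz: "z : path_image f | z : closed_segment y y'" using z(1) unfolding imf by auto
   have gz: "z : path_image g | z : closed_segment u' u | z : closed_segment v v'" using z(2) unfolding img by auto
   show ?thesis
   proof (cases "z : path_image f")
    case True
    hence "z $ 1 <= b" using fb[of z] by simp
    hence "z : closed_segment u' u ==> z = u" "z : closed_segment v v' ==> z = v"
     using segu[of z] segv[of z] by auto
    thus ?thesis using gz True uv by metis
   next
    case False
    hence fz': "z : closed_segment y y'" using fz by simp
    hence "z ~: closed_segment u' u" "z ~: closed_segment v v'"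
     using seg[of z] segu[of z] segv[of z] 3 by auto
    hence gz': "z : path_image g" using gz by simp
    hence "z = y" using fb[of z] seg[OF fz'] by auto
    thus ?thesis using gz' uv by metis
   qed
  qed
  thus ?thesis using path_component_image(1)[OF F(1,2)] path_component_image(1)[OF G(1,2)] F G by auto
 qed
qed

text \<open>Both paths stay on one side of a line on which their endpoints interlace. Exchanging the
  coordinates and enclosing both images in a box makes this the interlaced form of the meeting
  theorem.\<close>

lemma interlace_meet:
 fixes x y u v :: plane
 assumes f: "pc U x y" and g: "pc W u v"
  and e: "x $ 1 = a" "y $ 1 = a" "u $ 1 = a" "v $ 1 = a"
  and UW: "!!z. z : U ==> a <= z $ 1" "!!z. z : W ==> a <= z $ 1"
  and o: "x $ 2 <= u $ 2" "u $ 2 <= y $ 2" "y $ 2 <= v $ 2"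
 shows "EX z. pc U x z & pc W u z"
proof -
 consider "x = u" | "u = y" | "y = v" | "x $ 2 < u $ 2" "u $ 2 < y $ 2" "y $ 2 < v $ 2"
 proof -
  have "x = u | x $ 2 < u $ 2" using o(1) e plane_eqI[of x u] by (cases "x $ 2 = u $ 2") simp_all
  moreover have "u = y | u $ 2 < y $ 2" using o(2) e plane_eqI[of u y] by (cases "u $ 2 = y $ 2") simp_all
  moreover have "y = v | y $ 2 < v $ 2" using o(3) e plane_eqI[of y v] by (cases "y $ 2 = v $ 2") simp_all
  ultimately show thesis using that by blast
 qed
 thus ?thesis
 proof cases
  case 1 thus ?thesis using f g by (metis path_component_mem(1) path_component_refl)
 next
  case 2 thus ?thesis using f g by (metis path_component_mem(1) path_component_refl)
 next
  case 3 thus ?thesis using f g by metis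
 next
  case 4
  obtain f where F: "path f" "path_image f <= U" "pathstart f = x" "pathfinish f = y"
   using f(1) by (auto simp: path_component_def)
  obtain g where G: "path g" "path_image g <= W" "pathstart g = u" "pathfinish g = v"
   using g(1) by (auto simp: path_component_def)
  define S :: "plane => plane" where "S z = vector [z $ 2, z $ 1]" for z
  have S: "continuous_on T S" for T unfolding S_def[abs_def] by (intro continuous_on_plane_vector continuous_intros)
  have "bounded (path_image f Un path_image g)" using F(1) G(1) bounded_path_image by auto
  then obtain B where B: "!!z. z : path_image f Un path_image g ==> norm z <= B" by (auto simp: bounded_iff)
  have box: "S z : cbox (vector [- B, a]) (vector [B, B])" if "z : path_image f Un path_image g" for z
  proof -
   have "\<bar>z $ 1\<bar> <= B" "\<bar>z $ 2\<bar> <= B" using B[OF that] component_le_norm_cart[of z] order_trans by blast+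
   moreover have "a <= z $ 1" using that UW F(2) G(2) by auto
   ultimately show ?thesis by (auto simp: S_def rect_cbox[symmetric] rect_def)
  qed
  obtain w where w: "w : path_image (S \<circ> f)" "w : path_image (S \<circ> g)"
  proof (rule fashoda_interlace[of "S \<circ> f" "S \<circ> g" "vector [- B, a]" "vector [B, B]"])
   show "path (S \<circ> f)" "path (S \<circ> g)" using F(1) G(1) S by (auto intro: path_continuous_image)
   show "path_image (S \<circ> f) <= cbox (vector [- B, a]) (vector [B, B])"
    "path_image (S \<circ> g) <= cbox (vector [- B, a]) (vector [B, B])"
    using box by (auto simp: path_image_compose)
  qed (use F G e 4 in \<open>auto simp: S_def pathstart_compose pathfinish_compose\<close>)
  have "inj S" by (rule injI) (auto simp: S_def Finite_Cartesian_Product.vec_eq_iff forall_2)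
  with w obtain z where "z : path_image f" "z : path_image g" by (auto simp: path_image_compose dest: injD)
  thus ?thesis using path_component_image(1)[OF F(1,2)] path_component_image(1)[OF G(1,2)] F G by auto
 qed
qed

subsection \<open>Gluing crossings\<close>

lemma lr_restrict:
 assumes "lr a b c d U" "a <= a'" "a' <= b'" "b' <= b"
 shows "lr a' b' c d U"
proof -
 obtain x y where p: "pc (rect a b c d Int U) x y" "x $ 1 = a" "y $ 1 = b"
  using assms(1) by (auto simp: lr_def)
 obtain x' y' where "pc (rect a' b' c d Int (rect a b c d Int U)) x' y'" "x' $ 1 = a'" "y' $ 1 = b'"
  using lr_crop[OF p(1), of a' b' c d] p assms(2-4) by (auto simp: rect_def)
 thus ?thesis unfolding lr_def by (blast intro: path_component_of_subset)
qed

lemma lr_tb_connected: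
 assumes p: "pc (rect a b c d Int U) x y" "x $ 1 = a" "y $ 1 = b"
  and q: "pc (rect a' b' c d Int U) u v" "u $ 2 = c" "v $ 2 = d"
  and o: "a <= a'" "a' <= b'" "b' <= b"
 shows "pc (rect a b c d Int U) x u"
proof -
 have sub: "!!z. z : rect a b c d Int U ==> c <= z $ 2 & z $ 2 <= d" by (auto simp: rect_def)
 obtain x' y' where x': "pc (rect a' b' c d Int (rect a b c d Int U)) x' y'" "x' $ 1 = a'" "y' $ 1 = b'"
   "pc (rect a b c d Int U) x x'"
  using lr_crop[OF p(1) _ _ o(2) sub] p(2,3) o by auto
 obtain z where z: "pc (rect a' b' c d Int (rect a b c d Int U)) x' z" "pc (rect a' b' c d Int U) u z"
  using cross_meet[OF x'(1-3) q] by blast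
 have "pc (rect a b c d Int U) x' z" using z(1) by (rule path_component_of_subset[rotated]) auto
 moreover have "pc (rect a b c d Int U) u z"
  using z(2) by (rule path_component_of_subset[rotated]) (use o in \<open>auto simp: rect_def\<close>)
 ultimately show ?thesis using x'(4) path_component_trans path_component_sym by blast
qed

lemma lr_glue:
 assumes "lr a b c d U" "lr a' b' c d U" "tb a' b c d U" and o: "a <= a'" "a' <= b" "b <= b'"
 shows "lr a b' c d U"
proof -
 obtain x y where p: "pc (rect a b c d Int U) x y" "x $ 1 = a" "y $ 1 = b"
  using assms(1) by (auto simp: lr_def)
 obtain x' y' where p': "pc (rect a' b' c d Int U) x' y'" "x' $ 1 = a'" "y' $ 1 = b'"
  using assms(2) by (auto simp: lr_def)
 obtain u v where q: "pc (rect a' b c d Int U) u v" "u $ 2 = c" "v $ 2 = d"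
  using assms(3) by (auto simp: tb_def)
 let ?R = "rect a b' c d Int U"
 have "pc (rect a b c d Int U) x u" by (rule lr_tb_connected[OF p q]) (use o in auto)
 hence 1: "pc ?R x u" by (rule path_component_of_subset[rotated]) (use o in \<open>auto simp: rect_def\<close>)
 have "pc (rect a' b' c d Int U) x' u" by (rule lr_tb_connected[OF p' q]) (use o in auto)
 hence 2: "pc ?R x' u" by (rule path_component_of_subset[rotated]) (use o in \<open>auto simp: rect_def\<close>)
 have 3: "pc ?R x' y'" using p'(1) by (rule path_component_of_subset[rotated]) (use o in \<open>auto simp: rect_def\<close>)
 have "pc ?R x y'" using 1 2 3 path_component_trans path_component_sym by blast
 thus ?thesis unfolding lr_def using p(2) p'(3) by blast
qed

lemma lr_chain:
 assumes "!!j. j <= n ==> lr (x + real j * a) (x + real j * a + w) c d U"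
  and "!!j. j < n ==> tb (x + real (Suc j) * a) (x + real j * a + w) c d U"
  and "0 <= a" "a <= w"
 shows "lr x (x + real n * a + w) c d U"
 using assms
proof (induction n)
 case 0 thus ?case using 0(1)[of 0] by simp
next
 case (Suc n)
 have "lr x (x + real n * a + w) c d U" using Suc by auto
 moreover have "lr (x + real (Suc n) * a) (x + real (Suc n) * a + w) c d U" by (rule Suc.prems) simp
 moreover have "tb (x + real (Suc n) * a) (x + real n * a + w) c d U" by (rule Suc.prems) simp
 ultimately show ?case by (rule lr_glue) (use Suc.prems(3,4) in \<open>auto simp: algebra_simps\<close>)
qed

subsection \<open>Rings\<close>

text \<open>Long crossings of the four overlapping rectangles that form the annulus between the
  squares of half sides \<open>s\<close> and \<open>3 * s\<close>. They contain a circuit, and in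
  this form positive association bounds the probability from below.\<close>

definition ring :: "real => plane set => bool" where
 "ring s U \<longleftrightarrow> tb s (3 * s) (- 3 * s) (3 * s) U & tb (- 3 * s) (- s) (- 3 * s) (3 * s) U &
   lr (- 3 * s) (3 * s) s (3 * s) U & lr (- 3 * s) (3 * s) (- 3 * s) (- s) U"

lemma ring_mono: "ring s U ==> U <= W ==> ring s W"
 unfolding ring_def lr_joined tb_joined by (meson Int_mono joined_mono subset_refl)

text \<open>A path from inside to outside, cropped to the annulus, ends on one of the four outer
  sides. Cropped again to the rectangle along that side, it crosses it the short way and meets the
  long crossing there.\<close>

lemma ring_blocks:
 assumes ring: "ring s W" and s: "s > 0" and p: "pc U x y"
  and x: "max \<bar>x $ 1\<bar> \<bar>x $ 2\<bar> <= s" and y: "3 * s <= max \<bar>y $ 1\<bar> \<bar>y $ 2\<bar>"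
 shows "U Int W ~= {}"
proof -
 have ab: "s <= 3 * s" "- 3 * s <= - s" "- 3 * s <= 3 * s" using s by auto
 have "continuous_on UNIV (%z::plane. max \<bar>z $ 1\<bar> \<bar>z $ 2\<bar>)" by (intro continuous_intros)
 from crop[OF p this ab(1) x y] obtain x' y' where
  p': "pc (U Int {z. s <= max \<bar>z $ 1\<bar> \<bar>z $ 2\<bar> & max \<bar>z $ 1\<bar> \<bar>z $ 2\<bar> <= 3 * s}) x' y'"
  and x': "max \<bar>x' $ 1\<bar> \<bar>x' $ 2\<bar> = s" and y': "max \<bar>y' $ 1\<bar> \<bar>y' $ 2\<bar> = 3 * s" by blast
 let ?U = "U Int {z. s <= max \<bar>z $ 1\<bar> \<bar>z $ 2\<bar> & max \<bar>z $ 1\<bar> \<bar>z $ 2\<bar> <= 3 * s}"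
 have sub: "- 3 * s <= z $ 2 & z $ 2 <= 3 * s" "- 3 * s <= z $ 1 & z $ 1 <= 3 * s" if "z : ?U" for z
  using that by auto
 have x1: "x' $ 1 <= s" "- s <= x' $ 1" "x' $ 2 <= s" "- s <= x' $ 2" using x' by auto
 have p'': "pc ?U y' x'" using p' by (rule path_component_sym)
 have meet: "U Int W ~= {}" if "pc (rect a b c d Int ?U) v w" "pc (rect a' b' c' d' Int W) v' w" for a b c d a' b' c' d' v v' w
  using path_component_mem(2)[OF that(1)] path_component_mem(2)[OF that(2)] by auto
 consider "y' $ 1 = 3 * s" | "y' $ 1 = - 3 * s" | "y' $ 2 = 3 * s" | "y' $ 2 = - 3 * s"
  using y' by (auto simp: max_def abs_if split: if_splits)
 thus ?thesis
 proof cases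
  case 1
  obtain v w where f: "pc (rect s (3 * s) (- 3 * s) (3 * s) Int ?U) v w" "v $ 1 = s" "w $ 1 = 3 * s"
   using lr_crop[OF p' x1(1) _ ab(1) sub(1)] 1 by auto
  obtain v' w' where g: "pc (rect s (3 * s) (- 3 * s) (3 * s) Int W) v' w'" "v' $ 2 = - 3 * s" "w' $ 2 = 3 * s"
   using ring by (auto simp: ring_def tb_def)
  show ?thesis using cross_meet[OF f g] meet by blast
 next
  case 2
  obtain v w where f: "pc (rect (- 3 * s) (- s) (- 3 * s) (3 * s) Int ?U) v w" "v $ 1 = - 3 * s" "w $ 1 = - s"
   using lr_crop[OF p'' _ x1(2) ab(2) sub(1)] 2 by auto
  obtain v' w' where g: "pc (rect (- 3 * s) (- s) (- 3 * s) (3 * s) Int W) v' w'" "v' $ 2 = - 3 * s" "w' $ 2 = 3 * s"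
   using ring by (auto simp: ring_def tb_def)
  show ?thesis using cross_meet[OF f g] meet by blast
 next
  case 3
  obtain v w where f: "pc (rect (- 3 * s) (3 * s) s (3 * s) Int ?U) v w" "v $ 2 = s" "w $ 2 = 3 * s"
   using tb_crop[OF p' x1(3) _ ab(1) sub(2)] 3 by auto
  obtain v' w' where g: "pc (rect (- 3 * s) (3 * s) s (3 * s) Int W) v' w'" "v' $ 1 = - 3 * s" "w' $ 1 = 3 * s"
   using ring by (auto simp: ring_def lr_def)
  obtain z where "pc (rect (- 3 * s) (3 * s) s (3 * s) Int W) v' z" "pc (rect (- 3 * s) (3 * s) s (3 * s) Int ?U) v z"
   using cross_meet[OF g f] by blast
  thus ?thesis using meet by blast
 next
  case 4
  obtain v w where f: "pc (rect (- 3 * s) (3 * s) (- 3 * s) (- s) Int ?U) v w" "v $ 2 = - 3 * s" "w $ 2 = - s"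
   using tb_crop[OF p'' _ x1(4) ab(2) sub(2)] 4 by auto
  obtain v' w' where g: "pc (rect (- 3 * s) (3 * s) (- 3 * s) (- s) Int W) v' w'" "v' $ 1 = - 3 * s" "w' $ 1 = 3 * s"
   using ring by (auto simp: ring_def lr_def)
  obtain z where "pc (rect (- 3 * s) (3 * s) (- 3 * s) (- s) Int W) v' z" "pc (rect (- 3 * s) (3 * s) (- 3 * s) (- s) Int ?U) v z"
   using cross_meet[OF g f] by blast
  thus ?thesis using meet by blast
 qed
qed

text \<open>Four chosen paths carry the ring. Each horizontal one meets each vertical one in the
  large square, so the union is connected; compactness permits separating it from closed
  sets.\<close>

lemma ring_compact:
 assumes ring: "ring s W" and s: "s > 0"
 shows "EX P. compact P & connected P & P <= W & ring s P"
proof -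
 let ?R = "rect s (3 * s) (- 3 * s) (3 * s)" and ?L = "rect (- 3 * s) (- s) (- 3 * s) (3 * s)"
 let ?T = "rect (- 3 * s) (3 * s) s (3 * s)" and ?B = "rect (- 3 * s) (3 * s) (- 3 * s) (- s)"
 let ?Q = "rect (- 3 * s) (3 * s) (- 3 * s) (3 * s)"
 obtain r where r: "path r" "path_image r <= ?R Int W" "pathstart r $ 2 = - 3 * s" "pathfinish r $ 2 = 3 * s"
  using ring by (auto simp: ring_def tb_def path_component_def)
 obtain l where l: "path l" "path_image l <= ?L Int W" "pathstart l $ 2 = - 3 * s" "pathfinish l $ 2 = 3 * s"
  using ring by (auto simp: ring_def tb_def path_component_def)
 obtain t where t: "path t" "path_image t <= ?T Int W" "pathstart t $ 1 = - 3 * s" "pathfinish t $ 1 = 3 * s"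
  using ring by (auto simp: ring_def lr_def path_component_def)
 obtain b where b: "path b" "path_image b <= ?B Int W" "pathstart b $ 1 = - 3 * s" "pathfinish b $ 1 = 3 * s"
  using ring by (auto simp: ring_def lr_def path_component_def)
 have inQ: "?R <= ?Q" "?L <= ?Q" "?T <= ?Q" "?B <= ?Q" using s by (auto simp: rect_def)
 have x: "path_image h Int path_image v ~= {}" if hv: "path h" "path_image h <= ?Q" "pathstart h $ 1 = - 3 * s" "pathfinish h $ 1 = 3 * s"
  "path v" "path_image v <= ?Q" "pathstart v $ 2 = - 3 * s" "pathfinish v $ 2 = 3 * s" for h v
 proof -
  obtain z where "z : path_image h" "z : path_image v"
   by (rule fashoda[of h v "vector [- 3 * s, - 3 * s]" "vector [3 * s, 3 * s]"]) (use hv in \<open>simp_all add: rect_cbox\<close>)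
  thus ?thesis by blast
 qed
 define P where "P = ((path_image r Un path_image t) Un path_image l) Un path_image b"
 have "compact P" unfolding P_def using r l t b by (intro compact_Un compact_path_image)
 moreover have "connected P"
  unfolding P_def
 proof (intro connected_Un)
  have "path_image t Int path_image r ~= {}" by (rule x) (use r t inQ in auto)
  thus "path_image r Int path_image t ~= {}" by blast
  have "path_image t Int path_image l ~= {}" by (rule x) (use l t inQ in auto)
  thus "(path_image r Un path_image t) Int path_image l ~= {}" by blast
  have "path_image b Int path_image l ~= {}" by (rule x) (use l b inQ in auto)
  thus "(path_image r Un path_image t Un path_image l) Int path_image b ~= {}" by blast
 qed (use r l t b in \<open>auto intro: connected_path_image\<close>)
 moreover have "P <= W" unfolding P_def using r l t b by blast
 moreover have "ring s P"
  unfolding ring_def tb_def lr_def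
 proof (intro conjI exI)
  have pc: "pc (Z Int P) (pathstart g) (pathfinish g)" if "path g" "path_image g <= Z Int W" "path_image g <= P" for g Z
   using that unfolding path_component_def by (intro exI[of _ g]) auto
  show "pc (?R Int P) (pathstart r) (pathfinish r)" by (rule pc[OF r(1,2)]) (auto simp: P_def)
  show "pc (?L Int P) (pathstart l) (pathfinish l)" by (rule pc[OF l(1,2)]) (auto simp: P_def)
  show "pc (?T Int P) (pathstart t) (pathfinish t)" by (rule pc[OF t(1,2)]) (auto simp: P_def)
  show "pc (?B Int P) (pathstart b) (pathfinish b)" by (rule pc[OF b(1,2)]) (auto simp: P_def)
 qed (use r l t b in auto)
 ultimately show ?thesis by blast
qed

text \<open>Components of closed sets need not be path connected. If \<open>C\<close> missed
  \<open>P\<close> it would have positive distance \<open>d\<close> from it, and the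
  \<open>d\<close>-neighbourhood of \<open>C\<close>, open and connected and so path connected,
  would contain a path that \<open>ring_blocks\<close> excludes.\<close>

lemma connected_meets_ring:
 assumes P: "compact P" "ring s P" and s: "s > 0" and C: "connected C" "closed C"
  and x: "x : C" "max \<bar>x $ 1\<bar> \<bar>x $ 2\<bar> <= s" and y: "y : C" "3 * s <= max \<bar>y $ 1\<bar> \<bar>y $ 2\<bar>"
 shows "C Int P ~= {}"
proof
 assume "C Int P = {}"
 hence "P Int C = {}" by blast
 then obtain d where d: "d > 0" "!!u v. u : P ==> v : C ==> d <= dist u v"
  using separate_compact_closed[OF P(1) C(2)] by blast
 define N where "N = (\<Union>c\<in>C. C Un ball c d)"
 have "connected N" unfolding N_def
 proof (rule connected_Union)
  fix S assume "S : (%c. C Un ball c d) ` C"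
  then obtain c where c: "c : C" "S = C Un ball c d" by blast
  have "c : C Int ball c d" using c d by simp
  thus "connected S" unfolding c(2) by (intro connected_Un C connected_ball) blast
 qed (use x in blast)
 moreover have "N = (\<Union>c\<in>C. ball c d)" unfolding N_def using d by force
 hence "open N" by auto
 ultimately have "path_connected N" using connected_open_path_connected by blast
 moreover have "x : N" "y : N" unfolding N_def using x y by blast+
 ultimately have "pc N x y" unfolding path_connected_component by blast
 from ring_blocks[OF P(2) s this x(2) y(2)] obtain z where z: "z : N" "z : P" by blast
 then obtain c where "c : C" "dist c z < d" using `N = (\<Union>c\<in>C. ball c d)` by auto
 thus False using d(2)[OF z(2), of c] by (simp add: dist_commute)
qed

subsection \<open>The two gluing constructions of Tassion\<close>

lemma path_component_continuous_image:
 assumes "pc S x y" "continuous_on UNIV T"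
 shows "pc (T ` S) (T x) (T y)"
proof -
 obtain g where g: "path g" "path_image g <= S" "pathstart g = x" "pathfinish g = y"
  using assms(1) by (auto simp: path_component_def)
 have "path (T \<circ> g)" by (rule path_continuous_image[OF g(1)]) (rule continuous_on_subset[OF assms(2)], simp)
 thus ?thesis unfolding path_component_def
  by (intro exI[of _ "T \<circ> g"]) (use g in \<open>auto simp: path_image_compose pathstart_compose pathfinish_compose\<close>)
qed

lemma continuous_on_reflect: "continuous_on S (%z::plane. vector [- (z $ 1), z $ 2] :: plane)"
 by (intro continuous_on_plane_vector continuous_intros)

lemma hook_meet_left:
 assumes f: "pc (rect a b c d Int U) x y" "x $ 1 = b" "y $ 1 = a"
  and g: "pc (rect a b c d Int W) u v" "u $ 1 = a" "v $ 1 = a" and o: "u $ 2 <= y $ 2" "y $ 2 <= v $ 2"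
 shows "EX z. pc (rect a b c d Int U) x z & pc (rect a b c d Int W) u z"
proof -
 define T where "T z = (vector [- (z $ 1), z $ 2] :: plane)" for z :: plane
 have T: "continuous_on UNIV T" unfolding T_def[abs_def] by (rule continuous_on_reflect)
 have TT: "T (T z) = z" for z by (rule plane_eqI) (simp_all add: T_def)
 have im: "T ` (rect a b c d Int V) = rect (- b) (- a) c d Int T ` V" for V
 proof
  show "T ` (rect a b c d Int V) <= rect (- b) (- a) c d Int T ` V" by (auto simp: rect_def T_def)
  show "rect (- b) (- a) c d Int T ` V <= T ` (rect a b c d Int V)" by (auto simp: rect_def T_def intro!: image_eqI)
 qed
 note f' = path_component_continuous_image[OF f(1) T, unfolded im]
 note g' = path_component_continuous_image[OF g(1) T, unfolded im]
 obtain z where z: "pc (rect (- b) (- a) c d Int T ` U) (T x) z" "pc (rect (- b) (- a) c d Int T ` W) (T u) z"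
  using hook_meet[OF f' _ _ g'] f g o by (auto simp: T_def)
 have im': "T ` (rect (- b) (- a) c d Int T ` V) = rect a b c d Int V" for V
  unfolding im[symmetric] by (simp add: image_image TT)
 from path_component_continuous_image[OF z(1) T, unfolded im'] path_component_continuous_image[OF z(2) T, unfolded im']
 show ?thesis by (auto simp: TT)
qed

definition lr_from :: "real => real => real => real => real => real => plane set => bool" where
 "lr_from a b c d e f U \<longleftrightarrow> joined (rect a b c d) (rect a a e f) (rect b b c d) U"

definition lr_to :: "real => real => real => real => real => real => plane set => bool" where
 "lr_to a b c d e f U \<longleftrightarrow> joined (rect a b c d) (rect a a c d) (rect b b e f) U"

text \<open>Two squares of side \<open>2 * h\<close>, shifted by \<open>2 * h / 3\<close>, overlap
  in a strip of width \<open>2 * k\<close>. In it a square of half side \<open>k\<close> centred at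
  height \<open>a / 2\<close> carries crossings with ends above \<open>a / 2 + a'\<close> and below
  \<open>a / 2 - a'\<close> on both sides, tied together by \<open>t\<close>. Since
  \<open>a <= 2 * a'\<close>, these ends surround the heights from 0 to \<open>a\<close>, so the
  crossing of each large square is caught by \<open>hook_meet\<close> or its mirror image.\<close>

lemma tassion_extend:
 fixes h k a a' :: real
 assumes k: "k = 2 * h / 3" "h > 0" and a: "0 <= a" "a <= 2 * a'" "a / 2 + k <= h"
  and 1: "lr_to (- h) h (- h) h 0 a U" and 2: "lr_from (- h / 3) (5 * h / 3) (- h) h 0 a U"
  and ru: "lr_to (- h / 3) h (a / 2 - k) (a / 2 + k) (a / 2 + a') (a / 2 + k) U"
  and rd: "lr_to (- h / 3) h (a / 2 - k) (a / 2 + k) (a / 2 - k) (a / 2 - a') U"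
  and lu: "lr_from (- h / 3) h (a / 2 - k) (a / 2 + k) (a / 2 + a') (a / 2 + k) U"
  and ld: "lr_from (- h / 3) h (a / 2 - k) (a / 2 + k) (a / 2 - k) (a / 2 - a') U"
  and t: "tb (- h / 3) h (a / 2 - k) (a / 2 + k) U"
 shows "lr (- h) (5 * h / 3) (- h) h U"
proof -
 let ?S = "rect (- h / 3) h (a / 2 - k) (a / 2 + k)"
 obtain u v where q: "pc (?S Int U) u v" "u $ 2 = a / 2 - k" "v $ 2 = a / 2 + k"
  using t by (auto simp: tb_def)
 have tie: "pc (?S Int U) x u" if "pc (?S Int U) x y" "x $ 1 = - h / 3" "y $ 1 = h" for x y
  by (rule lr_tb_connected[OF that q]) (use k in auto)
 obtain x1 y1 where p1: "pc (?S Int U) x1 y1" "x1 $ 1 = - h / 3" "y1 $ 1 = h" "a / 2 + a' <= y1 $ 2"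
  using ru by (auto simp: lr_to_def joined_def rect_def)
 obtain x2 y2 where p2: "pc (?S Int U) x2 y2" "x2 $ 1 = - h / 3" "y2 $ 1 = h" "y2 $ 2 <= a / 2 - a'"
  using rd by (auto simp: lr_to_def joined_def rect_def)
 obtain x3 y3 where p3: "pc (?S Int U) x3 y3" "x3 $ 1 = - h / 3" "y3 $ 1 = h" "a / 2 + a' <= x3 $ 2"
  using lu by (auto simp: lr_from_def joined_def rect_def)
 obtain x4 y4 where p4: "pc (?S Int U) x4 y4" "x4 $ 1 = - h / 3" "y4 $ 1 = h" "x4 $ 2 <= a / 2 - a'"
  using ld by (auto simp: lr_from_def joined_def rect_def)
 note c = tie[OF p1(1-3)] tie[OF p2(1-3)] tie[OF p3(1-3)] tie[OF p4(1-3)]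
 note tr = path_component_trans and sy = path_component_sym
 have y21: "pc (?S Int U) y2 y1" using c p1(1) p2(1) by (meson tr sy)
 have x43: "pc (?S Int U) x4 x3" using c by (meson tr sy)
 have y2x4: "pc (?S Int U) y2 x4" using c p2(1) by (meson tr sy)
 have S1: "?S <= rect (- h) h (- h) h" and S2: "?S <= rect (- h / 3) (5 * h / 3) (- h) h"
  using k a by (auto simp: rect_def)
 obtain x y where p: "pc (rect (- h) h (- h) h Int U) x y" "x $ 1 = - h" "y $ 1 = h" "0 <= y $ 2" "y $ 2 <= a"
  using 1 by (auto simp: lr_to_def joined_def rect_def)
 obtain x' y' where p': "pc (rect (- h / 3) (5 * h / 3) (- h) h Int U) x' y'" "x' $ 1 = - h / 3" "y' $ 1 = 5 * h / 3" "0 <= x' $ 2" "x' $ 2 <= a"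
  using 2 by (auto simp: lr_from_def joined_def rect_def)
 have y21': "pc (rect (- h) h (- h) h Int U) y2 y1" using y21 by (rule path_component_of_subset[rotated]) (use S1 in auto)
 have x43': "pc (rect (- h / 3) (5 * h / 3) (- h) h Int U) x4 x3" using x43 by (rule path_component_of_subset[rotated]) (use S2 in auto)
 obtain z where z: "pc (rect (- h) h (- h) h Int U) x z" "pc (rect (- h) h (- h) h Int U) y2 z"
  using hook_meet[OF p(1-3) y21' p2(3) p1(3)] p p1 p2 a by auto
 obtain z' where z': "pc (rect (- h / 3) (5 * h / 3) (- h) h Int U) y' z'" "pc (rect (- h / 3) (5 * h / 3) (- h) h Int U) x4 z'"
  using hook_meet_left[OF path_component_sym[OF p'(1)] p'(3,2) x43' p4(2) p3(2)] p' p3 p4 a by auto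
 let ?B = "rect (- h) (5 * h / 3) (- h) h Int U"
 have B: "rect (- h) h (- h) h Int U <= ?B" "rect (- h / 3) (5 * h / 3) (- h) h Int U <= ?B" "?S Int U <= ?B"
  using k a by (auto simp: rect_def)
 note b = path_component_of_subset[OF B(1) z(1)] path_component_of_subset[OF B(1) z(2)]
  path_component_of_subset[OF B(3) y2x4] path_component_of_subset[OF B(2) z'(2)] path_component_of_subset[OF B(2) z'(1)]
 have "pc ?B x y'" using b by (meson tr sy)
 thus ?thesis unfolding lr_def using p(2) p'(3) by blast
qed

text \<open>In each square the two crossings, tied by the vertical one, join a low to a high point
  of the left side. For consecutive squares, shifted by \<open>h\<close>, these endpoints interlace,
  so \<open>interlace_meet\<close> links the connections into one tall path.\<close>

lemma tassion_stack:
 fixes h :: real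
 assumes h: "h > 0"
  and u: "!!j. j <= n ==> lr_from (- h) h (real j * h - h) (real j * h + h) (real j * h + h / 2) (real j * h + h) U"
  and d: "!!j. j <= n ==> lr_from (- h) h (real j * h - h) (real j * h + h) (real j * h - h) (real j * h - h / 2) U"
  and t: "!!j. j <= n ==> tb (- h) h (real j * h - h) (real j * h + h) U"
 shows "tb (- h) h (- h / 2) (real n * h + h / 2) U"
proof -
 define W where "W = {z::plane. - h <= z $ 1 & z $ 1 <= h} Int U"
 have ex: "EX p q. pc (rect (- h) h (real j * h - h) (real j * h + h) Int U) p q & p $ 1 = - h & q $ 1 = - h &
   p $ 2 <= real j * h - h / 2 & real j * h + h / 2 <= q $ 2" if j: "j <= n" for j
 proof -
  let ?S = "rect (- h) h (real j * h - h) (real j * h + h)"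
  obtain w v where q: "pc (?S Int U) w v" "w $ 2 = real j * h - h" "v $ 2 = real j * h + h"
   using t[OF j] by (auto simp: tb_def)
  obtain x y where p: "pc (?S Int U) x y" "x $ 1 = - h" "y $ 1 = h" "real j * h + h / 2 <= x $ 2"
   using u[OF j] by (auto simp: lr_from_def joined_def rect_def)
  obtain x' y' where p': "pc (?S Int U) x' y'" "x' $ 1 = - h" "y' $ 1 = h" "x' $ 2 <= real j * h - h / 2"
   using d[OF j] by (auto simp: lr_from_def joined_def rect_def)
  have "pc (?S Int U) x w" "pc (?S Int U) x' w"
   by (rule lr_tb_connected[OF p(1-3) q]; use h in simp) (rule lr_tb_connected[OF p'(1-3) q]; use h in simp)
  hence "pc (?S Int U) x' x" by (meson path_component_sym path_component_trans)
  thus ?thesis using p p' by blast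
 qed
 have "EX p q. pc W p q & p $ 2 <= - h / 2 & q $ 1 = - h & real j * h + h / 2 <= q $ 2 &
   (EX p'. pc (rect (- h) h (real j * h - h) (real j * h + h) Int U) p' q & p' $ 1 = - h & p' $ 2 <= real j * h - h / 2)"
  if "j <= n" for j
  using that
 proof (induction j)
  case 0
  obtain p q where pq: "pc (rect (- h) h (real 0 * h - h) (real 0 * h + h) Int U) p q" "p $ 1 = - h" "q $ 1 = - h"
   "p $ 2 <= real 0 * h - h / 2" "real 0 * h + h / 2 <= q $ 2" using ex[of 0] by blast
  have "pc W p q" using pq(1) by (rule path_component_of_subset[rotated]) (auto simp: W_def rect_def)
  thus ?case using pq by (intro exI[of _ p] exI[of _ q]) auto
 next
  case (Suc j)
  then obtain p q p' where 1: "pc W p q" "p $ 2 <= - h / 2" "q $ 1 = - h" "real j * h + h / 2 <= q $ 2"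
   "pc (rect (- h) h (real j * h - h) (real j * h + h) Int U) p' q" "p' $ 1 = - h" "p' $ 2 <= real j * h - h / 2" by auto
  let ?S = "rect (- h) h (real (Suc j) * h - h) (real (Suc j) * h + h)"
  obtain u v where 2: "pc (?S Int U) u v" "u $ 1 = - h" "v $ 1 = - h"
   "u $ 2 <= real (Suc j) * h - h / 2" "real (Suc j) * h + h / 2 <= v $ 2" using ex[OF Suc.prems] by blast
  have uS: "u : ?S" and qS: "q : rect (- h) h (real j * h - h) (real j * h + h)"
   using path_component_mem(1)[OF 2(1)] path_component_mem(2)[OF 1(5)] by auto
  have o1: "p' $ 2 <= u $ 2" using 1(7) uS h by (simp add: rect_def algebra_simps)
  have o2: "u $ 2 <= q $ 2" using 1(4) 2(4) by (simp add: algebra_simps)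
  have o3: "q $ 2 <= v $ 2" using 2(5) qS h by (simp add: rect_def algebra_simps)
  have le1: "!!z. z : rect (- h) h (real j * h - h) (real j * h + h) Int U ==> - h <= z $ 1"
   and le2: "!!z. z : ?S Int U ==> - h <= z $ 1" by (simp_all add: rect_def)
  obtain z where z: "pc (rect (- h) h (real j * h - h) (real j * h + h) Int U) p' z" "pc (?S Int U) u z"
   using interlace_meet[OF 1(5) 2(1) 1(6) 1(3) 2(2,3) le1 le2 o1 o2 o3] by blast
  have sub: "rect (- h) h (real j * h - h) (real j * h + h) Int U <= W" "?S Int U <= W" by (auto simp: W_def rect_def)
  note w = path_component_of_subset[OF sub(1) 1(5)] path_component_of_subset[OF sub(1) z(1)]
   path_component_of_subset[OF sub(2) z(2)] path_component_of_subset[OF sub(2) 2(1)]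
  have "pc W p v" using w 1(1) by (meson path_component_sym path_component_trans)
  thus ?case using 1(2) 2 by blast
 qed
 then obtain p q where pq: "pc W p q" "p $ 2 <= - h / 2" "real n * h + h / 2 <= q $ 2" by blast
 have "- h / 2 <= real n * h + h / 2" using h by (simp add: add_nonneg_nonneg)
 from tb_crop[OF pq(1,2,3) this, of "- h" h] obtain x' y' where
  "pc (rect (- h) h (- h / 2) (real n * h + h / 2) Int W) x' y'" "x' $ 2 = - h / 2" "y' $ 2 = real n * h + h / 2"
  by (auto simp: W_def)
 thus ?thesis unfolding tb_def
  by (intro exI[of _ x'] exI[of _ y'] conjI) (erule path_component_of_subset[rotated], auto simp: W_def)
qed

subsection \<open>Superconcentration\<close>

context gaussian_process
begin

text \<open>The Ornstein-Uhlenbeck operator with correlation \<open>p\<close>, applied to the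
  indicator of \<open>A\<close>: the second copy is integrated out.\<close>

definition smooth :: "'i set => ('i => real) set => real => 'w => real" where
 "smooth S A p x = (LINT y|M. indicator A (comb S p (sqrt (1 - p^2)) (x, y)))"

lemma smooth_unit: "0 <= smooth S A p x" "\<bar>smooth S A p x\<bar> <= 1"
proof -
 show 0: "0 <= smooth S A p x" unfolding smooth_def by (intro integral_nonneg_AE) auto
 have "\<bar>smooth S A p x\<bar> <= (LINT y|M. \<bar>indicator A (comb S p (sqrt (1 - p^2)) (x, y))\<bar>)"
  unfolding smooth_def by (rule integral_abs_bound)
 also have "... <= (LINT y|M. 1)" by (intro integral_mono_AE') auto
 finally show "\<bar>smooth S A p x\<bar> <= 1" by (simp add: prob_space)
qed

lemma smooth_measurable [measurable]:
 assumes [measurable]: "A : sets (vecs S)"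
 shows "smooth S A p : bm M"
 unfolding smooth_def by measurable

text \<open>By \<open>triple_law\<close>, correlation \<open>p^2\<close> arises from two
  conditionally independent copies. Hence noise stability is a positive semidefinite form in the two
  sets.\<close>

lemma noise_square:
 assumes S: "finite S" and A[measurable]: "A : sets (vecs S)" "B : sets (vecs S)" and p: "0 <= p" "p <= 1"
 shows "noise S A B (p^2) = (LINT x|M. smooth S A p x * smooth S B p x)"
proof -
 interpret P2: pair_prob_space M M by unfold_locales
 interpret P3: pair_prob_space M "M \<Otimes>\<^sub>M M" by unfold_locales
 define q t where "q = sqrt (1 - p^2)" and "t = sqrt (1 - (p^2)^2)"
 have pp: "p^2 <= 1" "(p^2)^2 <= 1" using p by (auto intro!: power_le_one)
 have q: "p^2 + q^2 = 1" "(p^2)^2 + t^2 = 1" using pp by (simp_all add: q_def t_def)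
 define H where "H x y = indicat_real A x * indicat_real B y" for x y
 have H: "(%(x, y). H x y) : bm (vecs S \<Otimes>\<^sub>M vecs S)"
  unfolding H_def by measurable
 have "noise S A B (p^2) = (LINT w|M2. H (\<lambda>s\<in>S. X s (fst w)) (\<lambda>s\<in>S. p^2 * X s (fst w) + t * X s (snd w)))"
  by (simp add: noise_def comb_def H_def t_def)
 also have "... = (LINT w|(M \<Otimes>\<^sub>M M2). H (comb S p q (fst w, fst (snd w))) (comb S p q (fst w, snd (snd w))))"
  using triple_law[OF S q refl H] by (simp add: comb_def)
 also have "... = (\<integral>x. \<integral>z. H (comb S p q (x, fst z)) (comb S p q (x, snd z)) \<partial>M2 \<partial>M)"
 proof (subst P3.integral_fst'[symmetric])
  show "integrable (M \<Otimes>\<^sub>M M2) (%w. H (comb S p q (fst w, fst (snd w))) (comb S p q (fst w, snd (snd w))))"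
   by (rule P3.P.integrable_unit[of _ 1]) (auto simp: H_def indicator_def)
 qed simp
 also have "... = (LINT x|M. smooth S A p x * smooth S B p x)"
 proof (rule Bochner_Integration.integral_cong[OF refl])
  fix x assume x: "x : space M"
  have m: "(%y. indicat_real A (comb S p q (x, y))) : bm M" "(%y. indicat_real B (comb S p q (x, y))) : bm M"
   using x by measurable
  show "(LINT z|M2. H (comb S p q (x, fst z)) (comb S p q (x, snd z))) = smooth S A p x * smooth S B p x"
   unfolding H_def smooth_def q_def[symmetric] by (rule pair_expectation_mult(2)[OF prob_space_axioms prob_space_axioms])
    (rule integrable_unit[OF m(1), of 1], simp add: indicator_def, rule integrable_unit[OF m(2), of 1], simp add: indicator_def)
 qed
 finally show ?thesis .
qed

lemma noise_le:
 assumes S: "finite S" and A[measurable]: "A : sets (vecs S)" "B : sets (vecs S)" and r: "0 <= r" "r <= 1"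
 shows "noise S A B r <= (noise S A A r + noise S B B r) / 2"
proof -
 let ?u = "smooth S A (sqrt r)" and ?v = "smooth S B (sqrt r)"
 have i: "integrable M (%x. smooth S C (sqrt r) x * smooth S D (sqrt r) x)"
  if [measurable]: "C : sets (vecs S)" "D : sets (vecs S)" for C D
  by (rule integrable_unit[of _ "1 * 1"]) (measurable, unfold abs_mult, intro mult_mono smooth_unit, auto)
 have n: "noise S C D r = (LINT x|M. smooth S C (sqrt r) x * smooth S D (sqrt r) x)"
  if "C : sets (vecs S)" "D : sets (vecs S)" for C D
  using noise_square[OF S that, of "sqrt r"] r by simp
 have "(LINT x|M. ?u x * ?v x) <= (LINT x|M. (?u x * ?u x + ?v x * ?v x) / 2)"
 proof (rule integral_mono)
  show "?u x * ?v x <= (?u x * ?u x + ?v x * ?v x) / 2" for x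
   using sum_squares_bound[of "?u x" "?v x"] by (simp add: power2_eq_square)
 qed (use i A in auto)
 thus ?thesis unfolding n[OF A] n[OF A(1) A(1)] n[OF A(2) A(2)] using i A by simp
qed

text \<open>Cauchy-Schwarz for the indicator and its smoothed version. It transfers a bound at
  correlation \<open>p^2\<close> to the larger correlation \<open>p\<close>.\<close>

lemma noise_root:
 assumes S: "finite S" and A[measurable]: "A : sets (vecs S)" and p: "0 <= p" "p <= 1"
 shows "(noise S A A p)^2 <= (LINT w|M. indicator A (\<lambda>s\<in>S. X s w)) * noise S A A (p^2)"
  and "0 <= noise S A A p"
proof -
 interpret P2: pair_prob_space M M by unfold_locales
 let ?u = "smooth S A p" and ?i = "%x. indicat_real A (\<lambda>s\<in>S. X s x)"
 define a where "a = (LINT x|M. ?i x)"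
 define b where "b = noise S A A p"
 define c where "c = noise S A A (p^2)"
 have im: "?i : bm M" by measurable
 have b: "b = (LINT x|M. ?i x * ?u x)"
 proof -
  have "b = (LINT w|M2. ?i (fst w) * indicat_real A (comb S p (sqrt (1 - p^2)) (fst w, snd w)))"
   by (simp add: b_def noise_def comb_def)
  also have "... = (\<integral>x. \<integral>y. ?i x * indicat_real A (comb S p (sqrt (1 - p^2)) (x, y)) \<partial>M \<partial>M)"
  proof (subst P2.integral_fst'[symmetric])
   show "integrable M2 (%w. ?i (fst w) * indicat_real A (comb S p (sqrt (1 - p^2)) (fst w, snd w)))"
    by (rule P2.P.integrable_unit[of _ 1]) (auto simp: indicator_def)
  qed simp
  also have "... = (LINT x|M. ?i x * ?u x)" unfolding smooth_def by simp
  finally show ?thesis .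
 qed
 show b0: "0 <= noise S A A p" unfolding b_def[symmetric] b
  by (intro integral_nonneg_AE AE_I2 mult_nonneg_nonneg smooth_unit) auto
 have c: "c = (LINT x|M. ?u x * ?u x)" unfolding c_def by (rule noise_square[OF S A A p])
 have ii: "integrable M ?i" by (rule integrable_unit[of _ 1]) (auto simp: indicator_def)
 have iu: "integrable M (%x. ?i x * ?u x)" "integrable M (%x. ?u x * ?u x)"
 proof -
  have "\<bar>?i x * ?u x\<bar> <= 1 * 1" "\<bar>?u x * ?u x\<bar> <= 1 * 1" for x
   unfolding abs_mult by (intro mult_mono smooth_unit; simp add: indicator_def)+
  thus "integrable M (%x. ?i x * ?u x)" "integrable M (%x. ?u x * ?u x)" by (auto intro!: integrable_unit[of _ "1 * 1"])
 qed
 have "2 * t * b <= t^2 * a + c" for t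
 proof -
  have "(LINT x|M. 2 * t * (?i x * ?u x)) <= (LINT x|M. t^2 * ?i x + ?u x * ?u x)"
  proof (rule integral_mono)
   show "2 * t * (?i x * ?u x) <= t^2 * ?i x + ?u x * ?u x" for x
    using sum_squares_bound[of t "?u x"] by (auto simp: indicator_def power2_eq_square)
  qed (use ii iu in auto)
  thus ?thesis using ii iu by (simp add: a_def b c)
 qed
 note q = this
 have a0: "0 <= a" unfolding a_def by (intro integral_nonneg_AE) auto
 have ba: "b <= a" unfolding b a_def
 proof (rule integral_mono[OF iu(1) ii])
  show "?i x * ?u x <= ?i x" for x using smooth_unit(2)[of S A p x] by (auto simp: indicator_def)
 qed
 have "b^2 <= a * c"
 proof (cases "a = 0")
  case True thus ?thesis using ba b0 by (simp add: b_def)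
 next
  case False
  hence "a > 0" using a0 by simp
  \<comment> \<open>\<open>t = b / a\<close> is the optimal choice in the quadratic bound
    \<open>q\<close>.\<close>
  have "2 * (b / a) * b <= (b / a)^2 * a + c" by (rule q)
  hence "b^2 / a <= c" using `a > 0` by (simp add: power2_eq_square field_simps)
  thus ?thesis using `a > 0` by (simp add: field_simps)
 qed
 thus "(noise S A A p)^2 <= (LINT w|M. indicator A (\<lambda>s\<in>S. X s w)) * noise S A A (p^2)" by (simp add: a_def b_def c_def)
qed

text \<open>Every application of \<open>noise_root\<close> squares the correlation to be treated and
  halves the gain in the exponent. After \<open>k\<close> of them the correlation is in the
  hypercontractive range, where the gain is 1/4.\<close>

lemma noise_iterate:
 assumes S: "finite S" and A: "A : sets (vecs S)" and p: "0 <= p" "p <= 1" "3 * (p ^ (2 ^ k))^2 <= 1"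
 shows "noise S A A p <= (LINT w|M. indicator A (\<lambda>s\<in>S. X s w)) powr (1 + 1 / 4 / 2 ^ k)"
 using p
proof (induction k arbitrary: p)
 case 0 thus ?case using noise_small[OF S A, of p] by (simp add: restrict_def)
next
 case (Suc k)
 let ?a = "\<integral>w. indicat_real A (\<lambda>s\<in>S. X s w) \<partial>M"
 have a0: "0 <= ?a" by (intro integral_nonneg_AE) auto
 have "(p^2) ^ (2 ^ k) = p ^ (2 ^ Suc k)" by (simp add: power_mult[symmetric])
 hence "noise S A A (p^2) <= ?a powr (1 + 1 / 4 / 2 ^ k)"
  using Suc.prems by (intro Suc.IH) (auto intro: power_le_one)
 hence "?a * noise S A A (p^2) <= ?a * ?a powr (1 + 1 / 4 / 2 ^ k)" using a0 by (rule mult_left_mono)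
 with noise_root(1)[OF S A Suc.prems(1,2)] have "(noise S A A p)^2 <= ?a * ?a powr (1 + 1 / 4 / 2 ^ k)" by linarith
 also have "... = (?a powr (1 + 1 / 4 / 2 ^ Suc k))^2"
 proof -
  have e: "1 + (1 + 1 / 4 / 2 ^ k :: real) = (1 + 1 / 4 / 2 ^ Suc k) + (1 + 1 / 4 / 2 ^ Suc k)" by (simp add: field_simps)
  have 1: "?a * ?a powr (1 + 1 / 4 / 2 ^ k) = ?a powr ((1 + 1 / 4 / 2 ^ Suc k) + (1 + 1 / 4 / 2 ^ Suc k))"
   unfolding e[symmetric] by (rule powr_mult_base[OF a0])
  show ?thesis unfolding 1 power2_eq_square by (rule powr_add)
 qed
 finally show ?case by (rule power2_le_imp_le) simp
qed

end

context nondegenerate_gaussian_process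
begin

text \<open>The variance is \<open>pi / 2 * (sin l * I)\<close>, where \<open>I\<close> is the mean
  kernel value between the sites selected by two copies at an angle \<open>l\<close> that is not
  controlled. Below \<open>l0\<close> the factor \<open>sin l\<close> is small and
  \<open>I <= 1\<close>; above \<open>l0\<close> noise stability makes it unlikely that the copies
  select given nearby cells, as no cell is selected with probability above \<open>r\<close>.\<close>

lemma clip_variance:
 assumes L: "selector S L" "a < b" and J: "finite J" "!!s. s : S ==> \<pi> s : J"
  and K: "!!s t. s : S ==> t : S ==> K s t <= w (\<pi> s) (\<pi> t)" "!!s t. s : S ==> t : S ==> K s t <= 1"
  and w: "!!i j. 0 <= w i j" "!!i j. w i j = w j i" "!!i. i : J ==> (\<Sum>j\<in>J. w i j) <= W"
  and small: "!!i. i : J ==> prob {v\<in>space M. a < L (%s. X s v) & L (%s. X s v) < b & (EX s:S. \<pi> s = i & X s v = L (%s. X s v))} <= r"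
  and l0: "0 < l0" "l0 < pi / 2" "3 * ((cos l0) ^ (2 ^ k))^2 <= 1" and W: "0 <= W"
 shows "(LINT v|M. (clip a b L (%s. X s v))^2) - (LINT v|M. clip a b L (%s. X s v))^2 <= pi / 2 * (sin l0 + W * r powr (1 / 4 / 2 ^ k))"
proof -
 interpret MM: prob_space "M \<Otimes>\<^sub>M M" by (rule prob_space_pair)
 have S: "finite S" using L by (auto simp: selector_def)
 note mL[measurable] = selector_measurable[OF L(1) subset_refl]
 obtain l where l: "0 < l" "l < pi / 2" and e: "(LINT v|M. clip a b L (%s. X s v) * clip a b L (%s. X s v))
   - (LINT v|M. clip a b L (%s. X s v)) * (LINT v|M. clip a b L (%s. X s v))
   = pi / 2 * (sin l * (LINT v|M2. (\<Sum>s\<in>S. \<Sum>t\<in>S. K s t * (clipD S a b L (comb S (cos l) (- sin l) v) s * clipD S a b L (comb S 1 0 v) t))))"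
  using clip_covariance[OF L L] unfolding Un_absorb by blast
 let ?D = "clipD S a b L"
 let ?x = "%v. comb S (cos l) (- sin l) v" and ?y = "%v. comb S 1 0 v"
 let ?f = "%v. \<Sum>s\<in>S. \<Sum>t\<in>S. K s t * (?D (?x v) s * ?D (?y v) t)"
 define I where "I = (LINT v|M2. ?f v)"
 have fi: "integrable M2 ?f"
  using clipD_product_integrable[OF L L] by (intro Bochner_Integration.integrable_sum integrable_mult_right) simp
 have gen: "AE v in M \<Otimes>\<^sub>M M. inj_on (?x v) S" "AE v in M \<Otimes>\<^sub>M M. inj_on (?y v) S"
  using AE_comb_generic[OF S finite.emptyI, of "cos l" "- sin l", simplified] AE_comb_generic[OF S finite.emptyI, of 1 0, simplified] by auto
 have D01: "0 <= ?D x s" for x s by (simp add: clipD_def)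
 \<comment> \<open>\<open>A i\<close> is the event that the selected site lies in cell
   \<open>i\<close>. At generic points its indicator is the sum of \<open>clipD\<close> over the
   cell, which turns the double sum over sites into one over cells.\<close>
 define A where "A i = {x\<in>space (vecs S). a < L x & L x < b & (EX s:S. \<pi> s = i & x s = L x)}" for i
 have A[measurable]: "A i : sets (vecs S)" for i
 proof -
  have "A i = (\<Union>s\<in>{s\<in>S. \<pi> s = i}. {x\<in>space (vecs S). a < L x & L x < b & x s = L x})"
   by (auto simp: A_def)
  also have "... : sets (vecs S)"
  proof (intro sets.finite_UN)
   fix s assume "s : {s : S. \<pi> s = i}"
   hence [measurable]: "(%x. x s) : bm (vecs S)" by simp
   have [measurable]: "Measurable.pred (vecs S) (%x. x s = L x)" unfolding pred_def by (rule borel_measurable_eq) fact+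
   show "{x\<in>space (vecs S). a < L x & L x < b & x s = L x} : sets (vecs S)" by measurable
  qed (use S in auto)
  finally show ?thesis .
 qed
 have indA: "(\<Sum>s | s : S & \<pi> s = i. ?D x s) = indicator (A i) x" if x: "inj_on x S" "x : space (vecs S)" for x i
 proof (cases "x : A i")
  case True
  then obtain s0 where s0: "s0 : S" "\<pi> s0 = i" "x s0 = L x" "a < L x" "L x < b" by (auto simp: A_def)
  have "?D x s = (if s = s0 then 1 else 0)" if "s : S" for s
   using inj_on_eq_iff[OF x(1) that s0(1)] that s0 by (simp add: clipD_def)
  hence "(\<Sum>s | s : S & \<pi> s = i. ?D x s) = (\<Sum>s | s : S & \<pi> s = i. if s = s0 then 1 else 0)"
   by (intro sum.cong refl) simp
  thus ?thesis using True S s0 by simp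
 next
  case False
  hence "(\<Sum>s | s : S & \<pi> s = i. ?D x s) = 0" using x(2) by (intro sum.neutral) (auto simp: clipD_def A_def)
  thus ?thesis using False by simp
 qed
 have g: "(\<Sum>s\<in>S. h s) = (\<Sum>i\<in>J. \<Sum>s | s : S & \<pi> s = i. h s)" for h :: "'i => real"
  by (rule sum.group[OF S J(1), symmetric]) (use J(2) in blast)
 have sumA: "(\<Sum>i\<in>J. indicator (A i) x) <= (1::real)" if x: "inj_on x S" "x : space (vecs S)" for x
 proof -
  have "(\<Sum>i\<in>J. indicator (A i) x) = (\<Sum>i\<in>J. \<Sum>s | s : S & \<pi> s = i. ?D x s)" using indA[OF x] by simp
  also have "... = (\<Sum>s\<in>S. ?D x s)" by (rule g[symmetric])
  also have "... <= 1" by (rule clipD_sum_le[OF x(1) S subset_refl])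
  finally show ?thesis .
 qed
 have combs: "comb S d m v : space (vecs S)" for d m v by (auto simp: comb_def space_PiM)
 have fle: "?f v <= (\<Sum>i\<in>J. \<Sum>j\<in>J. w i j * (indicator (A i) (?x v) * indicator (A j) (?y v)))"
  if "inj_on (?x v) S" "inj_on (?y v) S" for v
 proof -
  have "?f v <= (\<Sum>s\<in>S. \<Sum>t\<in>S. w (\<pi> s) (\<pi> t) * (?D (?x v) s * ?D (?y v) t))"
   using K(1) by (intro sum_mono mult_right_mono) (auto simp: D01)
  also have "... = (\<Sum>i\<in>J. \<Sum>s | s : S & \<pi> s = i. \<Sum>j\<in>J. \<Sum>t | t : S & \<pi> t = j. w (\<pi> s) (\<pi> t) * (?D (?x v) s * ?D (?y v) t))"
   by (subst g) (rule sum.cong[OF refl], rule sum.cong[OF refl], rule g)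
  also have "... = (\<Sum>i\<in>J. \<Sum>j\<in>J. \<Sum>s | s : S & \<pi> s = i. \<Sum>t | t : S & \<pi> t = j. w i j * (?D (?x v) s * ?D (?y v) t))"
   by (rule sum.cong[OF refl], subst sum.swap, intro sum.cong refl) simp
  also have "... = (\<Sum>i\<in>J. \<Sum>j\<in>J. w i j * ((\<Sum>s | s : S & \<pi> s = i. ?D (?x v) s) * (\<Sum>t | t : S & \<pi> t = j. ?D (?y v) t)))"
   by (simp only: sum_product) (simp only: sum_distrib_left)
  finally show ?thesis using that combs by (simp add: indA)
 qed
 have I1: "I <= 1"
 proof -
  have "I <= (LINT v|M2. 1)" unfolding I_def
  proof (rule integral_mono_AE[OF fi])
   show "AE v in M \<Otimes>\<^sub>M M. ?f v <= 1" using gen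
   proof eventually_elim
    case (elim v)
    have "?f v <= (\<Sum>s\<in>S. \<Sum>t\<in>S. ?D (?x v) s * ?D (?y v) t)"
     using K(2) by (intro sum_mono) (auto simp: clipD_def)
    also have "... = (\<Sum>s\<in>S. ?D (?x v) s) * (\<Sum>t\<in>S. ?D (?y v) t)" by (simp add: sum_product)
    also have "... <= 1 * 1"
     using clipD_sum_le[OF elim(1) S subset_refl] clipD_sum_le[OF elim(2) S subset_refl]
     by (intro mult_mono) (auto intro!: sum_nonneg simp: D01)
    finally show ?case by simp
   qed
  qed auto
  thus ?thesis by (simp add: MM.prob_space)
 qed
 define p where "p i = (\<integral>v. indicator (A i) (\<lambda>s\<in>S. X s v) \<partial>M :: real)" for i
 have p0: "0 <= p i" for i unfolding p_def by (intro integral_nonneg_AE) auto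
 have restr: "L (\<lambda>s\<in>S. X s v) = L (%s. X s v)" for v by (rule selector_cong[OF L(1)]) simp
 have pe: "p i <= r" if "i : J" for i
 proof -
  have "p i = (LINT v|M. indicator {v\<in>space M. (\<lambda>s\<in>S. X s v) : A i} v)"
   unfolding p_def by (rule Bochner_Integration.integral_cong) (auto simp: indicator_def)
  also have "... = prob {v\<in>space M. (\<lambda>s\<in>S. X s v) : A i}" by simp
  also have "{v\<in>space M. (\<lambda>s\<in>S. X s v) : A i} = {v\<in>space M. a < L (%s. X s v) & L (%s. X s v) < b & (EX s:S. \<pi> s = i & X s v = L (%s. X s v))}"
   by (auto simp: A_def restr space_PiM)
  finally show ?thesis using small[OF that] by simp
 qed
 have ps: "(\<Sum>i\<in>J. p i) <= 1"
 proof -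
  have ia: "integrable M (%v. indicat_real (A i) (\<lambda>s\<in>S. X s v))" for i
   by (rule integrable_unit[of _ 1]) (auto simp: indicator_def)
  have "(\<Sum>i\<in>J. p i) = (LINT v|M. (\<Sum>i\<in>J. indicator (A i) (\<lambda>s\<in>S. X s v)))" unfolding p_def using ia by simp
  also have "... <= (LINT v|M. 1)"
  proof (rule integral_mono_AE)
   have "AE v in M. ALL s:S. ALL t:S. s ~= t --> X s v ~= X t v"
    using S AE_distinct by (intro AE_finite_allI) (auto intro!: AE_impI)
   thus "AE v in M. (\<Sum>i\<in>J. indicat_real (A i) (\<lambda>s\<in>S. X s v)) <= 1"
   proof eventually_elim
    case (elim v)
    hence "inj_on (\<lambda>s\<in>S. X s v) S" by (auto simp: inj_on_def)
    thus ?case by (rule sumA) (simp add: space_PiM)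
   qed
  qed (use ia in auto)
  finally show ?thesis by (simp add: prob_space)
 qed
 \<comment> \<open>\<open>noise_le\<close> replaces mixed cells by the diagonal terms
   \<open>n i\<close>, the row sums of \<open>w\<close> contribute \<open>W\<close>, and
   \<open>n i\<close> is at most \<open>p i\<close> times a small power of \<open>r\<close>, where
   the \<open>p i\<close> sum to at most 1.\<close>
 have I2: "I <= W * r powr (1 / 4 / 2 ^ k)" if lt: "l0 <= l"
 proof -
  let ?q = "1 / 4 / 2 ^ k :: real"
  have c: "0 <= cos l" "cos l <= cos l0" "0 <= sin l" "cos l <= 1"
   using l l0 lt by (auto intro!: cos_ge_zero sin_ge_zero cos_monotone_0_pi_le)
  have "cos l ^ (2 ^ k) <= cos l0 ^ (2 ^ k)" using c by (intro power_mono) auto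
  hence "(cos l ^ (2 ^ k))^2 <= (cos l0 ^ (2 ^ k))^2" using c by (intro power_mono) auto
  hence k3: "3 * (cos l ^ (2 ^ k))^2 <= 1" using l0(3) by simp
  have sq: "sqrt (1 - (cos l)^2) = sin l" using c(3) by (simp add: sin_squared_eq[symmetric])
  define n where "n i = noise S (A i) (A i) (cos l)" for i
  have n: "n i <= p i * r powr ?q" if "i : J" for i
  proof -
   have "n i <= p i powr (1 + ?q)" unfolding n_def p_def by (rule noise_iterate[OF S A c(1,4) k3])
   also have "... = p i * p i powr ?q" using p0[of i] by (simp add: powr_mult_base)
   also have "... <= p i * r powr ?q" using p0[of i] pe[OF that] by (intro mult_left_mono powr_mono2) auto
   finally show ?thesis .
  qed
  have cross: "(LINT v|M2. indicator (A i) (?x v) * indicator (A j) (?y v)) <= (n i + n j) / 2" for i j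
  proof -
   have "(LINT v|M2. indicat_real (A i) (?x v) * indicator (A j) (?y v))
    = (LINT v|M2. indicat_real (A i) (comb S 1 0 v) * indicator (A j) (comb S (cos l) (sin l) v))"
    by (rule comb_law[OF S, where H = "%x y. indicat_real (A i) x * indicator (A j) y"]) (simp, simp, simp, measurable)
   also have "... = noise S (A i) (A j) (cos l)" by (simp add: noise_def sq)
   also have "... <= (n i + n j) / 2" unfolding n_def by (rule noise_le[OF S A A c(1,4)])
   finally show ?thesis .
  qed
  have ii: "integrable M2 (%v. indicat_real (A i) (?x v) * indicat_real (A j) (?y v))" for i j
   by (rule MM.integrable_unit[of _ 1]) (auto simp: indicator_def)
  have "I <= (LINT v|M2. (\<Sum>i\<in>J. \<Sum>j\<in>J. w i j * (indicator (A i) (?x v) * indicator (A j) (?y v))))"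
   unfolding I_def
  proof (rule integral_mono_AE[OF fi])
   show "integrable M2 (%v. \<Sum>i\<in>J. \<Sum>j\<in>J. w i j * (indicat_real (A i) (?x v) * indicator (A j) (?y v)))"
    by (intro Bochner_Integration.integrable_sum integrable_mult_right ii)
   show "AE v in M \<Otimes>\<^sub>M M. ?f v <= (\<Sum>i\<in>J. \<Sum>j\<in>J. w i j * (indicat_real (A i) (?x v) * indicator (A j) (?y v)))"
    using gen by eventually_elim (rule fle)
  qed
  also have "... = (\<Sum>i\<in>J. \<Sum>j\<in>J. w i j * (LINT v|M2. indicator (A i) (?x v) * indicator (A j) (?y v)))"
   using ii by simp
  also have "... <= (\<Sum>i\<in>J. \<Sum>j\<in>J. w i j * ((n i + n j) / 2))" by (intro sum_mono mult_left_mono cross w)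
  also have "... = (\<Sum>i\<in>J. \<Sum>j\<in>J. w i j * n i / 2) + (\<Sum>i\<in>J. \<Sum>j\<in>J. w i j * n j / 2)"
   by (simp add: sum.distrib[symmetric] field_simps)
  also have "(\<Sum>i\<in>J. \<Sum>j\<in>J. w i j * n j / 2) = (\<Sum>i\<in>J. \<Sum>j\<in>J. w i j * n i / 2)"
   by (subst sum.swap) (simp add: w(2))
  also have "(\<Sum>i\<in>J. \<Sum>j\<in>J. w i j * n i / 2) + (\<Sum>i\<in>J. \<Sum>j\<in>J. w i j * n i / 2) = (\<Sum>i\<in>J. (\<Sum>j\<in>J. w i j) * n i)"
   by (simp add: sum.distrib[symmetric] sum_distrib_left sum_distrib_right mult.commute)
  also have "... <= (\<Sum>i\<in>J. W * (p i * r powr ?q))"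
   using W n w noise_root(2)[OF S A c(1,4)] by (intro sum_mono mult_mono) (auto simp: n_def)
  also have "... = W * r powr ?q * (\<Sum>i\<in>J. p i)" by (simp only: sum_distrib_left) (simp add: mult_ac)
  also have "... <= W * r powr ?q * 1" using W ps by (intro mult_left_mono) auto
  finally show ?thesis by simp
 qed
 have "sin l * I <= sin l0 + W * r powr (1 / 4 / 2 ^ k)"
 proof -
  have I0: "0 <= W * r powr (1 / 4 / 2 ^ k)" using W by simp
  have s: "0 <= sin l" "0 <= sin l0" using l l0 by (auto intro!: sin_ge_zero)
  show ?thesis
  proof (cases "l0 <= l")
   case True
   have "sin l * I <= sin l * (W * r powr (1 / 4 / 2 ^ k))" by (rule mult_left_mono[OF I2[OF True] s(1)])
   also have "... <= 1 * (W * r powr (1 / 4 / 2 ^ k))" by (rule mult_right_mono[OF _ I0]) simp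
   finally show ?thesis using s by simp
  next
   case False
   have "sin l * I <= sin l * 1" by (rule mult_left_mono[OF I1 s(1)])
   also have "sin l <= sin l0" using False l l0 by (intro sin_monotone_2pi_le) auto
   finally show ?thesis using I0 by simp
  qed
 qed
 hence "pi / 2 * (sin l * I) <= pi / 2 * (sin l0 + W * r powr (1 / 4 / 2 ^ k))" by (intro mult_left_mono) auto
 thus ?thesis using e by (simp add: I_def power2_eq_square)
qed

end

section \<open>Crossing levels\<close>

lemma maxmin_ge:
 fixes x :: "'i => real"
 assumes S: "finite S" "\<U> ~= {}" "!!U. U : \<U> ==> U ~= {} & U <= S"
 shows "q <= (MAX U\<in>\<U>. MIN s\<in>U. x s) \<longleftrightarrow> (EX U:\<U>. ALL s:U. q <= x s)"
proof -
 have f: "finite \<U>" by (rule finite_subset[of _ "Pow S"]) (use S in auto)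
 have "q <= (MIN s\<in>U. x s) \<longleftrightarrow> (ALL s:U. q <= x s)" if "U : \<U>" for U
  using S(1) S(3)[OF that] finite_subset by (subst Min_ge_iff) auto
 thus ?thesis using f S(2) by (subst Max_ge_iff) auto
qed

lemma selector_maxmin:
 assumes S: "finite S" "\<U> ~= {}" "!!U. U : \<U> ==> U ~= {} & U <= S"
 shows "selector S (%x. MAX U\<in>\<U>. MIN s\<in>U. x s)"
proof -
 let ?L = "%x::'a => real. MAX U\<in>\<U>. MIN s\<in>U. x s"
 have f: "finite \<U>" by (rule finite_subset[of _ "Pow S"]) (use S in auto)
 have fU: "finite U" if "U : \<U>" for U using S(1) S(3)[OF that] finite_subset by blast
 have "?L : bm (vecs S)"
 proof (rule borel_measurable_Max[OF f])
  fix U assume U: "U : \<U>"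
  show "(%x. MIN s\<in>U. x s) : bm (vecs S)"
   by (rule borel_measurable_Min[OF fU[OF U]]) (use S(3)[OF U] in \<open>auto intro: measurable_component_singleton\<close>)
 qed
 moreover have "EX s:S. ?L x = x s" for x
 proof -
  have "?L x : (%U. MIN s\<in>U. x s) ` \<U>" using f S(2) by (intro Max_in) auto
  then obtain U where U: "U : \<U>" "?L x = (MIN s\<in>U. x s)" by blast
  have "(MIN s\<in>U. x s) : x ` U" using fU[OF U(1)] S(3)[OF U(1)] by (intro Min_in) auto
  thus ?thesis using U S(3)[OF U(1)] by auto
 qed
 moreover have "\<bar>?L x - ?L y\<bar> <= e" if e: "ALL s:S. \<bar>x s - y s\<bar> <= e" for x y e
 proof -
  have le: "?L x - e <= ?L y" if e: "ALL s:S. \<bar>x s - y s\<bar> <= e" for x y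
  proof -
   obtain U where U: "U : \<U>" "ALL s:U. ?L x <= x s" using maxmin_ge[OF S, of "?L x" x] by auto
   hence "ALL s:U. ?L x - e <= y s" using e S(3)[OF U(1)] by fastforce
   thus ?thesis using maxmin_ge[OF S, of "?L x - e" y] U(1) by blast
  qed
  show ?thesis using le[OF e] le[of y x] e by (auto simp: abs_minus_commute abs_le_iff)
 qed
 ultimately show ?thesis unfolding selector_def using S(1) by blast
qed

lemma selector_combine:
 assumes L: "selector S L" and L': "selector S' L'" and f: "f = min | f = (max :: real => real => real)"
 shows "selector (S Un S') (%x. f (L x) (L' x))"
 unfolding selector_def
proof (intro conjI allI impI)
 have m: "L : bm (vecs (S Un S'))" "L' : bm (vecs (S Un S'))"
  by (auto intro: selector_measurable[OF L] selector_measurable[OF L'])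
 show "finite (S Un S')" using assms by (simp add: selector_def)
 show "(%x. f (L x) (L' x)) : bm (vecs (S Un S'))"
  using f borel_measurable_min[OF m(2,1)] borel_measurable_max[OF m(2,1)] by auto
 show "EX s:S Un S'. f (L x) (L' x) = x s" for x
  using selector_select[OF L, of x] selector_select[OF L', of x] f by (auto simp: min_def max_def)
 show "\<bar>f (L x) (L' x) - f (L y) (L' y)\<bar> <= e" if "ALL s:S Un S'. \<bar>x s - y s\<bar> <= e" for x y e
  using selector_lipschitz[OF L, of x y e] selector_lipschitz[OF L', of x y e] that f by auto
qed

text \<open>Pointwise limits, on continuous functions, of selectors with sites in \<open>D\<close>.
  The set \<open>D\<close> records where the functional looks, which decoupling needs, and the
  definition yields measurability.\<close>

definition approx :: "plane set => ((plane => real) => real) => bool" where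
 "approx D V \<longleftrightarrow> (EX S L. (ALL n::nat. selector (S n) (L n) & S n <= D) &
   (ALL h. continuous_on UNIV h --> (%n. L n h) \<longlonglongrightarrow> V h))"

lemma approx_combine:
 assumes "approx D V" "approx D' V'" and f: "f = min | f = (max :: real => real => real)"
 shows "approx (D Un D') (%h. f (V h) (V' h))"
proof -
 obtain S L where 1: "!!n::nat. selector (S n) (L n)" "!!n. S n <= D" "!!h. continuous_on UNIV h ==> (%n. L n h) \<longlonglongrightarrow> V h"
  using assms(1) by (auto simp: approx_def)
 obtain S' L' where 2: "!!n::nat. selector (S' n) (L' n)" "!!n. S' n <= D'" "!!h. continuous_on UNIV h ==> (%n. L' n h) \<longlonglongrightarrow> V' h"
  using assms(2) by (auto simp: approx_def)
 have "selector (S n Un S' n) (%x. f (L n x) (L' n x)) & S n Un S' n <= D Un D'" for n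
  using selector_combine[OF 1(1) 2(1) f] 1(2) 2(2) by blast
 moreover have "(%n. f (L n h) (L' n h)) \<longlonglongrightarrow> f (V h) (V' h)" if "continuous_on UNIV h" for h
  using f tendsto_min[OF 1(3) 2(3), OF that that] tendsto_max[OF 1(3) 2(3), OF that that] by auto
 ultimately show ?thesis unfolding approx_def
  by (intro exI[of _ "%n. S n Un S' n"] exI[of _ "%n x. f (L n x) (L' n x)"]) blast
qed

lemmas approx_min = approx_combine[of _ _ _ _ min, simplified]
 and approx_max = approx_combine[of _ _ _ _ max, simplified]

definition level :: "plane set => plane set => plane set => (plane => real) => real" where
 "level Q A B h = Sup {q. joined Q A B {x. h x > q}}"

lemma joined_convex:
 assumes "convex Q" "A <= Q" "B <= Q" "A ~= {}" "B ~= {}" "Q <= U"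
 shows "joined Q A B U"
proof -
 obtain a b where ab: "a : A" "b : B" using assms by blast
 have "pc (Q Int U) a b"
  using convex_imp_path_connected[OF assms(1)] ab assms by (simp add: Int_absorb2 path_connected_component subset_iff)
 thus ?thesis unfolding joined_def using ab by blast
qed

text \<open>On a compact path the function attains its minimum, which exceeds \<open>q\<close>;
  crossings of strict superlevel sets therefore correspond exactly to a strict inequality for the
  supremum.\<close>

lemma less_level:
 assumes Q: "compact Q" "convex Q" and AB: "A <= Q" "B <= Q" "A ~= {}" "B ~= {}" and h: "continuous_on UNIV h"
 shows "q < level Q A B h \<longleftrightarrow> joined Q A B {x. h x > q}"
proof -
 let ?J = "{q. joined Q A B {x. h x > q}}"
 have hc: "continuous_on C h" for C using h by (rule continuous_on_subset) simp
 have ne: "Q ~= {}" using AB by blast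
 obtain lo where lo: "!!x. x : Q ==> lo <= h x" using continuous_attains_inf[OF Q(1) ne hc] by blast
 obtain hi where hi: "!!x. x : Q ==> h x <= hi" using continuous_attains_sup[OF Q(1) ne hc] by blast
 have "lo - 1 : ?J" using joined_convex[OF Q(2) AB, of "{x. h x > lo - 1}"] lo by force
 hence J: "?J ~= {}" by blast
 have bdd: "bdd_above ?J"
 proof (rule bdd_aboveI)
  fix q assume "q : ?J"
  then obtain x y where "pc (Q Int {x. h x > q}) x y" by (auto simp: joined_def)
  thus "q <= hi" using path_component_mem(1)[of "Q Int {x. h x > q}" x y] hi[of x] by auto
 qed
 show ?thesis
 proof
  assume "q < level Q A B h"
  then obtain q' where q': "joined Q A B {x. h x > q'}" "q < q'" using less_cSup_iff[OF J bdd] by (auto simp: level_def)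
  show "joined Q A B {x. h x > q}" by (rule joined_mono[OF q'(1)]) (use q'(2) in auto)
 next
  assume "joined Q A B {x. h x > q}"
  then obtain x y g where g: "x : A" "y : B" "path g" "path_image g <= Q Int {x. h x > q}" "pathstart g = x" "pathfinish g = y"
   by (auto simp: joined_def path_component_def)
  obtain z where z: "z : path_image g" "!!w. w : path_image g ==> h z <= h w"
   using continuous_attains_inf[OF compact_path_image[OF g(3)] path_image_nonempty hc] by blast
  have "h z > q" using z g by blast
  let ?q = "(h z + q) / 2"
  have "path_image g <= Q Int {x. h x > ?q}"
  proof
   fix w assume "w : path_image g"
   thus "w : Q Int {x. h x > ?q}" using z(2)[of w] g(4) `h z > q` by auto
  qed
  hence "?q : ?J" using g unfolding joined_def path_component_def by blast
  hence "?q <= level Q A B h" unfolding level_def by (rule cSup_upper[OF _ bdd])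
  thus "q < level Q A B h" using `h z > q` by auto
 qed
qed

section \<open>Discrete chains of sites in place of paths\<close>

definition steps :: "plane set => real => (plane \<times> plane) set" where
 "steps U e = {(s, t). s : U & t : U & dist s t <= 2 * e}"

text \<open>A chain is kept as a set all of whose sites are reachable from one end, so that a
  minimum over it is defined and each of its sites is joined to both ends.\<close>

definition chains :: "plane set => real => plane set => plane set => plane set set" where
 "chains S e A B = {U. U <= S & (EX a:U. EX x:A. dist x a <= e & (EX b:U. EX y:B. dist b y <= e) & (ALL s:U. (a, s) : (steps U e)\<^sup>*))}"

lemma chains_mono: "A <= A' ==> B <= B' ==> chains S e A B <= chains S e A' B'"
 unfolding chains_def by blast

text \<open>Steps are symmetric, so any site of the chain can serve as its start. This turns a
  selected site into an arm from that site to either side.\<close>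

lemma chains_arm:
 assumes U: "U : chains S e A B" and s: "s : U" and e: "0 <= e"
 shows "U : chains S e {s} A" "U : chains S e {s} B"
proof -
 obtain a x b y where a: "U <= S" "a : U" "x : A" "dist x a <= e" "b : U" "y : B" "dist b y <= e" "!!t. t : U ==> (a, t) : (steps U e)\<^sup>*"
  using U by (auto simp: chains_def)
 have "sym (steps U e)" by (auto simp: sym_def steps_def dist_commute)
 hence "(s, a) : (steps U e)\<^sup>*" using a(8)[OF s] by (meson sym_rtrancl symE)
 hence r: "ALL t:U. (s, t) : (steps U e)\<^sup>*" using a(8) by (meson rtrancl_trans)
 have "dist a x <= e" "dist s s <= e" using a(4) e by (simp_all add: dist_commute)
 show "U : chains S e {s} A" "U : chains S e {s} B"
  unfolding chains_def using r s a(1-3,5-7) `dist a x <= e` `dist s s <= e` by blast+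
qed

text \<open>Take the sites near the path that are reachable from its start. If they missed the end,
  the balls around reachable and unreachable sites would be closed sets covering the connected path;
  they would meet, and a common point gives a step of length at most \<open>2 * e\<close> between
  the two classes.\<close>

lemma chains_path:
 assumes S: "finite S" "!!x. x : Q ==> EX s:S. dist s x <= e" and j: "joined Q A B W"
 shows "EX U:chains S e A B. ALL s:U. EX z:Q Int W. dist s z <= e"
proof -
 obtain x y g where g: "x : A" "y : B" "path g" "path_image g <= Q Int W" "pathstart g = x" "pathfinish g = y"
  using j by (auto simp: joined_def path_component_def)
 let ?P = "path_image g"
 define U where "U = {s\<in>S. EX z:?P. dist s z <= e}"
 define R where "R = steps U e"
 have xy: "x : ?P" "y : ?P" using g pathstart_in_path_image pathfinish_in_path_image by blast+
 have near: "EX s:U. dist s z <= e" if z: "z : ?P" for z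
 proof -
  obtain s where "s : S" "dist s z <= e" using S(2)[of z] g(4) z by blast
  thus ?thesis using z by (auto simp: U_def)
 qed
 obtain a where a: "a : U" "dist a x <= e" using near[OF xy(1)] by blast
 obtain b where b: "b : U" "dist b y <= e" using near[OF xy(2)] by blast
 define C where "C = {s\<in>U. (a, s) : R\<^sup>*}"
 have fU: "finite U" using S(1) by (simp add: U_def)
 have "b : C"
 proof (rule ccontr)
  assume "b ~: C"
  let ?X = "\<Union>s\<in>C. cball s e" and ?Y = "\<Union>s\<in>U - C. cball s e"
  have cl: "closed ?X" "closed ?Y" using fU by (auto intro!: closed_UN simp: C_def)
  have "?P <= ?X Un ?Y"
  proof
   fix z assume "z : ?P"
   then obtain s where "s : U" "dist s z <= e" using near by blast
   thus "z : ?X Un ?Y" by (cases "s : C") auto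
  qed
  moreover have "a : C" using a by (simp add: C_def)
  hence "x : ?X Int ?P" using a(2) xy(1) by (intro IntI UN_I[of a]) auto
  hence "?X Int ?P ~= {}" by blast
  moreover have "b : U - C" using b `b ~: C` by simp
  hence "y : ?Y Int ?P" using b(2) xy(2) by (intro IntI UN_I[of b]) auto
  hence "?Y Int ?P ~= {}" by blast
  ultimately have "?X Int ?Y Int ?P ~= {}"
   using connected_closedD[OF connected_path_image[OF g(3)] _ _ cl] by blast
  then obtain s t z where st: "s : C" "t : U" "t ~: C" "dist s z <= e" "dist t z <= e" by auto
  have "dist s t <= 2 * e" using dist_triangle2[of s t z] st by simp
  hence "(s, t) : R" using st by (simp add: R_def C_def steps_def)
  hence "t : C" using st unfolding C_def by (auto intro: rtrancl.rtrancl_into_rtrancl)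
  thus False using st by simp
 qed
 have "(a, s) : (steps C e)\<^sup>*" if "s : C" for s
 proof -
  have "(a, s) : R\<^sup>*" using that by (simp add: C_def)
  thus ?thesis
  proof (induction rule: rtrancl_induct)
   case (step s t)
   hence "s : C" "t : C" by (auto simp: C_def R_def steps_def intro: rtrancl.rtrancl_into_rtrancl)
   hence "(s, t) : steps C e" using step(2) by (simp add: R_def steps_def)
   thus ?case using step.IH by (rule rtrancl.rtrancl_into_rtrancl[rotated])
  qed simp
 qed
 moreover have "C <= S" "dist x a <= e" "a : C" using a by (auto simp: U_def C_def dist_commute)
 ultimately have "C : chains S e A B" unfolding chains_def using `b : C` b g(1,2) by blast
 moreover have "ALL s:C. EX z:Q Int W. dist s z <= e" using g(4) by (auto simp: U_def C_def)
 ultimately show ?thesis by blast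
qed

lemma path_chains:
 assumes Q: "convex Q" "A <= Q" "B <= Q" "S <= Q" and U: "U : chains S e A B" and e: "e >= 0"
  and W: "!!s z. s : U ==> z : Q ==> dist s z <= 2 * e ==> z : W"
 shows "joined Q A B W"
proof -
 obtain a x b y where ab: "a : U" "x : A" "dist x a <= e" "b : U" "y : B" "dist b y <= e"
   "(a, b) : (steps U e)\<^sup>*" and US: "U <= S"
  using U by (auto simp: chains_def)
 have seg: "pc (Q Int W) s z" if "s : U" "z : Q" "dist s z <= 2 * e" for s z
 proof -
  have "closed_segment s z <= Q" using that US Q by (intro closed_segment_subset) auto
  moreover have "closed_segment s z <= W"
  proof
   fix w assume w: "w : closed_segment s z"
   hence "dist s w <= dist s z" using dist_in_closed_segment(1)[OF w] by (simp add: dist_commute)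
   thus "w : W" using W[OF that(1)] w calculation that(3) by auto
  qed
  ultimately have "pc (closed_segment s z) s z --> pc (Q Int W) s z" by (auto intro: path_component_of_subset)
  moreover have "pc (closed_segment s z) s z"
   using convex_imp_path_connected[OF convex_closed_segment, of s z] by (simp add: path_connected_component)
  ultimately show ?thesis by blast
 qed
 from ab(7) have "pc (Q Int W) a b & b : U"
 proof (induction rule: rtrancl_induct)
  case base
  show ?case using seg[of a a] ab(1) US Q e by auto
 next
  case (step s t)
  hence "t : U" "pc (Q Int W) s t" using seg[of s t] US Q by (auto simp: steps_def)
  thus ?case using step path_component_trans by auto
 qed
 moreover have "pc (Q Int W) x a" using seg[of a x] ab Q e by (auto intro: path_component_sym simp: dist_commute)
 moreover have "pc (Q Int W) b y" using seg[of b y] ab Q e by auto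
 ultimately have "pc (Q Int W) x y" by (meson path_component_trans)
 thus ?thesis unfolding joined_def using ab by blast
qed

definition net :: "plane set => (nat => plane set) => bool" where
 "net Q S \<longleftrightarrow> (ALL n. finite (S n) & S n <= Q & (ALL x:Q. EX s:S n. dist s x <= 1 / real (Suc n)))"

definition grid_level :: "(nat => plane set) => plane set => plane set => nat => (plane => real) => real" where
 "grid_level S A B n x = (MAX U\<in>chains (S n) (1 / real (Suc n)) A B. MIN s\<in>U. x s)"

lemma net_exists: "compact Q ==> EX S. net Q S"
proof -
 assume Q: "compact Q"
 have "EX S. finite S & S <= Q & (ALL x:Q. EX s:S. dist s x <= 1 / real (Suc n))" for n
 proof -
  obtain S where "finite S" "S <= Q" "Q <= (\<Union>x\<in>S. ball x (1 / real (Suc n)))"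
   by (rule compactE_image[OF Q, of Q "%x. ball x (1 / real (Suc n))"]) auto
  thus ?thesis by (intro exI[of _ S]) (fastforce simp: subset_iff intro: less_imp_le)
 qed
 thus ?thesis unfolding net_def by metis
qed

text \<open>Once the mesh is below the modulus of uniform continuity, a chain at level
  \<open>q\<close> gives a path at level \<open>q - r / 2\<close>, and a path at level
  \<open>q + r / 2\<close> gives a chain at level \<open>q\<close>.\<close>

lemma grid_level:
 assumes net: "net Q S" and Q: "compact Q" "convex Q" and AB: "A <= Q" "B <= Q" "A ~= {}" "B ~= {}"
 shows "selector (S n) (grid_level S A B n)"
  and "q <= grid_level S A B n x \<longleftrightarrow> (EX U:chains (S n) (1 / real (Suc n)) A B. ALL s:U. q <= x s)"
  and "continuous_on UNIV h ==> (%n. grid_level S A B n h) \<longlonglongrightarrow> level Q A B h"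
proof -
 define e where "e n = 1 / real (Suc n)" for n
 have e: "e n > 0" for n by (simp add: e_def)
 have S: "finite (S n)" "S n <= Q" "!!x. x : Q ==> EX s:S n. dist s x <= e n" for n
  using net unfolding net_def e_def by blast+
 let ?U = "%n. chains (S n) (e n) A B"
 let ?L = "grid_level S A B"
 have U: "?U n ~= {}" for n
  using chains_path[OF S(1,3) joined_convex[OF Q(2) AB subset_refl], of n] by blast
 have U': "U ~= {} & U <= S n" if "U : ?U n" for U n using that by (auto simp: chains_def)
 have ge: "q <= ?L n h \<longleftrightarrow> (EX U:?U n. ALL s:U. q <= h s)" for q n h
  unfolding grid_level_def e_def[symmetric] by (rule maxmin_ge[OF S(1) U U'])
 show "q <= ?L n x \<longleftrightarrow> (EX U:chains (S n) (1 / real (Suc n)) A B. ALL s:U. q <= x s)"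
  using ge by (simp add: e_def)
 show "selector (S n) (?L n)"
  unfolding grid_level_def[abs_def] e_def[symmetric] by (rule selector_maxmin[OF S(1) U U'])
 assume h: "continuous_on UNIV h"
 show "(%n. ?L n h) \<longlonglongrightarrow> level Q A B h"
 proof (rule LIMSEQ_I)
  fix r :: real assume r: "r > 0"
  note ll = less_level[OF Q AB h]
  have "uniformly_continuous_on Q h"
   using continuous_on_subset[OF h] Q(1) by (intro compact_uniformly_continuous) auto
  then obtain d where d: "d > 0" "!!x y. x : Q ==> y : Q ==> dist y x < d ==> dist (h y) (h x) < r / 2"
   using r unfolding uniformly_continuous_on_def by (meson half_gt_zero)
  obtain N where N: "e N < d / 2" using reals_Archimedean[of "d / 2"] d by (auto simp: e_def inverse_eq_divide)
  have "norm (?L n h - level Q A B h) < r" if n: "n >= N" for n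
  proof -
   have "e n <= e N" using n by (simp add: e_def frac_le)
   hence en: "2 * e n < d" using N by simp
   have "?L n h - r / 2 < level Q A B h"
   proof -
    obtain U where Un: "U : ?U n" "ALL s:U. ?L n h <= h s" using ge[of "?L n h" n h] by auto
    have "joined Q A B {x. h x > ?L n h - r / 2}"
    proof (rule path_chains[OF Q(2) AB(1,2) S(2) Un(1)])
     fix s z assume sz: "s : U" "z : Q" "dist s z <= 2 * e n"
     hence "s : Q" using U'[OF Un(1)] S(2) by blast
     thus "z : {x. h x > ?L n h - r / 2}"
      using d(2)[of z s] bspec[OF Un(2) sz(1)] sz en unfolding dist_real_def mem_Collect_eq by linarith
    qed (use e[of n] in simp)
    thus ?thesis using ll by blast
   qed
   moreover have "level Q A B h - r / 2 <= ?L n h"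
   proof (rule dense_le)
    fix q assume "q < level Q A B h - r / 2"
    hence "joined Q A B {x. h x > q + r / 2}" using ll[of "q + r / 2"] by simp
    from chains_path[OF S(1,3) this, of n] obtain U where Un: "U : ?U n"
     "ALL s:U. EX z:Q Int {x. h x > q + r / 2}. dist s z <= e n" by blast
    have "ALL s:U. q <= h s"
    proof
     fix s assume s: "s : U"
     then obtain z where z: "z : Q" "h z > q + r / 2" "dist s z <= e n" using Un(2) by blast
     have "s : Q" using U'[OF Un(1)] S(2) s by blast
     moreover have "dist z s < d" using z(3) en e[of n] by (simp add: dist_commute)
     ultimately have "dist (h z) (h s) < r / 2" using z(1) by (intro d(2))
     thus "q <= h s" using z(2) unfolding dist_real_def by linarith
    qed
    thus "q <= ?L n h" using ge[of q n h] Un(1) by blast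
   qed
   ultimately show ?thesis using r by (simp add: abs_less_iff)
  qed
  thus "EX N. ALL n>=N. norm (?L n h - level Q A B h) < r" by blast
 qed
qed

lemma approx_level:
 assumes "compact Q" "convex Q" "A <= Q" "B <= Q" "A ~= {}" "B ~= {}"
 shows "approx Q (level Q A B)"
proof -
 obtain S where S: "net Q S" using net_exists assms(1) by blast
 note g = grid_level[OF S assms]
 show ?thesis unfolding approx_def
  by (intro exI[of _ S] exI[of _ "grid_level S A B"]) (use g(1,3) S in \<open>auto simp: net_def\<close>)
qed

section \<open>Positive association and decoupling for limits of selectors\<close>

definition rise :: "real => real => real => real" where
 "rise a e z = max 0 (min 1 ((z - a) / e))"

lemma rise_unit: "0 <= rise a e z" "rise a e z <= 1" "\<bar>rise a e z\<bar> <= 1"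
 by (auto simp: rise_def)

lemma rise_measurable [measurable]: "rise a e : bm borel"
 unfolding rise_def[abs_def] by measurable

text \<open>The ramp lies between the indicators of two levels at distance \<open>e\<close>; the
  last equation identifies it with an affine image of clipping, to which the covariance estimates
  apply.\<close>

lemma rise_bounds:
 assumes "e > 0"
 shows "of_bool (a + e <= z) <= rise a e z" "rise a e z <= of_bool (a < z)" "max a (min (a + e) z) = a + e * rise a e z"
 using assms by (auto simp: rise_def field_simps max_def min_def)

lemma rise_tendsto: "(f \<longlongrightarrow> l) F ==> ((%x. rise a e (f x)) \<longlongrightarrow> rise a e l) F"
 unfolding rise_def divide_inverse by (intro tendsto_intros)

text \<open>Continuity is demanded for every outcome, so that the topological lemmas apply
  pointwise; \<open>continuous_version\<close> supplies such a field. \<open>kappa_half\<close>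
  feeds the anti-concentration bound, \<open>decay\<close> the decoupling and the sum over cells,
  and the last two assumptions give the symmetries of the square.\<close>

locale continuous_gaussian_field = nondegenerate_gaussian_process M X "%x y. \<kappa> (x - y)"
 for M :: "'w measure" and X :: "plane => 'w => real" and \<kappa> :: "plane => real" +
 assumes cont: "w : space M ==> continuous_on UNIV (%x. X x w)"
  and kappa_nonneg: "0 <= \<kappa> x" and kappa_le: "\<kappa> x <= 1"
  and kappa_half: "EX r>0. ALL x. norm x < r --> 1 / 2 <= \<kappa> x"
  and decay: "EX C. ALL x. \<kappa> x * norm x ^ 4 <= C"
  and kappa_turn: "\<kappa> (vector [- (x $ 2), x $ 1]) = \<kappa> x"
  and kappa_flip: "\<kappa> (vector [x $ 1, - (x $ 2)]) = \<kappa> x"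
begin

definition val :: "((plane => real) => real) => 'w => real" where
 "val V w = V (%x. X x w)"

lemma selector_rv:
 assumes "selector S L" shows "val L : bm M"
proof -
 have "(%w. L (\<lambda>s\<in>S. X s w)) : bm M"
  by (rule measurable_compose[OF _ selector_measurable[OF assms subset_refl]]) measurable
 moreover have "L (\<lambda>s\<in>S. X s w) = val L w" for w unfolding val_def by (rule selector_cong[OF assms]) simp
 ultimately show ?thesis by simp
qed

lemma approx_rv:
 assumes "approx D V" shows "val V : bm M"
proof -
 obtain S L where 1: "!!n::nat. selector (S n) (L n)" "!!h. continuous_on UNIV h ==> (%n. L n h) \<longlonglongrightarrow> V h"
  using assms by (auto simp: approx_def)
 show ?thesis
  by (rule borel_measurable_LIMSEQ_real[where u = "%n. val (L n)"]) (use 1 cont selector_rv in \<open>auto simp: val_def\<close>)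
qed

lemma expectation_rise_limit:
 assumes "approx D V" "approx D' V'"
  and V: "!!n::nat. selector (S n) (L n)" "!!h. continuous_on UNIV h ==> (%n. L n h) \<longlonglongrightarrow> V h"
  and V': "!!n::nat. selector (S' n) (L' n)" "!!h. continuous_on UNIV h ==> (%n. L' n h) \<longlonglongrightarrow> V' h"
 shows "(%n. \<integral>v. rise a e (val (L n) v) * rise a' e' (val (L' n) v) \<partial>M) \<longlonglongrightarrow> (LINT v|M. rise a e (val V v) * rise a' e' (val V' v))"
  and "(%n. \<integral>v. rise a e (val (L n) v) \<partial>M) \<longlonglongrightarrow> (LINT v|M. rise a e (val V v))"
proof -
 note [measurable] = approx_rv[OF assms(1)] approx_rv[OF assms(2)] selector_rv[OF V(1)] selector_rv[OF V'(1)]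
 have "(%n. \<integral>v. rise a e (val (L n) v) * rise b f (val (L' n) v) \<partial>M) \<longlonglongrightarrow> (LINT v|M. rise a e (val V v) * rise b f (val V' v))" for b f
 proof (rule integral_dominated_convergence[where w = "%_. 1"])
  show "AE v in M. (%n. rise a e (val (L n) v) * rise b f (val (L' n) v)) \<longlonglongrightarrow> rise a e (val V v) * rise b f (val V' v)"
   using cont V(2) V'(2) by (intro AE_I2 tendsto_mult rise_tendsto) (auto simp: val_def)
  show "AE v in M. norm (rise a e (val (L n) v) * rise b f (val (L' n) v)) <= 1" for n
   using rise_unit by (auto simp: abs_mult intro!: mult_le_one)
 qed auto
 thus "(%n. \<integral>v. rise a e (val (L n) v) * rise a' e' (val (L' n) v) \<partial>M) \<longlonglongrightarrow> (LINT v|M. rise a e (val V v) * rise a' e' (val V' v))" .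
 show "(%n. \<integral>v. rise a e (val (L n) v) \<partial>M) \<longlonglongrightarrow> (LINT v|M. rise a e (val V v))"
 proof (rule integral_dominated_convergence[where w = "%_. 1"])
  show "AE v in M. (%n. rise a e (val (L n) v)) \<longlonglongrightarrow> rise a e (val V v)"
   using cont V(2) by (intro AE_I2 rise_tendsto) (auto simp: val_def)
 qed (use rise_unit in auto)
qed

text \<open>A ramp is a clipped selector divided by its width, whence the denominator
  \<open>e * e'\<close>; the estimates for selectors pass to the limit by dominated
  convergence.\<close>

lemma rise_covariance:
 assumes V: "approx D V" "approx D' V'" and e: "e > 0" "e' > 0"
 shows "(LINT w|M. rise a e (val V w)) * (LINT w|M. rise a' e' (val V' w)) <= (LINT w|M. rise a e (val V w) * rise a' e' (val V' w))"
  and "(!!x y. x : D ==> y : D' ==> \<kappa> (x - y) <= k) ==> k >= 0 ==>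
   (LINT w|M. rise a e (val V w) * rise a' e' (val V' w)) <= (LINT w|M. rise a e (val V w)) * (LINT w|M. rise a' e' (val V' w)) + 2 * k / (e * e')"
proof -
 obtain S L where 1: "!!n::nat. selector (S n) (L n)" "!!n. S n <= D" "!!h. continuous_on UNIV h ==> (%n. L n h) \<longlonglongrightarrow> V h"
  using V(1) by (auto simp: approx_def)
 obtain S' L' where 2: "!!n::nat. selector (S' n) (L' n)" "!!n. S' n <= D'" "!!h. continuous_on UNIV h ==> (%n. L' n h) \<longlonglongrightarrow> V' h"
  using V(2) by (auto simp: approx_def)
 note lim = expectation_rise_limit(1)[OF V 1(1,3) 2(1,3), of a e a' e'] expectation_rise_limit(2)[OF V 1(1,3) 2(1,3), of a e] expectation_rise_limit(2)[OF V(2,1) 2(1,3) 1(1,3), of a' e']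
 let ?A = "%n w. rise a e (val (L n) w)" and ?B = "%n w. rise a' e' (val (L' n) w)"
 have ab: "a < a + e" "a' < a' + e'" using e by auto
 have cov: "(LINT w|M. clip a (a + e) (L n) (%s. X s w) * clip a' (a' + e') (L' n) (%s. X s w))
   - (LINT w|M. clip a (a + e) (L n) (%s. X s w)) * (LINT w|M. clip a' (a' + e') (L' n) (%s. X s w))
   = e * e' * ((LINT w|M. ?A n w * ?B n w) - (LINT w|M. ?A n w) * (LINT w|M. ?B n w))" for n
 proof -
  note [measurable] = selector_rv[OF 1(1)[of n]] selector_rv[OF 2(1)[of n]]
  have i: "integrable M (?A n)" "integrable M (?B n)" "integrable M (%w. ?A n w * ?B n w)"
   using rise_unit by (auto intro!: integrable_unit[of _ 1] mult_le_one simp: abs_mult)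
  have c: "clip a (a + e) (L n) (%s. X s w) = a + e * ?A n w" "clip a' (a' + e') (L' n) (%s. X s w) = a' + e' * ?B n w" for w
   using rise_bounds(3) e by (auto simp: clip_def val_def)
  have "(a + e * ?A n w) * (a' + e' * ?B n w) = a * a' + a * e' * ?B n w + a' * e * ?A n w + e * e' * (?A n w * ?B n w)" for w
   by (simp add: algebra_simps)
  thus ?thesis unfolding c using i by (simp add: prob_space algebra_simps)
 qed
 have "(LINT w|M. ?A n w) * (LINT w|M. ?B n w) <= (LINT w|M. ?A n w * ?B n w)" for n
 proof -
  have "0 <= e * e' * ((LINT w|M. ?A n w * ?B n w) - (LINT w|M. ?A n w) * (LINT w|M. ?B n w))"
   unfolding cov[symmetric] using clip_positive_association[OF 1(1) ab(1) 2(1) ab(2), of n n] kappa_nonneg by simp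
  thus ?thesis unfolding zero_le_mult_iff[of "e * e'"] using mult_pos_pos[OF e] by auto
 qed
 thus "(LINT w|M. rise a e (val V w)) * (LINT w|M. rise a' e' (val V' w)) <= (LINT w|M. rise a e (val V w) * rise a' e' (val V' w))"
  by (intro LIMSEQ_le[OF tendsto_mult[OF lim(2,3)] lim(1)]) auto
 assume k: "!!x y. x : D ==> y : D' ==> \<kappa> (x - y) <= k" "k >= 0"
 have "(LINT w|M. ?A n w * ?B n w) <= (LINT w|M. ?A n w) * (LINT w|M. ?B n w) + 2 * k / (e * e')" for n
 proof -
  have "\<kappa> (s - t) <= k" if "s : S n" "t : S' n" for s t using k(1) 1(2) 2(2) that by blast
  from clip_decoupling[OF 1(1)[of n] ab(1) 2(1)[of n] ab(2) this k(2)]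
  have "e * e' * ((LINT w|M. ?A n w * ?B n w) - (LINT w|M. ?A n w) * (LINT w|M. ?B n w)) <= 2 * k"
   unfolding cov[symmetric] by simp
  thus ?thesis using e by (simp add: field_simps)
 qed
 thus "(LINT w|M. rise a e (val V w) * rise a' e' (val V' w)) <= (LINT w|M. rise a e (val V w)) * (LINT w|M. rise a' e' (val V' w)) + 2 * k / (e * e')"
  by (intro LIMSEQ_le[OF lim(1) tendsto_add[OF tendsto_mult[OF lim(2,3)] tendsto_const]]) auto
qed

lemma expectation_rise_tendsto:
 assumes [measurable]: "Z : bm M"
 shows "(%n. \<integral>v. rise a (1 / real (Suc n)) (Z v) \<partial>M) \<longlonglongrightarrow> prob {v\<in>space M. a < Z v}"
proof -
 have "(%n. \<integral>v. rise a (1 / real (Suc n)) (Z v) \<partial>M) \<longlonglongrightarrow> (LINT v|M. indicator {v\<in>space M. a < Z v} v)"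
 proof (rule integral_dominated_convergence[where w = "%_. 1"])
  show "AE v in M. (%n. rise a (1 / real (Suc n)) (Z v)) \<longlonglongrightarrow> indicator {v\<in>space M. a < Z v} v"
  proof (rule AE_I2)
   fix v assume v: "v : space M"
   show "(%n. rise a (1 / real (Suc n)) (Z v)) \<longlonglongrightarrow> indicator {v\<in>space M. a < Z v} v"
   proof (cases "a < Z v")
    case True
    obtain N where N: "1 / real (Suc N) < Z v - a" using reals_Archimedean[of "Z v - a"] True by (auto simp: inverse_eq_divide)
    have "rise a (1 / real (Suc n)) (Z v) = 1" if "n >= N" for n
    proof -
     have "1 / real (Suc n) <= 1 / real (Suc N)" using that by (simp add: frac_le)
     hence "a + 1 / real (Suc n) <= Z v" using N by simp
     thus ?thesis using rise_bounds(1)[of "1 / real (Suc n)" a "Z v"] rise_unit(2)[of a "1 / real (Suc n)" "Z v"] by simp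
    qed
    hence "eventually (%n. rise a (1 / real (Suc n)) (Z v) = 1) sequentially" by (auto simp: eventually_sequentially)
    thus ?thesis using True v by (simp add: tendsto_eventually)
   next
    case False
    hence "rise a (1 / real (Suc n)) (Z v) = 0" for n
     using rise_bounds(2)[of "1 / real (Suc n)" a "Z v"] rise_unit(1)[of a "1 / real (Suc n)" "Z v"] by simp
    thus ?thesis using False by simp
   qed
  qed
 qed (use rise_unit in auto)
 thus ?thesis by simp
qed

lemma fkg:
 assumes V: "approx D V" "approx D' V'"
 shows "prob {w\<in>space M. a < val V w} * prob {w\<in>space M. b < val V' w} <= prob {w\<in>space M. a < val V w & b < val V' w}"
proof -
 note [measurable] = approx_rv[OF V(1)] approx_rv[OF V(2)]
 let ?e = "%n. 1 / real (Suc n)"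
 have "(LINT w|M. rise a (?e n) (val V w)) * (LINT w|M. rise b (?e n) (val V' w)) <= prob {w\<in>space M. a < val V w & b < val V' w}" for n
 proof -
  have "(LINT w|M. rise a (?e n) (val V w)) * (LINT w|M. rise b (?e n) (val V' w)) <= (LINT w|M. rise a (?e n) (val V w) * rise b (?e n) (val V' w))"
   by (rule rise_covariance(1)[OF V]) auto
  also have "... <= (LINT w|M. indicator {w\<in>space M. a < val V w & b < val V' w} w)"
  proof (rule integral_mono)
   show "integrable M (%w. rise a (?e n) (val V w) * rise b (?e n) (val V' w))"
    using rise_unit by (auto intro!: integrable_unit[of _ 1] mult_le_one simp: abs_mult)
   show "rise a (?e n) (val V w) * rise b (?e n) (val V' w) <= indicator {w\<in>space M. a < val V w & b < val V' w} w"
    if "w : space M" for w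
   proof -
    have "rise a (?e n) (val V w) * rise b (?e n) (val V' w) <= of_bool (a < val V w) * of_bool (b < val V' w)"
     by (intro mult_mono rise_bounds rise_unit) auto
    thus ?thesis using that by (auto simp: indicator_def)
   qed
  qed (intro integrable_unit[of _ 1], auto)
  finally show ?thesis by simp
 qed
 thus ?thesis
  by (intro LIMSEQ_le_const2[OF tendsto_mult[OF expectation_rise_tendsto[of "val V" a] expectation_rise_tendsto[of "val V'" b]]]) auto
qed

text \<open>The decreasing indicators are replaced by one minus a ramp, which is at most the
  indicator at a raised level. The shifts \<open>e\<close> and \<open>e'\<close> are the price for
  an error free of the number of sites.\<close>

lemma decouple:
 assumes V: "approx D V" "approx D' V'" and e: "e > 0" "e' > 0"
  and k: "!!x y. x : D ==> y : D' ==> \<kappa> (x - y) <= k" "k >= 0"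
 shows "prob {w\<in>space M. val V w <= a & val V' w <= b}
  <= prob {w\<in>space M. val V w <= a + e} * prob {w\<in>space M. val V' w <= b + e'} + 2 * k / (e * e')"
proof -
 note [measurable] = approx_rv[OF V(1)] approx_rv[OF V(2)]
 let ?A = "%w. rise a e (val V w)" and ?B = "%w. rise b e' (val V' w)"
 have i: "integrable M ?A" "integrable M ?B" "integrable M (%w. ?A w * ?B w)"
  using rise_unit by (auto intro!: integrable_unit[of _ 1] mult_le_one simp: abs_mult)
 have ex: "(1 - ?A w) * (1 - ?B w) = 1 - ?A w - ?B w + ?A w * ?B w" for w by (simp add: algebra_simps)
 have i': "integrable M (%w. (1 - ?A w) * (1 - ?B w))" unfolding ex using i by simp
 have l: "1 - rise c f z <= of_bool (z <= c + f)" "of_bool (z <= c) <= 1 - rise c f z" if "f > 0" for c f z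
  using that by (auto simp: rise_def max_def min_def field_simps)
 have one: "1 - (LINT w|M. rise c f (val W w)) <= prob {w\<in>space M. val W w <= c + f}" "(LINT w|M. rise c f (val W w)) <= 1"
  if f: "f > 0" and W[measurable]: "val W : bm M" for c f W
 proof -
  have i: "integrable M (%w. rise c f (val W w))" using rise_unit by (auto intro!: integrable_unit[of _ 1])
  have "(LINT w|M. 1 - rise c f (val W w)) <= (LINT w|M. indicator {w\<in>space M. val W w <= c + f} w)"
  proof (rule integral_mono)
   show "integrable M (%w. 1 - rise c f (val W w))" using i by simp
   show "integrable M (indicat_real {w\<in>space M. val W w <= c + f})" by (intro integrable_unit[of _ 1]) auto
   show "1 - rise c f (val W w) <= indicator {w\<in>space M. val W w <= c + f} w" if "w : space M" for w
    using l(1)[OF f, of c "val W w"] that by (auto simp: indicator_def)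
  qed
  thus "1 - (LINT w|M. rise c f (val W w)) <= prob {w\<in>space M. val W w <= c + f}" using i by (simp add: prob_space)
  have "(LINT w|M. rise c f (val W w)) <= (LINT w|M. 1)" using i rise_unit by (intro integral_mono) auto
  thus "(LINT w|M. rise c f (val W w)) <= 1" by (simp add: prob_space)
 qed
 have "prob {w\<in>space M. val V w <= a & val V' w <= b} = (LINT w|M. indicator {w\<in>space M. val V w <= a & val V' w <= b} w)" by simp
 also have "... <= (LINT w|M. (1 - ?A w) * (1 - ?B w))"
 proof (rule integral_mono[OF _ i'])
  show "indicator {w\<in>space M. val V w <= a & val V' w <= b} w <= (1 - ?A w) * (1 - ?B w)" if "w : space M" for w
  proof -
   have "of_bool (val V w <= a) * of_bool (val V' w <= b) <= (1 - ?A w) * (1 - ?B w)"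
    using rise_unit by (intro mult_mono l e) auto
   thus ?thesis using that by (auto simp: indicator_def)
  qed
 qed (intro integrable_unit[of _ 1], auto)
 also have "... = 1 - (LINT w|M. ?A w) - (LINT w|M. ?B w) + (LINT w|M. ?A w * ?B w)"
  unfolding ex using i by (simp add: prob_space)
 also have "... <= (1 - (LINT w|M. ?A w)) * (1 - (LINT w|M. ?B w)) + 2 * k / (e * e')"
  using rise_covariance(2)[OF V e k, of a b] by (simp add: algebra_simps)
 also have "(1 - (LINT w|M. ?A w)) * (1 - (LINT w|M. ?B w)) <= prob {w\<in>space M. val V w <= a + e} * prob {w\<in>space M. val V' w <= b + e'}"
  using one[OF e(1), of V a] one[OF e(2), of V' b] by (intro mult_mono) auto
 finally show ?thesis by simp
qed

end

subsection \<open>Invariance, density and duality of crossing levels\<close>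

lemma joined_image:
 assumes T: "continuous_on UNIV T" "continuous_on UNIV T'" "!!x. T' (T x) = x" "!!x. T (T' x) = x"
 shows "joined (T ` Q) (T ` A) (T ` B) U \<longleftrightarrow> joined Q A B {x. T x : U}"
proof -
 have e: "T ` (Q Int {x. T x : U}) = T ` Q Int U" "T' ` (T ` Q Int U) = Q Int {x. T x : U}"
  using T(3,4) by (auto intro!: image_eqI)
 show ?thesis
 proof
  assume "joined (T ` Q) (T ` A) (T ` B) U"
  then obtain x y where "x : A" "y : B" "pc (T ` Q Int U) (T x) (T y)" by (auto simp: joined_def)
  thus "joined Q A B {x. T x : U}" unfolding joined_def
   using path_component_continuous_image[OF _ T(2), of "T ` Q Int U" "T x" "T y", unfolded e T(3)] by blast
 next
  assume "joined Q A B {x. T x : U}"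
  thus "joined (T ` Q) (T ` A) (T ` B) U" unfolding joined_def
   using path_component_continuous_image[OF _ T(1), of "Q Int {x. T x : U}", unfolded e] by blast
 qed
qed

lemma norm_plane_le: "norm (x :: plane) <= \<bar>x $ 1\<bar> + \<bar>x $ 2\<bar>"
 using norm_le_l1_cart[of x] by (simp add: sum_2)

context continuous_gaussian_field
begin

text \<open>Symmetries, including the change of sign, are used by making the transformed field
  another instance of the same locale with the same kernel.\<close>

lemma transform:
 assumes T: "inj T" "continuous_on UNIV T" "!!x y. \<kappa> (T x - T y) = \<kappa> (x - y)" and b: "b = 1 | b = - 1"
 shows "continuous_gaussian_field M (%x w. b * X (T x) w) \<kappa>"
proof
 have b0: "b ~= 0" using b by auto
 show "(%w. b * X (T x) w) : bm M" for x by simp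
 have re: "(\<Sum>s\<in>S. a s * (b * X (T s) w)) = (\<Sum>u\<in>T ` S. b * a (inv_into UNIV T u) * X u w)"
  "qform S (%x y. \<kappa> (x - y)) a a = qform (T ` S) (%x y. \<kappa> (x - y)) (%u. b * a (inv_into UNIV T u)) (%u. b * a (inv_into UNIV T u))" for S a w
 proof -
  have i: "inj_on T S" using T(1) by (rule inj_on_subset) simp
  show "(\<Sum>s\<in>S. a s * (b * X (T s) w)) = (\<Sum>u\<in>T ` S. b * a (inv_into UNIV T u) * X u w)"
   by (simp add: sum.reindex[OF i] T(1) mult_ac)
  have e: "b * x * (b * y) = x * y" for x y using b by auto
  show "qform S (%x y. \<kappa> (x - y)) a a = qform (T ` S) (%x y. \<kappa> (x - y)) (%u. b * a (inv_into UNIV T u)) (%u. b * a (inv_into UNIV T u))"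
   by (simp add: qform_def sum.reindex[OF i] T(1,3) e)
 qed
 show "(LINT w|M. cos (\<Sum>s\<in>S. a s * (b * X (T s) w))) = exp (- qform S (%x y. \<kappa> (x - y)) a a / 2)" if "finite S" for S a
  unfolding re(1) re(2)[of S a] using exp_cos[of "T ` S"] that by simp
 show "(LINT w|M. sin (\<Sum>s\<in>S. a s * (b * X (T s) w))) = 0" if "finite S" for S a
  unfolding re(1) using exp_sin[of "T ` S"] that by simp
 show "integrable M (%w. (b * X (T x) w)^2)" for x using square_integrable[of "T x"] by (simp add: power_mult_distrib)
 show "(LINT w|M. b * X (T x) w) = 0" for x using exp_zero[of "T x"] by simp
 have e: "b * u * (b * v) = u * v" for u v using b by auto
 show "(LINT w|M. b * X (T x) w * (b * X (T y) w)) = \<kappa> (x - y)" for x y using exp_mult[of "T x" "T y"] T(3) by (simp add: e)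
 show "AE w in M. b * X (T x) w ~= b * X (T y) w" if "x ~= y" for x y
  using AE_distinct[of "T x" "T y"] that T(1) b0 by (auto simp: inj_eq)
 show "AE w in M. b * X (T x) w ~= e" for x e
 proof -
  have "(b * z ~= e) = (z ~= b * e)" for z using b by auto
  thus ?thesis using AE_no_atom[of "T x" "b * e"] by simp
 qed
 show "continuous_on UNIV (%x. b * X (T x) w)" if "w : space M" for w
  using continuous_on_compose2[OF cont[OF that] T(2)] by (intro continuous_intros) simp
qed (rule kappa_nonneg kappa_le kappa_half decay kappa_turn kappa_flip)+

lemma same_law:
 assumes Y: "continuous_gaussian_field M Y \<kappa>" and V: "approx D V"
 shows "prob {w\<in>space M. a < V (%x. Y x w)} = prob {w\<in>space M. a < val V w}"
proof -
 interpret Y: continuous_gaussian_field M Y \<kappa> by fact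
 obtain S L where 1: "!!n::nat. selector (S n) (L n)" "!!h. continuous_on UNIV h ==> (%n. L n h) \<longlonglongrightarrow> V h"
  using V by (auto simp: approx_def)
 have eq: "(LINT w|M. rise a e (val (L n) w)) = (LINT w|M. rise a e (Y.val (L n) w))" for e n
 proof -
  let ?P = "vecs (S n)"
  have fin: "finite (S n)" using 1(1) by (simp add: selector_def)
  have d: "distr M ?P (%w. \<lambda>s\<in>S n. X s w) = distr M ?P (%w. \<lambda>s\<in>S n. Y s w)"
   by (rule joint_law_unique) (use fin exp_cos Y.exp_cos exp_sin Y.exp_sin in \<open>auto intro: prob_space_axioms\<close>)
  have m: "(%x. rise a e (L n x)) : bm ?P"
   using selector_measurable[OF 1(1)[of n] subset_refl] by measurable
  have "(LINT x|distr M ?P (%w. \<lambda>s\<in>S n. X s w). rise a e (L n x)) = (LINT x|distr M ?P (%w. \<lambda>s\<in>S n. Y s w). rise a e (L n x))"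
   by (simp only: d)
  hence "(LINT w|M. rise a e (L n (\<lambda>s\<in>S n. X s w))) = (LINT w|M. rise a e (L n (\<lambda>s\<in>S n. Y s w)))"
   using m by (simp add: integral_distr del: restrict_apply)
  moreover have "L n (\<lambda>s\<in>S n. X s w) = val (L n) w" "L n (\<lambda>s\<in>S n. Y s w) = Y.val (L n) w" for w
   unfolding val_def Y.val_def by (rule selector_cong[OF 1(1)], simp)+
  ultimately show ?thesis by simp
 qed
 have "(LINT w|M. rise a e (val V w)) = (LINT w|M. rise a e (Y.val V w))" for e
  using expectation_rise_limit(2)[OF V V 1 1, of a e, unfolded eq] Y.expectation_rise_limit(2)[OF V V 1 1, of a e]
  by (rule LIMSEQ_unique)
 thus ?thesis
  using LIMSEQ_unique[OF expectation_rise_tendsto[OF approx_rv[OF V], of a]] Y.expectation_rise_tendsto[OF Y.approx_rv[OF V], of a]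
  by (simp add: Y.val_def)
qed

text \<open>\<open>clip_density\<close> with \<open>m = 1 / 2\<close>. The ramps enlarge the window
  to three times its width, and the factor 2 from \<open>m\<close> makes the constant 6.\<close>

lemma density_net:
 assumes V: "approx D V" and T: "finite T" "!!x. x : D ==> EX t:T. 1 / 2 <= \<kappa> (x - t)" and ab: "a < b"
 shows "prob {w\<in>space M. a <= val V w & val V w <= b} <= 6 * real (card T) * (b - a)"
proof -
 note [measurable] = approx_rv[OF V]
 define d where "d = b - a"
 have d: "d > 0" using ab by (simp add: d_def)
 obtain S L where 1: "!!n::nat. selector (S n) (L n)" "!!n. S n <= D" "!!h. continuous_on UNIV h ==> (%n. L n h) \<longlonglongrightarrow> V h"
  using V by (auto simp: approx_def)
 note lim = expectation_rise_limit(2)[OF V V 1(1,3) 1(1,3)]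
 let ?\<psi> = "%z. rise (a - d) d z - rise b d z"
 have \<psi>: "of_bool (a <= z & z <= b) <= ?\<psi> z" "?\<psi> z <= of_bool (a - d < z & z < b + d)" for z
  using d by (auto simp: rise_def d_def max_def min_def field_simps)
 have i: "integrable M (%w. rise c e (val W w))" if "val W : bm M" for c e W
  using that rise_unit by (auto intro!: integrable_unit[of _ 1])
 have step: "(LINT w|M. rise (a - d) d (val (L n) w)) - (LINT w|M. rise b d (val (L n) w)) <= 6 * real (card T) * d" for n
 proof -
  note [measurable] = selector_rv[OF 1(1)[of n]]
  have "(LINT w|M. rise (a - d) d (val (L n) w)) - (LINT w|M. rise b d (val (L n) w)) = (LINT w|M. ?\<psi> (val (L n) w))"
   using i by simp
  also have "... <= (LINT w|M. indicator {w\<in>space M. a - d < val (L n) w & val (L n) w < b + d} w)"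
  proof (rule integral_mono)
   show "?\<psi> (val (L n) w) <= indicator {w\<in>space M. a - d < val (L n) w & val (L n) w < b + d} w" if "w : space M" for w
    using \<psi>(2)[of "val (L n) w"] that by (auto simp: indicator_def)
  qed (use i in auto, intro integrable_unit[of _ 1], auto)
  finally have le: "(LINT w|M. rise (a - d) d (val (L n) w)) - (LINT w|M. rise b d (val (L n) w))
   <= prob {w\<in>space M. a - d < val (L n) w & val (L n) w < b + d}" by simp
  have m: "1 / 2 <= (\<Sum>t\<in>T. \<kappa> (s - t))" if s: "s : S n" for s
  proof -
   obtain t where t: "t : T" "1 / 2 <= \<kappa> (s - t)" using T(2) 1(2) s by blast
   have "\<kappa> (s - t) <= (\<Sum>t\<in>T. \<kappa> (s - t))" using T(1) t(1) kappa_nonneg by (intro member_le_sum) auto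
   thus ?thesis using t by simp
  qed
  have "(\<Sum>s\<in>T. \<Sum>t\<in>T. \<kappa> (s - t)) <= (\<Sum>s\<in>T. \<Sum>t\<in>T. 1)" by (intro sum_mono kappa_le)
  hence "sqrt (\<Sum>s\<in>T. \<Sum>t\<in>T. \<kappa> (s - t)) <= sqrt ((real (card T))^2)"
   by (intro real_sqrt_le_mono) (simp add: power2_eq_square)
  hence "sqrt (\<Sum>s\<in>T. \<Sum>t\<in>T. \<kappa> (s - t)) <= real (card T)" by simp
  hence "(b + d - (a - d)) * sqrt (\<Sum>s\<in>T. \<Sum>t\<in>T. \<kappa> (s - t)) <= 3 * d * real (card T)"
   using d by (intro mult_mono) (auto simp: d_def sum_nonneg kappa_nonneg)
  with clip_density[OF 1(1)[of n] _ T(1) m, of "a - d" "b + d"] d ab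
  have "1 / 2 * prob {w\<in>space M. a - d < val (L n) w & val (L n) w < b + d} <= 3 * d * real (card T)" by (simp add: val_def)
  thus ?thesis using le by (simp add: mult_ac)
 qed
 have "prob {w\<in>space M. a <= val V w & val V w <= b} = (LINT w|M. indicator {w\<in>space M. a <= val V w & val V w <= b} w)" by simp
 also have "... <= (LINT w|M. ?\<psi> (val V w))"
 proof (rule integral_mono)
  show "indicator {w\<in>space M. a <= val V w & val V w <= b} w <= ?\<psi> (val V w)" if "w : space M" for w
   using \<psi>(1)[of "val V w"] that by (auto simp: indicator_def)
 qed (intro integrable_unit[of _ 1], auto, use i in auto)
 also have "... = (LINT w|M. rise (a - d) d (val V w)) - (LINT w|M. rise b d (val V w))"
  using i by simp
 also have "... <= 6 * real (card T) * d" by (rule LIMSEQ_le_const2[OF tendsto_diff[OF lim lim]]) (use step in auto)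
 finally show ?thesis by (simp add: d_def)
qed

lemma density:
 "EX C>=0. ALL n>=1. ALL D V a b. approx D V --> D <= rect (- n) n (- n) n --> a < b -->
   prob {w\<in>space M. a <= val V w & val V w <= b} <= C * n^2 * (b - a)"
proof -
 obtain r where r: "r > 0" "!!x. norm x < r ==> 1 / 2 <= \<kappa> x" using kappa_half by blast
 \<comment> \<open>The grid has spacing \<open>r / 2\<close>, so that a point differs from the grid
   point below it by less than \<open>r\<close> in l1 norm.\<close>
 define d where "d = r / 2"
 have d: "d > 0" using r by (simp add: d_def)
 have "prob {w\<in>space M. a <= val V w & val V w <= b} <= 6 * (2 / d + 5)^2 * n^2 * (b - a)"
  if n: "n >= 1" and V: "approx D V" and D: "D <= rect (- n) n (- n) n" and ab: "a < b" for n D V a b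
 proof -
  define N where "N = \<lceil>n / d\<rceil> + 1"
  define T where "T = (%(i, j). vector [d * of_int i, d * of_int j] :: plane) ` ({- N..N} \<times> {- N..N})"
  have nd: "n / d > 0" using n d by simp
  have N0: "N >= 0" using nd unfolding N_def by linarith
  have fin: "finite T" by (simp add: T_def)
  have "card T <= card ({- N..N} \<times> {- N..N})" unfolding T_def by (rule card_image_le) simp
  also have "... = nat (2 * N + 1) * nat (2 * N + 1)" by (simp add: card_cartesian_product algebra_simps)
  finally have "real (card T) <= real (nat (2 * N + 1) * nat (2 * N + 1))" by (rule of_nat_mono)
  also have "... = (2 * real_of_int N + 1)^2" using N0 by (simp add: power2_eq_square)
  also have "... <= ((2 / d + 5) * n)^2"
  proof (rule power_mono)
   have "real_of_int N <= n / d + 2" unfolding N_def by linarith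
   hence "2 * real_of_int N + 1 <= 2 * (n / d) + 5" by simp
   also have "... <= (2 / d + 5) * n" using n by (simp add: algebra_simps)
   finally show "2 * real_of_int N + 1 <= (2 / d + 5) * n" .
  qed (use N0 in simp)
  finally have card: "real (card T) <= (2 / d + 5)^2 * n^2" by (simp add: power_mult_distrib)
  have "EX t:T. 1 / 2 <= \<kappa> (x - t)" if x: "x : D" for x
  proof -
   let ?i = "%c. \<lfloor>x $ c / d\<rfloor>"
   have fl: "0 <= x $ c - d * of_int (?i c) & x $ c - d * of_int (?i c) < d" for c
   proof -
    have "of_int (?i c) <= x $ c / d" "x $ c / d < of_int (?i c) + 1" by linarith+
    hence "of_int (?i c) * d <= x $ c" "x $ c < (of_int (?i c) + 1) * d"
     using pos_le_divide_eq[OF d] pos_divide_less_eq[OF d] by blast+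
    thus ?thesis by (simp add: algebra_simps)
   qed
   have iN: "?i c : {- N..N}" if c: "- n <= x $ c" "x $ c <= n" for c
   proof -
    have "- (n / d) <= x $ c / d" "x $ c / d <= n / d" using c d by (auto simp: field_simps)
    hence "- N <= ?i c" "?i c <= N" unfolding N_def by linarith+
    thus ?thesis by simp
   qed
   let ?t = "vector [d * of_int (?i 1), d * of_int (?i 2)] :: plane"
   have "?t : T" unfolding T_def using iN[of 1] iN[of 2] D x by (auto simp: rect_def intro!: image_eqI[of _ _ "(?i 1, ?i 2)"])
   moreover have "norm (x - ?t) < r"
    using norm_plane_le[of "x - ?t"] fl[of 1] fl[of 2] by (simp add: d_def)
   ultimately show ?thesis using r(2) by blast
  qed
  from density_net[OF V fin this ab]
  have "prob {w\<in>space M. a <= val V w & val V w <= b} <= 6 * real (card T) * (b - a)" .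
  also have "... <= 6 * ((2 / d + 5)^2 * n^2) * (b - a)" using card ab by (intro mult_right_mono mult_left_mono) auto
  finally show ?thesis by simp
 qed
 thus ?thesis by (intro exI[of _ "6 * (2 / d + 5)^2"]) auto
qed

lemma no_atom:
 assumes V: "approx D V" "D <= rect (- n) n (- n) n"
 shows "prob {w\<in>space M. val V w = a} = 0"
proof -
 note [measurable] = approx_rv[OF V(1)]
 obtain C where C: "C >= 0" "!!n D V a b. n >= 1 ==> approx D V ==> D <= rect (- n) n (- n) n ==> a < b ==>
   prob {w\<in>space M. a <= val V w & val V w <= b} <= C * n^2 * (b - a)" using density by blast
 define N where "N = max n 1"
 have D: "D <= rect (- N) N (- N) N" using V(2) by (auto simp: rect_def N_def)
 have "prob {w\<in>space M. val V w = a} <= 0 + e" if e: "e > 0" for e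
 proof -
  define K where "K = C * N^2 + 1"
  have K: "K > 0" using C by (simp add: K_def add_nonneg_pos)
  have "prob {w\<in>space M. val V w = a} <= prob {w\<in>space M. a <= val V w & val V w <= a + e / K}"
   using e K by (intro finite_measure_mono) auto
  also have "... <= C * N^2 * (a + e / K - a)" by (rule C(2)[OF _ V(1) D]) (use e K in \<open>auto simp: N_def\<close>)
  also have "... <= K * (e / K)" unfolding add_diff_cancel_left' using e K by (intro mult_right_mono) (auto simp: K_def)
  finally show ?thesis using K by simp
 qed
 hence "prob {w\<in>space M. val V w = a} <= 0" by (rule field_le_epsilon)
 thus ?thesis using measure_nonneg[of M] by (simp add: antisym)
qed

end

subsection \<open>Crossing probabilities\<close>

lemma rect_nonempty: "a <= b ==> c <= d ==> rect a b c d ~= {}"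
proof -
 assume "a <= b" "c <= d"
 hence "vector [a, c] : rect a b c d" by (simp add: rect_def)
 thus ?thesis by blast
qed

lemma rect_subset: "a' <= a ==> b <= b' ==> c' <= c ==> d <= d' ==> rect a b c d <= rect a' b' c' d'"
 by (auto simp: rect_def)

lemma image_inverse: "(!!x. T' (T x) = x) ==> (!!x. T (T' x) = x) ==> T ` R = {y. T' y : R}"
 by (auto intro!: image_eqI)

definition admissible :: "plane set => plane set => plane set => bool" where
 "admissible Q A B \<longleftrightarrow> compact Q & convex Q & A <= Q & B <= Q & A ~= {} & B ~= {}"

lemma admissible_rect:
 "a <= b ==> c <= d ==> a <= a1 ==> a1 <= b1 ==> b1 <= b ==> c <= c1 ==> c1 <= d1 ==> d1 <= d ==>
  a <= a2 ==> a2 <= b2 ==> b2 <= b ==> c <= c2 ==> c2 <= d2 ==> d2 <= d ==>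
  admissible (rect a b c d) (rect a1 b1 c1 d1) (rect a2 b2 c2 d2)" by (simp add: admissible_def rect_subset rect_nonempty)

context continuous_gaussian_field
begin

definition isom :: "(plane => plane) => (plane => plane) => bool" where
 "isom T T' \<longleftrightarrow> continuous_on UNIV T & continuous_on UNIV T' & (ALL x. T' (T x) = x) & (ALL x. T (T' x) = x) &
   (ALL x y. \<kappa> (T x - T y) = \<kappa> (x - y))"

lemma kappa_minus: "\<kappa> (- x) = \<kappa> x"
proof -
 have "- x = vector [- (vector [- (x $ 2), x $ 1] :: plane) $ 2, (vector [- (x $ 2), x $ 1] :: plane) $ 1]"
  by (rule plane_eqI) simp_all
 thus ?thesis using kappa_turn[of "vector [- (x $ 2), x $ 1]"] kappa_turn[of x] by simp
qed

lemma isom_shift: "isom (%x. x + v) (%x. x - v)"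
 by (auto simp: isom_def intro!: continuous_intros)

lemma isom_turn: "isom (%x. vector [- (x $ 2), x $ 1]) (%x. vector [x $ 2, - (x $ 1)])"
 unfolding isom_def
proof (intro conjI allI)
 fix x y :: plane
 have "vector [- (x $ 2), x $ 1] - vector [- (y $ 2), y $ 1] = (vector [- ((x - y) $ 2), (x - y) $ 1] :: plane)"
  by (rule plane_eqI) simp_all
 thus "\<kappa> (vector [- (x $ 2), x $ 1] - vector [- (y $ 2), y $ 1]) = \<kappa> (x - y)" by (simp only: kappa_turn)
qed (auto intro!: continuous_on_plane_vector continuous_intros plane_eqI)

lemma isom_flip: "isom (%x. vector [x $ 1, - (x $ 2)]) (%x. vector [x $ 1, - (x $ 2)])"
 unfolding isom_def
proof (intro conjI allI)
 fix x y :: plane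
 have "vector [x $ 1, - (x $ 2)] - vector [y $ 1, - (y $ 2)] = (vector [(x - y) $ 1, - ((x - y) $ 2)] :: plane)"
  by (rule plane_eqI) simp_all
 thus "\<kappa> (vector [x $ 1, - (x $ 2)] - vector [y $ 1, - (y $ 2)]) = \<kappa> (x - y)" by (simp only: kappa_flip)
qed (auto intro!: continuous_on_plane_vector continuous_intros plane_eqI)

lemma isom_mirror: "isom (%x. vector [- (x $ 1), x $ 2]) (%x. vector [- (x $ 1), x $ 2])"
 unfolding isom_def
proof (intro conjI allI)
 fix x y :: plane
 have "vector [- (x $ 1), x $ 2] - vector [- (y $ 1), y $ 2] = - (vector [(x - y) $ 1, - ((x - y) $ 2)] :: plane)"
  by (rule plane_eqI) simp_all
 thus "\<kappa> (vector [- (x $ 1), x $ 2] - vector [- (y $ 1), y $ 2]) = \<kappa> (x - y)" by (simp only: kappa_minus kappa_flip)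
qed (auto intro!: continuous_on_plane_vector continuous_intros plane_eqI)

definition crossing :: "plane set => plane set => plane set => real => 'w set" where
 "crossing Q A B q = {w\<in>space M. joined Q A B {x. q < X x w}}"

lemma crossing_level:
 assumes "admissible Q A B"
 shows "crossing Q A B q = {w\<in>space M. q < val (level Q A B) w}"
proof -
 have "q < level Q A B (%x. X x w) \<longleftrightarrow> joined Q A B {x. q < X x w}" if "w : space M" for w
  by (rule less_level[OF _ _ _ _ _ _ cont[OF that]]) (use assms in \<open>auto simp: admissible_def\<close>)
 thus ?thesis unfolding crossing_def val_def by blast
qed

lemma approx_admissible: "admissible Q A B ==> approx Q (level Q A B)"
 by (simp add: admissible_def approx_level)

lemma crossing_sets [measurable]: "admissible Q A B ==> crossing Q A B q : sets M"
 using approx_rv[OF approx_admissible] by (simp add: crossing_level)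

lemma crossing_image:
 assumes T: "isom T T'" and Q: "admissible Q A B"
 shows "prob (crossing (T ` Q) (T ` A) (T ` B) q) = prob (crossing Q A B q)"
proof -
 have "inj T" using T by (metis injI isom_def)
 hence Y: "continuous_gaussian_field M (%x w. 1 * X (T x) w) \<kappa>" using T by (intro transform) (auto simp: isom_def)
 then interpret Y: continuous_gaussian_field M "%x w. X (T x) w" \<kappa> by simp
 have "crossing (T ` Q) (T ` A) (T ` B) q = Y.crossing Q A B q"
  unfolding crossing_def Y.crossing_def using T by (subst joined_image[where T' = T']) (auto simp: isom_def)
 also have "... = {w\<in>space M. q < level Q A B (%x. X (T x) w)}" using Y.crossing_level[OF Q] by (simp add: Y.val_def)
 finally show ?thesis using same_law[OF Y.continuous_gaussian_field_axioms approx_admissible[OF Q], of q] crossing_level[OF Q] by simp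
qed

definition Lr :: "real => real => real => real => real => 'w set" where
 "Lr a b c d q = {w\<in>space M. lr a b c d {x. q < X x w}}"

definition Tb :: "real => real => real => real => real => 'w set" where
 "Tb a b c d q = {w\<in>space M. tb a b c d {x. q < X x w}}"

definition H :: "real => real => real => real" where
 "H w h q = prob (Lr 0 w 0 h q)"

lemma Lr_crossing: "Lr a b c d q = crossing (rect a b c d) (rect a a c d) (rect b b c d) q"
 by (simp add: Lr_def crossing_def lr_joined)

lemma Tb_crossing: "Tb a b c d q = crossing (rect a b c d) (rect a b c c) (rect a b d d) q"
 by (simp add: Tb_def crossing_def tb_joined)

lemma admissible_lr: "a <= b ==> c <= d ==> admissible (rect a b c d) (rect a a c d) (rect b b c d)"
 and admissible_tb: "a <= b ==> c <= d ==> admissible (rect a b c d) (rect a b c c) (rect a b d d)"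
 by (auto intro: admissible_rect)

lemma shift_rect: "(%x. x + vector [u, v]) ` rect a b c d = rect (a + u) (b + u) (c + v) (d + v)"
 by (subst image_inverse[where T' = "%x. x - vector [u, v]"]) (auto simp: rect_def algebra_simps)

lemma turn_rect: "(%x. vector [- (x $ 2), x $ 1]) ` rect a b c d = rect (- d) (- c) a b"
 by (subst image_inverse[where T' = "%x. vector [x $ 2, - (x $ 1)]"]) (auto simp: rect_def intro!: plane_eqI)

lemma flip_rect: "(%x. vector [x $ 1, - (x $ 2)]) ` rect a b c d = rect a b (- d) (- c)"
 by (subst image_inverse[where T' = "%x. vector [x $ 1, - (x $ 2)]"]) (auto simp: rect_def intro!: plane_eqI)

lemma mirror_rect: "(%x. vector [- (x $ 1), x $ 2]) ` rect a b c d = rect (- b) (- a) c d"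
 by (subst image_inverse[where T' = "%x. vector [- (x $ 1), x $ 2]"]) (auto simp: rect_def intro!: plane_eqI)

lemma prob_Lr: "a <= b ==> c <= d ==> prob (Lr a b c d q) = H (b - a) (d - c) q"
 using crossing_image[OF isom_shift, OF admissible_lr, of 0 "b - a" 0 "d - c" "vector [a, c]" q]
 by (simp add: shift_rect Lr_crossing H_def)

lemma prob_Tb: "a <= b ==> c <= d ==> prob (Tb a b c d q) = H (d - c) (b - a) q"
 using crossing_image[OF isom_turn, OF admissible_lr, of c d "- b" "- a" q] prob_Lr[of c d "- b" "- a" q]
 by (simp add: turn_rect Tb_crossing Lr_crossing)

lemma Lr_sets [measurable]: "a <= b ==> c <= d ==> Lr a b c d q : sets M"
 unfolding Lr_crossing by (rule crossing_sets[OF admissible_lr])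

lemma Tb_sets [measurable]: "a <= b ==> c <= d ==> Tb a b c d q : sets M"
 unfolding Tb_crossing by (rule crossing_sets[OF admissible_tb])

lemma prob_at_least:
 assumes "approx D V" "D <= rect (- n) n (- n) n"
 shows "prob {w\<in>space M. a <= val V w} = prob {w\<in>space M. a < val V w}"
proof -
 note [measurable] = approx_rv[OF assms(1)]
 have "{w\<in>space M. a <= val V w} = {w\<in>space M. a < val V w} Un {w\<in>space M. val V w = a}" by auto
 hence "prob {w\<in>space M. a <= val V w} = prob {w\<in>space M. a < val V w} + prob {w\<in>space M. val V w = a}"
  by (simp add: finite_measure_Union[symmetric] disjoint_iff)
 thus ?thesis using no_atom[OF assms] by simp
qed

lemma rect_bounded: "EX n. rect a b c d <= rect (- n) n (- n) n"
 by (intro exI[of _ "\<bar>a\<bar> + \<bar>b\<bar> + \<bar>c\<bar> + \<bar>d\<bar>"] rect_subset) linarith+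

text \<open>No horizontal crossing of \<open>{X > q}\<close> means a vertical crossing of
  \<open>{X < q}\<close> up to the value of the exact level. The latter is a crossing for the
  negated field, which has the same law, and a quarter turn makes it horizontal.\<close>

lemma H_duality:
 assumes wh: "0 <= w" "0 <= h"
 shows "H w h q + H h w (- q) = 1"
proof -
 have neg: "continuous_gaussian_field M (%x r. - 1 * X (id x) r) \<kappa>" by (rule transform) auto
 then interpret Y: continuous_gaussian_field M "%x r. - X x r" \<kappa> by simp
 let ?Q = "rect 0 w 0 h" and ?V = "level (rect 0 w 0 h) (rect 0 w 0 0) (rect 0 w h h)"
 note adm = admissible_tb[OF wh]
 note ap = approx_admissible[OF adm]
 note [measurable] = Y.approx_rv[OF ap]
 \<comment> \<open>\<open>crossing_duality\<close> requires a gap between the levels, so only a weak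
   inequality for the dual level results; it differs from the strict one by a null event.\<close>
 have eq: "space M - Lr 0 w 0 h q = {r\<in>space M. - q <= Y.val ?V r}" (is "?L = ?R")
 proof
  show "?L <= ?R"
  proof
   fix r assume r: "r : ?L"
   hence sp: "r : space M" and n: "\<not> lr 0 w 0 h {x. q < X x r}" by (auto simp: Lr_def)
   have "z <= Y.val ?V r" if "z < - q" for z
   proof -
    have "tb 0 w 0 h {x. X x r < - z}" using crossing_duality[OF cont[OF sp] wh, of q "- z"] n that by auto
    moreover have "{x. X x r < - z} = {x. z < - X x r}" by auto
    ultimately have "r : Y.Tb 0 w 0 h z" using sp by (simp add: Y.Tb_def)
    thus ?thesis using Y.crossing_level[OF adm] by (auto simp: Y.Tb_crossing)
   qed
   hence "- q <= Y.val ?V r" by (rule dense_le)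
   thus "r : ?R" using sp by simp
  qed
  show "?R <= ?L"
  proof
   fix r assume r: "r : ?R"
   hence sp: "r : space M" by simp
   have "r ~: Lr 0 w 0 h q"
   proof
    assume "r : Lr 0 w 0 h q"
    hence "q < val (level ?Q (rect 0 0 0 h) (rect w w 0 h)) r" using crossing_level[OF admissible_lr[OF wh]] by (auto simp: Lr_crossing)
    \<comment> \<open>A level strictly above \<open>q\<close> leaves room to cross
      \<open>{X > p}\<close> and \<open>{X < p}\<close> simultaneously; these sets are disjoint,
      contrary to \<open>cross_meet\<close>.\<close>
    then obtain p where p: "q < p" "p < val (level ?Q (rect 0 0 0 h) (rect w w 0 h)) r" using dense by blast
    hence 1: "lr 0 w 0 h {x. p < X x r}" using crossing_level[OF admissible_lr[OF wh], of p] sp by (auto simp: Lr_crossing[symmetric] Lr_def)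
    have "- p < Y.val ?V r" using r p by simp
    hence "r : Y.Tb 0 w 0 h (- p)" using Y.crossing_level[OF adm] sp by (simp add: Y.Tb_crossing)
    hence 2: "tb 0 w 0 h {x. X x r < p}" by (simp add: Y.Tb_def)
    from 1 obtain x y where xy: "pc (?Q Int {x. p < X x r}) x y" "x $ 1 = 0" "y $ 1 = w" by (auto simp: lr_def)
    from 2 obtain u v where uv: "pc (?Q Int {x. X x r < p}) u v" "u $ 2 = 0" "v $ 2 = h" by (auto simp: tb_def)
    obtain z where z: "pc (?Q Int {x. p < X x r}) x z" "pc (?Q Int {x. X x r < p}) u z"
     using cross_meet[OF xy uv] by blast
    show False using path_component_rect(4)[OF z(1)] path_component_rect(4)[OF z(2)] by simp
   qed
   thus "r : ?L" using sp by simp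
  qed
 qed
 have "1 - H w h q = prob (space M - Lr 0 w 0 h q)"
  unfolding H_def by (rule prob_compl[OF Lr_sets[OF wh], symmetric])
 also have "... = prob {r\<in>space M. - q <= Y.val ?V r}" unfolding eq ..
 also have "... = prob {r\<in>space M. - q < Y.val ?V r}" proof -
  obtain n where "?Q <= rect (- n) n (- n) n" using rect_bounded by blast
  thus ?thesis by (rule Y.prob_at_least[OF ap])
 qed
 also have "... = prob {r\<in>space M. - q < val ?V r}" using same_law[OF Y.continuous_gaussian_field_axioms ap] by (simp add: Y.val_def)
 also have "... = prob (Tb 0 w 0 h (- q))" by (simp add: Tb_crossing crossing_level[OF adm])
 also have "... = H h w (- q)" using prob_Tb[OF wh] by simp
 finally show ?thesis by simp
qed

lemma H_square: "0 <= s ==> H s s 0 = 1 / 2"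
 using H_duality[of s s 0] by simp

lemma H_mono:
 assumes "0 <= w'" "w' <= w" "0 <= h" "h <= h'" "q' <= q"
 shows "H w h q <= H w' h' q'"
 unfolding H_def
proof (rule finite_measure_mono)
 show "Lr 0 w 0 h q <= Lr 0 w' 0 h' q'"
 proof
  fix v assume v: "v : Lr 0 w 0 h q"
  hence "lr 0 w' 0 h {x. q < X x v}" using lr_restrict[of 0 w 0 h _ 0 w'] assms by (auto simp: Lr_def)
  then obtain x y where xy: "pc (rect 0 w' 0 h Int {x. q < X x v}) x y" "x $ 1 = 0" "y $ 1 = w'" by (auto simp: lr_def)
  have "rect 0 w' 0 h Int {x. q < X x v} <= rect 0 w' 0 h' Int {x. q' < X x v}" using assms by (auto simp: rect_def)
  from path_component_of_subset[OF this xy(1)] show "v : Lr 0 w' 0 h' q'" using xy v by (auto simp: Lr_def lr_def)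
 qed
qed (use assms in simp)

text \<open>These upper level events play the part of increasing events: minima keep the form, and
  \<open>fkg\<close> gives positive correlation.\<close>

definition incr :: "real => 'w set => bool" where
 "incr q E \<longleftrightarrow> (EX D V. approx D V & E = {w\<in>space M. q < val V w})"

lemma incr_crossing: "admissible Q A B ==> incr q (crossing Q A B q)"
 unfolding incr_def using crossing_level approx_admissible by blast

lemma incr_Lr: "a <= b ==> c <= d ==> incr q (Lr a b c d q)"
 and incr_Tb: "a <= b ==> c <= d ==> incr q (Tb a b c d q)"
 unfolding Lr_crossing Tb_crossing by (simp_all add: incr_crossing admissible_lr admissible_tb)

lemma incr_Int:
 assumes "incr q E" "incr q E'"
 shows "incr q (E Int E')" "prob E * prob E' <= prob (E Int E')"
proof -
 obtain D V D' V' where V: "approx D V" "E = {w\<in>space M. q < val V w}" "approx D' V'" "E' = {w\<in>space M. q < val V' w}"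
  using assms by (auto simp: incr_def)
 have e: "E Int E' = {w\<in>space M. q < val (%h. min (V h) (V' h)) w}" "E Int E' = {w\<in>space M. q < val V w & q < val V' w}"
  using V by (auto simp: val_def)
 show "incr q (E Int E')" unfolding incr_def using approx_min[OF V(1,3)] e(1) by blast
 show "prob E * prob E' <= prob (E Int E')" unfolding e(2) unfolding V(2,4) by (rule fkg[OF V(1,3)])
qed

lemma incr_Inter:
 assumes "Es ~= []" "!!E. E : set Es ==> incr q E" "!!E. E : set Es ==> c <= prob E" "0 <= c"
 shows "incr q (\<Inter>(set Es)) & c ^ length Es <= prob (\<Inter>(set Es))"
 using assms(1-3)
proof (induction Es rule: list_nonempty_induct)
 case (cons E Es)
 hence IH: "incr q (\<Inter>(set Es))" "c ^ length Es <= prob (\<Inter>(set Es))" and E: "incr q E" "c <= prob E" by auto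
 have "c * c ^ length Es <= prob E * prob (\<Inter>(set Es))" using IH(2) E(2) assms(4) by (intro mult_mono) auto
 thus ?case using incr_Int[OF E(1) IH(1)] by simp
qed simp

end

subsection \<open>Weak Russo--Seymour--Welsh theory at level zero\<close>

lemma joined_commute: "joined Q A B U \<longleftrightarrow> joined Q B A U"
 unfolding joined_def using path_component_sym by blast

context continuous_gaussian_field
begin

lemma crossing_commute: "crossing Q A B q = crossing Q B A q"
 unfolding crossing_def by (subst joined_commute) simp

text \<open>The quantity of Tassion's argument: a square of half side \<open>h\<close> is crossed by
  a path that must land on the right side between the heights \<open>e\<close> and
  \<open>f\<close>.\<close>

definition G :: "real => real => real => real" where
 "G h e f = prob (crossing (rect (- h) h (- h) h) (rect (- h) (- h) (- h) h) (rect h h e f) 0)"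

lemma admissible_G:
 "- h <= e ==> e <= f ==> f <= h ==> admissible (rect (- h) h (- h) h) (rect (- h) (- h) (- h) h) (rect h h e f)"
 by (rule admissible_rect) auto

lemma prob_to:
 assumes "- h <= e" "e <= f" "f <= h" "a = u - h" "b = u + h" "c = v - h" "d = v + h" "e' = v + e" "f' = v + f"
 shows "prob (crossing (rect a b c d) (rect a a c d) (rect b b e' f') 0) = G h e f"
 using crossing_image[OF isom_shift admissible_G[OF assms(1-3)], of "vector [u, v]" 0] assms(4-)
 by (simp add: shift_rect G_def add.commute)

lemma prob_from:
 assumes "- h <= e" "e <= f" "f <= h" "a = u - h" "b = u + h" "c = v - h" "d = v + h" "e' = v + e" "f' = v + f"
 shows "prob (crossing (rect a b c d) (rect a a e' f') (rect b b c d) 0) = G h e f"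
proof -
 have "prob (crossing (rect a b c d) (rect b b c d) (rect a a e' f') 0) = prob (crossing (rect (- h) h (- h) h) (rect h h (- h) h) (rect (- h) (- h) e f) 0)"
  using crossing_image[OF isom_shift, of "rect (- h) h (- h) h" "rect h h (- h) h" "rect (- h) (- h) e f" "vector [u, v]" 0] assms
  by (simp add: shift_rect add.commute admissible_rect)
 also have "... = G h e f"
  using crossing_image[OF isom_mirror admissible_G[OF assms(1-3)], of 0] by (simp add: mirror_rect G_def)
 finally show ?thesis using crossing_commute by simp
qed

lemma G_flip: "- h <= e ==> e <= f ==> f <= h ==> G h (- f) (- e) = G h e f"
 using crossing_image[OF isom_flip admissible_G, of h e f 0] by (simp add: flip_rect G_def)

lemma G_mono:
 assumes "- h <= e'" "e' <= e" "e <= f" "f <= f'" "f' <= h"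
 shows "G h e f <= G h e' f'"
 unfolding G_def
proof (rule finite_measure_mono)
 have "rect h h e f <= rect h h e' f'" using assms by (intro rect_subset) auto
 thus "crossing (rect (- h) h (- h) h) (rect (- h) (- h) (- h) h) (rect h h e f) 0
  <= crossing (rect (- h) h (- h) h) (rect (- h) (- h) (- h) h) (rect h h e' f') 0"
  unfolding crossing_def joined_def by blast
qed (use assms in \<open>auto intro!: crossing_sets admissible_G\<close>)

lemma G_split:
 assumes "- h <= e" "e <= m" "m <= f" "f <= h"
 shows "G h e f <= G h e m + G h m f"
proof -
 let ?C = "%e f. crossing (rect (- h) h (- h) h) (rect (- h) (- h) (- h) h) (rect h h e f) 0"
 have s: "?C e m : sets M" "?C m f : sets M" using assms by (auto intro!: crossing_sets admissible_G)
 have "rect h h e f <= rect h h e m Un rect h h m f" by (auto simp: rect_def)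
 hence "?C e f <= ?C e m Un ?C m f" unfolding crossing_def joined_def by blast
 hence "prob (?C e f) <= prob (?C e m Un ?C m f)" using s by (intro finite_measure_mono) auto
 also have "... <= prob (?C e m) + prob (?C m f)" using s by (rule measure_Un_le)
 finally show ?thesis by (simp add: G_def)
qed

lemma G_half: "0 < h ==> 1 / 4 <= G h 0 h"
proof -
 assume h: "0 < h"
 have "G h (- h) h = 1 / 2"
  using prob_Lr[of "- h" h "- h" h 0] H_square[of "2 * h"] h by (simp add: G_def Lr_crossing)
 moreover have "G h (- h) 0 = G h 0 h" using G_flip[of h 0 h] h by simp
 ultimately show ?thesis using G_split[of h "- h" 0 h] h by simp
qed

text \<open>Continuity from above in the landing interval, needed because the critical height is a
  supremum. The decreasing events intersect inside the event that the level is at least 0, by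
  uniform continuity near the right side, and the absence of atoms makes the inequality
  strict.\<close>

lemma G_limit:
 assumes ef: "- h <= e" "e <= f" "f <= h" and c: "!!a. a > 0 ==> c <= G h (max (- h) (e - a)) (min h (f + a))"
 shows "c <= G h e f"
proof -
 let ?Q = "rect (- h) h (- h) h" and ?A = "rect (- h) (- h) (- h) h"
 define a where "a n = 1 / real (Suc n)" for n
 have a: "a n > 0" for n by (simp add: a_def)
 define B where "B n = rect h h (max (- h) (e - a n)) (min h (f + a n))" for n
 define E where "E n = crossing ?Q ?A (B n) 0" for n
 have adm: "admissible ?Q ?A (B n)" for n unfolding B_def using ef a[of n] by (intro admissible_G) auto
 note adm' = admissible_G[OF ef]
 have Bmono: "B n <= B m" if "m <= n" for m n
 proof -
  have "a n <= a m" using that by (simp add: a_def frac_le)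
  thus ?thesis unfolding B_def by (intro rect_subset) auto
 qed
 have "decseq E" unfolding decseq_def E_def crossing_def joined_def using Bmono by blast
 moreover have Es: "range E <= sets M" unfolding E_def using adm by auto
 ultimately have "(%n. prob (E n)) \<longlonglongrightarrow> prob (\<Inter>n. E n)" by (intro finite_Lim_measure_decseq)
 moreover have "c <= prob (E n)" for n using c[OF a] by (simp add: E_def B_def G_def)
 ultimately have "c <= prob (\<Inter>n. E n)" by (intro LIMSEQ_le_const) auto
 also have "... <= prob {v\<in>space M. 0 <= val (level ?Q ?A (rect h h e f)) v}"
 proof (rule finite_measure_mono)
  note [measurable] = approx_rv[OF approx_admissible[OF adm']]
  show "{v\<in>space M. 0 <= val (level ?Q ?A (rect h h e f)) v} : sets M" by measurable
  show "(\<Inter>n. E n) <= {v\<in>space M. 0 <= val (level ?Q ?A (rect h h e f)) v}"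
  proof
   fix v assume v: "v : (\<Inter>n. E n)"
   hence sp: "v : space M" by (auto simp: E_def crossing_def)
   let ?h = "%x. X x v"
   have "0 <= val (level ?Q ?A (rect h h e f)) v + r" if r: "r > 0" for r
   proof -
    have "uniformly_continuous_on ?Q ?h"
     using continuous_on_subset[OF cont[OF sp]] by (intro compact_uniformly_continuous) auto
    then obtain d where d: "d > 0" "!!x y. x : ?Q ==> y : ?Q ==> dist y x < d ==> dist (?h y) (?h x) < r"
     using r unfolding uniformly_continuous_on_def by meson
    obtain n where n: "a n < d" using reals_Archimedean[of d] d by (auto simp: a_def inverse_eq_divide)
    have "v : E n" using v by blast
    then obtain x y where xy: "x : ?A" "y : B n" "pc (?Q Int {x. 0 < ?h x}) x y"
     by (auto simp: E_def crossing_def joined_def)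
    define z where "z = (vector [h, max e (min f (y $ 2))] :: plane)"
    have z: "z : rect h h e f" using ef by (auto simp: z_def rect_def)
    have yz: "norm (y - z) <= a n"
    proof -
     have "\<bar>(y - z) $ 1\<bar> + \<bar>(y - z) $ 2\<bar> <= a n" using xy(2) ef a[of n] by (auto simp: z_def B_def rect_def)
     thus ?thesis using norm_plane_le[of "y - z"] by linarith
    qed
    have yQ: "y : ?Q" "?h y > 0" using path_component_mem(2)[OF xy(3)] by auto
    have zQ: "z : ?Q" using z ef by (auto simp: rect_def)
    have seg: "closed_segment y z <= ?Q Int {x. - r < ?h x}"
    proof
     fix w assume w: "w : closed_segment y z"
     have wQ: "w : ?Q" using closed_segment_subset[OF yQ(1) zQ convex_rect] w by blast
     have "dist w y < d" using dist_in_closed_segment(1)[OF w] yz n by (simp add: dist_norm norm_minus_commute)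
     hence "dist (?h w) (?h y) < r" by (intro d(2) yQ wQ)
     thus "w : ?Q Int {x. - r < ?h x}" using wQ yQ(2) unfolding dist_real_def by auto
    qed
    have "pc (closed_segment y z) y z"
     using convex_imp_path_connected[OF convex_closed_segment, of y z] by (simp add: path_connected_component)
    from path_component_of_subset[OF seg this] have 1: "pc (?Q Int {x. - r < ?h x}) y z" .
    have "?Q Int {x. 0 < ?h x} <= ?Q Int {x. - r < ?h x}" using r by auto
    from path_component_trans[OF path_component_of_subset[OF this xy(3)] 1]
    have "joined ?Q ?A (rect h h e f) {x. - r < ?h x}" using xy(1) z by (auto simp: joined_def)
    hence "v : crossing ?Q ?A (rect h h e f) (- r)" using sp by (simp add: crossing_def)
    thus ?thesis unfolding crossing_level[OF adm'] by simp
   qed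
   hence "0 <= val (level ?Q ?A (rect h h e f)) v" by (rule field_le_epsilon)
   thus "v : {v\<in>space M. 0 <= val (level ?Q ?A (rect h h e f)) v}" using sp by simp
  qed
 qed
 also have "... = G h e f"
  using prob_at_least[OF approx_admissible[OF adm'], of h 0] by (simp add: G_def crossing_level[OF adm'])
 finally show ?thesis .
qed

text \<open>A crossing lands in the upper half with probability at least 1/4. \<open>c\<close> is
  the largest height up to \<open>h / 2\<close> above which 1/8 remains; unless this cap is reached,
  the heights from 0 to \<open>c\<close> carry the other 1/8.\<close>

lemma half_target:
 assumes h: "0 < h"
 shows "EX c. 0 <= c & c <= h / 2 & 1 / 8 <= G h c h & (c < h / 2 --> 1 / 8 <= G h 0 c)"
proof -
 define A where "A = {c. 0 <= c & c <= h / 2 & 1 / 8 <= G h c h}"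
 have A: "0 : A" "bdd_above A" using G_half[OF h] h by (auto simp: A_def intro!: bdd_aboveI[of _ "h / 2"])
 define c where "c = Sup A"
 have c: "0 <= c" "c <= h / 2"
 proof -
  show "0 <= c" unfolding c_def by (rule cSup_upper[OF A])
  show "c <= h / 2" unfolding c_def
  proof (rule cSup_least)
   show "A ~= {}" using A(1) by blast
  qed (simp add: A_def)
 qed
 have "1 / 8 <= G h c h"
 proof (rule G_limit)
  fix e :: real assume e: "e > 0"
  then obtain a where a: "a : A" "c - e < a" using less_cSup_iff[of A "c - e"] A unfolding c_def by auto
  hence "1 / 8 <= G h a h" by (simp add: A_def)
  also have "... <= G h (max (- h) (c - e)) (min h (h + e))" using a e h by (intro G_mono) (auto simp: A_def)
  finally show "1 / 8 <= G h (max (- h) (c - e)) (min h (h + e))" .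
 qed (use c h in auto)
 moreover have "1 / 8 <= G h 0 c" if lt: "c < h / 2"
 proof (rule G_limit)
  fix e :: real assume e: "e > 0"
  define b where "b = min (h / 2) (c + e)"
  have b: "c < b" "b <= h / 2" "b <= c + e" using lt e unfolding b_def by linarith+
  hence "b ~: A" using cSup_upper[of b A] A by (auto simp: c_def)
  hence "G h b h < 1 / 8" using b c by (auto simp: A_def)
  hence "1 / 8 <= G h 0 b" using G_split[of h 0 b h] G_half[OF h] b c h by simp
  also have "... <= G h (max (- h) (0 - e)) (min h (c + e))" using b c e h by (intro G_mono) auto
  finally show "1 / 8 <= G h (max (- h) (0 - e)) (min h (c + e))" .
 qed (use c h in auto)
 ultimately show ?thesis using c by blast
qed

lemma rsw_stack:
 assumes h: "0 < h" and g: "1 / 8 <= G h (h / 2) h"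
 shows "(1 / 8) ^ 18 <= H (6 * h) (2 * h) 0"
proof -
 let ?Q = "%j. rect (- h) h (real j * h - h) (real j * h + h)"
 define U where "U j = crossing (?Q j) (rect (- h) (- h) (real j * h + h / 2) (real j * h + h)) (rect h h (real j * h - h) (real j * h + h)) 0" for j
 define D where "D j = crossing (?Q j) (rect (- h) (- h) (real j * h - h) (real j * h - h / 2)) (rect h h (real j * h - h) (real j * h + h)) 0" for j
 define T where "T j = Tb (- h) h (real j * h - h) (real j * h + h) 0" for j
 \<comment> \<open>Six squares with three events each, hence the exponent 18; the path from
   \<open>- h / 2\<close> to \<open>5 * h + h / 2\<close> has height \<open>6 * h\<close>.\<close>
 define Es where "Es = map U [0..<6] @ map D [0..<6] @ map T [0..<6]"
 have pU: "prob (U j) = G h (h / 2) h" for j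
  unfolding U_def by (rule prob_from[where u = 0 and v = "real j * h"]) (use h in auto)
 have pD: "prob (D j) = G h (- h) (- (h / 2))" for j
  unfolding D_def by (rule prob_from[where u = 0 and v = "real j * h"]) (use h in auto)
 have pT: "1 / 8 <= prob (T j)" for j unfolding T_def using h by (simp add: prob_Tb H_square)
 have i: "incr 0 (U j)" "incr 0 (D j)" "incr 0 (T j)" for j
  unfolding U_def D_def T_def using h by (auto intro!: incr_crossing incr_Tb admissible_rect)
 have "incr 0 (\<Inter>(set Es)) & (1 / 8) ^ length Es <= prob (\<Inter>(set Es))"
  by (rule incr_Inter) (use i pU pD pT g G_flip[of h "h / 2" h] h in \<open>auto simp: Es_def\<close>)
 hence "(1 / 8) ^ 18 <= prob (\<Inter>(set Es))" by (simp add: Es_def)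
 also have "... <= prob (Tb (- h) h (- h / 2) (real 5 * h + h / 2) 0)"
 proof (rule finite_measure_mono)
  show "\<Inter>(set Es) <= Tb (- h) h (- h / 2) (real 5 * h + h / 2) 0"
  proof
   fix w assume "w : \<Inter>(set Es)"
   hence w: "w : U j" "w : D j" "w : T j" if "j <= 5" for j using that by (auto simp: Es_def)
   hence sp: "w : space M" by (auto simp: T_def Tb_def)
   have "tb (- h) h (- h / 2) (real 5 * h + h / 2) {x. 0 < X x w}"
    by (rule tassion_stack[OF h]) (use w in \<open>auto simp: U_def D_def T_def Tb_def crossing_def lr_from_def\<close>)
   thus "w : Tb (- h) h (- h / 2) (real 5 * h + h / 2) 0" using sp by (simp add: Tb_def)
  qed
 qed (use h in simp)
 also have "... = H (6 * h) (2 * h) 0" using h by (subst prob_Tb) auto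
 finally show ?thesis .
qed

lemma rsw_chain:
 assumes h: "0 < h" and g: "c <= H (8 * h / 3) (2 * h) 0" "0 <= c" "c <= 1 / 2"
 shows "c ^ 11 <= H (6 * h) (2 * h) 0"
proof -
 let ?a = "2 * h / 3" and ?w = "8 * h / 3"
 define U where "U j = Lr (0 + real j * ?a) (0 + real j * ?a + ?w) 0 (2 * h) 0" for j
 define T where "T j = Tb (0 + real (Suc j) * ?a) (0 + real j * ?a + ?w) 0 (2 * h) 0" for j
 \<comment> \<open>Six rectangles shifted by \<open>2 * h / 3\<close> span
   \<open>10 * h / 3 + 8 * h / 3 = 6 * h\<close>; their five overlaps are squares of side
   \<open>2 * h\<close>. This makes 11 events.\<close>
 define Es where "Es = map U [0..<6] @ map T [0..<5]"
 have o: "0 + real (Suc j) * ?a <= 0 + real j * ?a + ?w" for j using h by (simp add: algebra_simps)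
 have pU: "prob (U j) = H ?w (2 * h) 0" for j unfolding U_def using h by (subst prob_Lr) auto
 have pT: "c <= prob (T j)" for j
 proof -
  have "0 + real j * ?a + ?w - (0 + real (Suc j) * ?a) = 2 * h" by (simp add: field_simps)
  thus ?thesis unfolding T_def using h g(3) H_square[of "2 * h"] by (subst prob_Tb[OF o]) auto
 qed
 have i: "incr 0 (U j)" "incr 0 (T j)" for j
  unfolding U_def T_def using h o[of j] by (auto intro!: incr_Lr incr_Tb)
 have "incr 0 (\<Inter>(set Es)) & c ^ length Es <= prob (\<Inter>(set Es))"
  by (rule incr_Inter) (use i pU pT g in \<open>auto simp: Es_def\<close>)
 hence "c ^ 11 <= prob (\<Inter>(set Es))" by (simp add: Es_def)
 also have "... <= prob (Lr 0 (0 + real 5 * ?a + ?w) 0 (2 * h) 0)"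
 proof (rule finite_measure_mono)
  show "\<Inter>(set Es) <= Lr 0 (0 + real 5 * ?a + ?w) 0 (2 * h) 0"
  proof
   fix v assume "v : \<Inter>(set Es)"
   hence v: "j <= 5 ==> v : U j" "j < 5 ==> v : T j" for j by (auto simp: Es_def)
   hence sp: "v : space M" using v(1)[of 0] by (auto simp: U_def Lr_def)
   have "lr 0 (0 + real 5 * ?a + ?w) 0 (2 * h) {x. 0 < X x v}"
    by (rule lr_chain) (use v h in \<open>auto simp: U_def T_def Tb_def Lr_def\<close>)
   thus "v : Lr 0 (0 + real 5 * ?a + ?w) 0 (2 * h) 0" using sp by (simp add: Lr_def)
  qed
 qed (use h in simp)
 also have "... = H (6 * h) (2 * h) 0" using h by (simp add: H_def)
 finally show ?thesis .
qed

lemma rsw_extend: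
 assumes h: "0 < h" and k: "k = 2 * h / 3" and \<alpha>: "0 <= \<alpha>" "\<alpha> <= h / 2" "0 <= \<alpha>'" "\<alpha>' <= k" "\<alpha> <= 2 * \<alpha>'"
  and g: "1 / 8 <= G h 0 \<alpha>" "1 / 8 <= G k \<alpha>' k"
 shows "(1 / 8) ^ 7 <= H (8 * h / 3) (2 * h) 0"
proof -
 let ?S = "rect (- h / 3) h (\<alpha> / 2 - k) (\<alpha> / 2 + k)" and ?l = "rect (- h / 3) (- h / 3)" and ?r = "rect h h"
 let ?c = "\<alpha> / 2 - k" and ?d = "\<alpha> / 2 + k"
 define E1 where "E1 = crossing (rect (- h) h (- h) h) (rect (- h) (- h) (- h) h) (?r 0 \<alpha>) 0"
 define E2 where "E2 = crossing (rect (- h / 3) (5 * h / 3) (- h) h) (?l 0 \<alpha>) (rect (5 * h / 3) (5 * h / 3) (- h) h) 0"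
 define ru where "ru = crossing ?S (?l ?c ?d) (?r (\<alpha> / 2 + \<alpha>') ?d) 0"
 define rd where "rd = crossing ?S (?l ?c ?d) (?r ?c (\<alpha> / 2 - \<alpha>')) 0"
 define lu where "lu = crossing ?S (?l (\<alpha> / 2 + \<alpha>') ?d) (?r ?c ?d) 0"
 define ld where "ld = crossing ?S (?l ?c (\<alpha> / 2 - \<alpha>')) (?r ?c ?d) 0"
 define T where "T = Tb (- h / 3) h ?c ?d 0"
 have o: "\<alpha> / 2 + k <= h" using \<alpha> k by simp
 define Es where "Es = [E1, E2, ru, rd, lu, ld, T]"
 have p1: "prob E1 = G h 0 \<alpha>" by (simp add: E1_def G_def)
 have p2: "prob E2 = G h 0 \<alpha>" unfolding E2_def by (rule prob_from[where u = "2 * h / 3" and v = 0]) (use h \<alpha> in auto)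
 have p3: "prob ru = G k \<alpha>' k" unfolding ru_def by (rule prob_to[where u = "h / 3" and v = "\<alpha> / 2"]) (use h \<alpha> k in auto)
 have p4: "prob rd = G k (- k) (- \<alpha>')" unfolding rd_def by (rule prob_to[where u = "h / 3" and v = "\<alpha> / 2"]) (use h \<alpha> k in auto)
 have p5: "prob lu = G k \<alpha>' k" unfolding lu_def by (rule prob_from[where u = "h / 3" and v = "\<alpha> / 2"]) (use h \<alpha> k in auto)
 have p6: "prob ld = G k (- k) (- \<alpha>')" unfolding ld_def by (rule prob_from[where u = "h / 3" and v = "\<alpha> / 2"]) (use h \<alpha> k in auto)
 have "prob T = H (?d - ?c) (h - - h / 3) 0" unfolding T_def by (rule prob_Tb) (use h k in auto)
 also have "?d - ?c = 2 * k" by simp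
 also have "h - - h / 3 = 2 * k" using k by simp
 finally have p7: "prob T = 1 / 2" using H_square[of "2 * k"] h k by simp
 have fl: "G k (- k) (- \<alpha>') = G k \<alpha>' k" using \<alpha> h k by (intro G_flip) auto
 have "incr 0 E1" "incr 0 E2" "incr 0 ru" "incr 0 rd" "incr 0 lu" "incr 0 ld" "incr 0 T"
  unfolding E1_def E2_def ru_def rd_def lu_def ld_def T_def using h \<alpha> k by (auto intro!: incr_crossing incr_Tb admissible_rect)
 hence "incr 0 (\<Inter>(set Es)) & (1 / 8) ^ length Es <= prob (\<Inter>(set Es))"
  by (intro incr_Inter) (use p1 p2 p3 p4 p5 p6 p7 fl g in \<open>auto simp: Es_def\<close>)
 moreover have "length Es = 7" by (simp add: Es_def)
 ultimately have "(1 / 8) ^ 7 <= prob (\<Inter>(set Es))" by metis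
 also have "... <= prob (Lr (- h) (5 * h / 3) (- h) h 0)"
 proof (rule finite_measure_mono)
  show "\<Inter>(set Es) <= Lr (- h) (5 * h / 3) (- h) h 0"
  proof
   fix w assume "w : \<Inter>(set Es)"
   hence w: "w : E1" "w : E2" "w : ru" "w : rd" "w : lu" "w : ld" "w : T" by (auto simp: Es_def)
   have "lr (- h) (5 * h / 3) (- h) h {x. 0 < X x w}" by (rule tassion_extend[OF k h \<alpha>(1,5) o])
     (use w in \<open>auto simp: E1_def E2_def ru_def rd_def lu_def ld_def T_def Tb_def crossing_def lr_from_def lr_to_def\<close>)
   thus "w : Lr (- h) (5 * h / 3) (- h) h 0" using w(7) by (simp add: Lr_def T_def Tb_def)
  qed
 qed (use h in simp)
 also have "... = H (8 * h / 3) (2 * h) 0" using h by (subst prob_Lr) auto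
 finally show ?thesis .
qed

text \<open>Scales grow by 3/2, so that the square used in \<open>rsw_extend\<close> belongs to the
  preceding scale. If \<open>\<alpha> n\<close> reaches its cap, \<open>rsw_stack\<close> applies;
  if it is at most twice its predecessor, \<open>rsw_extend\<close> does. Were both to fail from
  some point on, \<open>\<alpha>\<close> would double at each scale although it is at most half of
  \<open>h n\<close>.\<close>

lemma weak_rsw: "EX c>0. ALL R. EX s>=R. 0 < s & c <= H (3 * s) s 0"
proof -
 define h where "h n = (3 / 2 :: real) ^ n" for n :: nat
 have h0: "h n > 0" and hS: "h n = 2 * h (Suc n) / 3" for n by (simp_all add: h_def)
 have "\<exists>\<alpha>. ALL n. 0 <= \<alpha> n & \<alpha> n <= h n / 2 & 1 / 8 <= G (h n) (\<alpha> n) (h n) & (\<alpha> n < h n / 2 --> 1 / 8 <= G (h n) 0 (\<alpha> n))"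
  using half_target[OF h0] by (intro choice allI)
 then obtain \<alpha> where \<alpha>: "!!n. 0 <= \<alpha> n" "!!n. \<alpha> n <= h n / 2" "!!n. 1 / 8 <= G (h n) (\<alpha> n) (h n)"
  "!!n. \<alpha> n < h n / 2 ==> 1 / 8 <= G (h n) 0 (\<alpha> n)" by blast
 have often: "EX n>=N. \<alpha> n = h n / 2 | (EX m. n = Suc m & \<alpha> n < h n / 2 & \<alpha> n <= 2 * \<alpha> m)" for N
 proof (rule ccontr)
  assume no: "\<not> ?thesis"
  have lt: "\<alpha> n < h n / 2" if "n >= N" for n using no \<alpha>(2)[of n] that by (auto simp: less_le)
  have gr: "2 * \<alpha> n < \<alpha> (Suc n)" if "n >= N" for n
  proof -
   have "\<not> (EX m. Suc n = Suc m & \<alpha> (Suc n) < h (Suc n) / 2 & \<alpha> (Suc n) <= 2 * \<alpha> m)" using no le_SucI[OF that] by blast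
   thus ?thesis using lt[of "Suc n"] that by auto
  qed
  define c where "c = \<alpha> (Suc N)"
  have c: "c > 0" using gr[of N] \<alpha>(1)[of N] by (simp add: c_def)
  have pow: "2 ^ j * c <= \<alpha> (Suc N + j)" for j
  proof (induction j)
   case (Suc j)
   thus ?case using gr[of "Suc N + j"] by simp
  qed (simp add: c_def)
  have up: "2 ^ j * c <= h (Suc N) * (3 / 2) ^ j" for j
  proof -
   have "2 ^ j * c <= h (Suc N + j)" using pow[of j] \<alpha>(2)[of "Suc N + j"] h0[of "Suc N + j"] by linarith
   also have "... = h (Suc N) * (3 / 2) ^ j" by (simp add: h_def power_add)
   finally show ?thesis .
  qed
  obtain j where j: "h (Suc N) / c < (4 / 3) ^ j" using real_arch_pow[of "4 / 3" "h (Suc N) / c"] by auto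
  have "h (Suc N) * (3 / 2) ^ j < c * (4 / 3) ^ j * (3 / 2) ^ j"
   using j c by (intro mult_strict_right_mono) (auto simp: field_simps)
  also have "... = 2 ^ j * c" by (simp add: mult.assoc power_mult_distrib[symmetric])
  finally show False using up[of j] by simp
 qed
 \<comment> \<open>The exponent 77 is 7 * 11, from \<open>rsw_extend\<close> followed by
   \<open>rsw_chain\<close>; it also covers the 18 of \<open>rsw_stack\<close>.\<close>
 define c where "c = (1 / 8 :: real) ^ 77"
 have "EX s>=R. 0 < s & c <= H (3 * s) s 0" for R
 proof -
  obtain N where N: "R < (3 / 2) ^ N" using real_arch_pow[of "3 / 2" R] by auto
  obtain n where n: "n >= N" "\<alpha> n = h n / 2 | (EX m. n = Suc m & \<alpha> n < h n / 2 & \<alpha> n <= 2 * \<alpha> m)" using often by blast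
  have "(3 / 2 :: real) ^ N <= h n" unfolding h_def using n(1) by (intro power_increasing) auto
  hence "R <= 2 * h n" using N h0[of n] by linarith
  moreover have "c <= H (6 * h n) (2 * h n) 0"
   using n(2)
  proof
   assume eq: "\<alpha> n = h n / 2"
   have "(1 / 8) ^ 18 <= H (6 * h n) (2 * h n) 0" by (rule rsw_stack[OF h0 \<alpha>(3)[of n, unfolded eq]])
   moreover have "c <= (1 / 8) ^ 18" unfolding c_def by (intro power_decreasing) auto
   ultimately show ?thesis by linarith
  next
   assume "EX m. n = Suc m & \<alpha> n < h n / 2 & \<alpha> n <= 2 * \<alpha> m"
   then obtain m where m: "n = Suc m" "\<alpha> n < h n / 2" "\<alpha> n <= 2 * \<alpha> m" by blast
   have "(1 / 8) ^ 7 <= H (8 * h n / 3) (2 * h n) 0"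
    by (rule rsw_extend[OF h0 hS[of m, folded m(1)], where \<alpha> = "\<alpha> n" and \<alpha>' = "\<alpha> m"])
     (use \<alpha>[of n] \<alpha>[of m] m h0[of m] in auto)
   moreover have "(1 / 8 :: real) ^ 7 <= 1 / 2" by (simp add: power_divide)
   ultimately have "((1 / 8) ^ 7) ^ 11 <= H (6 * h n) (2 * h n) 0" by (intro rsw_chain[OF h0]) simp_all
   thus ?thesis by (simp add: c_def power_mult[symmetric])
  qed
  ultimately show ?thesis using h0[of n] by (intro exI[of _ "2 * h n"]) (simp add: mult.assoc[symmetric])
 qed
 moreover have "c > 0" by (simp add: c_def)
 ultimately show ?thesis by blast
qed

end

subsection \<open>Rings at arbitrarily large scales\<close>

definition ring_level :: "real => (plane => real) => real" where
 "ring_level s h =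
  min (min (level (rect s (3 * s) (- 3 * s) (3 * s)) (rect s (3 * s) (- 3 * s) (- 3 * s)) (rect s (3 * s) (3 * s) (3 * s)) h)
       (level (rect (- 3 * s) (- s) (- 3 * s) (3 * s)) (rect (- 3 * s) (- s) (- 3 * s) (- 3 * s)) (rect (- 3 * s) (- s) (3 * s) (3 * s)) h))
    (min (level (rect (- 3 * s) (3 * s) s (3 * s)) (rect (- 3 * s) (- 3 * s) s (3 * s)) (rect (3 * s) (3 * s) s (3 * s)) h)
       (level (rect (- 3 * s) (3 * s) (- 3 * s) (- s)) (rect (- 3 * s) (- 3 * s) (- 3 * s) (- s)) (rect (3 * s) (3 * s) (- 3 * s) (- s)) h))"

lemma less_ring_level:
 assumes "0 < s" "continuous_on UNIV h"
 shows "q < ring_level s h \<longleftrightarrow> ring s {x. q < h x}"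
proof -
 have l: "q < level Q A B h \<longleftrightarrow> joined Q A B {x. q < h x}" if "admissible Q A B" for Q A B
  using that assms(2) unfolding admissible_def by (intro less_level) auto
 show ?thesis unfolding ring_level_def ring_def lr_joined tb_joined min_less_iff_conj
  using assms(1) by (subst (1 2 3 4) l) (auto intro!: admissible_rect)
qed

lemma approx_mono: "approx D V ==> D <= D' ==> approx D' V"
 unfolding approx_def by (meson subset_trans)

lemma approx_ring_level:
 assumes s: "0 < s"
 shows "approx {z : rect (- 3 * s) (3 * s) (- 3 * s) (3 * s). s <= max \<bar>z $ 1\<bar> \<bar>z $ 2\<bar>} (ring_level s)"
proof -
 have a: "approx Q (level Q A B)" if "admissible Q A B" for Q A B
  using that unfolding admissible_def by (intro approx_level) auto
 show ?thesis unfolding ring_level_def[abs_def]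
  by (rule approx_mono[OF approx_min[OF approx_min[OF a a] approx_min[OF a a]]])
   (use s in \<open>auto intro!: admissible_rect\<close>, use s in \<open>auto simp: rect_def\<close>)
qed

lemma component_beyond:
 assumes "\<not> bounded C" shows "EX y:C. s <= max \<bar>y $ 1\<bar> \<bar>(y :: plane) $ 2\<bar>"
proof (rule ccontr)
 assume n: "\<not> ?thesis"
 have "C <= rect (- s) s (- s) s"
 proof
  fix y assume "y : C"
  hence "\<bar>y $ 1\<bar> < s" "\<bar>y $ 2\<bar> < s" using n by auto
  thus "y : rect (- s) s (- s) s" by (simp add: rect_def abs_less_iff)
 qed
 from bounded_subset[OF compact_imp_bounded[OF compact_rect] this] assms show False by simp
qed

context continuous_gaussian_field
begin

lemma prob_ring:
 assumes s: "0 < s" and c: "0 <= c" "c <= H (6 * s) (2 * s) q"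
 shows "c ^ 4 <= prob {w\<in>space M. q < val (ring_level s) w}"
proof -
 define Es where "Es = [Tb s (3 * s) (- 3 * s) (3 * s) q, Tb (- 3 * s) (- s) (- 3 * s) (3 * s) q,
  Lr (- 3 * s) (3 * s) s (3 * s) q, Lr (- 3 * s) (3 * s) (- 3 * s) (- s) q]"
 have "incr q (\<Inter>(set Es)) & c ^ length Es <= prob (\<Inter>(set Es))"
  by (rule incr_Inter) (use s c in \<open>auto simp: Es_def prob_Tb prob_Lr incr_Lr incr_Tb\<close>)
 moreover have "\<Inter>(set Es) = {w\<in>space M. q < val (ring_level s) w}"
  using less_ring_level[OF s cont] by (auto simp: Es_def Tb_def Lr_def val_def ring_def)
 ultimately show ?thesis by (simp add: Es_def power4_eq_xxxx mult.assoc)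
qed

lemma kappa_far: "EX C>=0. ALL x r. 0 < r --> r <= norm x --> \<kappa> x <= C / r ^ 4"
proof -
 obtain C where C: "!!x. \<kappa> x * norm x ^ 4 <= C" using decay by blast
 have "0 <= C" using C[of 0] by simp
 moreover have "\<kappa> x <= C / r ^ 4" if r: "0 < r" "r <= norm x" for x r
 proof -
  have "\<kappa> x * r ^ 4 <= \<kappa> x * norm x ^ 4" using r by (intro mult_left_mono power_mono kappa_nonneg) auto
  also have "... <= C" by (rule C)
  finally show ?thesis using r by (simp add: field_simps)
 qed
 ultimately show ?thesis by blast
qed

text \<open>A functional of the field in a box whose positivity certifies a ring of some scale at
  least \<open>R\<close>. Being approximable, it is open to decoupling and
  anti-concentration.\<close>

definition ring_detector :: "real => real => ((plane => real) => real) => bool" where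
 "ring_detector R n V \<longleftrightarrow> 1 <= n & approx (rect (- n) n (- n) n) V &
   (ALL h. continuous_on UNIV h --> 0 < V h --> (EX s>=R. 0 < s & 3 * s <= n & ring s {x. 0 < h x}))"

lemma ring_detector_level:
 assumes "0 < s" "R <= s" "1 <= n" "3 * s <= n"
 shows "ring_detector R n (ring_level s)"
 unfolding ring_detector_def
proof (intro conjI allI impI)
 show "approx (rect (- n) n (- n) n) (ring_level s)"
  by (rule approx_mono[OF approx_ring_level[OF assms(1)]]) (use assms in \<open>auto simp: rect_def\<close>)
qed (use assms less_ring_level in auto)

lemma ring_detector_max:
 assumes "ring_detector R n V" "ring_detector R n' V'" "n <= n'"
 shows "ring_detector R n' (%h. max (V h) (V' h))"
 unfolding ring_detector_def
proof (intro conjI allI impI)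
 show "approx (rect (- n') n' (- n') n') (%h. max (V h) (V' h))"
  by (rule approx_mono[OF approx_max[of "rect (- n) n (- n) n" _ "rect (- n') n' (- n') n'"]])
   (use assms in \<open>auto simp: ring_detector_def rect_def\<close>)
 fix h :: "plane => real" assume h: "continuous_on UNIV h" "0 < max (V h) (V' h)"
 then consider "0 < V h" | "0 < V' h" by (auto simp: max_def split: if_splits)
 thus "EX s>=R. 0 < s & 3 * s <= n' & ring s {x. 0 < h x}"
 proof cases
  case 1
  then obtain s where "R <= s" "0 < s" "3 * s <= n" "ring s {x. 0 < h x}" using assms(1) h(1) by (auto simp: ring_detector_def)
  thus ?thesis using assms(3) by (intro exI[of _ s]) auto
 next
  case 2 thus ?thesis using assms(2) h(1) by (auto simp: ring_detector_def)
 qed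
qed (use assms in \<open>auto simp: ring_detector_def\<close>)

text \<open>Adding an independent-looking ring multiplies the failure probability by at most \<open>1 - c / 2\<close>.\<close>

lemma ring_detector_step:
 "EX c>0. c <= 1 & (ALL R n V x. ring_detector R n V --> 0 < x --> (EX n' V'. ring_detector R n' V' &
   prob {w\<in>space M. val V' w <= 0} <= (prob {w\<in>space M. val V w <= 0} + x) * (1 - c / 2) + x))"
proof -
 obtain c0 where c0: "c0 > 0" "!!R. EX s>=R. 0 < s & c0 <= H (3 * s) s 0" using weak_rsw by blast
 define c where "c = c0 ^ 4"
 obtain C where C: "C >= 0" "!!x r. 0 < r ==> r <= norm x ==> \<kappa> x <= C / r ^ 4" using kappa_far by blast
 obtain C' where C': "C' >= 0" "!!n D V a b. n >= 1 ==> approx D V ==> D <= rect (- n) n (- n) n ==> a < b ==>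
   prob {w\<in>space M. a <= val V w & val V w <= b} <= C' * n^2 * (b - a)" using density by blast
 have c: "0 < c" "c <= 1"
 proof -
  show "0 < c" using c0 by (simp add: c_def)
  obtain s where "c0 <= H (3 * s) s 0" using c0(2)[of 0] by blast
  hence "c0 <= 1" unfolding H_def using prob_le_1 by (rule order_trans)
  thus "c <= 1" unfolding c_def using c0(1) by (intro power_le_one) auto
 qed
 have thick: "prob {w\<in>space M. val V w <= e} <= prob {w\<in>space M. val V w <= 0} + C' * n^2 * e"
  if n: "n >= 1" and V: "approx D V" "D <= rect (- n) n (- n) n" and e: "e > 0" for n D V e
 proof -
  note [measurable] = approx_rv[OF V(1)]
  have "prob {w\<in>space M. val V w <= e} <= prob ({w\<in>space M. val V w <= 0} Un {w\<in>space M. 0 <= val V w & val V w <= e})"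
   by (intro finite_measure_mono) auto
  also have "... <= prob {w\<in>space M. val V w <= 0} + prob {w\<in>space M. 0 <= val V w & val V w <= e}"
   by (intro measure_Un_le) auto
  finally show ?thesis using C'(2)[OF n V e] by simp
 qed
 have "EX n' V'. ring_detector R n' V' &
   prob {w\<in>space M. val V' w <= 0} <= (prob {w\<in>space M. val V w <= 0} + x) * (1 - c / 2) + x"
  if V: "ring_detector R n V" and x: "0 < x" for R n V x
 proof -
  have n: "n >= 1" and aV: "approx (rect (- n) n (- n) n) V" using V by (auto simp: ring_detector_def)
  define e where "e = x / (C' * n^2 + 1)"
  have Cn: "C' * n^2 + 1 > 0" using C' by (simp add: add_nonneg_pos)
  have e: "e > 0" using x Cn by (simp add: e_def)
  have "C' * n^2 * e <= (C' * n^2 + 1) * e" using e by (intro mult_right_mono) auto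
  hence pe: "prob {w\<in>space M. val V w <= e} <= prob {w\<in>space M. val V w <= 0} + x"
   using thick[OF n aV subset_refl e] Cn by (simp add: e_def)
  define D where "D = 9 * C' + 1"
  have D: "D > 0" "9 * C' <= D" using C' by (auto simp: D_def)
  \<comment> \<open>Chosen so that the decoupling error computed in \<open>err\<close> equals
    \<open>A * x / s^2\<close>; with \<open>s\<close> at least \<open>A\<close> and 1 it is at most
    \<open>x\<close>.\<close>
  define A where "A = 64 * C * D / (c * e * x)"
  obtain s0 where s0: "2 * max (max R (2 * n)) A <= s0" "0 < s0" "c0 <= H (3 * s0) s0 0" using c0(2) by blast
  define s where "s = s0 / 2"
  have s: "R <= s" "2 * n <= s" "A <= s" "0 < s" "1 <= s" using s0 n by (auto simp: s_def)
  let ?D = "{z : rect (- 3 * s) (3 * s) (- 3 * s) (3 * s). s <= max \<bar>z $ 1\<bar> \<bar>z $ 2\<bar>}"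
  \<comment> \<open>A shift of order \<open>s^-2\<close>: \<open>D\<close> exceeds
    \<open>9 * C'\<close>, so anti-concentration in the box of size \<open>3 * s\<close> costs at
    most \<open>c / 2\<close>, while the kernel of order \<open>s^-4\<close> still leaves a small
    decoupling error.\<close>
  define e' where "e' = c / (2 * D * s^2)"
  have e': "e' > 0" using c D s by (auto simp: e'_def intro!: divide_pos_pos mult_pos_pos)
  note aR = approx_ring_level[OF s(4)]
  have DR: "?D <= rect (- (3 * s)) (3 * s) (- (3 * s)) (3 * s)" by (auto simp: rect_def)
  note [measurable] = approx_rv[OF aV] approx_rv[OF aR]
  have "c <= prob {w\<in>space M. 0 < val (ring_level s) w}"
   unfolding c_def by (rule prob_ring) (use s s0 c0 in \<open>auto simp: s_def\<close>)
  moreover have "prob {w\<in>space M. val (ring_level s) w <= 0} = 1 - prob {w\<in>space M. 0 < val (ring_level s) w}"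
   by (subst prob_neg[symmetric]) (auto simp: not_less)
  moreover have "C' * (3 * s)^2 * e' <= c / 2"
  proof -
   have "C' * (3 * s)^2 * e' = (9 * C') / D * (c / 2)"
    using s D by (simp add: e'_def power_mult_distrib field_simps)
   also have "... <= 1 * (c / 2)" using D c by (intro mult_right_mono) auto
   finally show ?thesis by simp
  qed
  ultimately have pe': "prob {w\<in>space M. val (ring_level s) w <= e'} <= 1 - c / 2"
   using thick[OF _ aR DR e'] s by simp
  let ?k = "C / (s / 2) ^ 4"
  have far: "\<kappa> (y - z) <= ?k" if "y : rect (- n) n (- n) n" "z : ?D" for y z
  proof (rule C(2))
   have yz: "\<bar>y $ 1\<bar> <= n" "\<bar>y $ 2\<bar> <= n" "s <= \<bar>z $ 1\<bar> | s <= \<bar>z $ 2\<bar>"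
    using that by (auto simp: rect_def abs_le_iff le_max_iff_disj)
   have "s / 2 <= \<bar>y $ 1 - z $ 1\<bar>" if "s <= \<bar>z $ 1\<bar>" using that yz(1) s(2) by linarith
   moreover have "s / 2 <= \<bar>y $ 2 - z $ 2\<bar>" if "s <= \<bar>z $ 2\<bar>" using that yz(2) s(2) by linarith
   ultimately have "s / 2 <= \<bar>(y - z) $ 1\<bar> | s / 2 <= \<bar>(y - z) $ 2\<bar>" using yz(3) by auto
   thus "s / 2 <= norm (y - z)" using component_le_norm_cart[of "y - z"] by (meson order_trans)
  qed (use s in simp)
  have err: "2 * ?k / (e * e') <= x"
  proof -
   have "2 * ?k / (e * e') = A * x / s^2"
    using s e c x D by (simp add: A_def e'_def field_simps power2_eq_square power4_eq_xxxx)
   also have "... <= s * x / s^2" using s x by (intro divide_right_mono mult_right_mono) auto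
   also have "... = x / s" using s by (simp add: power2_eq_square)
   also have "... <= x" using s x by (simp add: field_simps)
   finally show ?thesis .
  qed
  let ?V = "%h. max (V h) (ring_level s h)"
  have "ring_detector R (3 * s) ?V" by (rule ring_detector_max[OF V ring_detector_level]) (use s n in auto)
  moreover have "{w\<in>space M. val ?V w <= 0} = {w\<in>space M. val V w <= 0 & val (ring_level s) w <= 0}"
   by (auto simp: val_def)
  moreover have "prob {w\<in>space M. val V w <= 0 & val (ring_level s) w <= 0}
   <= prob {w\<in>space M. val V w <= 0 + e} * prob {w\<in>space M. val (ring_level s) w <= 0 + e'} + 2 * ?k / (e * e')"
   by (rule decouple[OF aV aR e e' far]) (use C in auto)
  moreover have "prob {w\<in>space M. val V w <= 0 + e} * prob {w\<in>space M. val (ring_level s) w <= 0 + e'}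
   <= (prob {w\<in>space M. val V w <= 0} + x) * (1 - c / 2)"
   using pe pe' x by (intro mult_mono) auto
  ultimately show ?thesis using err by (intro exI[of _ "3 * s"] exI[of _ ?V]) auto
 qed
 thus ?thesis using c by blast
qed

text \<open>The infimum \<open>u\<close> of the failure probabilities satisfies
  \<open>u <= (u + 2 * x) * (1 - c / 2) + x\<close> for every positive \<open>x\<close>, which
  forces \<open>u = 0\<close>.\<close>

lemma rings_bounded:
 assumes e: "e > 0"
 shows "EX n V. ring_detector R n V & prob {w\<in>space M. val V w <= 0} < e"
proof -
 from ring_detector_step obtain c where c': "0 < c & c <= 1 & (ALL R n V x. ring_detector R n V --> 0 < x --> (EX n' V'. ring_detector R n' V' &
   prob {w\<in>space M. val V' w <= 0} <= (prob {w\<in>space M. val V w <= 0} + x) * (1 - c / 2) + x))" ..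
 note c = c'[THEN conjunct1] c'[THEN conjunct2, THEN conjunct1] c'[THEN conjunct2, THEN conjunct2, rule_format]
 define F where "F = {prob {w\<in>space M. val V w <= 0} | n V. ring_detector R n V}"
 have "ring_detector R (3 * max R 1) (ring_level (max R 1))" by (rule ring_detector_level) auto
 hence ne: "F ~= {}" by (auto simp: F_def)
 have bd: "bdd_below F" by (rule bdd_belowI[of _ 0]) (auto simp: F_def)
 define u where "u = Inf F"
 have u0: "0 <= u" unfolding u_def by (rule cInf_greatest[OF ne]) (auto simp: F_def)
 have "u * (c / 6) <= 0 + x" if x: "x > 0" for x
 proof -
  obtain p where "p : F" "p < u + x" using cInf_lessD[OF ne, of "u + x"] x by (auto simp: u_def)
  then obtain n V where V: "ring_detector R n V" "prob {w\<in>space M. val V w <= 0} < u + x" by (auto simp: F_def)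
  obtain n' V' where V': "ring_detector R n' V'"
   "prob {w\<in>space M. val V' w <= 0} <= (prob {w\<in>space M. val V w <= 0} + x) * (1 - c / 2) + x"
   using c(3)[OF V(1) x] by blast
  have "u <= prob {w\<in>space M. val V' w <= 0}" unfolding u_def using V'(1) by (intro cInf_lower[OF _ bd]) (auto simp: F_def)
  also have "... <= (prob {w\<in>space M. val V w <= 0} + x) * (1 - c / 2) + x" by (rule V'(2))
  also have "... <= (u + 2 * x) * (1 - c / 2) + x" using V(2) c by (intro add_right_mono mult_right_mono) auto
  finally have "u * (c / 2) <= 3 * x - x * c" by (simp add: algebra_simps)
  moreover have "0 <= x * c" using x c by simp
  ultimately show ?thesis by simp
 qed
 hence "u * (c / 6) <= 0" by (rule field_le_epsilon)
 hence "u <= 0" using c by (simp add: mult_le_0_iff)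
 then obtain p where "p : F" "p < e" using cInf_lessD[OF ne, of e] e by (auto simp: u_def)
 thus ?thesis by (auto simp: F_def)
qed

lemma AE_rings: "AE w in M. ALL R::nat. EX s>=real R. 0 < s & ring s {x. 0 < X x w}"
proof (subst AE_all_countable, rule allI)
 fix R :: nat
 have "EX V. (EX n. ring_detector R n V) & prob {w\<in>space M. val V w <= 0} < 1 / real (Suc j)" for j
  using rings_bounded[of "1 / real (Suc j)" R] by auto
 then obtain V where V: "!!j. EX n. ring_detector R n (V j)" "!!j. prob {w\<in>space M. val (V j) w <= 0} < 1 / real (Suc j)"
  by metis
 have [measurable]: "val (V j) : bm M" for j using V(1)[of j] approx_rv by (auto simp: ring_detector_def)
 define N where "N = {w\<in>space M. ALL j. val (V j) w <= 0}"
 have [measurable]: "N : sets M" unfolding N_def by measurable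
 have "prob N <= 0 + x" if x: "x > 0" for x
 proof -
  obtain j where j: "1 / real (Suc j) < x" using reals_Archimedean[OF x] by (auto simp: inverse_eq_divide)
  have "prob N <= prob {w\<in>space M. val (V j) w <= 0}" by (intro finite_measure_mono) (auto simp: N_def)
  thus ?thesis using V(2)[of j] j by simp
 qed
 hence "prob N <= 0" by (rule field_le_epsilon)
 hence N: "N : null_sets M" by (simp add: emeasure_eq_measure null_sets_def antisym)
 show "AE w in M. EX s>=real R. 0 < s & ring s {x. 0 < X x w}"
 proof (rule AE_I'[OF N], rule subsetI)
  fix w assume w: "w : {w\<in>space M. \<not> (EX s>=real R. 0 < s & ring s {x. 0 < X x w})}"
  have "val (V j) w <= 0" for j
  proof (rule ccontr)
   assume "\<not> ?thesis"
   hence "0 < V j (%x. X x w)" by (simp add: val_def)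
   moreover obtain n where "ring_detector R n (V j)" using V(1) by blast
   ultimately show False using w cont[of w] by (auto simp: ring_detector_def)
  qed
  thus "w : N" using w by (simp add: N_def)
 qed
qed

lemma ring_blocks_component:
 assumes ring: "ring s {x. \<not> P x}" "0 < s" and cl: "closed {x. P x}" and C: "C : components {x. P x}"
  and x: "x : C" "max \<bar>x $ 1\<bar> \<bar>x $ 2\<bar> <= s" and y: "y : C" "3 * s <= max \<bar>y $ 1\<bar> \<bar>y $ 2\<bar>"
 shows False
proof -
 obtain K where K: "compact K" "K <= {x. \<not> P x}" "ring s K" using ring_compact[OF ring] by blast
 have "C Int K ~= {}"
  using connected_meets_ring[OF K(1,3) ring(2) in_components_connected[OF C] closed_components[OF cl C] x y] .
 thus False using K(2) in_components_subset[OF C] by blast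
qed

text \<open>The negated field has the same properties, so \<open>{X < 0}\<close> contains rings at
  arbitrarily large scales. They block \<open>{X >= q}\<close> for all \<open>q >= 0\<close> outside
  a single null set.\<close>

lemma no_unbounded:
 "AE w in M. ALL q>=0. unbounded_components {x. q <= X x w} = {}"
proof -
 have neg: "continuous_gaussian_field M (%x w. - 1 * X (id x) w) \<kappa>" by (rule transform) auto
 then interpret Y: continuous_gaussian_field M "%x w. - X x w" \<kappa> by simp
 from Y.AE_rings AE_space show ?thesis
 proof eventually_elim
  case (elim w)
  show ?case
  proof (intro allI impI)
   fix q :: real assume q: "0 <= q"
   have cl: "closed {x. q <= X x w}" by (intro closed_Collect_le continuous_on_const cont elim(2))
   show "unbounded_components {x. q <= X x w} = {}"
   proof (rule ccontr)
    assume "\<not> ?thesis"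
    then obtain C where C: "C : components {x. q <= X x w}" "\<not> bounded C" by (auto simp: unbounded_components_def)
    obtain x where x: "x : C" using C by (metis all_not_in_conv bounded_empty)
    obtain R :: nat where R: "max \<bar>x $ 1\<bar> \<bar>x $ 2\<bar> <= real R" using real_arch_simple by blast
    obtain s where s: "real R <= s" "0 < s" "ring s {x. 0 < - X x w}" using elim(1) by blast
    obtain y where y: "y : C" "3 * s <= max \<bar>y $ 1\<bar> \<bar>y $ 2\<bar>" using component_beyond[OF C(2)] by blast
    have "ring s {x. \<not> q <= X x w}" by (rule ring_mono[OF s(3)]) (use q in auto)
    from ring_blocks_component[OF this s(2) cl C(1) x _ y] R s(1) show False by simp
   qed
  qed
 qed
qed

end

subsection \<open>The sharp threshold\<close>

lemma sum_inverse_squares_nat: "(\<Sum>m<N. 1 / (1 + real m)^2) <= 2 - 1 / real N"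
proof (induction N)
 case (Suc N)
 have "1 / (1 + real N)^2 <= 1 / real N - 1 / real (Suc N)" if "N > 0"
 proof -
  have "1 / (1 + real N)^2 <= 1 / (real N * (1 + real N))"
   using that by (intro divide_left_mono mult_pos_pos) (auto simp: power2_eq_square intro!: mult_right_mono)
  also have "... = 1 / real N - 1 / real (Suc N)" using that by (simp add: field_simps)
  finally show ?thesis .
 qed
 thus ?case using Suc by (cases "N = 0") auto
qed simp

lemma sum_inverse_squares_int:
 assumes "finite F"
 shows "(\<Sum>j\<in>F. 1 / (1 + \<bar>real_of_int (i - j)\<bar>)^2) <= 4"
proof -
 have half: "(\<Sum>j\<in>F'. 1 / (1 + \<bar>real_of_int (i - j)\<bar>)^2) <= 2"
  if F': "F' <= F" and inj: "inj_on (%j. nat \<bar>i - j\<bar>) F'" for F'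
 proof -
  have fin: "finite F'" using F' assms finite_subset by blast
  then obtain N where N: "(%j. nat \<bar>i - j\<bar>) ` F' <= {..<N}" using finite_nat_bounded by blast
  have "(\<Sum>j\<in>F'. 1 / (1 + \<bar>real_of_int (i - j)\<bar>)^2) = (\<Sum>m\<in>(%j. nat \<bar>i - j\<bar>) ` F'. 1 / (1 + real m)^2)"
   by (subst sum.reindex[OF inj]) simp
  also have "... <= (\<Sum>m<N. 1 / (1 + real m)^2)" using N by (intro sum_mono2) auto
  also have "... <= 2 - 1 / real N" by (rule sum_inverse_squares_nat)
  finally show ?thesis by (simp add: order_trans)
 qed
 have "(\<Sum>j\<in>F. 1 / (1 + \<bar>real_of_int (i - j)\<bar>)^2)
  = (\<Sum>j\<in>{j\<in>F. i <= j}. 1 / (1 + \<bar>real_of_int (i - j)\<bar>)^2) + (\<Sum>j\<in>{j\<in>F. j < i}. 1 / (1 + \<bar>real_of_int (i - j)\<bar>)^2)"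
  using assms by (subst sum.union_disjoint[symmetric]) (auto intro!: sum.cong)
 also have "... <= 2 + 2" by (intro add_mono half) (auto simp: inj_on_def)
 finally show ?thesis by simp
qed

text \<open>Only the deviations of the mean from the two atoms are kept. Cauchy-Schwarz bounds their
  contribution from below in terms of \<open>c0 * q0\<close>, with \<open>c0 + q0\<close> bounded
  crudely by 2.\<close>

lemma (in prob_space) two_values:
 assumes [measurable]: "Z : bm M" and Z: "!!w. 0 <= Z w" "!!w. Z w <= 1"
  and c: "0 <= c" "c <= prob {w\<in>space M. Z w = 0}" and q: "0 <= q" "q <= prob {w\<in>space M. Z w = 1}"
 shows "c * q / 2 <= (LINT w|M. (Z w)^2) - (LINT w|M. Z w)^2"
proof -
 define m where "m = (LINT w|M. Z w)"
 define c0 where "c0 = prob {w\<in>space M. Z w = 0}"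
 define q0 where "q0 = prob {w\<in>space M. Z w = 1}"
 have i: "integrable M Z" "integrable M (%w. (Z w)^2)"
  using Z by (auto intro!: integrable_unit[of _ 1] power_le_one)
 have ex: "(Z w - m)^2 = (Z w)^2 - 2 * m * Z w + m^2" for w by (simp add: power2_eq_square algebra_simps)
 have "m^2 * c0 + (1 - m)^2 * q0 = (LINT w|M. m^2 * indicator {w\<in>space M. Z w = 0} w + (1 - m)^2 * indicator {w\<in>space M. Z w = 1} w)"
  unfolding c0_def q0_def by (subst Bochner_Integration.integral_add) (auto intro!: integrable_mult_right integrable_unit[of _ 1])
 also have "... <= (LINT w|M. (Z w - m)^2)"
 proof (rule integral_mono)
  show "integrable M (%w. (Z w - m)^2)" unfolding ex using i by simp
  show "integrable M (%w. m^2 * indicator {w\<in>space M. Z w = 0} w + (1 - m)^2 * indicator {w\<in>space M. Z w = 1} w)"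
   by (intro Bochner_Integration.integrable_add integrable_mult_right integrable_unit[of _ 1]) auto
  show "m^2 * indicator {w\<in>space M. Z w = 0} w + (1 - m)^2 * indicator {w\<in>space M. Z w = 1} w <= (Z w - m)^2" for w
   by (auto simp: indicator_def)
 qed
 also have "... = (LINT w|M. (Z w)^2) - m^2"
  unfolding ex using i by (simp add: m_def prob_space power2_eq_square)
 finally have 1: "m^2 * c0 + (1 - m)^2 * q0 <= (LINT w|M. (Z w)^2) - m^2" .
 have "c0 * q0 <= (c0 + q0) * (m^2 * c0 + (1 - m)^2 * q0)"
 proof -
  have "(c0 + q0) * (m^2 * c0 + (1 - m)^2 * q0) - c0 * q0 = (c0 * m - q0 * (1 - m))^2"
   by (simp add: power2_eq_square algebra_simps)
  thus ?thesis by (metis diff_ge_0_iff_ge zero_le_power2)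
 qed
 also have "... <= 2 * (m^2 * c0 + (1 - m)^2 * q0)"
 proof (rule mult_right_mono)
  show "c0 + q0 <= 2" using prob_le_1[of "{w\<in>space M. Z w = 0}"] prob_le_1[of "{w\<in>space M. Z w = 1}"] unfolding c0_def q0_def by linarith
 qed (simp add: c0_def q0_def)
 finally have "c0 * q0 <= 2 * (m^2 * c0 + (1 - m)^2 * q0)" .
 moreover have "c * q <= c0 * q0" using c q by (intro mult_mono) (auto simp: c0_def q0_def)
 ultimately show ?thesis using 1 by (simp add: m_def)
qed

context continuous_gaussian_field
begin

text \<open>A ring of the negated field around \<open>v\<close>, of scale at least 1 and within
  distance \<open>n\<close>, prevents a path in \<open>{X > 0}\<close> from \<open>A\<close> to
  \<open>E\<close>. Translation and sign change preserve the law, so a detector built at the origin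
  serves around every point.\<close>

lemma arm_bound:
 fixes v :: plane
 assumes V: "ring_detector 1 n V" and Q: "admissible Q A E"
  and A: "!!z. z : A ==> \<bar>z $ 1 - v $ 1\<bar> <= 1 & \<bar>z $ 2 - v $ 2\<bar> <= 1" and E: "!!z. z : E ==> n <= \<bar>z $ 1 - v $ 1\<bar>"
 shows "prob {w\<in>space M. 0 < val (level Q A E) w} <= prob {w\<in>space M. val V w <= 0}"
proof -
 have inj: "inj (%x::plane. x + v)" by (simp add: inj_def)
 have "continuous_gaussian_field M (%x w. - 1 * X (x + v) w) \<kappa>"
  by (rule transform[OF inj]) (auto intro!: continuous_intros)
 then interpret Y: continuous_gaussian_field M "%x w. - X (x + v) w" \<kappa> by simp
 have aV: "approx (rect (- n) n (- n) n) V" using V by (simp add: ring_detector_def)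
 note [measurable] = approx_rv[OF aV] Y.approx_rv[OF aV]
 have "prob {w\<in>space M. 0 < val (level Q A E) w} <= prob {w\<in>space M. Y.val V w <= 0}"
 proof (rule finite_measure_mono)
  show "{w\<in>space M. 0 < val (level Q A E) w} <= {w\<in>space M. Y.val V w <= 0}"
  proof
   fix w assume "w : {w\<in>space M. 0 < val (level Q A E) w}"
   hence sp: "w : space M" and j: "joined Q A E {x. 0 < X x w}"
    using crossing_level[OF Q, of 0] by (auto simp: crossing_def)
   obtain x y where xy: "x : A" "y : E" "pc (Q Int {x. 0 < X x w}) x y" using j by (auto simp: joined_def)
   have "\<not> 0 < Y.val V w"
   proof
    assume "0 < Y.val V w"
    then obtain s where s: "1 <= s" "3 * s <= n" "ring s {x. 0 < - X (x + v) w}"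
     using V Y.cont[OF sp] by (auto simp: ring_detector_def Y.val_def)
    have "pc ((%z. z - v) ` (Q Int {x. 0 < X x w})) (x - v) (y - v)"
     by (rule path_component_continuous_image[OF xy(3)]) (intro continuous_intros)
    from ring_blocks[OF s(3) _ this] obtain z where "z : (%z. z - v) ` (Q Int {x. 0 < X x w})" "z : {x. 0 < - X (x + v) w}"
     using A[OF xy(1)] E[OF xy(2)] s by fastforce
    thus False by auto
   qed
   thus "w : {w\<in>space M. Y.val V w <= 0}" using sp by simp
  qed
 qed simp
 also have "... = 1 - prob {w\<in>space M. 0 < Y.val V w}" by (subst prob_neg[symmetric]) (auto simp: not_less)
 also have "prob {w\<in>space M. 0 < Y.val V w} = prob {w\<in>space M. 0 < val V w}"
  using same_law[OF Y.continuous_gaussian_field_axioms aV] by (simp add: Y.val_def)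
 also have "1 - ... = prob {w\<in>space M. val V w <= 0}" by (subst prob_neg[symmetric]) (auto simp: not_less)
 finally show ?thesis .
qed

section \<open>Unit cells and the superconcentration of crossing levels\<close>

definition cell :: "plane => int \<times> int" where
 "cell z = (\<lfloor>z $ 1\<rfloor>, \<lfloor>z $ 2\<rfloor>)"

text \<open>A product weight with finite sum over the planar lattice, just dominating fourth-order
  decay since \<open>(1 + a)^2 * (1 + b)^2\<close> is at most
  \<open>(1 + max a b)^4\<close>.\<close>

definition cell_weight :: "int \<times> int => int \<times> int => real" where
 "cell_weight i j = 1 / (1 + \<bar>real_of_int (fst i - fst j)\<bar>)^2 * (1 / (1 + \<bar>real_of_int (snd i - snd j)\<bar>)^2)"

lemma kappa_cell: "EX C>0. ALL x y. \<kappa> (x - y) <= C * cell_weight (cell x) (cell y)"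
proof -
 obtain C where C: "C >= 0" "!!x r. 0 < r ==> r <= norm x ==> \<kappa> x <= C / r ^ 4" using kappa_far by blast
 have "\<kappa> (x - y) <= (81 * C + 16) * cell_weight (cell x) (cell y)" for x y
 proof -
  define a where "a = \<bar>\<lfloor>x $ 1\<rfloor> - \<lfloor>y $ 1\<rfloor>\<bar>"
  define b where "b = \<bar>\<lfloor>x $ 2\<rfloor> - \<lfloor>y $ 2\<rfloor>\<bar>"
  define m where "m = max a b"
  have ab: "0 <= a" "0 <= b" "a <= m" "b <= m" by (auto simp: a_def b_def m_def)
  have "(1 + real_of_int a)^2 * (1 + real_of_int b)^2 <= (1 + real_of_int m)^2 * (1 + real_of_int m)^2"
   using ab by (intro mult_mono power_mono) auto
  also have "... = (1 + real_of_int m) ^ 4" by (simp add: power_add[symmetric])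
  finally have "1 / (1 + real_of_int m) ^ 4 <= 1 / ((1 + real_of_int a)^2 * (1 + real_of_int b)^2)"
   using ab by (intro divide_left_mono mult_pos_pos zero_less_power) auto
  also have "... = cell_weight (cell x) (cell y)" by (simp add: cell_weight_def cell_def a_def b_def)
  finally have w: "1 / (1 + real_of_int m) ^ 4 <= cell_weight (cell x) (cell y)" .
  \<comment> \<open>For \<open>m <= 1\<close> the kernel is at most 1 and \<open>(1 + m)^4\<close>
    at most 16. For \<open>m >= 2\<close> the distance is at least \<open>m - 1\<close>, which is at
    least \<open>(1 + m) / 3\<close>; the fourth power of 3 gives 81.\<close>
  have "\<kappa> (x - y) <= (81 * C + 16) * (1 / (1 + real_of_int m) ^ 4)"
  proof (cases "m <= 1")
   case True
   have "(1 + real_of_int m) ^ 4 <= 2 ^ 4" using True ab by (intro power_mono) auto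
   hence "1 <= 16 * (1 / (1 + real_of_int m) ^ 4)" using ab by (simp add: field_simps)
   also have "... <= (81 * C + 16) * (1 / (1 + real_of_int m) ^ 4)" using C ab by (intro mult_right_mono) auto
   finally show ?thesis using kappa_le[of "x - y"] by linarith
  next
   case False
   let ?r = "(1 + real_of_int m) / 3"
   have fl: "real_of_int \<bar>\<lfloor>u\<rfloor> - \<lfloor>t\<rfloor>\<bar> - 1 <= \<bar>u - t\<bar>" for u t :: real by linarith
   have "real_of_int m - 1 <= \<bar>(x - y) $ 1\<bar> | real_of_int m - 1 <= \<bar>(x - y) $ 2\<bar>"
    using fl[of "x $ 1" "y $ 1"] fl[of "x $ 2" "y $ 2"] by (auto simp: m_def a_def b_def max_def)
   hence "real_of_int m - 1 <= norm (x - y)" using component_le_norm_cart[of "x - y"] by (meson order_trans)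
   moreover have "2 <= real_of_int m" using False by linarith
   hence "?r <= real_of_int m - 1" by simp
   ultimately have "\<kappa> (x - y) <= C / ?r ^ 4" using ab by (intro C(2)) auto
   also have "... = 81 * C * (1 / (1 + real_of_int m) ^ 4)" by (simp add: power_divide)
   also have "... <= (81 * C + 16) * (1 / (1 + real_of_int m) ^ 4)" using ab by (intro mult_right_mono) auto
   finally show ?thesis .
  qed
  also have "... <= (81 * C + 16) * cell_weight (cell x) (cell y)" using w C by (intro mult_left_mono) auto
  finally show ?thesis .
 qed
 thus ?thesis using C by (intro exI[of _ "81 * C + 16"]) auto
qed

text \<open>The site selected by a crossing is joined to the side of the rectangle that is farther away.\<close>

lemma pivotal_bound:
 assumes V: "ring_detector 1 n V" "prob {w\<in>space M. val V w <= 0} < e" and s: "2 * n <= s" and p: "0 < p"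
  and S: "net (rect 0 s 0 (3 * s)) S"
 defines "L \<equiv> grid_level S (rect 0 0 0 (3 * s)) (rect s s 0 (3 * s))"
 shows "\<forall>\<^sub>F m in sequentially. prob {w\<in>space M. p / 2 < L m (%s. X s w) & L m (%s. X s w) < p &
   (EX z:S m. cell z = i & X z w = L m (%s. X s w))} <= e" (is "\<forall>\<^sub>F m in _. prob (?P m) <= e")
proof (cases "EX z:rect 0 s 0 (3 * s). cell z = i")
 case False
 hence "?P m = {}" for m using S by (auto simp: net_def)
 moreover have "0 <= e" using V(2) measure_nonneg[of M "{w\<in>space M. val V w <= 0}"] by linarith
 ultimately have "prob (?P m) <= e" for m by (simp only: measure_empty)
 thus ?thesis by (intro always_eventually allI)
next
 case True
 let ?Q = "rect 0 s 0 (3 * s)" and ?A = "rect 0 0 0 (3 * s)" and ?B = "rect s s 0 (3 * s)"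
 have s0: "0 < s" using s V(1) by (simp add: ring_detector_def)
 have adm: "admissible ?Q ?A ?B" using s0 by (intro admissible_lr) auto
 define A' where "A' = {z\<in>?Q. cell z = i}"
 \<comment> \<open>The side at horizontal distance at least \<open>s / 2\<close> from the cell
   corner, hence at least \<open>n\<close>.\<close>
 define E where "E = (if s / 2 <= real_of_int (fst i) then ?A else ?B)"
 define v where "v = (vector [real_of_int (fst i), real_of_int (snd i)] :: plane)"
 have adm': "admissible ?Q A' E" using adm True by (auto simp: admissible_def A'_def E_def)
 have "prob {w\<in>space M. 0 < val (level ?Q A' E) w} <= prob {w\<in>space M. val V w <= 0}"
 proof (rule arm_bound[OF V(1) adm', where v = v])
  show "\<bar>z $ 1 - v $ 1\<bar> <= 1 & \<bar>z $ 2 - v $ 2\<bar> <= 1" if "z : A'" for z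
  proof -
   have "fst i = \<lfloor>z $ 1\<rfloor>" "snd i = \<lfloor>z $ 2\<rfloor>" using that by (auto simp: A'_def cell_def)
   thus ?thesis unfolding v_def by simp linarith
  qed
  show "n <= \<bar>z $ 1 - v $ 1\<bar>" if "z : E" for z using that s by (auto simp: E_def v_def rect_def split: if_splits)
 qed
 hence lt: "prob {w\<in>space M. 0 < val (level ?Q A' E) w} < e" using V(2) by linarith
 let ?L' = "grid_level S A' E"
 have Qc: "compact ?Q" "convex ?Q" by simp_all
 note g = grid_level[OF S Qc, of ?A ?B, folded L_def] and g' = grid_level[OF S Qc, of A' E]
 have adm1: "?A <= ?Q" "?B <= ?Q" "?A ~= {}" "?B ~= {}" and adm2: "A' <= ?Q" "E <= ?Q" "A' ~= {}" "E ~= {}"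
  using adm adm' by (auto simp: admissible_def)
 note g = g[OF adm1] and g' = g'[OF adm2]
 note aL = approx_admissible[OF adm']
 note [measurable] = approx_rv[OF aL] selector_rv[OF g'(1)]
 have le: "prob (?P m) <= (LINT w|M. rise (p / 4) (p / 4) (val (?L' m) w))" for m
 proof -
  have fin: "finite (S m)" using S by (simp add: net_def)
  have "val (L m) : bm M" by (rule selector_rv[OF g(1)])
  hence [measurable]: "(%w. L m (%s. X s w)) : bm M" by (simp add: val_def[abs_def])
  have Ps[measurable]: "?P m : sets M" using fin by measurable
  have "prob (?P m) = (LINT w|M. indicator (?P m) w)"
   by (simp only: Bochner_Integration.integral_indicator Int_absorb2[OF sets.sets_into_space[OF Ps]])
  also have "... <= (LINT w|M. rise (p / 4) (p / 4) (val (?L' m) w))"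
  proof (rule integral_mono_AE)
   show "integrable M (indicat_real (?P m))"
    by (rule integrable_unit[of _ 1]) (rule borel_measurable_indicator[OF Ps], simp add: indicator_def)
   show "integrable M (%w. rise (p / 4) (p / 4) (val (?L' m) w))" using rise_unit by (intro integrable_unit[of _ 1]) auto
   have "AE w in M. ALL z:S m. ALL t:S m. z ~= t --> X z w ~= X t w"
    using fin AE_distinct by (intro AE_finite_allI) (auto intro!: AE_impI)
   thus "AE w in M. indicator (?P m) w <= rise (p / 4) (p / 4) (val (?L' m) w)"
   proof eventually_elim
    case (elim w)
    show ?case
    proof (cases "w : ?P m")
     case True
     define q where "q = L m (%s. X s w)"
     obtain z where z: "z : S m" "cell z = i" "X z w = q" and q: "p / 2 < q" using True by (auto simp: q_def)
     obtain U where U: "U : chains (S m) (1 / real (Suc m)) ?A ?B" "ALL s:U. q <= X s w"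
      using g(2)[of q m "%s. X s w"] by (auto simp: q_def)
     have US: "U <= S m" using U(1) by (auto simp: chains_def)
     \<comment> \<open>If an optimal chain avoided the selected site, all its values would differ
       from the level and so exceed it strictly; its minimum would then be a larger level.\<close>
     have "z : U"
     proof (rule ccontr)
      assume nz: "z ~: U"
      have gt: "q < X s w" if "s : U" for s
      proof -
       have "s ~= z" using that nz by auto
       from elim[rule_format, OF subsetD[OF US that] z(1) this] have "X s w ~= X z w" .
       thus ?thesis using U(2) that z(3) by (simp add: less_le)
      qed
      have fU: "finite U" by (rule finite_subset[OF US fin])
      have "U ~= {}" using U(1) by (auto simp: chains_def)
      define r where "r = (MIN s\<in>U. X s w)"
      have "r : (%s. X s w) ` U" unfolding r_def using fU `U ~= {}` by (intro Min_in) auto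
      hence "q < r" using gt by blast
      have "ALL s:U. r <= X s w" using fU by (simp add: r_def)
      hence "r <= q" using g(2)[of r m "%s. X s w"] U(1) by (auto simp: q_def)
      thus False using `q < r` by simp
     qed
     hence "U : chains (S m) (1 / real (Suc m)) {z} E" using chains_arm[OF U(1)] by (simp add: E_def)
     hence "U : chains (S m) (1 / real (Suc m)) A' E"
      using chains_mono[of "{z}" A' E E] z S by (auto simp: A'_def net_def)
     hence "q <= val (?L' m) w" using g'(2)[of q m "%s. X s w"] U(2) by (auto simp: val_def)
     hence "p / 4 + p / 4 <= val (?L' m) w" using q by simp
     hence "1 <= rise (p / 4) (p / 4) (val (?L' m) w)" using rise_bounds(1)[of "p / 4" "p / 4" "val (?L' m) w"] p by simp
     thus ?thesis by (rule order_trans[OF indicator_le_1])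
    next
     case False
     show ?thesis unfolding indicator_simps(2)[OF False] by (rule rise_unit)
    qed
   qed
  qed
  finally show ?thesis .
 qed
 have lim: "(%m. \<integral>w. rise (p / 4) (p / 4) (val (?L' m) w) \<partial>M) \<longlonglongrightarrow> (LINT w|M. rise (p / 4) (p / 4) (val (level ?Q A' E) w))"
  by (rule expectation_rise_limit(2)[OF aL aL g'(1,3) g'(1,3)])
 have "(LINT w|M. rise (p / 4) (p / 4) (val (level ?Q A' E) w)) <= (LINT w|M. indicator {w\<in>space M. 0 < val (level ?Q A' E) w} w)"
 proof (rule integral_mono)
  show "rise (p / 4) (p / 4) (val (level ?Q A' E) w) <= indicator {w\<in>space M. 0 < val (level ?Q A' E) w} w" if "w : space M" for w
   using rise_bounds(2)[of "p / 4" "p / 4" "val (level ?Q A' E) w"] rise_unit(2) p that by (auto simp: indicator_def split: if_splits)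
 qed (use rise_unit in \<open>auto intro!: integrable_unit[of _ 1]\<close>)
 also have "... < e" using lt by simp
 finally have "\<forall>\<^sub>F m in sequentially. (LINT w|M. rise (p / 4) (p / 4) (val (?L' m) w)) < e"
  by (rule order_tendstoD(2)[OF lim])
 thus ?thesis by eventually_elim (use le in \<open>meson less_imp_le order_trans\<close>)
qed

text \<open>The ramp between \<open>p / 2\<close> and \<open>p\<close> of the crossing level
  vanishes on noncrossing at level 0, which has probability at least \<open>c\<close> by duality,
  and is 1 on crossing at level \<open>p\<close>. By \<open>two_values\<close> its variance is at
  least \<open>c * H s (3 * s) p / 2\<close>, whereas superconcentration makes it at most
  \<open>c * t / 2\<close>. Starting the ramp above 0 keeps selected sites on arms of positive
  level.\<close>

lemma easy_crossing_small:
 assumes c: "0 < c" and p: "0 < p" and t: "0 < t"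
 shows "EX R. ALL s>=R. c <= H (3 * s) s 0 --> H s (3 * s) p <= t"
proof -
 obtain C where C: "C > 0" "!!x y. \<kappa> (x - y) <= C * cell_weight (cell x) (cell y)" using kappa_cell by blast
 \<comment> \<open>Clipping between \<open>p / 2\<close> and \<open>p\<close> rescales the ramp by
   \<open>p / 2\<close>; variance \<open>v\<close> of the clipped level is variance
   \<open>c * t / 2\<close> of the ramp.\<close>
 define v where "v = c * t * p^2 / 8"
 have v: "v > 0" using c p t by (simp add: v_def)
 define d where "d = min 1 (v / pi)"
 have d: "0 < d" "d <= 1" "d <= v / pi" using v by (auto simp: d_def)
 hence d: "0 < d" "d < pi / 2" "d <= v / pi" using pi_gt3 by auto
 have cosd: "0 <= cos d" "cos d < 1"
  using d cos_monotone_0_pi[of 0 d] by (auto intro: cos_ge_zero)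
 \<comment> \<open>Brings the correlation \<open>cos d\<close>, raised to \<open>2 ^ k >= k\<close>,
   below 1/2 and so into the hypercontractive range.\<close>
 obtain k where k: "cos d ^ k < 1 / 2" using real_arch_pow_inv[OF _ cosd(2), of "1 / 2"] by auto
 have k3: "3 * (cos d ^ (2 ^ k))^2 <= 1"
 proof -
  have "cos d ^ (2 ^ k) <= cos d ^ k" using cosd by (intro power_decreasing) (auto simp: less_imp_le)
  hence "(cos d ^ (2 ^ k))^2 <= (1 / 2)^2" using k cosd by (intro power_mono) auto
  thus ?thesis by (simp add: power2_eq_square)
 qed
 define l :: real where "l = 1 / 4 / 2 ^ k"
 have l: "l > 0" by (simp add: l_def)
 define W where "W = C * 16"
 have W: "W > 0" using C by (simp add: W_def)
 \<comment> \<open>Makes the cell term of \<open>clip_variance\<close> equal to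
   \<open>v / pi\<close>; the choice of \<open>d\<close> bounds the other term by the same amount,
   and \<open>pi / 2\<close> times the sum is \<open>v\<close>.\<close>
 define \<epsilon> where "\<epsilon> = (v / (pi * W)) powr (1 / l)"
 have \<epsilon>: "\<epsilon> > 0" "W * \<epsilon> powr l = v / pi" using v W l by (auto simp: \<epsilon>_def powr_powr)
 obtain n V where V: "ring_detector 1 n V" "prob {u\<in>space M. val V u <= 0} < \<epsilon>" using rings_bounded[OF \<epsilon>(1)] by blast
 have "H s (3 * s) p <= t" if s: "2 * n <= s" and hs: "c <= H (3 * s) s 0" for s
 proof -
  let ?Q = "rect 0 s 0 (3 * s)" and ?A = "rect 0 0 0 (3 * s)" and ?B = "rect s s 0 (3 * s)"
  have s0: "0 < s" using s V(1) by (simp add: ring_detector_def)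
  have adm: "admissible ?Q ?A ?B" using s0 by (intro admissible_lr) auto
  obtain S where S: "net ?Q S" using net_exists[of ?Q] by auto
  define L where "L = grid_level S ?A ?B"
  have g: "!!m. selector (S m) (L m)" "!!h. continuous_on UNIV h ==> (%m. L m h) \<longlonglongrightarrow> level ?Q ?A ?B h"
   unfolding L_def using adm by (auto simp: admissible_def intro!: grid_level(1,3)[OF S])
  define J where "J = {0..\<lfloor>s\<rfloor>} \<times> {0..\<lfloor>3 * s\<rfloor>}"
  have J: "finite J" by (simp add: J_def)
  let ?U = "val (level ?Q ?A ?B)"
  note ap = approx_admissible[OF adm]
  note [measurable] = approx_rv[OF ap]
  have "\<forall>\<^sub>F m in sequentially. ALL i:J. prob {u\<in>space M. p / 2 < L m (%s. X s u) & L m (%s. X s u) < p &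
   (EX z:S m. cell z = i & X z u = L m (%s. X s u))} <= \<epsilon>"
   unfolding L_def by (intro eventually_ball_finite[OF J] ballI pivotal_bound[OF V s p S])
  hence ev: "\<forall>\<^sub>F m in sequentially. (LINT u|M. rise (p / 2) (p / 2) (val (L m) u) * rise (p / 2) (p / 2) (val (L m) u))
   - (LINT u|M. rise (p / 2) (p / 2) (val (L m) u))^2 <= c * t / 2"
  proof eventually_elim
   case (elim m)
   have SQ: "S m <= ?Q" using S by (simp add: net_def)
   have "(LINT u|M. (clip (p / 2) p (L m) (%s. X s u))^2) - (LINT u|M. clip (p / 2) p (L m) (%s. X s u))^2
    <= pi / 2 * (sin d + W * \<epsilon> powr (1 / 4 / 2 ^ k))"
   proof (rule clip_variance[OF g(1), where \<pi> = cell and J = J and w = "%i j. C * cell_weight i j"])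
    show "cell z : J" if "z : S m" for z
     using SQ that by (auto simp: J_def cell_def rect_def intro!: floor_mono)
    show "(\<Sum>j\<in>J. C * cell_weight i j) <= W" for i
    proof -
     have "(\<Sum>j\<in>J. cell_weight i j) = (\<Sum>a\<in>{0..\<lfloor>s\<rfloor>}. 1 / (1 + \<bar>real_of_int (fst i - a)\<bar>)^2) * (\<Sum>b\<in>{0..\<lfloor>3 * s\<rfloor>}. 1 / (1 + \<bar>real_of_int (snd i - b)\<bar>)^2)"
      unfolding J_def sum_product sum.cartesian_product cell_weight_def by (intro sum.cong) auto
     also have "... <= 4 * 4" by (intro mult_mono sum_inverse_squares_int sum_nonneg) auto
     finally show ?thesis using C(1) by (simp add: W_def sum_distrib_left[symmetric])
    qed
    show "C * cell_weight i j = C * cell_weight j i" for i j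
    proof -
     have e: "\<bar>real_of_int (a - b)\<bar> = \<bar>real_of_int (b - a)\<bar>" for a b by simp
     show ?thesis unfolding cell_weight_def e[of "fst i"] e[of "snd i"] ..
    qed
   qed (use p C kappa_le d k3 elim J W in \<open>auto simp: cell_weight_def\<close>)
   also have "... <= pi / 2 * (v / pi + v / pi)"
    using \<epsilon>(2) d sin_x_le_x[of d] by (intro mult_left_mono add_mono) (auto simp: l_def)
   also have "... = v" by simp
   finally have le: "(LINT u|M. (clip (p / 2) p (L m) (%s. X s u))^2) - (LINT u|M. clip (p / 2) p (L m) (%s. X s u))^2 <= v" .
   let ?r = "%u. rise (p / 2) (p / 2) (val (L m) u)"
   note [measurable] = selector_rv[OF g(1)[of m]]
   have i: "integrable M ?r" "integrable M (%u. ?r u * ?r u)"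
    using rise_unit by (auto intro!: integrable_unit[of _ 1] mult_le_one simp: abs_mult)
   have cl: "clip (p / 2) p (L m) (%s. X s u) = p / 2 + p / 2 * ?r u" for u
    using rise_bounds(3)[of "p / 2" "p / 2" "val (L m) u"] p by (simp add: clip_def val_def)
   have ex: "(p / 2 + p / 2 * ?r u)^2 = p^2 / 4 + p^2 / 2 * ?r u + p^2 / 4 * (?r u * ?r u)" for u
    by (simp add: power2_eq_square algebra_simps)
   have eq: "(LINT u|M. (clip (p / 2) p (L m) (%s. X s u))^2) - (LINT u|M. clip (p / 2) p (L m) (%s. X s u))^2
    = p^2 / 4 * ((LINT u|M. ?r u * ?r u) - (LINT u|M. ?r u)^2)"
    unfolding cl ex using i by (simp add: prob_space power2_eq_square field_simps)
   have "p^2 / 4 * ((LINT u|M. ?r u * ?r u) - (LINT u|M. ?r u)^2) <= v" using le unfolding eq .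
   also have "v = p^2 / 4 * (c * t / 2)" by (simp add: v_def)
   finally show ?case by (rule mult_left_le_imp_le) (use p in simp)
  qed
  have "(LINT u|M. rise (p / 2) (p / 2) (?U u) * rise (p / 2) (p / 2) (?U u)) - (LINT u|M. rise (p / 2) (p / 2) (?U u))^2 <= c * t / 2"
   by (rule tendsto_upperbound[OF tendsto_diff[OF expectation_rise_limit(1)[OF ap ap g g] tendsto_power[OF expectation_rise_limit(2)[OF ap ap g g]]] ev sequentially_bot])
  moreover have "c * H s (3 * s) p / 2 <= (LINT u|M. (rise (p / 2) (p / 2) (?U u))^2) - (LINT u|M. rise (p / 2) (p / 2) (?U u))^2"
  proof (rule two_values)
   have Hs: "H s (3 * s) q = prob {u\<in>space M. q < ?U u}" for q
    using crossing_level[OF adm, of q] by (simp add: H_def Lr_crossing)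
   have "c <= 1 - H s (3 * s) 0" using H_duality[of s "3 * s" 0] hs s0 by simp
   also have "... = prob {u\<in>space M. ?U u <= 0}" unfolding Hs by (subst prob_neg[symmetric]) (auto simp: not_less)
   also have "... <= prob {u\<in>space M. rise (p / 2) (p / 2) (?U u) = 0}"
   proof (rule finite_measure_mono)
    show "{u\<in>space M. ?U u <= 0} <= {u\<in>space M. rise (p / 2) (p / 2) (?U u) = 0}"
     using p by (auto simp: rise_def divide_nonpos_pos)
   qed measurable
   finally show "c <= prob {u\<in>space M. rise (p / 2) (p / 2) (?U u) = 0}" .
   show "H s (3 * s) p <= prob {u\<in>space M. rise (p / 2) (p / 2) (?U u) = 1}" unfolding Hs
   proof (rule finite_measure_mono)
    show "{u\<in>space M. p < ?U u} <= {u\<in>space M. rise (p / 2) (p / 2) (?U u) = 1}"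
     using p by (auto simp: rise_def field_simps)
   qed measurable
  qed (use c rise_unit in \<open>auto simp: H_def\<close>)
  ultimately have "c * H s (3 * s) p <= c * t" by (simp add: power2_eq_square)
  thus ?thesis using c by simp
 qed
 thus ?thesis by blast
qed

lemma hard_crossing_likely:
 assumes "0 < p" "0 < d"
 shows "EX s>=R. 0 < s & 1 - d <= H (3 * s) s (- p)"
proof -
 obtain c where c: "c > 0" "!!R. EX s>=R. 0 < s & c <= H (3 * s) s 0" using weak_rsw by blast
 obtain R' where R': "!!s. R' <= s ==> c <= H (3 * s) s 0 ==> H s (3 * s) p <= d" using easy_crossing_small[OF c(1) assms] by blast
 obtain s where s: "max R R' <= s" "0 < s" "c <= H (3 * s) s 0" using c(2) by blast
 thus ?thesis using R'[of s] H_duality[of s "3 * s" p] by (intro exI[of _ s]) auto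
qed

end

subsection \<open>Renormalisation\<close>

lemma (in prob_space) inter_bound:
 assumes "Es ~= []" "!!E. E : set Es ==> E : sets M & 1 - x <= prob E"
 shows "\<Inter>(set Es) : sets M & 1 - real (length Es) * x <= prob (\<Inter>(set Es))"
 using assms
proof (induction Es rule: list_nonempty_induct)
 case (cons E Es)
 let ?F = "\<Inter>(set Es)"
 have F: "?F : sets M" "1 - real (length Es) * x <= prob ?F" and E: "E : sets M" "1 - x <= prob E" using cons by auto
 have "prob (E - ?F) = prob E - prob (E Int ?F)" by (rule finite_measure_Diff'[OF E(1) F(1)])
 moreover have "prob (E - ?F) <= prob (space M - ?F)"
  using E(1) F(1) sets.sets_into_space[OF E(1)] by (intro finite_measure_mono) auto
 moreover have "prob (space M - ?F) = 1 - prob ?F" by (rule prob_compl[OF F(1)])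
 ultimately show ?case using E F by (simp add: algebra_simps)
qed simp

context continuous_gaussian_field
begin

lemma strip_bound:
 assumes L: "0 < L"
 shows "prob {w\<in>space M. val (level (rect 0 (9 * L) y (y + L)) (rect 0 0 y (y + L)) (rect (9 * L) (9 * L) y (y + L))) w <= a}
  <= 7 * (1 - H (3 * L) L a)"
proof -
 let ?V = "level (rect 0 (9 * L) y (y + L)) (rect 0 0 y (y + L)) (rect (9 * L) (9 * L) y (y + L))"
 have adm: "admissible (rect 0 (9 * L) y (y + L)) (rect 0 0 y (y + L)) (rect (9 * L) (9 * L) y (y + L))"
  using L by (intro admissible_lr) auto
 note [measurable] = approx_rv[OF approx_admissible[OF adm]]
 define U where "U j = Lr (0 + real j * (2 * L)) (0 + real j * (2 * L) + 3 * L) y (y + L) a" for j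
 define T where "T j = Tb (0 + real (Suc j) * (2 * L)) (0 + real j * (2 * L) + 3 * L) y (y + L) a" for j
 \<comment> \<open>Four rectangles of length \<open>3 * L\<close> shifted by \<open>2 * L\<close>
   span \<open>9 * L\<close>, with three square overlaps of side \<open>L\<close>: seven events for
   the union bound.\<close>
 define Es where "Es = map U [0..<4] @ map T [0..<3]"
 have o: "0 + real (Suc j) * (2 * L) <= 0 + real j * (2 * L) + 3 * L" for j using L by (simp add: algebra_simps)
 have pU: "prob (U j) = H (3 * L) L a" "U j : sets M" for j unfolding U_def using L by (auto simp: prob_Lr)
 have pT: "H (3 * L) L a <= prob (T j)" "T j : sets M" for j
 proof -
  have d: "0 + real j * (2 * L) + 3 * L - (0 + real (Suc j) * (2 * L)) = L" by (simp add: algebra_simps)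
  have "prob (T j) = H (y + L - y) (0 + real j * (2 * L) + 3 * L - (0 + real (Suc j) * (2 * L))) a"
   unfolding T_def by (rule prob_Tb[OF o]) (use L in simp)
  hence "prob (T j) = H L L a" unfolding d by simp
  thus "H (3 * L) L a <= prob (T j)" using H_mono[of L "3 * L" L L a a] L by simp
  show "T j : sets M" unfolding T_def using L by (intro Tb_sets o) simp
 qed
 have "\<Inter>(set Es) : sets M & 1 - real (length Es) * (1 - H (3 * L) L a) <= prob (\<Inter>(set Es))"
  by (rule inter_bound) (use pU pT in \<open>auto simp: Es_def\<close>)
 hence "1 - 7 * (1 - H (3 * L) L a) <= prob (\<Inter>(set Es))" by (simp add: Es_def)
 also have "... <= prob {w\<in>space M. a < val ?V w}"
 proof (rule finite_measure_mono)
  show "\<Inter>(set Es) <= {w\<in>space M. a < val ?V w}"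
  proof
   fix w assume "w : \<Inter>(set Es)"
   hence w: "j <= 3 ==> w : U j" "j < 3 ==> w : T j" for j by (auto simp: Es_def)
   hence sp: "w : space M" using w(1)[of 0] by (auto simp: U_def Lr_def)
   have "lr 0 (0 + real 3 * (2 * L) + 3 * L) y (y + L) {x. a < X x w}"
    by (rule lr_chain) (use w L in \<open>auto simp: U_def T_def Tb_def Lr_def\<close>)
   moreover have "0 + real 3 * (2 * L) + 3 * L = 9 * L" by simp
   ultimately have "w : Lr 0 (9 * L) y (y + L) a" using sp by (simp only: Lr_def mem_Collect_eq)
   thus "w : {w\<in>space M. a < val ?V w}" unfolding Lr_crossing crossing_level[OF adm] .
  qed
 qed simp
 finally have "prob {w\<in>space M. \<not> a < val ?V w} <= 7 * (1 - H (3 * L) L a)" by (subst prob_neg) auto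
 thus ?thesis by (simp add: not_less)
qed

text \<open>The rectangle of height \<open>3 * L\<close> contains two strips of height
  \<open>L\<close> at distance \<open>L\<close>, and either crossing suffices. Decoupling them
  squares the failure probability \<open>7 * (1 - H (3 * L) L a)\<close>, at the price of lowering
  the level by \<open>e\<close>.\<close>

lemma renormalisation_step:
 "EX C>=0. ALL L e a. 0 < L --> 0 < e --> 1 - H (9 * L) (3 * L) (a - e) <= 49 * (1 - H (3 * L) L a)^2 + C / (L ^ 4 * e^2)"
proof -
 obtain C where C: "C >= 0" "!!x r. 0 < r ==> r <= norm x ==> \<kappa> x <= C / r ^ 4" using kappa_far by blast
 have "1 - H (9 * L) (3 * L) (a - e) <= 49 * (1 - H (3 * L) L a)^2 + (2 * C) / (L ^ 4 * e^2)" if L: "0 < L" and e: "0 < e" for L e a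
 proof -
  let ?V = "%y. level (rect 0 (9 * L) y (y + L)) (rect 0 0 y (y + L)) (rect (9 * L) (9 * L) y (y + L))"
  have adm: "admissible (rect 0 (9 * L) y (y + L)) (rect 0 0 y (y + L)) (rect (9 * L) (9 * L) y (y + L))" for y
   using L by (intro admissible_lr) auto
  note ap = approx_admissible[OF adm]
  note [measurable] = approx_rv[OF ap]
  have S: "Lr 0 (9 * L) 0 (3 * L) (a - e) : sets M" using L by simp
  have "1 - H (9 * L) (3 * L) (a - e) = prob (space M - Lr 0 (9 * L) 0 (3 * L) (a - e))"
   unfolding H_def by (rule prob_compl[OF S, symmetric])
  also have "... <= prob {w\<in>space M. val (?V 0) w <= a - e & val (?V (2 * L)) w <= a - e}"
  proof (rule finite_measure_mono)
   have sub: "Lr 0 (9 * L) y (y + L) (a - e) <= Lr 0 (9 * L) 0 (3 * L) (a - e)" if y: "0 <= y" "y <= 2 * L" for y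
   proof
    fix w assume w: "w : Lr 0 (9 * L) y (y + L) (a - e)"
    then obtain x z where xz: "pc (rect 0 (9 * L) y (y + L) Int {x. a - e < X x w}) x z" "x $ 1 = 0" "z $ 1 = 9 * L"
     by (auto simp: Lr_def lr_def)
    have "rect 0 (9 * L) y (y + L) Int {x. a - e < X x w} <= rect 0 (9 * L) 0 (3 * L) Int {x. a - e < X x w}" using y L by (auto simp: rect_def)
    from path_component_of_subset[OF this xz(1)] show "w : Lr 0 (9 * L) 0 (3 * L) (a - e)" using xz w by (auto simp: Lr_def lr_def)
   qed
   have lev: "Lr 0 (9 * L) y (y + L) (a - e) = {w\<in>space M. a - e < val (?V y) w}" for y
    unfolding Lr_crossing by (rule crossing_level[OF adm])
   show "space M - Lr 0 (9 * L) 0 (3 * L) (a - e) <= {w\<in>space M. val (?V 0) w <= a - e & val (?V (2 * L)) w <= a - e}"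
    using sub[of 0] sub[of "2 * L"] L unfolding lev by (auto simp: not_less)
  qed measurable
  also have "... <= prob {w\<in>space M. val (?V 0) w <= a - e + e} * prob {w\<in>space M. val (?V (2 * L)) w <= a - e + e} + 2 * (C / L ^ 4) / (e * e)"
  proof (rule decouple[OF ap ap e e])
   fix x z assume xz: "x : rect 0 (9 * L) 0 (0 + L)" "z : rect 0 (9 * L) (2 * L) (2 * L + L)"
   hence "L <= \<bar>(x - z) $ 2\<bar>" by (auto simp: rect_def)
   hence "L <= norm (x - z)" using component_le_norm_cart[of "x - z" 2] by linarith
   thus "\<kappa> (x - z) <= C / L ^ 4" by (rule C(2)[OF L])
  qed (use C L in simp)
  also have "prob {w\<in>space M. val (?V 0) w <= a - e + e} * prob {w\<in>space M. val (?V (2 * L)) w <= a - e + e}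
   <= (7 * (1 - H (3 * L) L a)) * (7 * (1 - H (3 * L) L a))"
   using strip_bound[OF L, of 0 a] strip_bound[OF L, of "2 * L" a] by (intro mult_mono) (auto simp: H_def)
  also have "(7 * (1 - H (3 * L) L a)) * (7 * (1 - H (3 * L) L a)) = 49 * (1 - H (3 * L) L a)^2" by (simp add: power2_eq_square algebra_simps)
  also have "2 * (C / L ^ 4) / (e * e) = (2 * C) / (L ^ 4 * e^2)" by (simp add: power2_eq_square)
  finally show ?thesis by simp
 qed
 thus ?thesis using C by (intro exI[of _ "2 * C"]) auto
qed

lemma hard_crossings_summable:
 assumes p: "0 < p"
 shows "EX L>0. ALL k. 1 - H (3 * (3 ^ k * L)) (3 ^ k * L) (- p) <= (1 / 2) ^ k"
proof -
 obtain C where C: "C >= 0" "!!L e a. 0 < L ==> 0 < e ==> 1 - H (9 * L) (3 * L) (a - e) <= 49 * (1 - H (3 * L) L a)^2 + C / (L ^ 4 * e^2)"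
  using renormalisation_step by blast
 \<comment> \<open>With 1/196 = 1/(4 * 49), the squared term takes a quarter of the current bound;
   the size of \<open>L\<close> limits the decoupling error to another quarter. Together they give
   the factor 1/2 per scale.\<close>
 obtain L where L: "max 1 (16 * 784 * C / p^2) <= L" "0 < L" "1 - 1 / 196 <= H (3 * L) L (- (p / 2))"
  using hard_crossing_likely[of "p / 2" "1 / 196" "max 1 (16 * 784 * C / p^2)"] p by auto
 \<comment> \<open>The levels decrease from \<open>- p / 2\<close> towards \<open>- p\<close>.
   Squared shifts shrink by 4 per scale while the fourth power of the scale grows by 81, so the
   decoupling errors are summable.\<close>
 define a where "a k = - (p * (1 - (1 / 2) ^ Suc k))" for k :: nat
 define q where "q k = 1 - H (3 * (3 ^ k * L)) (3 ^ k * L) (a k)" for k :: nat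
 have q0: "0 <= q k" for k by (simp add: q_def H_def)
 have "q k <= (1 / 196) * (1 / 2) ^ k" for k
 proof (induction k)
  case 0 thus ?case using L(3) by (simp add: q_def a_def)
 next
  case (Suc k)
  define e where "e = p * (1 / 2) ^ (k + 2)"
  have e: "e > 0" using p by (simp add: e_def)
  have aS: "a (Suc k) = a k - e" by (simp add: a_def e_def algebra_simps)
  have Lk: "0 < 3 ^ k * L" using L by simp
  have "q (Suc k) <= 49 * (q k)^2 + C / ((3 ^ k * L) ^ 4 * e^2)"
   using C(2)[OF Lk e, of "a k"] by (simp add: q_def aS mult.assoc)
  also have "49 * (q k)^2 <= 49 * ((1 / 196) * (1 / 2) ^ k)^2" using Suc q0[of k] by (intro mult_left_mono power_mono) auto
  also have "... = (1 / 784) * ((1 / 2) ^ k * (1 / 2) ^ k)" by (simp add: power2_eq_square)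
  also have "... <= (1 / 784) * ((1 / 2) ^ k * 1)" by (intro mult_left_mono power_le_one) auto
  also have "C / ((3 ^ k * L) ^ 4 * e^2) <= (1 / 784) * (1 / 2) ^ k"
  proof -
   have LC: "16 * 784 * C <= L ^ 4 * p^2"
   proof -
    have "16 * 784 * C <= L * p^2" using L(1) p by (simp add: field_simps)
    also have "... <= L ^ 4 * p^2" using L(1) self_le_power[of L 4] by (intro mult_right_mono) auto
    finally show ?thesis .
   qed
   have e2: "(3 ^ k * L) ^ 4 * e^2 = (81 / 4) ^ k * (L ^ 4 * p^2) / 16"
   proof -
    have "(3 ^ k) ^ 4 = (81 :: real) ^ k" "((1 / 2) ^ (k + 2))^2 = (1 / 4 :: real) ^ k / 16"
     by (simp_all add: power_mult[symmetric] mult.commute[of k] power_mult power_add power_mult_distrib power2_eq_square power_divide flip: power_mult_distrib)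
    thus ?thesis by (simp add: e_def power_mult_distrib power_divide)
   qed
   have k2: "(2 :: real) ^ k <= (81 / 4) ^ k" by (intro power_mono) auto
   have "2 ^ k * (16 * 784 * C) <= (81 / 4) ^ k * (L ^ 4 * p^2)" by (rule mult_mono[OF k2 LC]) (use C in auto)
   hence "2 ^ k * C * 784 <= (3 ^ k * L) ^ 4 * e^2" unfolding e2 by simp
   moreover have "0 < (3 ^ k * L) ^ 4 * e^2" by (intro mult_pos_pos zero_less_power Lk e)
   ultimately show ?thesis by (simp add: field_simps)
  qed
  finally show ?case by simp
 qed
 hence q: "q k <= (1 / 2) ^ k" for k by (rule order_trans) simp
 have "1 - H (3 * (3 ^ k * L)) (3 ^ k * L) (- p) <= (1 / 2) ^ k" for k
 proof -
  have "- p <= a k" using p by (simp add: a_def)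
  hence "H (3 * (3 ^ k * L)) (3 ^ k * L) (a k) <= H (3 * (3 ^ k * L)) (3 ^ k * L) (- p)" using L by (intro H_mono) auto
  thus ?thesis using q[of k] by (simp add: q_def)
 qed
 thus ?thesis using L(2) by blast
qed

end

text \<open>The horizontal crossing of scale \<open>k\<close> meets the vertical crossings of the
  scales \<open>k\<close> and \<open>k + 1\<close>, so all of them lie in one unbounded component.
  Any two unbounded components meet the connected part of a large ring, which lies in the same set,
  and hence coincide.\<close>

lemma unique_unbounded_component:
 fixes f :: "plane => real"
 assumes f: "continuous_on UNIV f" and L: "0 < L"
  and ev: "!!k. K <= k ==> lr 0 (3 * (3 ^ k * L)) 0 (3 ^ k * L) {x. a < f x}"
   "!!k. K <= k ==> tb 0 (3 ^ k * L) 0 (3 * (3 ^ k * L)) {x. a < f x}"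
   "!!k. K <= k ==> ring (3 ^ k * L / 2) {x. a < f x}"
 shows "\<exists>!C. C : unbounded_components {x. a <= f x}"
proof -
 let ?U = "{x. a < f x}" and ?D = "{x. a <= f x}"
 let ?l = "%k. 3 ^ k * L"
 have l: "0 < ?l k" for k using L by simp
 have large: "EX k>=K. r <= ?l k" for r
 proof -
  obtain n where n: "r / L < 3 ^ n" using real_arch_pow[of 3 "r / L"] by auto
  have "(3 :: real) ^ n <= 3 ^ max n K" by (intro power_increasing) auto
  hence "r / L <= 3 ^ max n K" using n by linarith
  thus ?thesis using L by (intro exI[of _ "max n K"]) (simp add: field_simps)
 qed
 have cl: "closed ?D" by (intro closed_Collect_le continuous_on_const f)
 obtain x y where xy: "!!k. K <= k ==> pc (rect 0 (3 * ?l k) 0 (?l k) Int ?U) (x k) (y k)"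
  "!!k. K <= k ==> x k $ 1 = 0" "!!k. K <= k ==> y k $ 1 = 3 * ?l k"
  using ev(1) unfolding lr_def by metis
 obtain u v where uv: "!!k. K <= k ==> pc (rect 0 (?l k) 0 (3 * ?l k) Int ?U) (u k) (v k)"
  "!!k. K <= k ==> u k $ 2 = 0" "!!k. K <= k ==> v k $ 2 = 3 * ?l k"
  using ev(2) unfolding tb_def by metis
 have link: "pc ?U (x k) (u j)" if k: "K <= k" and j: "j = k | j = Suc k" for k j
 proof -
  let ?R = "rect 0 (3 * ?l k) 0 (3 * ?l j)"
  have j': "K <= j" "?l k <= ?l j" "?l j <= 3 * ?l k" using k j l[of k] L by auto
  have 1: "pc (?R Int ?U) (x k) (y k)"
   by (rule path_component_of_subset[OF _ xy(1)[OF k]]) (use j' l[of j] in \<open>auto simp: rect_def\<close>)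
  have 2: "pc (?R Int ?U) (u j) (v j)"
   by (rule path_component_of_subset[OF _ uv(1)[OF j'(1)]]) (use j' in \<open>auto simp: rect_def\<close>)
  obtain z where z: "pc (?R Int ?U) (x k) z" "pc (?R Int ?U) (u j) z"
   using cross_meet[OF 1 xy(2,3)[OF k] 2 uv(2,3)[OF j'(1)]] by blast
  have "pc (?R Int ?U) (x k) (u j)" using z by (meson path_component_sym path_component_trans)
  thus ?thesis by (rule path_component_of_subset[rotated]) simp
 qed
 have all: "pc ?U (x K) (x (K + n))" for n
 proof (induction n)
  case 0
  have "x K : ?U" using path_component_mem(1)[OF xy(1)[of K]] by simp
  thus ?case by (simp add: path_component_refl)
 next
  case (Suc n)
  have "pc ?U (x (K + n)) (x (K + Suc n))"
   using link[of "K + n" "K + Suc n"] link[of "K + Suc n" "K + Suc n"] by (meson add_Suc_right le_add1 path_component_sym path_component_trans)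
  thus ?case using Suc path_component_trans by blast
 qed
 have UD: "?U <= ?D" by auto
 have yK: "connected_component ?D (x K) (y k)" if k: "K <= k" for k
 proof -
  have "pc ?U (x k) (y k)" using path_component_of_subset[OF Int_lower2 xy(1)[OF k]] .
  hence "pc ?U (x K) (y k)" using all[of "k - K"] k path_component_trans by fastforce
  from path_component_of_subset[OF UD this] show ?thesis
   using path_component_subset_connected_component[of ?D "x K"] by auto
 qed
 define C where "C = connected_component_set ?D (x K)"
 have "x K : ?D" using yK[of K] connected_component_in(1) by fastforce
 hence "C : components ?D" by (auto simp: C_def components_def)
 moreover have "\<not> bounded C"
 proof
  assume "bounded C"
  then obtain B where B: "!!z. z : C ==> norm z <= B" by (auto simp: bounded_iff)
  obtain k where k: "K <= k" "B + 1 <= ?l k" using large by blast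
  have "norm (y k) <= B" using yK[OF k(1)] by (intro B) (simp add: C_def)
  moreover have "\<bar>y k $ 1\<bar> <= norm (y k)" by (rule component_le_norm_cart)
  ultimately show False using xy(3)[OF k(1)] k(2) l[of k] by linarith
 qed
 ultimately have ex: "C : unbounded_components ?D" by (simp add: unbounded_components_def)
 have "C1 = C2" if C12: "C1 : unbounded_components ?D" "C2 : unbounded_components ?D" for C1 C2
 proof -
  have c: "C1 : components ?D" "C2 : components ?D" "\<not> bounded C1" "\<not> bounded C2"
   using C12 by (auto simp: unbounded_components_def)
  obtain x1 x2 where x: "x1 : C1" "x2 : C2" using c(3,4) by (metis all_not_in_conv bounded_empty)
  obtain k where k: "K <= k" "2 * max (max \<bar>x1 $ 1\<bar> \<bar>x1 $ 2\<bar>) (max \<bar>x2 $ 1\<bar> \<bar>x2 $ 2\<bar>) <= ?l k" using large by blast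
  have s: "0 < ?l k / 2" using l[of k] by simp
  obtain P where P: "compact P" "connected P" "P <= ?U" "ring (?l k / 2) P" using ring_compact[OF ev(3)[OF k(1)] s] by blast
  have meet: "C Int P ~= {}" if C: "C : components ?D" "\<not> bounded C" and z: "z : C" "max \<bar>z $ 1\<bar> \<bar>z $ 2\<bar> <= ?l k / 2" for C z
  proof -
   obtain y where y: "y : C" "3 * (?l k / 2) <= max \<bar>y $ 1\<bar> \<bar>y $ 2\<bar>" using component_beyond[OF C(2)] by blast
   show ?thesis by (rule connected_meets_ring[OF P(1,4) s in_components_connected[OF C(1)] closed_components[OF cl C(1)] z y])
  qed
  have b: "u <= ?l k / 2" "v <= ?l k / 2" if "2 * max u v <= ?l k" for u v :: real using that by auto
  have "C1 Int P ~= {}" by (rule meet[OF c(1,3) x(1) b(1)[OF k(2)]])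
  moreover have "C2 Int P ~= {}" by (rule meet[OF c(2,4) x(2) b(2)[OF k(2)]])
  ultimately show ?thesis using joinable_components_eq[of P ?D C1 C2] P(2) c(1,2) subset_trans[OF P(3) UD] by blast
 qed
 thus ?thesis using ex by blast
qed

context continuous_gaussian_field
begin

lemma AE_unique_unbounded:
 assumes p: "0 < p"
 shows "AE w in M. \<exists>!C. C : unbounded_components {x. - p <= X x w}"
proof -
 obtain L where L: "L > 0" "!!k. 1 - H (3 * (3 ^ k * L)) (3 ^ k * L) (- p) <= (1 / 2) ^ k"
  using hard_crossings_summable[OF p] by blast
 let ?l = "%k. 3 ^ k * L"
 \<comment> \<open>With \<open>s = l / 2\<close> the rectangles of the ring measure
   \<open>3 * l\<close> by \<open>l\<close> like the two crossings, so all six events have the same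
   probability and Borel-Cantelli covers them together.\<close>
 define Es where "Es k = (let l = 3 ^ k * L; s = l / 2 in
  [Lr 0 (3 * l) 0 l (- p), Tb 0 l 0 (3 * l) (- p), Tb s (3 * s) (- 3 * s) (3 * s) (- p), Tb (- 3 * s) (- s) (- 3 * s) (3 * s) (- p),
   Lr (- 3 * s) (3 * s) s (3 * s) (- p), Lr (- 3 * s) (3 * s) (- 3 * s) (- s) (- p)])" for k :: nat
 define A where "A k = space M - \<Inter>(set (Es k))" for k
 have E: "\<Inter>(set (Es k)) : sets M & 1 - real (length (Es k)) * (1 / 2) ^ k <= prob (\<Inter>(set (Es k)))" for k
 proof (rule inter_bound)
  show "Es k ~= []" by (simp add: Es_def Let_def)
  show "F : sets M & 1 - (1 / 2) ^ k <= prob F" if "F : set (Es k)" for F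
   using that L(1) L(2)[of k] L(2)[of k, unfolded mult.commute[of "3 ^ k" L]] by (auto simp: Es_def Let_def prob_Tb prob_Lr)
 qed
 have A: "A k : sets M" "prob (A k) <= 6 * (1 / 2) ^ k" for k
 proof -
  have "prob (A k) = 1 - prob (\<Inter>(set (Es k)))" unfolding A_def using E by (intro prob_compl) blast
  thus "prob (A k) <= 6 * (1 / 2) ^ k" using E[of k] by (simp add: Es_def Let_def)
  show "A k : sets M" unfolding A_def using E by blast
 qed
 have "summable (%k. prob (A k))"
  by (rule summable_comparison_test'[where N = 0 and g = "%k. 6 * (1 / 2) ^ k"]) (use A in \<open>auto intro!: summable_mult summable_geometric\<close>)
 hence "AE w in M. eventually (%k. w : space M - A k) sequentially"
  using A by (intro borel_cantelli_AE1) (auto simp: emeasure_eq_measure)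
 with AE_space show ?thesis
 proof eventually_elim
  case (elim w)
  then obtain K where "!!k. K <= k ==> w : space M - A k" by (auto simp: eventually_sequentially)
  hence K: "!!k. K <= k ==> w : \<Inter>(set (Es k))" by (auto simp: A_def)
  show ?case
  proof (rule unique_unbounded_component[OF cont[OF elim(1)] L(1), where K = K])
   fix k assume "K <= k"
   from K[OF this] show "lr 0 (3 * ?l k) 0 (?l k) {x. - p < X x w}" "tb 0 (?l k) 0 (3 * ?l k) {x. - p < X x w}"
    "ring (?l k / 2) {x. - p < X x w}" by (auto simp: Es_def Let_def Lr_def Tb_def ring_def)
  qed
 qed
qed

end

section \<open>From the hypotheses on the field to the theorem\<close>

lemma gaussian_rv_centred:
 assumes M: "prob_space M" and Z: "gaussian_rv M Z" "(LINT w|M. Z w) = 0"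
 shows "(LINT w|M. cos (Z w)) = exp (- (LINT w|M. (Z w)^2) / 2)"
  and "(LINT w|M. sin (Z w)) = 0"
  and "(LINT w|M. (Z w)^2) ~= 0 ==> AE w in M. Z w ~= e"
proof -
 interpret prob_space M by fact
 have m[measurable]: "Z : bm M" using Z(1) by (simp add: gaussian_rv_def)
 consider a where "AE w in M. Z w = a" | a s where "s > 0" "distributed M lborel Z (normal_density a s)"
  using Z(1) by (auto simp: gaussian_rv_def)
 hence "(LINT w|M. cos (Z w)) = exp (- (LINT w|M. (Z w)^2) / 2) & (LINT w|M. sin (Z w)) = 0 &
  ((LINT w|M. (Z w)^2) ~= 0 --> (AE w in M. Z w ~= e))"
 proof cases
  case 1
  have c: "(LINT w|M. g (Z w)) = g a" if [measurable]: "g : bm borel" for g :: "real => real"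
  proof -
   have "(LINT w|M. g (Z w)) = (LINT w|M. g a)" by (rule integral_cong_AE) (use 1 in auto)
   thus ?thesis by (simp add: prob_space)
  qed
  have "a = 0" using c[of "%x. x"] Z(2) by simp
  thus ?thesis using c[of cos] c[of sin] c[of "%x. x^2"] by simp
 next
  case 2
  have a: "a = 0" using normal_distributed_expectation[OF 2] Z(2) by simp
  have v: "(LINT w|M. (Z w)^2) = s^2" using normal_distributed_variance[OF 2] Z(2) by simp
  define Y where "Y w = Z w / s" for w
  have "distributed M lborel Y std_normal_density"
   using normal_standard_normal_convert[OF 2(1), of Z 0] 2(2) a by (simp add: Y_def[abs_def])
  hence d: "distr M lborel Y = stdG" by (rule distributed_distr_eq_density)
  have ZY: "Z w = s * Y w" for w using 2(1) by (simp add: Y_def)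
  have [measurable]: "Y : bm M" unfolding Y_def[abs_def] by measurable
  have i: "(LINT w|M. g (Y w)) = (LINT x|stdG. g x)" if [measurable]: "g : bm borel" for g :: "real => real"
   unfolding d[symmetric] by (rule integral_distr[symmetric]) measurable
  have "(LINT w|M. cos (Z w)) = exp (- (s^2) / 2)" "(LINT w|M. sin (Z w)) = 0"
   unfolding ZY using i[of "%y. cos (s * y)"] i[of "%y. sin (s * y)"] stdG_char[of s] by simp_all
  moreover have "AE w in M. Z w ~= e"
  proof -
   have "AE y in lborel. y ~= e / s" by (rule AE_lborel_singleton)
   hence "AE y in stdG. y ~= e / s" by (subst AE_density) auto
   hence "AE w in M. Y w ~= e / s" unfolding d[symmetric] by (rule AE_distrD[rotated]) simp
   thus ?thesis by (rule eventually_mono) (use 2(1) in \<open>auto simp: Y_def\<close>)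
  qed
  ultimately show ?thesis using v by simp
 qed
 thus "(LINT w|M. cos (Z w)) = exp (- (LINT w|M. (Z w)^2) / 2)" "(LINT w|M. sin (Z w)) = 0"
  "(LINT w|M. (Z w)^2) ~= 0 ==> AE w in M. Z w ~= e" by auto
qed

lemma law_invariant_product:
 assumes f: "!!x. f x : bm M" and T: "law_invariant M f T"
 shows "(LINT w|M. f (T x) w * f (T y) w) = (LINT w|M. f x w * f y w)"
proof -
 let ?P = "PiM UNIV (%_::plane. borel :: real measure)"
 have m: "(%w x. g x w) : M \<rightarrow>\<^sub>M ?P" if "!!x. g x : bm M" for g :: "plane => 'a => real"
  using that by (intro measurable_PiM_single') auto
 have i: "(LINT h|field_law M g. h x * h y) = (LINT w|M. g x w * g y w)" if "!!x. g x : bm M" for g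
  unfolding field_law_def by (subst integral_distr[OF m[OF that]]) simp_all
 show ?thesis using i[of f] i[of "%x. f (T x)"] f T by (simp add: law_invariant_def)
qed

text \<open>With both covariances equal to 1, the matrix of the two points would have equal
  rows.\<close>

lemma nondegenerate_pair:
 assumes "nondegenerate M f" "x ~= y" and c: "!!x y. covariance M (f x) (f y) = \<kappa> (x - y)" and 1: "\<kappa> 0 = 1"
 shows "\<not> (\<kappa> (x - y) = 1 & \<kappa> (y - x) = 1)"
proof
 assume k: "\<kappa> (x - y) = 1 & \<kappa> (y - x) = 1"
 let ?A = "covariance_matrix M f [x, y]"
 have A: "?A = Matrix.mat 2 2 (%_. 1)"
  unfolding covariance_matrix_def by (rule eq_matI) (use k 1 in \<open>auto simp: c less_2_cases_iff\<close>)
 have "invertible_mat ?A" using assms(1,2) unfolding nondegenerate_def by (metis distinct_length_2_or_more distinct_singleton)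
 then obtain B where B: "inverts_mat ?A B" unfolding invertible_mat_def by blast
 hence AB: "?A * B = 1\<^sub>m 2" by (simp add: inverts_mat_def A)
 hence d: "dim_col B = 2" using index_mult_mat(3) index_one_mat(3) by metis
 have "(?A * B) $$ (0, 0) = (?A * B) $$ (1, 0)" unfolding A using d by simp
 thus False unfolding AB by simp
qed

text \<open>The field is set to 0 on a null set containing all outcomes with a discontinuous path.
  Linear combinations keep their laws, and distinctness of two values follows from the positive
  variance of their difference.\<close>

lemma continuous_version:
 assumes M: "prob_space M" and gf: "gaussian_field M f" and nd: "nondegenerate M f" and ce: "centered M f"
  and no: "normalized M f" and co: "continuous_field M f"
  and cov: "!!x y. covariance M (f x) (f y) = \<kappa> (x - y)" and nonneg: "!!x. \<kappa> x >= 0"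
  and turn: "law_invariant M f quarter_turn" and flip: "law_invariant M f horizontal_reflection"
  and smooth: "continuous_on UNIV \<kappa>"
  and decay: "b > 4" "!!x. x ~= 0 ==> \<bar>\<kappa> x\<bar> <= C' * norm x powr (- b)"
 shows "EX g. continuous_gaussian_field M g \<kappa> & (AE w in M. ALL x. g x w = f x w)"
proof -
 interpret prob_space M by fact
 have f[measurable]: "f x : bm M" for x using gf by (simp add: gaussian_field_def)
 have e0: "(LINT w|M. f x w) = 0" for x using ce by (simp add: centered_def)
 have pr: "(LINT w|M. f x w * f y w) = \<kappa> (x - y)" for x y using cov[of x y] by (simp add: covariance_def e0)
 have k0: "\<kappa> 0 = 1" using no pr[of 0 0] by (simp add: normalized_def e0 power2_eq_square)
 \<comment> \<open>The integral of a nonintegrable function is 0 by convention, whereas here it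
   equals \<open>\<kappa> 0 = 1\<close>.\<close>
 have i2: "integrable M (%w. f x w * f x w)" for x
  using not_integrable_integral_eq[of M "%w. f x w * f x w"] pr[of x x] k0 by force
 have ip: "integrable M (%w. f x w * f y w)" for x y
 proof (rule Bochner_Integration.integrable_bound[OF Bochner_Integration.integrable_add[OF i2[of x] i2[of y]]])
  show "AE w in M. norm (f x w * f y w) <= norm (f x w * f x w + f y w * f y w)"
  proof (rule AE_I2)
   fix w
   have "2 * (\<bar>f x w\<bar> * \<bar>f y w\<bar>) <= f x w * f x w + f y w * f y w"
    using sum_squares_bound[of "\<bar>f x w\<bar>" "\<bar>f y w\<bar>"] by (simp add: power2_eq_square)
   moreover have "0 <= \<bar>f x w\<bar> * \<bar>f y w\<bar>" by simp
   ultimately show "norm (f x w * f y w) <= norm (f x w * f x w + f y w * f y w)"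
    unfolding real_norm_def abs_mult[of "f x w" "f y w"] by linarith
  qed
 qed simp
 have i1: "integrable M (f x)" for x
  using square_integrable_imp_integrable[OF f] i2[of x] by (simp add: power2_eq_square)
 have sq: "(LINT w|M. (\<Sum>s\<in>S. a s * f s w)^2) = qform S (%x y. \<kappa> (x - y)) a a" if "finite S" for S a
 proof -
  have "(%w. (\<Sum>s\<in>S. a s * f s w)^2) = (%w. \<Sum>s\<in>S. \<Sum>t\<in>S. a s * a t * (f s w * f t w))"
   by (simp add: fun_eq_iff power2_eq_square sum_product mult_ac)
  thus ?thesis using ip by (simp add: qform_def pr)
 qed
 have lin: "gaussian_rv M (%w. \<Sum>s\<in>S. a s * f s w)" "(LINT w|M. (\<Sum>s\<in>S. a s * f s w)) = 0" if "finite S" for S a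
  using gf that i1 by (auto simp: gaussian_field_def e0)
 have char: "(LINT w|M. cos (\<Sum>s\<in>S. a s * f s w)) = exp (- qform S (%x y. \<kappa> (x - y)) a a / 2)"
  "(LINT w|M. sin (\<Sum>s\<in>S. a s * f s w)) = 0" if S: "finite S" for S a
  using gaussian_rv_centred(1,2)[OF M lin(1)[OF S, of a] lin(2)[OF S, of a]] sq[OF S, of a] by simp_all
 have two: "gaussian_rv M (%w. f x w - f y w)" "(LINT w|M. (f x w - f y w)^2) = 2 - (\<kappa> (x - y) + \<kappa> (y - x))" "(LINT w|M. f x w - f y w) = 0"
  if "x ~= y" for x y
 proof -
  let ?a = "%s. if s = x then 1 else - 1 :: real"
  have fin: "finite {x, y}" by simp
  have e: "(\<Sum>s\<in>{x, y}. ?a s * f s w) = f x w - f y w" for w using that by simp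
  show "gaussian_rv M (%w. f x w - f y w)" "(LINT w|M. f x w - f y w) = 0"
   using lin[OF fin, of ?a] unfolding e by auto
  show "(LINT w|M. (f x w - f y w)^2) = 2 - (\<kappa> (x - y) + \<kappa> (y - x))"
   using sq[OF fin, of ?a] that unfolding e by (simp add: qform_def k0)
 qed
 have km: "\<kappa> (y - x) = \<kappa> (x - y)" for x y using pr[of x y] pr[of y x] by (simp add: mult.commute)
 have one: "(LINT w|M. (f x w)^2) = 1" "gaussian_rv M (f x)" for x
 proof -
  show "(LINT w|M. (f x w)^2) = 1" using pr[of x x] by (simp add: power2_eq_square k0)
  show "gaussian_rv M (f x)" using lin(1)[of "{x}" "%_. 1"] by simp
 qed
 have kle: "\<kappa> x <= 1" for x
 proof (cases "x = 0")
  case False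
  have "0 <= (LINT w|M. (f x w - f 0 w)^2)" by (intro integral_nonneg_AE) simp
  thus ?thesis using two(2)[OF False] km[of 0 x] by simp
 qed (simp add: k0)
 obtain N where N: "{w\<in>space M. \<not> continuous_on UNIV (%x. f x w)} <= N" "N : null_sets M"
  using co by (auto simp: continuous_field_def eventually_ae_filter)
 define g where "g x w = (if w : N then 0 else f x w)" for x w
 have [measurable]: "N : sets M" using N(2) by auto
 have g[measurable]: "g x : bm M" for x unfolding g_def[abs_def] by measurable
 have ae: "AE w in M. ALL x. g x w = f x w" by (rule AE_I'[OF N(2)]) (auto simp: g_def)
 have ig: "(LINT w|M. F (%x. g x w)) = (LINT w|M. F (%x. f x w))"
  if "(%w. F (%x. g x w)) : bm M" "(%w. F (%x. f x w)) : bm M" for F :: "_ => real"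
  by (rule integral_cong_AE[OF that]) (use ae in \<open>auto elim!: eventually_mono\<close>)
 have "continuous_gaussian_field M g \<kappa>"
 proof
  show "(LINT w|M. cos (\<Sum>s\<in>S. a s * g s w)) = exp (- qform S (%x y. \<kappa> (x - y)) a a / 2)" if "finite S" for S a
   using ig[of "%h. cos (\<Sum>s\<in>S. a s * h s)"] char(1)[OF that, of a] that by simp
  show "(LINT w|M. sin (\<Sum>s\<in>S. a s * g s w)) = 0" if "finite S" for S a
   using ig[of "%h. sin (\<Sum>s\<in>S. a s * h s)"] char(2)[OF that, of a] that by simp
  show "integrable M (%w. (g x w)^2)" for x
   by (rule Bochner_Integration.integrable_bound[OF i2[of x]]) (auto simp: g_def power2_eq_square)
  show "(LINT w|M. g x w) = 0" for x using ig[of "%h. h x"] e0[of x] by simp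
  show "(LINT w|M. g x w * g y w) = \<kappa> (x - y)" for x y using ig[of "%h. h x * h y"] pr[of x y] by simp
  show "AE w in M. g x w ~= g y w" if "x ~= y" for x y
  proof -
   have "\<kappa> (x - y) ~= 1" using nondegenerate_pair[OF nd that, of \<kappa>] cov k0 km[of x y] by auto
   hence "(LINT w|M. (f x w - f y w)^2) ~= 0" unfolding two(2)[OF that] km[of x y] by simp
   from gaussian_rv_centred(3)[OF M two(1,3)[OF that] this, of 0] ae show ?thesis by eventually_elim simp
  qed
  show "AE w in M. g x w ~= e" for x e
  proof -
   have "(LINT w|M. (f x w)^2) ~= 0" unfolding one(1) by simp
   from gaussian_rv_centred(3)[OF M one(2) e0 this, of e] ae show ?thesis by eventually_elim simp
  qed
  show "continuous_on UNIV (%x. g x w)" if "w : space M" for w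
   using N(1) that by (cases "w : N") (auto simp: g_def)
  show "EX r>0. ALL x. norm x < r --> 1 / 2 <= \<kappa> x"
  proof -
   have "isCont \<kappa> 0" using smooth by (simp add: continuous_on_eq_continuous_at)
   from this[unfolded continuous_at_eps_delta, rule_format, of "1 / 2"]
   obtain r where r: "r > 0" "!!x. dist x 0 < r ==> dist (\<kappa> x) (\<kappa> 0) < 1 / 2" by auto
   have "1 / 2 <= \<kappa> x" if "norm x < r" for x
   proof -
    have "dist (\<kappa> x) (\<kappa> 0) < 1 / 2" using r(2)[of x] that by simp
    thus ?thesis using k0 unfolding dist_real_def by linarith
   qed
   thus ?thesis using r(1) by blast
  qed
  show "EX C. ALL x. \<kappa> x * norm x ^ 4 <= C"
  proof (intro exI allI)
   fix x
   show "\<kappa> x * norm x ^ 4 <= max 1 \<bar>C'\<bar>"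
   proof (cases "norm x <= 1")
    case True
    have "\<kappa> x * norm x ^ 4 <= 1 * 1" using True kle nonneg by (intro mult_mono power_le_one) auto
    thus ?thesis by simp
   next
    case False
    hence x: "1 < norm x" "x ~= 0" by auto
    have "\<kappa> x <= C' * norm x powr (- b)" using decay(2)[OF x(2)] by simp
    also have "... <= \<bar>C'\<bar> * norm x powr (- 4)" using x decay(1) by (intro mult_mono powr_mono) auto
    finally have "\<kappa> x * norm x ^ 4 <= \<bar>C'\<bar> * norm x powr (- 4) * norm x ^ 4" by (intro mult_right_mono) auto
    also have "... = \<bar>C'\<bar>" using x by (simp add: powr_minus powr_numeral)
    finally show ?thesis by simp
   qed
  qed
  have z: "quarter_turn 0 = 0" "horizontal_reflection 0 = 0" by (auto simp: quarter_turn_def horizontal_reflection_def intro!: plane_eqI)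
  show "\<kappa> (vector [- (x $ 2), x $ 1]) = \<kappa> x" for x
   using law_invariant_product[OF f turn, of x 0] by (simp add: pr z) (simp add: quarter_turn_def)
  show "\<kappa> (vector [x $ 1, - (x $ 2)]) = \<kappa> x" for x
   using law_invariant_product[OF f flip, of x 0] by (simp add: pr z) (simp add: horizontal_reflection_def)
 qed (rule nonneg kle g)+
 thus ?thesis using ae by blast
qed

theorem proposition3p5:
 fixes M :: "'w measure"
  and f :: "plane \<Rightarrow> 'w \<Rightarrow> real"
  and \<kappa> :: "plane \<Rightarrow> real"
 assumes "prob_space M"
  and "gaussian_field M f"
  and "nondegenerate M f"
  and "centered M f"
  and "normalized M f"
  and "continuous_field M f"
  and "stationary M f"
  and "\<And>x y. covariance M (f x) (f y) = \<kappa> (x - y)"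
  and "\<And>x. \<kappa> x \<ge> 0"
  and "law_invariant M f quarter_turn"
  and "law_invariant M f horizontal_reflection"
  and "C_class 8 \<kappa>"
  and "\<And>b1 b2 :: nat. b1 + b2 \<le> 2 \<Longrightarrow>
      (((partial 1 ^^ b1) ((partial 2 ^^ b2) \<kappa>)) \<longlongrightarrow> 0) at_infinity"
  and "\<exists>\<alpha>>4. \<exists>C'::real. \<forall>x. x \<noteq> 0 \<longrightarrow> \<bar>\<kappa> x\<bar> \<le> C' * norm x powr (- \<alpha>)"
  and "\<exists>\<delta>>0. \<exists>C::real. \<forall>\<^sub>F \<epsilon> in at_right (0::real). \<exists>R.
      is_matrix_sqrt (face_centered_lattice \<epsilon>) R (\<lambda>x y. \<kappa> (x - y)) \<and>
      symmetric_matrix (face_centered_lattice \<epsilon>) R \<and>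
      inf_op_norm (face_centered_lattice \<epsilon>) R \<le> ennreal (C * (1 / \<epsilon> powr (2 - \<delta>)))"
 shows "critical_threshold M f = 0 \<and>
     (\<forall>p>0. AE \<omega> in M. unbounded_components (excursion f p \<omega>) \<noteq> {}) \<and>
     (\<forall>p\<le>0. AE \<omega> in M. unbounded_components (excursion f p \<omega>) = {}) \<and>
     (\<forall>p>0. AE \<omega> in M. \<exists>!C. C \<in> unbounded_components (excursion f p \<omega>))"
proof -
 interpret prob_space M by fact
 obtain \<alpha> C' where decay: "\<alpha> > 4" "\<And>x. x \<noteq> 0 \<Longrightarrow> \<bar>\<kappa> x\<bar> \<le> C' * norm x powr (- \<alpha>)" using assms(14) by blast
 have "C_class (Suc 7) \<kappa>" using assms(12) by simp
 then have "\<kappa> differentiable (at x)" for x by (simp only: C_class.simps)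
 then have cont: "continuous_on UNIV \<kappa>"
  by (intro continuous_at_imp_continuous_on) (simp add: differentiable_imp_continuous_within)
 obtain g where g: "continuous_gaussian_field M g \<kappa>" "AE \<omega> in M. \<forall>x. g x \<omega> = f x \<omega>"
  using continuous_version[OF assms(1-6,8-11) cont decay] by blast
 interpret G: continuous_gaussian_field M g \<kappa> by (rule g(1))
 \<comment> \<open>One null set serves all levels, since the two fields agree at every point outside
   it.\<close>
 have exc: "AE \<omega> in M. \<forall>p. excursion f p \<omega> = {x. - p \<le> g x \<omega>}"
  using g(2) by (rule eventually_mono) (simp add: excursion_def)
 have un: "AE \<omega> in M. \<exists>!C. C \<in> unbounded_components (excursion f p \<omega>)" if "p > 0" for p
  using exc G.AE_unique_unbounded[OF that] by eventually_elim simp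
 have ex: "AE \<omega> in M. unbounded_components (excursion f p \<omega>) \<noteq> {}" if "p > 0" for p
  using un[OF that] by (rule eventually_mono) blast
 have none: "AE \<omega> in M. unbounded_components (excursion f p \<omega>) = {}" if "p \<le> 0" for p
  using exc G.no_unbounded by eventually_elim (use that in simp)
 \<comment> \<open>In a probability space existence and absence of an unbounded component cannot
   both be almost sure, so the set in \<open>critical_threshold\<close> consists exactly of the
   positive levels.\<close>
 have "\<not> (AE \<omega> in M. unbounded_components (excursion f p \<omega>) = {}) \<longleftrightarrow> 0 < p" for p
 proof (cases "0 < p")
  case True
  have False if "AE \<omega> in M. unbounded_components (excursion f p \<omega>) = {}"
  proof -
   have "AE \<omega> in M. False" using that ex[OF True] by eventually_elim simp
   then show False by simp
  qed
  then show ?thesis using True by blast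
 next
  case False then show ?thesis using none[of p] by simp
 qed
 then have "critical_threshold M f = Inf {ereal p | p. 0 < p}" by (simp add: critical_threshold_def)
 also have "\<dots> = 0"
 proof (rule antisym)
  show "Inf {ereal p | p. 0 < p} \<le> 0"
  proof (rule dense_ge)
   fix y :: ereal assume "0 < y"
   then obtain z where "0 < ereal z" "ereal z < y" using ereal_dense2[of 0 y] by auto
   then have "Inf {ereal p | p. 0 < p} \<le> ereal z" by (intro Inf_lower) auto
   then show "Inf {ereal p | p. 0 < p} \<le> y" using \<open>ereal z < y\<close> by (meson less_imp_le order_trans)
  qed
  show "0 \<le> Inf {ereal p | p. 0 < p}" by (rule Inf_greatest) auto
 qed
 finally show ?thesis using un ex none by blast
qed

end
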